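(* Let $Q_1,Q_2,Q_3$ be independent $\mathrm{GOE}(4)$ random matrices, with associated random quartic spherical spectrahedron $\mathscr{S}_{3,4}\subset S^3$ and symmetroid surface $\Sigma_{3,4}\subset S^3$. Let $\sigma_4$ be the number of singular points on $\partial\mathscr{S}_{3,4}$ and $\rho_4$ the number of singular points on $\Sigma_{3,4}$. Then $$\mathbb{E}\,\sigma_4=6-\frac{4}{\sqrt{3}}\qquad\text{and}\qquad \mathbb{E}\,\rho_4=12.$$
   Context: $Q\sim\mathrm{GOE}(n)$ means that $Q$ is a random real symmetric $n\times n$ matrix with density proportional to $\exp(-\mathrm{tr}(Q^2)/2)$; that is, the entries $Q_{ij}$, $i\le j$, are independent centered Gaussians, with variance $1$ on the diagonal and variance $1/2$ off the diagonal. $S^3$ is the unit sphere in $\mathbb{R}^4$, $\mathcal{P}_4$ is the cone of positive semidefinite real symmetric $4\times4$ matrices, and $\mathbf{1}$ is the identity matrix. For $x=(x_0,x_1,x_2,x_3)$ put $A(x)=x_0\mathbf{1}+\tfrac{1}{\sqrt{24}}(x_1Q_1+x_2Q_2+x_3Q_3)$. Then $\mathscr{S}_{3,4}=\{x\in S^3:A(x)\in\mathcal{P}_4\}$ and $\Sigma_{3,4}=\{x\in S^3:\det A(x)=0\}$. A singular point of $\Sigma_{3,4}$ is a singular point in the sense of algebraic geometry (a point of $\Sigma_{3,4}$ where the gradient of the polynomial $\det A$ vanishes); a singular point on $\partial\mathscr{S}_{3,4}$ is a singular point of $\Sigma_{3,4}$ that belongs to $\mathscr{S}_{3,4}$. With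 probability one, both numbers are finite. *)

theory Defs
  imports "HOL-Probability.Probability"
begin

text \<open>
  Being GOE is a property of the law of the random matrix, so symmetry is required almost
  surely. The parameter of \<^const>\<open>normal_density\<close> is the standard deviation, hence
  \<^term>\<open>sqrt (1/2)\<close> for variance \<open>1/2\<close>. The linear order on the index type only selects one
  entry from each symmetric pair.
\<close>

definition GOE :: "'a measure \<Rightarrow> ('a \<Rightarrow> real ^ 'n::{finite,linorder} ^ 'n::{finite,linorder}) \<Rightarrow> bool" where
  "GOE M Q \<longleftrightarrow>
     Q \<in> borel_measurable M \<and>
     (AE \<omega> in M. transpose (Q \<omega>) = Q \<omega>) \<and>
     prob_space.indep_vars M (\<lambda>_. borel) (\<lambda>(i, j) \<omega>. Q \<omega> $ i $ j) {(i, j). i \<le> j} \<and>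
     (\<forall>i. distributed M lborel (\<lambda>\<omega>. Q \<omega> $ i $ i) (normal_density 0 1)) \<and>
     (\<forall>i j. i < j \<longrightarrow> distributed M lborel (\<lambda>\<omega>. Q \<omega> $ i $ j) (normal_density 0 (sqrt (1/2))))"

definition psd :: "real ^ 'n ^ 'n \<Rightarrow> bool" where
  "psd A \<longleftrightarrow> transpose A = A \<and> (\<forall>v. 0 \<le> v \<bullet> (A *v v))"

text \<open>
  The index type \<open>4\<close> has the elements \<open>0, 1, 2, 3\<close>, so \<open>x $ 0, \<dots>, x $ 3\<close> are the four
  coordinates of \<open>x\<close>.
\<close>

definition pencil ::
    "real ^ 4 ^ 4 \<Rightarrow> real ^ 4 ^ 4 \<Rightarrow> real ^ 4 ^ 4 \<Rightarrow> real ^ 4 \<Rightarrow> real ^ 4 ^ 4" where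
  "pencil Q1 Q2 Q3 x =
     (x $ 0) *\<^sub>R mat 1 + (1 / sqrt 24) *\<^sub>R ((x $ 1) *\<^sub>R Q1 + (x $ 2) *\<^sub>R Q2 + (x $ 3) *\<^sub>R Q3)"

definition spectrahedron ::
    "real ^ 4 ^ 4 \<Rightarrow> real ^ 4 ^ 4 \<Rightarrow> real ^ 4 ^ 4 \<Rightarrow> (real ^ 4) set" where
  "spectrahedron Q1 Q2 Q3 = {x \<in> sphere 0 1. psd (pencil Q1 Q2 Q3 x)}"

definition symmetroid ::
    "real ^ 4 ^ 4 \<Rightarrow> real ^ 4 ^ 4 \<Rightarrow> real ^ 4 ^ 4 \<Rightarrow> (real ^ 4) set" where
  "symmetroid Q1 Q2 Q3 = {x \<in> sphere 0 1. det (pencil Q1 Q2 Q3 x) = 0}"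

text \<open>The gradient is that of the quartic form on all of \<open>\<real>\<^sup>4\<close>.\<close>

definition sing_symmetroid ::
    "real ^ 4 ^ 4 \<Rightarrow> real ^ 4 ^ 4 \<Rightarrow> real ^ 4 ^ 4 \<Rightarrow> (real ^ 4) set" where
  "sing_symmetroid Q1 Q2 Q3 =
     {x \<in> symmetroid Q1 Q2 Q3. GDERIV (\<lambda>y. det (pencil Q1 Q2 Q3 y)) x :> 0}"

definition sing_spectrahedron ::
    "real ^ 4 ^ 4 \<Rightarrow> real ^ 4 ^ 4 \<Rightarrow> real ^ 4 ^ 4 \<Rightarrow> (real ^ 4) set" where
  "sing_spectrahedron Q1 Q2 Q3 = sing_symmetroid Q1 Q2 Q3 \<inter> spectrahedron Q1 Q2 Q3"

end

theory Submission
  imports Defs "HOL-Probability.Probability" "HOL-Real_Asymp.Real_Asymp"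
begin

text \<open>
  Let \<open>x\<close> be a point of the symmetroid. The pencil contains the identity, and the derivative of the
  determinant in this direction is the trace of the adjugate. The adjugate of a singular symmetric
  matrix has rank at most one, so this trace vanishes only if the adjugate does. Therefore the singular
  points are exactly the points at which the pencil has corank at least two
  (\<open>sing_symmetroid_iff_adj\<close>), and almost surely the corank is then two.

  Antipodal points are counted together in the affine chart \<open>x\<^sub>1 \<noteq> 0\<close>. There, a singular point is a triple
  \<open>(s, t, l)\<close> such that \<open>l\<close> is a double eigenvalue of \<open>Q\<^sub>1 + s Q\<^sub>2 + t Q\<^sub>3\<close>. In \<open>2 \<times> 2\<close> blocks
  \<open>((A, B), (B\<^sup>T, C))\<close> with \<open>C - l\<close> invertible, this means \<open>A = l + B (C - l)\<^sup>-\<^sup>1 B\<^sup>T\<close>. A dimension count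
  shows that solutions at infinity or outside this chart almost surely do not occur (\<open>AE_generic\<close>). The
  symmetroid counts each solution twice. The spectrahedron counts it once if \<open>det (C - l) > 0\<close>, because
  then exactly one of the two antipodal rank-two matrices is positive semidefinite, and not at all if
  \<open>det (C - l) < 0\<close> (\<open>count_singular_points\<close>, \<open>count_psd_singular_points\<close>).

  The expected number of solutions is a Kac-Rice integral. The equation for \<open>A\<close> consists of three scalar equations
  in three unknowns, so the area formula (\<open>area_formula\<close>), averaged over the Gaussian block \<open>A\<close>, expresses
  the expectation as an integral of a Gaussian density times a Jacobian (\<open>chart_area\<close>). The Jacobian is the
  determinant of three \<open>2 \<times> 2\<close> symmetric matrices: the restrictions of the identity, of \<open>Q\<^sub>2\<close> and of \<open>Q\<^sub>3\<close> to the
  double eigenspace. Replacing \<open>Q\<^sub>1\<close> by \<open>Q\<^sub>1 + s Q\<^sub>2 + t Q\<^sub>3\<close> and completing squares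
  (\<open>gauss_double_shift\<close>) decouples \<open>Q\<^sub>2\<close> and \<open>Q\<^sub>3\<close>, whose mean Jacobian is a power of a Gram determinant
  (\<open>expected_det3\<close>). The parameters \<open>(s, t)\<close> contribute the area \<open>2 \<pi>\<close> of the projective plane, the
  eigenspace contributes the volume of a Grassmannian (\<open>grassmannian_integral\<close>), and what remains is the mean of
  the squared product of the two other eigenvalues, counted from \<open>l\<close> (\<open>core_integral_value\<close>). Up to
  normalisation its value is \<open>3\<close> without a sign condition and \<open>3 - 2 / \<surd>3\<close> if the product
  is required to be positive. The mean number of solutions is twice this (\<open>expected_count\<close>), which gives
  \<open>2 \<cdot> 2 \<cdot> 3 = 12\<close> and \<open>2 (3 - 2 / \<surd>3) = 6 - 4 / \<surd>3\<close>.
\<close>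

section \<open>Planar integrals\<close>

text \<open>Any invertible \<open>2 \<times> 2\<close> matrix is a product of shears and scalings
  of one coordinate at a time, so the one-dimensional affine substitution is enough.\<close>
lemma nn_integral_linear_2d:
  fixes f :: "real \<Rightarrow> real \<Rightarrow> ennreal"
  assumes f [measurable]: "case_prod f \<in> borel_measurable (borel \<Otimes>\<^sub>M borel)"
    and D: "a * d - b * c \<noteq> (0::real)"
  shows "(\<integral>\<^sup>+x. \<integral>\<^sup>+y. f x y \<partial>lborel \<partial>lborel) =
    ennreal \<bar>a * d - b * c\<bar> * (\<integral>\<^sup>+x. \<integral>\<^sup>+y. f (a * x + b * y) (c * x + d * y) \<partial>lborel \<partial>lborel)"
proof (cases "a = 0")
  case False
  let ?e = "(a * d - b * c) / a"
  have "(\<integral>\<^sup>+x. \<integral>\<^sup>+y. f x y \<partial>lborel \<partial>lborel)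
      = (\<integral>\<^sup>+x. \<bar>?e\<bar> * (\<integral>\<^sup>+y. f x (c * x / a + ?e * y) \<partial>lborel) \<partial>lborel)"
    using D False by (intro nn_integral_cong nn_integral_real_affine) auto
  also have "\<dots> = \<bar>?e\<bar> * (\<integral>\<^sup>+x. \<integral>\<^sup>+y. f x (c * x / a + ?e * y) \<partial>lborel \<partial>lborel)"
    by (rule nn_integral_cmult) measurable
  also have "(\<integral>\<^sup>+x. \<integral>\<^sup>+y. f x (c * x / a + ?e * y) \<partial>lborel \<partial>lborel)
      = (\<integral>\<^sup>+y. \<integral>\<^sup>+x. f x (c * x / a + ?e * y) \<partial>lborel \<partial>lborel)"
    by (rule lborel_pair.Fubini'[symmetric]) measurable
  also have "\<dots> = (\<integral>\<^sup>+y. \<bar>a\<bar> * (\<integral>\<^sup>+x. f (b * y + a * x) (c * (b * y + a * x) / a + ?e * y) \<partial>lborel) \<partial>lborel)"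
    using False by (intro nn_integral_cong nn_integral_real_affine) auto
  also have "\<dots> = \<bar>a\<bar> * (\<integral>\<^sup>+y. \<integral>\<^sup>+x. f (b * y + a * x) (c * (b * y + a * x) / a + ?e * y) \<partial>lborel \<partial>lborel)"
    by (rule nn_integral_cmult) measurable
  also have "(\<integral>\<^sup>+y. \<integral>\<^sup>+x. f (b * y + a * x) (c * (b * y + a * x) / a + ?e * y) \<partial>lborel \<partial>lborel)
      = (\<integral>\<^sup>+y. \<integral>\<^sup>+x. f (a * x + b * y) (c * x + d * y) \<partial>lborel \<partial>lborel)"
    using False by (intro nn_integral_cong arg_cong2[where f=f]) (auto simp: field_simps)
  also have "\<dots> = (\<integral>\<^sup>+x. \<integral>\<^sup>+y. f (a * x + b * y) (c * x + d * y) \<partial>lborel \<partial>lborel)"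
    by (rule lborel_pair.Fubini') measurable
  finally show ?thesis
    using False by (simp add: mult.assoc[symmetric] ennreal_mult''[symmetric] abs_mult)
next
  case True
  with D have bc: "b \<noteq> 0" "c \<noteq> 0" by auto
  have "(\<integral>\<^sup>+x. \<integral>\<^sup>+y. f x y \<partial>lborel \<partial>lborel)
      = \<bar>b\<bar> * (\<integral>\<^sup>+y. \<integral>\<^sup>+x. f (0 + b * y) x \<partial>lborel \<partial>lborel)"
    using bc by (intro nn_integral_real_affine) auto
  also have "(\<integral>\<^sup>+y. \<integral>\<^sup>+x. f (0 + b * y) x \<partial>lborel \<partial>lborel)
     = (\<integral>\<^sup>+y. \<bar>c\<bar> * (\<integral>\<^sup>+x. f (0 + b * y) (d * y + c * x) \<partial>lborel) \<partial>lborel)"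
    using bc by (intro nn_integral_cong nn_integral_real_affine) auto
  also have "\<dots> = \<bar>c\<bar> * (\<integral>\<^sup>+y. \<integral>\<^sup>+x. f (0 + b * y) (d * y + c * x) \<partial>lborel \<partial>lborel)"
    by (rule nn_integral_cmult) measurable
  also have "(\<integral>\<^sup>+y. \<integral>\<^sup>+x. f (0 + b * y) (d * y + c * x) \<partial>lborel \<partial>lborel) =
     (\<integral>\<^sup>+y. \<integral>\<^sup>+x. f (a * x + b * y) (c * x + d * y) \<partial>lborel \<partial>lborel)"
    using True by (intro nn_integral_cong arg_cong2[where f=f]) (auto simp: field_simps)
  also have "\<dots> = (\<integral>\<^sup>+x. \<integral>\<^sup>+y. f (a * x + b * y) (c * x + d * y) \<partial>lborel \<partial>lborel)"
    by (rule lborel_pair.Fubini') measurable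
  finally show ?thesis
    using True by (simp add: mult.assoc[symmetric] ennreal_mult''[symmetric] abs_mult[symmetric])
qed

lemma nn_integral_even:
  fixes f :: "real \<Rightarrow> ennreal"
  assumes [measurable]: "f \<in> borel_measurable borel" and even: "\<And>x. f (- x) = f x"
  shows "(\<integral>\<^sup>+x. f x \<partial>lborel) = 2 * (\<integral>\<^sup>+x\<in>{0..}. f x \<partial>lborel)"
proof -
  have "f x = f x * indicator {0..} x + f x * indicator {..0} x" if "x \<noteq> 0" for x
    using that by (cases "0 < x") simp_all
  then have "(\<integral>\<^sup>+x. f x \<partial>lborel) = (\<integral>\<^sup>+x. f x * indicator {0..} x + f x * indicator {..0} x \<partial>lborel)"
    by (intro nn_integral_cong_AE AE_mp[OF AE_lborel_singleton[of 0] AE_I2]) auto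
  also have "\<dots> = (\<integral>\<^sup>+x\<in>{0..}. f x \<partial>lborel) + (\<integral>\<^sup>+x\<in>{..0}. f x \<partial>lborel)"
    by (rule nn_integral_add) measurable
  also have "(\<integral>\<^sup>+x\<in>{..0}. f x \<partial>lborel) = (\<integral>\<^sup>+x. f (0 + - 1 * x) * indicator {..0} (0 + - 1 * x :: real) \<partial>lborel)"
    by (subst nn_integral_real_affine[of _ "- 1" 0]) simp_all
  also have "\<dots> = (\<integral>\<^sup>+x\<in>{0..}. f x \<partial>lborel)"
    by (intro nn_integral_cong) (simp add: even indicator_def)
  finally show ?thesis unfolding mult_2 .
qed

lemma nn_integral_arctan: "(\<integral>\<^sup>+t. ennreal (1 / (1 + t\<^sup>2)) \<partial>lborel) = ennreal pi"
proof -
  have "(\<integral>\<^sup>+t\<in>{0..}. ennreal (1 / (1 + t\<^sup>2)) \<partial>lborel) = ennreal (pi / 2 - arctan 0)"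
    by (rule nn_integral_FTC_atLeast)
      (auto intro!: derivative_eq_intros tendsto_arctan_at_top simp: field_simps power2_eq_square)
  moreover have "2 * ennreal (pi / 2) = ennreal pi"
    using ennreal_mult'[of 2 "pi/2"] by simp
  ultimately show ?thesis
    using nn_integral_even[of "\<lambda>t. ennreal (1 / (1 + t\<^sup>2))"] by simp
qed

lemma nn_integral_square_substitution:
  fixes f :: "real \<Rightarrow> real"
  assumes f [measurable]: "f \<in> borel_measurable borel" and c: "c > 0"
  shows "(\<integral>\<^sup>+x\<in>{0..}. ennreal (f (c * x\<^sup>2) * (2 * c * x)) \<partial>lborel) = (\<integral>\<^sup>+w\<in>{0..}. ennreal (f w) \<partial>lborel)"
proof -
  have eq: "(\<integral>\<^sup>+w. f w * indicator {0..c * (real n)\<^sup>2} w \<partial>lborel) =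
     (\<integral>\<^sup>+x. f (c * x\<^sup>2) * (2 * c * x) * indicator {0..real n} x \<partial>lborel)" for n
    using c by (subst nn_integral_substitution[of "\<lambda>x. c * x\<^sup>2" 0 "real n" f "\<lambda>x. 2 * c * x", simplified])
     (auto intro!: derivative_eq_intros continuous_intros simp: set_borel_measurable_def)
  have *: "(\<integral>\<^sup>+x\<in>{0..}. ennreal (h x) \<partial>lborel) = (SUP n. \<integral>\<^sup>+x. h x * indicator {0..u n} x \<partial>lborel)"
    if [measurable]: "h \<in> borel_measurable borel" and u: "incseq u" "filterlim u at_top sequentially"
    for h :: "real \<Rightarrow> real" and u :: "nat \<Rightarrow> real"
  proof -
    have "(\<Union>n. {0..u n}) = {0..}"
    proof safe
      fix x :: real assume "0 \<le> x"
      have "\<forall>\<^sub>F n in sequentially. x \<le> u n" using u(2) by (auto simp: filterlim_at_top)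
      then show "x \<in> (\<Union>n. {0..u n})" using \<open>0 \<le> x\<close> by (auto simp: eventually_sequentially)
    qed auto
    moreover have "incseq (\<lambda>n. {0..u n})" using u(1) by (fastforce simp: incseq_def)
    ultimately have "(\<integral>\<^sup>+x\<in>{0..}. ennreal (h x) \<partial>lborel) = (SUP n. \<integral>\<^sup>+x\<in>{0..u n}. ennreal (h x) \<partial>lborel)"
      using emeasure_density[of "\<lambda>x. ennreal (h x)" lborel]
        SUP_emeasure_incseq[of "\<lambda>n. {0..u n}" "density lborel (\<lambda>x. ennreal (h x))"]
      by (simp add: image_subset_iff)
    then show ?thesis by (simp add: ennreal_mult'' ennreal_indicator)
  qed
  have lim: "filterlim (\<lambda>n. c * (real n)\<^sup>2) at_top sequentially"
    using c by real_asymp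
  have incseq: "incseq (\<lambda>n. c * (real n)\<^sup>2)"
    using c by (auto simp: incseq_def power_mono)
  show ?thesis
    unfolding *[OF f incseq lim] using *[OF _ _ filterlim_real_sequentially, of "\<lambda>x. f (c * x\<^sup>2) * (2 * c * x)"]
    by (simp add: eq incseq_def)
qed

text \<open>Polar coordinates without angles: the substitution \<open>y = x t\<close> turns the
  plane into the slopes \<open>t\<close>, whose density \<open>1 / (1 + t\<^sup>2)\<close> has
  total mass \<open>\<pi>\<close>, times the squared radius \<open>w\<close>.\<close>
lemma nn_integral_polar:
  fixes f :: "real \<Rightarrow> real"
  assumes f [measurable]: "f \<in> borel_measurable borel"
  shows "(\<integral>\<^sup>+x. \<integral>\<^sup>+y. ennreal (f (x\<^sup>2 + y\<^sup>2)) \<partial>lborel \<partial>lborel) = ennreal pi * (\<integral>\<^sup>+w\<in>{0..}. ennreal (f w) \<partial>lborel)"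
proof -
  let ?I = "\<integral>\<^sup>+w\<in>{0..}. ennreal (f w) \<partial>lborel"
  have "(\<integral>\<^sup>+x. \<integral>\<^sup>+y. ennreal (f (x\<^sup>2 + y\<^sup>2)) \<partial>lborel \<partial>lborel)
     = (\<integral>\<^sup>+x. \<integral>\<^sup>+t. ennreal \<bar>x\<bar> * ennreal (f ((1 + t\<^sup>2) * x\<^sup>2)) \<partial>lborel \<partial>lborel)"
  proof (rule nn_integral_cong_AE, rule AE_mp[OF AE_lborel_singleton[of 0] AE_I2], rule impI)
    fix x :: real assume "x \<noteq> 0"
    then have "(\<integral>\<^sup>+y. ennreal (f (x\<^sup>2 + y\<^sup>2)) \<partial>lborel) = \<bar>x\<bar> * (\<integral>\<^sup>+y. ennreal (f (x\<^sup>2 + (0 + x * y)\<^sup>2)) \<partial>lborel)"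
      by (intro nn_integral_real_affine) auto
    then show "(\<integral>\<^sup>+y. ennreal (f (x\<^sup>2 + y\<^sup>2)) \<partial>lborel) = (\<integral>\<^sup>+t. ennreal \<bar>x\<bar> * ennreal (f ((1 + t\<^sup>2) * x\<^sup>2)) \<partial>lborel)"
      by (subst nn_integral_cmult) (auto simp: algebra_simps power_mult_distrib)
  qed
  also have "\<dots> = (\<integral>\<^sup>+t. \<integral>\<^sup>+x. ennreal \<bar>x\<bar> * ennreal (f ((1 + t\<^sup>2) * x\<^sup>2)) \<partial>lborel \<partial>lborel)"
    by (rule lborel_pair.Fubini') measurable
  also have "\<dots> = (\<integral>\<^sup>+t. ennreal (1 / (1 + t\<^sup>2)) * ?I \<partial>lborel)"
  proof (intro nn_integral_cong)
    fix t :: real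
    have pos: "1 + t\<^sup>2 > 0" by (simp add: add_pos_nonneg)
    have eqs: "2 * (ennreal \<bar>x\<bar> * ennreal (f ((1 + t\<^sup>2) * x\<^sup>2)))
        = ennreal (1 / (1 + t\<^sup>2)) * ennreal (f ((1 + t\<^sup>2) * x\<^sup>2) * (2 * (1 + t\<^sup>2) * x))" if "0 \<le> x" for x
    proof -
      have "2 * (ennreal \<bar>x\<bar> * ennreal (f ((1 + t\<^sup>2) * x\<^sup>2))) = ennreal (2 * x * f ((1 + t\<^sup>2) * x\<^sup>2))"
        using that by (simp add: ennreal_mult' mult.assoc)
      also have "2 * x * f ((1 + t\<^sup>2) * x\<^sup>2) = 1 / (1 + t\<^sup>2) * (f ((1 + t\<^sup>2) * x\<^sup>2) * (2 * (1 + t\<^sup>2) * x))"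
        using pos by (simp add: eq_divide_eq)
      finally show ?thesis using pos by (simp only: ennreal_mult' divide_nonneg_pos zero_le_one)
    qed
    have "(\<integral>\<^sup>+x. ennreal \<bar>x\<bar> * ennreal (f ((1 + t\<^sup>2) * x\<^sup>2)) \<partial>lborel)
      = 2 * (\<integral>\<^sup>+x\<in>{0..}. ennreal \<bar>x\<bar> * ennreal (f ((1 + t\<^sup>2) * x\<^sup>2)) \<partial>lborel)"
      by (rule nn_integral_even) simp_all
    also have "\<dots> = (\<integral>\<^sup>+x\<in>{0..}. 2 * (ennreal \<bar>x\<bar> * ennreal (f ((1 + t\<^sup>2) * x\<^sup>2))) \<partial>lborel)"
      by (subst nn_integral_cmult[symmetric]) (auto simp: mult.assoc)
    also have "\<dots> = (\<integral>\<^sup>+x. ennreal (1 / (1 + t\<^sup>2)) * (ennreal (f ((1 + t\<^sup>2) * x\<^sup>2) * (2 * (1 + t\<^sup>2) * x)) * indicator {0..} x) \<partial>lborel)"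
    proof (rule nn_integral_cong)
      fix x :: real
      show "2 * (ennreal \<bar>x\<bar> * ennreal (f ((1 + t\<^sup>2) * x\<^sup>2))) * indicator {0..} x
        = ennreal (1 / (1 + t\<^sup>2)) * (ennreal (f ((1 + t\<^sup>2) * x\<^sup>2) * (2 * (1 + t\<^sup>2) * x)) * indicator {0..} x)"
        by (cases "0 \<le> x") (simp_all only: eqs indicator_simps atLeast_iff mult_1_right mult_zero_right not_False_eq_True)
    qed
    also have "\<dots> = ennreal (1 / (1 + t\<^sup>2)) * ?I"
      by (subst nn_integral_cmult) (measurable, simp only: nn_integral_square_substitution[OF f pos])
    finally show "(\<integral>\<^sup>+x. ennreal \<bar>x\<bar> * ennreal (f ((1 + t\<^sup>2) * x\<^sup>2)) \<partial>lborel) = ennreal (1 / (1 + t\<^sup>2)) * ?I" .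
  qed
  also have "\<dots> = ennreal pi * ?I"
    by (simp add: nn_integral_multc nn_integral_arctan)
  finally show ?thesis .
qed

lemma nn_integral_polar_powr:
  assumes k: "k > 1"
  shows "(\<integral>\<^sup>+x. \<integral>\<^sup>+y. ennreal ((1 + x\<^sup>2 + y\<^sup>2) powr - k) \<partial>lborel \<partial>lborel) = ennreal (pi / (k - 1))"
proof -
  have "(\<integral>\<^sup>+w\<in>{0..}. ennreal ((1 + w) powr - k) \<partial>lborel) = ennreal (0 - (- ((1 + 0) powr (1 - k) / (k - 1))))"
  proof (rule nn_integral_FTC_atLeast)
    show "((\<lambda>w. - ((1 + w) powr (1 - k) / (k - 1))) has_real_derivative (1 + w) powr - k) (at w)" if "0 \<le> w" for w
    proof -
      have "((\<lambda>w. (1 + w) powr (1 - k)) has_real_derivative (1 - k) * (1 + w) powr (1 - k - 1) * 1) (at w)"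
        using that DERIV_fun_powr[of "\<lambda>w. 1 + w" 1 w "1 - k"] by (auto intro!: derivative_eq_intros)
      from DERIV_minus[OF DERIV_cdivide[OF this, of "k - 1"]] show ?thesis
      proof (rule DERIV_cong)
        have "- ((1 - k) * P / (k - 1)) = P" for P :: real
          using k by (simp only: minus_divide_left) (simp add: nonzero_divide_eq_eq algebra_simps)
        moreover have "1 - k - 1 = - k" by simp
        ultimately show "- ((1 - k) * (1 + w) powr (1 - k - 1) * 1 / (k - 1)) = (1 + w) powr - k"
          by (simp only: mult_1_right)
      qed
    qed
    show "((\<lambda>w. - ((1 + w) powr (1 - k) / (k - 1))) \<longlongrightarrow> 0) at_top"
      using k by real_asymp
  qed auto
  then show ?thesis
    using nn_integral_polar[of "\<lambda>w. (1 + w) powr - k"] k ennreal_mult'[of pi "1 / (k - 1)"]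
    by (simp add: add.assoc)
qed

section \<open>The radial integral behind the two constants\<close>

lemma nn_integral_exp_square:
  assumes c: "c > 0"
  shows "(\<integral>\<^sup>+x. ennreal (exp (- c * (x + m)\<^sup>2)) \<partial>lborel) = ennreal (sqrt (pi / c))"
proof -
  have "exp (- c * (x + m)\<^sup>2) = sqrt (pi / c) * normal_density (- m) (sqrt (1 / (2 * c))) x" for x
  proof -
    have s: "(sqrt (1 / (2 * c)))\<^sup>2 = 1 / (2 * c)" using c by simp
    have "2 * pi * (1 / (2 * c)) = pi / c" "- (x - - m)\<^sup>2 / (2 * (1 / (2 * c))) = - c * (x + m)\<^sup>2"
      using c by (simp_all add: field_simps)
    then show ?thesis using c by (simp only: normal_density_def s) simp
  qed
  then have "(\<integral>\<^sup>+x. ennreal (exp (- c * (x + m)\<^sup>2)) \<partial>lborel)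
     = (\<integral>\<^sup>+x. ennreal (sqrt (pi / c)) * ennreal (normal_density (- m) (sqrt (1 / (2 * c))) x) \<partial>lborel)"
    using c by (simp add: ennreal_mult')
  also have "\<dots> = ennreal (sqrt (pi / c)) * (\<integral>\<^sup>+x. ennreal (normal_density (- m) (sqrt (1 / (2 * c))) x) \<partial>lborel)"
    by (rule nn_integral_cmult) simp
  also have "(\<integral>\<^sup>+x. ennreal (normal_density (- m) (sqrt (1 / (2 * c))) x) \<partial>lborel) = 1"
    using c by (subst nn_integral_eq_integral) auto
  finally show ?thesis by simp
qed

text \<open>With \<open>E = ((a, b), (b, c))\<close>, the exponent is \<open>- tr N\<^sup>2 /
  2\<close> for a symmetric \<open>4 \<times> 4\<close> matrix \<open>N\<close> that has the
  double eigenvalue \<open>l\<close> and for which the other two eigenvalues are \<open>l\<close>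
  plus those of \<open>E\<close>. Integrating out \<open>l\<close> leaves a Gaussian in \<open>p =
  (a + c) / 2\<close>, \<open>q = (a - c) / 2\<close> and \<open>b\<close>; since \<open>det E =
  p\<^sup>2 - (q\<^sup>2 + b\<^sup>2)\<close>, only \<open>p\<close> and the squared radius
  \<open>w = q\<^sup>2 + b\<^sup>2\<close> matter.\<close>
lemma core_integral:
  fixes D :: "real set"
  assumes D [measurable]: "D \<in> sets borel"
  shows "(\<integral>\<^sup>+l. \<integral>\<^sup>+c. \<integral>\<^sup>+b. \<integral>\<^sup>+a. ennreal (indicator D (a * c - b\<^sup>2) * (a * c - b\<^sup>2)\<^sup>2 *
        exp (- (4 * l\<^sup>2 + 2 * l * (a + c) + (a\<^sup>2 + 2 * b\<^sup>2 + c\<^sup>2)) / 2)) \<partial>lborel \<partial>lborel \<partial>lborel \<partial>lborel)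
    = ennreal (2 * pi * sqrt (pi / 2)) *
      (\<integral>\<^sup>+p. (\<integral>\<^sup>+w\<in>{0..}. ennreal (indicator D (p\<^sup>2 - w) * (p\<^sup>2 - w)\<^sup>2 * exp (- w) * exp (- p\<^sup>2 / 2)) \<partial>lborel) \<partial>lborel)"
    (is "(\<integral>\<^sup>+l. \<integral>\<^sup>+c. \<integral>\<^sup>+b. \<integral>\<^sup>+a. ?F l c b a \<partial>lborel \<partial>lborel \<partial>lborel \<partial>lborel) = _")
proof -
  let ?G = "\<lambda>c b a. ennreal (indicator D (a * c - b\<^sup>2) * (a * c - b\<^sup>2)\<^sup>2 * exp ((a + c)\<^sup>2 / 8 - (a\<^sup>2 + 2 * b\<^sup>2 + c\<^sup>2) / 2))"
  let ?H = "\<lambda>b p q. ennreal (indicator D (p\<^sup>2 - (q\<^sup>2 + b\<^sup>2)) * (p\<^sup>2 - (q\<^sup>2 + b\<^sup>2))\<^sup>2 * exp (- (q\<^sup>2 + b\<^sup>2)) * exp (- p\<^sup>2 / 2))"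
  have inner: "(\<integral>\<^sup>+l. ?F l c b a \<partial>lborel) = ?G c b a * ennreal (sqrt (pi / 2))" for c b a
  proof -
    \<comment> \<open>the square in \<open>l\<close> is completed at \<open>l = - (a + c) / 4\<close>\<close>
    have "- (4 * l\<^sup>2 + 2 * l * (a + c) + (a\<^sup>2 + 2 * b\<^sup>2 + c\<^sup>2)) / 2
        = ((a + c)\<^sup>2 / 8 - (a\<^sup>2 + 2 * b\<^sup>2 + c\<^sup>2) / 2) + - 2 * (l + (a + c) / 4)\<^sup>2" for l
      by (simp add: power2_eq_square field_simps)
    then have "?F l c b a = ?G c b a * ennreal (exp (- 2 * (l + (a + c) / 4)\<^sup>2))" for l
      by (simp only: exp_add) (simp add: ennreal_mult[symmetric] mult.assoc)
    then show ?thesis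
      by (simp only:) (subst nn_integral_cmult, simp, simp only: nn_integral_exp_square)
  qed
  have "(\<integral>\<^sup>+l. \<integral>\<^sup>+c. \<integral>\<^sup>+b. \<integral>\<^sup>+a. ?F l c b a \<partial>lborel \<partial>lborel \<partial>lborel \<partial>lborel)
     = (\<integral>\<^sup>+c. \<integral>\<^sup>+l. \<integral>\<^sup>+b. \<integral>\<^sup>+a. ?F l c b a \<partial>lborel \<partial>lborel \<partial>lborel \<partial>lborel)"
    by (rule lborel_pair.Fubini') measurable
  also have "\<dots> = (\<integral>\<^sup>+c. \<integral>\<^sup>+b. \<integral>\<^sup>+l. \<integral>\<^sup>+a. ?F l c b a \<partial>lborel \<partial>lborel \<partial>lborel \<partial>lborel)"
    by (rule nn_integral_cong, rule lborel_pair.Fubini') measurable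
  also have "\<dots> = (\<integral>\<^sup>+c. \<integral>\<^sup>+b. \<integral>\<^sup>+a. \<integral>\<^sup>+l. ?F l c b a \<partial>lborel \<partial>lborel \<partial>lborel \<partial>lborel)"
    by (rule nn_integral_cong, rule nn_integral_cong, rule lborel_pair.Fubini') measurable
  also have "\<dots> = (\<integral>\<^sup>+c. \<integral>\<^sup>+b. \<integral>\<^sup>+a. ?G c b a * ennreal (sqrt (pi / 2)) \<partial>lborel \<partial>lborel \<partial>lborel)"
    by (simp only: inner)
  also have "\<dots> = (\<integral>\<^sup>+c. \<integral>\<^sup>+b. \<integral>\<^sup>+a. ?G c b a \<partial>lborel \<partial>lborel \<partial>lborel) * ennreal (sqrt (pi / 2))"
    by (subst nn_integral_multc[symmetric], measurable, rule nn_integral_cong,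
        subst nn_integral_multc[symmetric], measurable, rule nn_integral_cong,
        subst nn_integral_multc[symmetric], measurable)
  also have "(\<integral>\<^sup>+c. \<integral>\<^sup>+b. \<integral>\<^sup>+a. ?G c b a \<partial>lborel \<partial>lborel \<partial>lborel) = (\<integral>\<^sup>+b. \<integral>\<^sup>+c. \<integral>\<^sup>+a. ?G c b a \<partial>lborel \<partial>lborel \<partial>lborel)"
    by (rule lborel_pair.Fubini') measurable
  also have "\<dots> = (\<integral>\<^sup>+b. ennreal 2 * (\<integral>\<^sup>+p. \<integral>\<^sup>+q. ?H b p q \<partial>lborel \<partial>lborel) \<partial>lborel)"
  proof (rule nn_integral_cong)
    fix b :: real
    have "?G (1 * p + 1 * q) b (1 * p + - 1 * q) = ?H b p q" for p q
    proof -
      have "((1 * p + - 1 * q) + (1 * p + 1 * q))\<^sup>2 / 8 - ((1 * p + - 1 * q)\<^sup>2 + 2 * b\<^sup>2 + (1 * p + 1 * q)\<^sup>2) / 2 = - (q\<^sup>2 + b\<^sup>2) + - p\<^sup>2 / 2"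
        by (simp add: power2_eq_square field_simps)
      moreover have "(1 * p + - 1 * q) * (1 * p + 1 * q) - b\<^sup>2 = p\<^sup>2 - (q\<^sup>2 + b\<^sup>2)"
        by (simp add: power2_eq_square algebra_simps)
      ultimately show ?thesis by (simp only: exp_add mult.assoc)
    qed
    moreover have "(\<integral>\<^sup>+c. \<integral>\<^sup>+a. ?G c b a \<partial>lborel \<partial>lborel)
        = ennreal \<bar>1 * - 1 - 1 * 1\<bar> * (\<integral>\<^sup>+p. \<integral>\<^sup>+q. ?G (1 * p + 1 * q) b (1 * p + - 1 * q) \<partial>lborel \<partial>lborel)"
      by (rule nn_integral_linear_2d) simp_all
    ultimately show "(\<integral>\<^sup>+c. \<integral>\<^sup>+a. ?G c b a \<partial>lborel \<partial>lborel) = ennreal 2 * (\<integral>\<^sup>+p. \<integral>\<^sup>+q. ?H b p q \<partial>lborel \<partial>lborel)"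
      by (simp only:) simp
  qed
  also have "\<dots> = ennreal 2 * (\<integral>\<^sup>+b. \<integral>\<^sup>+p. \<integral>\<^sup>+q. ?H b p q \<partial>lborel \<partial>lborel \<partial>lborel)"
    by (rule nn_integral_cmult) measurable
  also have "(\<integral>\<^sup>+b. \<integral>\<^sup>+p. \<integral>\<^sup>+q. ?H b p q \<partial>lborel \<partial>lborel \<partial>lborel) = (\<integral>\<^sup>+p. \<integral>\<^sup>+b. \<integral>\<^sup>+q. ?H b p q \<partial>lborel \<partial>lborel \<partial>lborel)"
    by (rule lborel_pair.Fubini') measurable
  also have "\<dots> = (\<integral>\<^sup>+p. ennreal pi * (\<integral>\<^sup>+w\<in>{0..}. ennreal (indicator D (p\<^sup>2 - w) * (p\<^sup>2 - w)\<^sup>2 * exp (- w) * exp (- p\<^sup>2 / 2)) \<partial>lborel) \<partial>lborel)"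
  proof (rule nn_integral_cong)
    fix p :: real
    have "(\<integral>\<^sup>+b. \<integral>\<^sup>+q. ?H b p q \<partial>lborel \<partial>lborel) = (\<integral>\<^sup>+q. \<integral>\<^sup>+b. ?H b p q \<partial>lborel \<partial>lborel)"
      by (rule lborel_pair.Fubini') measurable
    then show "(\<integral>\<^sup>+b. \<integral>\<^sup>+q. ?H b p q \<partial>lborel \<partial>lborel) = ennreal pi * (\<integral>\<^sup>+w\<in>{0..}. ennreal (indicator D (p\<^sup>2 - w) * (p\<^sup>2 - w)\<^sup>2 * exp (- w) * exp (- p\<^sup>2 / 2)) \<partial>lborel)"
      by (simp only:) (rule nn_integral_polar, measurable)
  qed
  also have "\<dots> = ennreal pi * (\<integral>\<^sup>+p. (\<integral>\<^sup>+w\<in>{0..}. ennreal (indicator D (p\<^sup>2 - w) * (p\<^sup>2 - w)\<^sup>2 * exp (- w) * exp (- p\<^sup>2 / 2)) \<partial>lborel) \<partial>lborel)"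
    by (rule nn_integral_cmult) measurable
  finally show ?thesis
    by (simp add: ennreal_mult' mult_ac)
qed

lemma std_normal_moments:
  "has_bochner_integral lborel (\<lambda>x. exp (- x\<^sup>2 / 2) * x ^ (2 * k)) (sqrt (2 * pi) * (fact (2 * k) / (2 ^ k * fact k)))"
proof -
  have "exp (- x\<^sup>2 / 2) * x ^ (2 * k) = sqrt (2 * pi) * (std_normal_density x * x ^ (2 * k))" for x :: real
    by (simp add: std_normal_density_def)
  then show ?thesis
    using has_bochner_integral_mult_right[OF std_normal_moment_even[of k], of "sqrt (2 * pi)"]
    by (simp only: mult.assoc)
qed

text \<open>The fourth, second and zeroth Gaussian moments give \<open>3 - 2 + 2 = 3\<close>, and
  \<open>exp (- p\<^sup>2)\<close> rescales the Gaussian by \<open>1 / \<surd>3\<close>.\<close>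
lemma nn_integral_moment_combination:
  assumes nonneg: "\<And>p. 0 \<le> p ^ 4 - 2 * p\<^sup>2 + 2 - r * exp (- p\<^sup>2)"
  shows "(\<integral>\<^sup>+p. ennreal ((p ^ 4 - 2 * p\<^sup>2 + 2 - r * exp (- p\<^sup>2)) * exp (- p\<^sup>2 / 2)) \<partial>lborel)
     = ennreal (sqrt (2 * pi) * (3 - r / sqrt 3))"
proof -
  have g3: "has_bochner_integral lborel (\<lambda>p. exp (- (3 / 2) * (p + 0)\<^sup>2)) (sqrt (2 * pi / 3))"
    by (rule has_bochner_integral_nn_integral) (use nn_integral_exp_square[of "3/2" 0] in simp_all)
  have "has_bochner_integral lborel (\<lambda>p. (p ^ 4 - 2 * p\<^sup>2 + 2 - r * exp (- p\<^sup>2)) * exp (- p\<^sup>2 / 2))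
     (sqrt (2 * pi) * (fact (2 * 2) / (2 ^ 2 * fact 2)) - 2 * (sqrt (2 * pi) * (fact (2 * 1) / (2 ^ 1 * fact 1)))
       + 2 * (sqrt (2 * pi) * (fact (2 * 0) / (2 ^ 0 * fact 0))) - r * sqrt (2 * pi / 3))"
  proof (rule has_bochner_integral_cong[THEN iffD1, OF refl _ refl])
    show "has_bochner_integral lborel (\<lambda>p. exp (- p\<^sup>2 / 2) * p ^ (2 * 2) - 2 * (exp (- p\<^sup>2 / 2) * p ^ (2 * 1))
        + 2 * (exp (- p\<^sup>2 / 2) * p ^ (2 * 0)) - r * exp (- (3 / 2) * (p + 0)\<^sup>2))
     (sqrt (2 * pi) * (fact (2 * 2) / (2 ^ 2 * fact 2)) - 2 * (sqrt (2 * pi) * (fact (2 * 1) / (2 ^ 1 * fact 1)))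
       + 2 * (sqrt (2 * pi) * (fact (2 * 0) / (2 ^ 0 * fact 0))) - r * sqrt (2 * pi / 3))"
      by (intro has_bochner_integral_add has_bochner_integral_diff has_bochner_integral_mult_right std_normal_moments g3)
    fix p :: real
    have "exp (- (3 / 2) * (p + 0)\<^sup>2) = exp (- p\<^sup>2) * exp (- p\<^sup>2 / 2)"
      by (simp flip: exp_add)
    then show "exp (- p\<^sup>2 / 2) * p ^ (2 * 2) - 2 * (exp (- p\<^sup>2 / 2) * p ^ (2 * 1))
        + 2 * (exp (- p\<^sup>2 / 2) * p ^ (2 * 0)) - r * exp (- (3 / 2) * (p + 0)\<^sup>2) = (p ^ 4 - 2 * p\<^sup>2 + 2 - r * exp (- p\<^sup>2)) * exp (- p\<^sup>2 / 2)"
      by (simp add: algebra_simps power2_eq_square power4_eq_xxxx)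
  qed
  moreover have "sqrt (2 * pi) * (fact (2 * 2) / (2 ^ 2 * fact 2)) - 2 * (sqrt (2 * pi) * (fact (2 * 1) / (2 ^ 1 * fact 1)))
       + 2 * (sqrt (2 * pi) * (fact (2 * 0) / (2 ^ 0 * fact 0))) - r * sqrt (2 * pi / 3) = sqrt (2 * pi) * (3 - r / sqrt 3)"
    by (simp add: fact_numeral real_sqrt_divide algebra_simps)
  ultimately show ?thesis
    using nonneg by (subst nn_integral_eq_integral) (auto simp: has_bochner_integral_iff)
qed

text \<open>An antiderivative is available because a polynomial times \<open>exp (- w)\<close>
  integrates to a polynomial times \<open>exp (- w)\<close>; excluding \<open>w = P\<close>
  changes nothing.\<close>
lemma radial_integral_all:
  "(\<integral>\<^sup>+w\<in>{0..}. ennreal (indicator (- {0}) (P - w) * (P - w)\<^sup>2 * exp (- w) * e) \<partial>lborel)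
     = ennreal ((P\<^sup>2 - 2 * P + 2) * e)" if e: "e \<ge> (0::real)"
proof -
  have "(\<integral>\<^sup>+w\<in>{0..}. ennreal ((P - w)\<^sup>2 * exp (- w) * e) \<partial>lborel) =
     ennreal (0 - (- ((P - 0)\<^sup>2 - 2 * (P - 0) + 2) * exp (- 0) * e))"
  proof (rule nn_integral_FTC_atLeast)
    show "((\<lambda>w. - ((P - w)\<^sup>2 - 2 * (P - w) + 2) * exp (- w) * e) has_real_derivative (P - w)\<^sup>2 * exp (- w) * e) (at w)" for w
      by (auto intro!: derivative_eq_intros simp: power2_eq_square algebra_simps)
    show "((\<lambda>w. - ((P - w)\<^sup>2 - 2 * (P - w) + 2) * exp (- w) * e) \<longlongrightarrow> 0) at_top"
      by real_asymp
  qed (use e in auto)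
  moreover have "indicator (- {0}) (P - w) * (P - w)\<^sup>2 = (P - w)\<^sup>2" for w
    by (simp add: indicator_def)
  moreover have "0 - (- ((P - 0)\<^sup>2 - 2 * (P - 0) + 2) * exp (- 0) * e) = (P\<^sup>2 - 2 * P + 2) * e"
    by (simp add: algebra_simps)
  ultimately show ?thesis by (simp only:)
qed

text \<open>The restriction to \<open>w < P\<close> truncates the previous integral, which
  subtracts the tail \<open>2 exp (- P)\<close>. This tail is the only source of
  \<open>\<surd>3\<close> in the final answer.\<close>
lemma radial_integral_pos:
  "(\<integral>\<^sup>+w\<in>{0..}. ennreal (indicator {0<..} (P - w) * (P - w)\<^sup>2 * exp (- w) * e) \<partial>lborel)
     = ennreal ((P\<^sup>2 - 2 * P + 2 - 2 * exp (- P)) * e)" if e: "e \<ge> (0::real)" and P: "P \<ge> 0"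
proof -
  have "(\<integral>\<^sup>+w\<in>{0..P}. ennreal ((P - w)\<^sup>2 * exp (- w) * e) \<partial>lborel) =
     ennreal (- ((P - P)\<^sup>2 - 2 * (P - P) + 2) * exp (- P) * e - (- ((P - 0)\<^sup>2 - 2 * (P - 0) + 2) * exp (- 0) * e))"
  proof (rule nn_integral_FTC_Icc)
    show "((\<lambda>w. - ((P - w)\<^sup>2 - 2 * (P - w) + 2) * exp (- w) * e) has_real_derivative (P - w)\<^sup>2 * exp (- w) * e) (at w)" for w
      by (auto intro!: derivative_eq_intros simp: power2_eq_square algebra_simps)
  qed (use e P in auto)
  moreover have "ennreal (indicator {0<..} (P - w) * (P - w)\<^sup>2 * exp (- w) * e) * indicator {0..} w
      = ennreal ((P - w)\<^sup>2 * exp (- w) * e) * indicator {0..P} w" for w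
    by (simp add: indicator_def)
  ultimately show ?thesis by (simp add: algebra_simps)
qed

text \<open>The set \<open>D\<close> records which signs of the product of the two nonzero
  eigenvalues are counted: all of them for the symmetroid, only positive ones for the
  spectrahedron.\<close>
definition sector_constant :: "real set \<Rightarrow> real" where
  "sector_constant D = (if D = {0<..} then 3 - 2 / sqrt 3 else 3)"

lemma core_integral_value:
  assumes D: "D = - {0} \<or> D = {0<..}"
  shows "(\<integral>\<^sup>+l. \<integral>\<^sup>+c. \<integral>\<^sup>+b. \<integral>\<^sup>+a. ennreal (indicator D (a * c - b\<^sup>2) * (a * c - b\<^sup>2)\<^sup>2 *
        exp (- (4 * l\<^sup>2 + 2 * l * (a + c) + (a\<^sup>2 + 2 * b\<^sup>2 + c\<^sup>2)) / 2)) \<partial>lborel \<partial>lborel \<partial>lborel \<partial>lborel)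
    = ennreal (2 * pi\<^sup>2 * sector_constant D)"
proof -
  define r where "r = (if D = {0<..} then 2 else 0 :: real)"
  have ne: "- {0::real} \<noteq> {0<..}"
  proof -
    have "- 1 \<in> - {0::real}" "- 1 \<notin> {0::real<..}" by simp_all
    then show ?thesis by blast
  qed
  have rad: "(\<integral>\<^sup>+w\<in>{0..}. ennreal (indicator D (p\<^sup>2 - w) * (p\<^sup>2 - w)\<^sup>2 * exp (- w) * exp (- p\<^sup>2 / 2)) \<partial>lborel)
     = ennreal ((p ^ 4 - 2 * p\<^sup>2 + 2 - r * exp (- p\<^sup>2)) * exp (- p\<^sup>2 / 2))" for p :: real
    using D ne by (auto simp: r_def radial_integral_all radial_integral_pos)
  have nonneg: "0 \<le> p ^ 4 - 2 * p\<^sup>2 + 2 - r * exp (- p\<^sup>2)" for p :: real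
  proof -
    have pos: "0 < 1 + p\<^sup>2 + p ^ 4 / 2" by (intro add_pos_nonneg) auto
    have "exp (- p\<^sup>2) * (1 + p\<^sup>2 + p ^ 4 / 2) \<le> exp (- p\<^sup>2) * exp (p\<^sup>2)"
      using exp_lower_Taylor_quadratic[of "p\<^sup>2"] by (intro mult_left_mono) (auto simp flip: power_mult)
    also have "\<dots> = 1" by (simp flip: exp_add)
    also have "1 \<le> 1 + (p\<^sup>2) ^ 4 / 4" by simp
    also have "\<dots> = (1 - p\<^sup>2 + p ^ 4 / 2) * (1 + p\<^sup>2 + p ^ 4 / 2)"
      by (simp add: field_simps power2_eq_square power4_eq_xxxx)
    finally have "exp (- p\<^sup>2) \<le> 1 - p\<^sup>2 + p ^ 4 / 2" using pos by simp
    moreover have "0 \<le> exp (- p\<^sup>2)" by simp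
    moreover have "r * exp (- p\<^sup>2) \<le> 2 * exp (- p\<^sup>2)" by (simp add: r_def)
    ultimately show ?thesis by linarith
  qed
  have "sqrt (pi / 2) * sqrt (2 * pi) = pi"
    by (simp add: real_sqrt_mult[symmetric])
  then have "2 * pi * sqrt (pi / 2) * (sqrt (2 * pi) * (3 - r / sqrt 3)) = 2 * pi\<^sup>2 * (3 - r / sqrt 3)"
    by (simp add: power2_eq_square)
  moreover have "3 - r / sqrt 3 = sector_constant D"
    by (simp add: sector_constant_def r_def)
  moreover have "D \<in> sets borel" using D by auto
  ultimately show ?thesis
    by (simp only: core_integral rad nn_integral_moment_combination[OF nonneg])
      (simp only: ennreal_mult'[symmetric] mult_nonneg_nonneg pi_ge_zero real_sqrt_ge_zero divide_nonneg_nonneg zero_le_numeral)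
qed

section \<open>Gaussian vectors\<close>

definition centered :: "real \<Rightarrow> real \<Rightarrow> ennreal" where
  "centered \<sigma> x = ennreal (normal_density 0 \<sigma> x)"

lemma centered_measurable [measurable]: "centered \<sigma> \<in> borel_measurable borel"
  by (simp add: centered_def[abs_def])

lemma nn_integral_centered: "\<sigma> > 0 \<Longrightarrow> (\<integral>\<^sup>+x. centered \<sigma> x \<partial>lborel) = 1"
  by (simp add: centered_def nn_integral_eq_integral)

lemma centered_1: "centered 1 x = ennreal (exp (- x\<^sup>2 / 2) / sqrt (2 * pi))"
  by (simp add: centered_def std_normal_density_def)

text \<open>The density depends on the radius only and rotations preserve area.\<close>
lemma std_normal_rotation:
  fixes f :: "real \<Rightarrow> real \<Rightarrow> ennreal"
  assumes [measurable]: "case_prod f \<in> borel_measurable (borel \<Otimes>\<^sub>M borel)" and cs: "c\<^sup>2 + s\<^sup>2 = (1::real)"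
  shows "(\<integral>\<^sup>+x. \<integral>\<^sup>+y. centered 1 x * centered 1 y * f x y \<partial>lborel \<partial>lborel)
       = (\<integral>\<^sup>+x. \<integral>\<^sup>+y. centered 1 x * centered 1 y * f (c * x - s * y) (s * x + c * y) \<partial>lborel \<partial>lborel)"
proof -
  have det: "c * c - - s * s = 1" using cs by (simp add: power2_eq_square)
  have inv: "centered 1 (c * x + - s * y) * centered 1 (s * x + c * y) = centered 1 x * centered 1 y" for x y
  proof -
    have "(c * x + - s * y)\<^sup>2 + (s * x + c * y)\<^sup>2 = (c\<^sup>2 + s\<^sup>2) * (x\<^sup>2 + y\<^sup>2)"
      by (simp add: power2_eq_square algebra_simps)
    then have "- (c * x + - s * y)\<^sup>2 / 2 + - (s * x + c * y)\<^sup>2 / 2 = - x\<^sup>2 / 2 + - y\<^sup>2 / 2"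
      using cs by simp
    then have "exp (- (c * x + - s * y)\<^sup>2 / 2) * exp (- (s * x + c * y)\<^sup>2 / 2) = exp (- x\<^sup>2 / 2) * exp (- y\<^sup>2 / 2)"
      by (simp only: exp_add[symmetric])
    then show ?thesis
      by (simp only: centered_1 ennreal_mult'[symmetric] divide_nonneg_nonneg exp_ge_zero real_sqrt_ge_zero times_divide_times_eq
          mult_nonneg_nonneg pi_ge_zero zero_le_numeral)
  qed
  have "(\<integral>\<^sup>+x. \<integral>\<^sup>+y. centered 1 x * centered 1 y * f x y \<partial>lborel \<partial>lborel)
    = ennreal \<bar>c * c - - s * s\<bar> * (\<integral>\<^sup>+x. \<integral>\<^sup>+y. centered 1 (c * x + - s * y) * centered 1 (s * x + c * y) * f (c * x + - s * y) (s * x + c * y) \<partial>lborel \<partial>lborel)"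
    using det by (intro nn_integral_linear_2d) auto
  then show ?thesis unfolding inv det by simp
qed

lemma std_normal_combine:
  fixes f :: "real \<Rightarrow> ennreal"
  assumes [measurable]: "f \<in> borel_measurable borel" and r: "r\<^sup>2 = a\<^sup>2 + b\<^sup>2"
  shows "(\<integral>\<^sup>+x. \<integral>\<^sup>+y. centered 1 x * centered 1 y * f (a * x + b * y) \<partial>lborel \<partial>lborel) = (\<integral>\<^sup>+x. centered 1 x * f (r * x) \<partial>lborel)"
proof -
  obtain c s where cs: "c\<^sup>2 + s\<^sup>2 = 1" "a = r * c" "b = r * s"
  proof (cases "r = 0")
    case True
    then have "a = 0" "b = 0" using r by (simp_all add: add_nonneg_eq_0_iff)
    then show ?thesis using that[of 1 0] True by simp
  next
    case False
    then have "(a / r)\<^sup>2 + (b / r)\<^sup>2 = 1" unfolding power_divide add_divide_distrib[symmetric] r[symmetric] by simp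
    then show ?thesis using that[of "a / r" "b / r"] False by simp
  qed
  have "(\<integral>\<^sup>+x. \<integral>\<^sup>+y. centered 1 x * centered 1 y * f (a * x + b * y) \<partial>lborel \<partial>lborel)
     = (\<integral>\<^sup>+x. \<integral>\<^sup>+y. centered 1 x * centered 1 y * f (a * (c * x - s * y) + b * (s * x + c * y)) \<partial>lborel \<partial>lborel)"
    by (rule std_normal_rotation[OF _ cs(1)]) measurable
  also have "\<dots> = (\<integral>\<^sup>+x. \<integral>\<^sup>+y. centered 1 x * f (r * x) * centered 1 y \<partial>lborel \<partial>lborel)"
  proof (intro nn_integral_cong)
    fix x y
    have "a * (c * x - s * y) + b * (s * x + c * y) = r * (c\<^sup>2 + s\<^sup>2) * x"
      by (simp add: cs(2,3) power2_eq_square algebra_simps)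
    then show "centered 1 x * centered 1 y * f (a * (c * x - s * y) + b * (s * x + c * y)) = centered 1 x * f (r * x) * centered 1 y"
      by (simp add: cs(1) mult_ac)
  qed
  also have "\<dots> = (\<integral>\<^sup>+x. centered 1 x * f (r * x) \<partial>lborel)"
    by (simp add: nn_integral_cmult nn_integral_centered)
  finally show ?thesis .
qed

text \<open>A centred Gaussian density \<open>f\<close> with covariance form \<open>C\<close>,
  expressed by what is used later: any two linear functionals have the joint law of \<open>p
  X\<close> and \<open>q X + r Y\<close> for independent standard normal \<open>X, Y\<close>,
  where the lower triangular matrix of \<open>p, q, r\<close> is a Cholesky factor of their
  covariance matrix. This form passes to products and never needs a multivariate density.\<close>
definition gaussian_law :: "('v::euclidean_space \<Rightarrow> ennreal) \<Rightarrow> ('v \<Rightarrow> 'v \<Rightarrow> real) \<Rightarrow> bool" where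
  "gaussian_law f C \<longleftrightarrow> f \<in> borel_measurable borel \<and>
    (\<forall>a b. \<exists>p q r. p\<^sup>2 = C a a \<and> p * q = C a b \<and> q\<^sup>2 + r\<^sup>2 = C b b \<and>
      (\<forall>h. case_prod h \<in> borel_measurable (borel \<Otimes>\<^sub>M borel) \<longrightarrow>
        (\<integral>\<^sup>+v. f v * h (a \<bullet> v) (b \<bullet> v) \<partial>lborel)
          = (\<integral>\<^sup>+x. \<integral>\<^sup>+y. centered 1 x * centered 1 y * h (p * x) (q * x + r * y) \<partial>lborel \<partial>lborel)))"

definition product_density :: "('a \<Rightarrow> ennreal) \<Rightarrow> ('b \<Rightarrow> ennreal) \<Rightarrow> 'a \<times> 'b \<Rightarrow> ennreal" where
  "product_density f g = (\<lambda>(x, y). f x * g y)"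

lemma product_density_measurable [measurable (raw)]:
  fixes f :: "'a::euclidean_space \<Rightarrow> ennreal" and g :: "'b::euclidean_space \<Rightarrow> ennreal"
  assumes [measurable]: "f \<in> borel_measurable borel" "g \<in> borel_measurable borel"
  shows "product_density f g \<in> borel_measurable borel"
  unfolding product_density_def borel_prod[symmetric] by measurable

lemma gaussian_law_centered:
  assumes \<sigma>: "\<sigma> > 0"
  shows "gaussian_law (centered \<sigma>) (\<lambda>a b. \<sigma>\<^sup>2 * a * b)"
  unfolding gaussian_law_def
proof (intro conjI allI)
  fix a b :: real
  show "\<exists>p q r. p\<^sup>2 = \<sigma>\<^sup>2 * a * a \<and> p * q = \<sigma>\<^sup>2 * a * b \<and> q\<^sup>2 + r\<^sup>2 = \<sigma>\<^sup>2 * b * b \<and>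
      (\<forall>h. case_prod h \<in> borel_measurable (borel \<Otimes>\<^sub>M borel) \<longrightarrow>
        (\<integral>\<^sup>+v. centered \<sigma> v * h (a \<bullet> v) (b \<bullet> v) \<partial>lborel)
          = (\<integral>\<^sup>+x. \<integral>\<^sup>+y. centered 1 x * centered 1 y * h (p * x) (q * x + r * y) \<partial>lborel \<partial>lborel))"
  proof (rule exI[of _ "\<sigma> * a"], rule exI[of _ "\<sigma> * b"], rule exI[of _ 0], intro conjI allI impI)
    fix h :: "real \<Rightarrow> real \<Rightarrow> ennreal" assume [measurable]: "case_prod h \<in> borel_measurable (borel \<Otimes>\<^sub>M borel)"
    have scale: "ennreal \<sigma> * centered \<sigma> (\<sigma> * x) = centered 1 x" for x
      using \<sigma> by (simp add: centered_def normal_density_def ennreal_mult'[symmetric] real_sqrt_mult power_mult_distrib)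
    have "(\<integral>\<^sup>+v. centered \<sigma> v * h (a \<bullet> v) (b \<bullet> v) \<partial>lborel) = ennreal \<bar>\<sigma>\<bar> * (\<integral>\<^sup>+x. centered \<sigma> (0 + \<sigma> * x) * h (a * (0 + \<sigma> * x)) (b * (0 + \<sigma> * x)) \<partial>lborel)"
      unfolding inner_real_def using \<sigma> by (intro nn_integral_real_affine) auto
    also have "\<dots> = (\<integral>\<^sup>+x. ennreal \<bar>\<sigma>\<bar> * (centered \<sigma> (0 + \<sigma> * x) * h (a * (0 + \<sigma> * x)) (b * (0 + \<sigma> * x))) \<partial>lborel)"
      by (rule nn_integral_cmult[symmetric]) measurable
    also have "\<dots> = (\<integral>\<^sup>+x. centered 1 x * h (\<sigma> * a * x) (\<sigma> * b * x) \<partial>lborel)"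
      using \<sigma> by (intro nn_integral_cong) (simp add: scale mult.assoc[symmetric] mult.commute[of a] mult.commute[of b])
    also have "\<dots> = (\<integral>\<^sup>+x. \<integral>\<^sup>+y. centered 1 x * h (\<sigma> * a * x) (\<sigma> * b * x) * centered 1 y \<partial>lborel \<partial>lborel)"
      by (simp add: nn_integral_cmult nn_integral_centered)
    also have "\<dots> = (\<integral>\<^sup>+x. \<integral>\<^sup>+y. centered 1 x * centered 1 y * h (\<sigma> * a * x) (\<sigma> * b * x + 0 * y) \<partial>lborel \<partial>lborel)"
      by (simp add: mult_ac)
    finally show "(\<integral>\<^sup>+v. centered \<sigma> v * h (a \<bullet> v) (b \<bullet> v) \<partial>lborel)
        = (\<integral>\<^sup>+x. \<integral>\<^sup>+y. centered 1 x * centered 1 y * h (\<sigma> * a * x) (\<sigma> * b * x + 0 * y) \<partial>lborel \<partial>lborel)" .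
  qed (simp_all add: power2_eq_square)
qed simp

text \<open>Sums of independent Gaussian pairs are Gaussian: the two Cholesky factors act on four
  independent standard normals, and rotations reduce these to two.\<close>
lemma gaussian_law_product_density:
  fixes f :: "'v::euclidean_space \<Rightarrow> ennreal" and g :: "'w::euclidean_space \<Rightarrow> ennreal"
  assumes f: "gaussian_law f C1" and g: "gaussian_law g C2"
  shows "gaussian_law (product_density f g) (\<lambda>a b. C1 (fst a) (fst b) + C2 (snd a) (snd b))"
  unfolding gaussian_law_def
proof (intro conjI allI)
  have [measurable]: "f \<in> borel_measurable borel" "g \<in> borel_measurable borel"
    using f g by (simp_all add: gaussian_law_def)
  show "product_density f g \<in> borel_measurable borel" by simp
  fix a b :: "'v \<times> 'w"
  obtain p1 q1 r1 where 1: "p1\<^sup>2 = C1 (fst a) (fst a)" "p1 * q1 = C1 (fst a) (fst b)" "q1\<^sup>2 + r1\<^sup>2 = C1 (fst b) (fst b)"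
    and h1: "\<And>h. case_prod h \<in> borel_measurable (borel \<Otimes>\<^sub>M borel) \<Longrightarrow> (\<integral>\<^sup>+v. f v * h (fst a \<bullet> v) (fst b \<bullet> v) \<partial>lborel)
          = (\<integral>\<^sup>+x. \<integral>\<^sup>+y. centered 1 x * centered 1 y * h (p1 * x) (q1 * x + r1 * y) \<partial>lborel \<partial>lborel)"
    using f unfolding gaussian_law_def by meson
  obtain p2 q2 r2 where 2: "p2\<^sup>2 = C2 (snd a) (snd a)" "p2 * q2 = C2 (snd a) (snd b)" "q2\<^sup>2 + r2\<^sup>2 = C2 (snd b) (snd b)"
    and h2: "\<And>h. case_prod h \<in> borel_measurable (borel \<Otimes>\<^sub>M borel) \<Longrightarrow> (\<integral>\<^sup>+v. g v * h (snd a \<bullet> v) (snd b \<bullet> v) \<partial>lborel)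
          = (\<integral>\<^sup>+x. \<integral>\<^sup>+y. centered 1 x * centered 1 y * h (p2 * x) (q2 * x + r2 * y) \<partial>lborel \<partial>lborel)"
    using g unfolding gaussian_law_def by meson
  define p where "p = sqrt (p1\<^sup>2 + p2\<^sup>2)"
  have p2: "p\<^sup>2 = p1\<^sup>2 + p2\<^sup>2" by (simp add: p_def)
  obtain c s where cs: "c\<^sup>2 + s\<^sup>2 = 1" "p1 = p * c" "p2 = p * s"
  proof (cases "p = 0")
    case True
    then have "p1 = 0" "p2 = 0" using p2 by (simp_all add: add_nonneg_eq_0_iff)
    then show ?thesis using that[of 1 0] True by simp
  next
    case False
    then have "(p1 / p)\<^sup>2 + (p2 / p)\<^sup>2 = 1" unfolding power_divide add_divide_distrib[symmetric] p2[symmetric] by simp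
    then show ?thesis using that[of "p1 / p" "p2 / p"] False by simp
  qed
  define q where "q = q1 * c + q2 * s"
  define k where "k = q2 * c - q1 * s"
  define r' where "r' = sqrt (r1\<^sup>2 + r2\<^sup>2)"
  define r where "r = sqrt (k\<^sup>2 + r'\<^sup>2)"
  have r': "r'\<^sup>2 = r1\<^sup>2 + r2\<^sup>2" and r: "r\<^sup>2 = k\<^sup>2 + r'\<^sup>2" by (simp_all add: r'_def r_def)
  show "\<exists>p q r. p\<^sup>2 = C1 (fst a) (fst a) + C2 (snd a) (snd a) \<and> p * q = C1 (fst a) (fst b) + C2 (snd a) (snd b) \<and>
       q\<^sup>2 + r\<^sup>2 = C1 (fst b) (fst b) + C2 (snd b) (snd b) \<and>
      (\<forall>h. case_prod h \<in> borel_measurable (borel \<Otimes>\<^sub>M borel) \<longrightarrow>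
        (\<integral>\<^sup>+v. product_density f g v * h (a \<bullet> v) (b \<bullet> v) \<partial>lborel)
          = (\<integral>\<^sup>+x. \<integral>\<^sup>+y. centered 1 x * centered 1 y * h (p * x) (q * x + r * y) \<partial>lborel \<partial>lborel))"
  proof (rule exI[of _ p], rule exI[of _ q], rule exI[of _ r], intro conjI allI impI)
    show "p\<^sup>2 = C1 (fst a) (fst a) + C2 (snd a) (snd a)" by (simp add: p2 1 2)
    have "p * q = p1 * q1 + p2 * q2" by (simp add: q_def cs(2,3) algebra_simps)
    then show "p * q = C1 (fst a) (fst b) + C2 (snd a) (snd b)" by (simp add: 1 2)
    have "q\<^sup>2 + k\<^sup>2 = (c\<^sup>2 + s\<^sup>2) * (q1\<^sup>2 + q2\<^sup>2)"
      by (simp add: q_def k_def power2_eq_square algebra_simps)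
    then have "q\<^sup>2 + r\<^sup>2 = (q1\<^sup>2 + r1\<^sup>2) + (q2\<^sup>2 + r2\<^sup>2)"
      by (simp add: r r' cs(1))
    then show "q\<^sup>2 + r\<^sup>2 = C1 (fst b) (fst b) + C2 (snd b) (snd b)" by (simp add: 1 2)
    fix h :: "real \<Rightarrow> real \<Rightarrow> ennreal" assume h [measurable]: "case_prod h \<in> borel_measurable (borel \<Otimes>\<^sub>M borel)"
    let ?n = "centered 1"
    have "(\<integral>\<^sup>+v. product_density f g v * h (a \<bullet> v) (b \<bullet> v) \<partial>lborel)
       = (\<integral>\<^sup>+v. \<integral>\<^sup>+w. product_density f g (v, w) * h (a \<bullet> (v, w)) (b \<bullet> (v, w)) \<partial>lborel \<partial>lborel)"
      unfolding lborel_prod[symmetric] by (rule lborel.nn_integral_fst[symmetric]) (simp add: lborel_prod)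
    also have "\<dots> = (\<integral>\<^sup>+v. f v * (\<integral>\<^sup>+w. g w * h (fst a \<bullet> v + snd a \<bullet> w) (fst b \<bullet> v + snd b \<bullet> w) \<partial>lborel) \<partial>lborel)"
      by (simp add: product_density_def inner_prod_def nn_integral_cmult[symmetric] mult.assoc)
    also have "\<dots> = (\<integral>\<^sup>+v. f v * (\<integral>\<^sup>+x2. \<integral>\<^sup>+y2. ?n x2 * ?n y2 * h (fst a \<bullet> v + p2 * x2) (fst b \<bullet> v + (q2 * x2 + r2 * y2)) \<partial>lborel \<partial>lborel) \<partial>lborel)"
      by (intro nn_integral_cong arg_cong2[where f="(*)"] refl h2[of "\<lambda>s t. h (fst a \<bullet> _ + s) (fst b \<bullet> _ + t)"]) measurable
    also have "\<dots> = (\<integral>\<^sup>+x1. \<integral>\<^sup>+y1. ?n x1 * ?n y1 * (\<integral>\<^sup>+x2. \<integral>\<^sup>+y2. ?n x2 * ?n y2 * h (p1 * x1 + p2 * x2) (q1 * x1 + r1 * y1 + (q2 * x2 + r2 * y2)) \<partial>lborel \<partial>lborel) \<partial>lborel \<partial>lborel)"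
      by (rule h1[of "\<lambda>s t. \<integral>\<^sup>+x2. \<integral>\<^sup>+y2. ?n x2 * ?n y2 * h (s + p2 * x2) (t + (q2 * x2 + r2 * y2)) \<partial>lborel \<partial>lborel"]) measurable
    also have "\<dots> = (\<integral>\<^sup>+x1. \<integral>\<^sup>+y1. \<integral>\<^sup>+x2. \<integral>\<^sup>+y2. ?n x1 * ?n x2 * (?n y1 * ?n y2 * h (p1 * x1 + p2 * x2) (q1 * x1 + q2 * x2 + (r1 * y1 + r2 * y2))) \<partial>lborel \<partial>lborel \<partial>lborel \<partial>lborel)"
      by (simp add: nn_integral_cmult[symmetric] mult_ac add_ac)
    also have "\<dots> = (\<integral>\<^sup>+x1. \<integral>\<^sup>+x2. \<integral>\<^sup>+y1. \<integral>\<^sup>+y2. ?n x1 * ?n x2 * (?n y1 * ?n y2 * h (p1 * x1 + p2 * x2) (q1 * x1 + q2 * x2 + (r1 * y1 + r2 * y2))) \<partial>lborel \<partial>lborel \<partial>lborel \<partial>lborel)"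
      by (rule nn_integral_cong, rule lborel_pair.Fubini') measurable
    also have "\<dots> = (\<integral>\<^sup>+x1. \<integral>\<^sup>+x2. ?n x1 * ?n x2 * (\<integral>\<^sup>+y1. \<integral>\<^sup>+y2. ?n y1 * ?n y2 * h (p1 * x1 + p2 * x2) (q1 * x1 + q2 * x2 + (r1 * y1 + r2 * y2)) \<partial>lborel \<partial>lborel) \<partial>lborel \<partial>lborel)"
      by (simp add: nn_integral_cmult)
    also have "\<dots> = (\<integral>\<^sup>+x1. \<integral>\<^sup>+x2. ?n x1 * ?n x2 * (\<integral>\<^sup>+y. ?n y * h (p1 * x1 + p2 * x2) (q1 * x1 + q2 * x2 + r' * y) \<partial>lborel) \<partial>lborel \<partial>lborel)"
      by (intro nn_integral_cong arg_cong2[where f="(*)"] refl std_normal_combine[OF _ r', of "\<lambda>t. h _ (_ + t)"]) measurable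
    also have "\<dots> = (\<integral>\<^sup>+x. \<integral>\<^sup>+z. ?n x * ?n z * (\<integral>\<^sup>+y. ?n y * h (p1 * (c * x - s * z) + p2 * (s * x + c * z)) (q1 * (c * x - s * z) + q2 * (s * x + c * z) + r' * y) \<partial>lborel) \<partial>lborel \<partial>lborel)"
      by (rule std_normal_rotation[OF _ cs(1), of "\<lambda>x1 x2. \<integral>\<^sup>+y. ?n y * h (p1 * x1 + p2 * x2) (q1 * x1 + q2 * x2 + r' * y) \<partial>lborel"]) measurable
    also have "\<dots> = (\<integral>\<^sup>+x. \<integral>\<^sup>+z. ?n x * ?n z * (\<integral>\<^sup>+y. ?n y * h (p * x) (q * x + (k * z + r' * y)) \<partial>lborel) \<partial>lborel \<partial>lborel)"
    proof -
      have "p1 * (c * x - s * z) + p2 * (s * x + c * z) = p * (c\<^sup>2 + s\<^sup>2) * x" for x z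
        by (simp add: cs(2,3) power2_eq_square algebra_simps)
      moreover have "q1 * (c * x - s * z) + q2 * (s * x + c * z) + r' * y = q * x + (k * z + r' * y)" for x y z
        by (simp add: q_def k_def algebra_simps)
      ultimately show ?thesis by (simp only: cs(1) mult_1_right)
    qed
    also have "\<dots> = (\<integral>\<^sup>+x. ?n x * (\<integral>\<^sup>+z. \<integral>\<^sup>+y. ?n z * ?n y * h (p * x) (q * x + (k * z + r' * y)) \<partial>lborel \<partial>lborel) \<partial>lborel)"
      by (simp add: nn_integral_cmult[symmetric] mult.assoc)
    also have "\<dots> = (\<integral>\<^sup>+x. ?n x * (\<integral>\<^sup>+y. ?n y * h (p * x) (q * x + r * y) \<partial>lborel) \<partial>lborel)"
      by (intro nn_integral_cong arg_cong2[where f="(*)"] refl std_normal_combine[OF _ r, of "\<lambda>t. h _ (_ + t)"]) measurable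
    also have "\<dots> = (\<integral>\<^sup>+x. \<integral>\<^sup>+y. ?n x * ?n y * h (p * x) (q * x + r * y) \<partial>lborel \<partial>lborel)"
      by (simp add: nn_integral_cmult[symmetric] mult.assoc)
    finally show "(\<integral>\<^sup>+v. product_density f g v * h (a \<bullet> v) (b \<bullet> v) \<partial>lborel)
        = (\<integral>\<^sup>+x. \<integral>\<^sup>+y. ?n x * ?n y * h (p * x) (q * x + r * y) \<partial>lborel \<partial>lborel)" .
  qed
qed

section \<open>Expected area of a pair of Gaussian matrices\<close>

lemma nn_integral_centered_abs: "(\<integral>\<^sup>+x. centered 1 x * ennreal \<bar>R * x\<bar> \<partial>lborel) = ennreal (\<bar>R\<bar> * sqrt (2 / pi))"
proof -
  have m: "has_bochner_integral lborel (\<lambda>x. std_normal_density x * \<bar>x\<bar> ^ (2 * 0 + 1)) (sqrt (2 / pi) * 2 ^ 0 * fact 0)"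
    by (rule std_normal_moment_abs_odd)
  have "(\<integral>\<^sup>+x. centered 1 x * ennreal \<bar>R * x\<bar> \<partial>lborel) = (\<integral>\<^sup>+x. ennreal \<bar>R\<bar> * ennreal (std_normal_density x * \<bar>x\<bar> ^ (2 * 0 + 1)) \<partial>lborel)"
    by (simp add: centered_def abs_mult ennreal_mult'[symmetric] ennreal_mult''[symmetric] mult_ac)
  also have "\<dots> = ennreal \<bar>R\<bar> * (\<integral>\<^sup>+x. ennreal (std_normal_density x * \<bar>x\<bar> ^ (2 * 0 + 1)) \<partial>lborel)"
    by (rule nn_integral_cmult) simp
  also have "(\<integral>\<^sup>+x. ennreal (std_normal_density x * \<bar>x\<bar> ^ (2 * 0 + 1)) \<partial>lborel) = ennreal (sqrt (2 / pi) * 2 ^ 0 * fact 0)"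
    using m by (subst nn_integral_eq_integral) (auto simp: has_bochner_integral_iff)
  finally show ?thesis by (simp add: ennreal_mult')
qed

lemma nn_integral_rayleigh: "(\<integral>\<^sup>+x. \<integral>\<^sup>+y. centered 1 x * centered 1 y * ennreal (sqrt (x\<^sup>2 + y\<^sup>2)) \<partial>lborel \<partial>lborel) = ennreal (sqrt (pi / 2))"
proof -
  let ?f = "\<lambda>w. sqrt w * exp (- w / 2) / (2 * pi)"
  let ?g = "\<lambda>u::real. exp (- u\<^sup>2 / 2) * u ^ (2 * 1) / pi"
  have "centered 1 x * centered 1 y * ennreal (sqrt (x\<^sup>2 + y\<^sup>2)) = ennreal (?f (x\<^sup>2 + y\<^sup>2))" for x y
  proof -
    have e: "exp (- (x\<^sup>2 + y\<^sup>2) / 2) = exp (- x\<^sup>2 / 2) * exp (- y\<^sup>2 / 2)"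
      by (simp add: exp_add[symmetric] add_divide_distrib)
    have "sqrt (2 * pi) * sqrt (2 * pi) = 2 * pi" by simp
    have "exp (- x\<^sup>2 / 2) / sqrt (2 * pi) * (exp (- y\<^sup>2 / 2) / sqrt (2 * pi)) * sqrt (x\<^sup>2 + y\<^sup>2) = ?f (x\<^sup>2 + y\<^sup>2)"
    proof -
      have gen: "a / S * (b / S) * c = c * (a * b) / (S * S)" for a b c S :: real by simp
      show ?thesis unfolding gen e \<open>sqrt (2 * pi) * sqrt (2 * pi) = 2 * pi\<close> ..
    qed
    then show ?thesis
      by (simp only: centered_1) (subst ennreal_mult'[symmetric], simp, subst ennreal_mult'[symmetric], simp_all)
  qed
  then have "(\<integral>\<^sup>+x. \<integral>\<^sup>+y. centered 1 x * centered 1 y * ennreal (sqrt (x\<^sup>2 + y\<^sup>2)) \<partial>lborel \<partial>lborel) = (\<integral>\<^sup>+x. \<integral>\<^sup>+y. ennreal (?f (x\<^sup>2 + y\<^sup>2)) \<partial>lborel \<partial>lborel)"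
    by (simp only:)
  also have "\<dots> = ennreal pi * (\<integral>\<^sup>+w\<in>{0..}. ennreal (?f w) \<partial>lborel)"
    by (rule nn_integral_polar) simp
  also have "(\<integral>\<^sup>+w\<in>{0..}. ennreal (?f w) \<partial>lborel) = (\<integral>\<^sup>+u\<in>{0..}. ennreal (?f (1 * u\<^sup>2) * (2 * 1 * u)) \<partial>lborel)"
    by (rule nn_integral_square_substitution[symmetric]) simp_all
  also have "\<dots> = (\<integral>\<^sup>+u\<in>{0..}. ennreal (?g u) \<partial>lborel)"
    by (intro nn_integral_cong) (auto split: split_indicator simp: power2_eq_square)
  finally have 1: "(\<integral>\<^sup>+x. \<integral>\<^sup>+y. centered 1 x * centered 1 y * ennreal (sqrt (x\<^sup>2 + y\<^sup>2)) \<partial>lborel \<partial>lborel)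
     = ennreal pi * (\<integral>\<^sup>+u\<in>{0..}. ennreal (?g u) \<partial>lborel)" .
  have "2 * (\<integral>\<^sup>+u\<in>{0..}. ennreal (?g u) \<partial>lborel) = (\<integral>\<^sup>+u. ennreal (?g u) \<partial>lborel)"
    by (rule nn_integral_even[symmetric]) simp_all
  also have "\<dots> = ennreal (sqrt (2 * pi) / pi)"
    using has_bochner_integral_divide_zero[OF std_normal_moments[of 1], of pi]
    by (subst nn_integral_eq_integral) (auto simp: has_bochner_integral_iff fact_numeral)
  finally have 2: "2 * (\<integral>\<^sup>+u\<in>{0..}. ennreal (?g u) \<partial>lborel) = ennreal (sqrt (2 * pi) / pi)" .
  have "2 * ennreal (sqrt (2 * pi) / pi / 2) = ennreal (sqrt (2 * pi) / pi)"
    using ennreal_mult'[of 2 "sqrt (2 * pi) / pi / 2"] by simp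
  then have "2 * (\<integral>\<^sup>+u\<in>{0..}. ennreal (?g u) \<partial>lborel) = 2 * ennreal (sqrt (2 * pi) / pi / 2)"
    using 2 by (simp only:)
  then have "(\<integral>\<^sup>+u\<in>{0..}. ennreal (?g u) \<partial>lborel) = ennreal (sqrt (2 * pi) / pi / 2)"
    unfolding ennreal_mult_cancel_left by simp
  moreover have "pi * (sqrt (2 * pi) / pi / 2) = sqrt (pi / 2)"
    by (simp add: real_sqrt_mult real_sqrt_divide real_div_sqrt field_simps)
  ultimately show ?thesis unfolding 1 by (simp add: ennreal_mult'[symmetric])
qed

text \<open>Given \<open>(x, y)\<close>, the wedge is a centred normal variable of standard
  deviation \<open>\<surd>(x\<^sup>2 + y\<^sup>2)\<close>, whose mean absolute value is
  \<open>\<surd>(2 / \<pi>)\<close> times this; the mean radius is \<open>\<surd>(\<pi> /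
  2)\<close>.\<close>
lemma std_normal_wedge:
  "(\<integral>\<^sup>+x. \<integral>\<^sup>+y. centered 1 x * centered 1 y * (\<integral>\<^sup>+x'. \<integral>\<^sup>+y'. centered 1 x' * centered 1 y' * ennreal \<bar>x * y' - x' * y\<bar> \<partial>lborel \<partial>lborel) \<partial>lborel \<partial>lborel) = 1"
proof -
  have "(\<integral>\<^sup>+x'. \<integral>\<^sup>+y'. centered 1 x' * centered 1 y' * ennreal \<bar>x * y' - x' * y\<bar> \<partial>lborel \<partial>lborel) = ennreal (sqrt (x\<^sup>2 + y\<^sup>2)) * ennreal (sqrt (2 / pi))" for x y
  proof -
    have "(\<integral>\<^sup>+x'. \<integral>\<^sup>+y'. centered 1 x' * centered 1 y' * ennreal \<bar>- y * x' + x * y'\<bar> \<partial>lborel \<partial>lborel) = (\<integral>\<^sup>+z. centered 1 z * ennreal \<bar>sqrt (x\<^sup>2 + y\<^sup>2) * z\<bar> \<partial>lborel)"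
      by (rule std_normal_combine) simp_all
    also have "\<dots> = ennreal (sqrt (x\<^sup>2 + y\<^sup>2)) * ennreal (sqrt (2 / pi))"
      unfolding nn_integral_centered_abs by (simp add: ennreal_mult')
    finally show ?thesis by (simp add: algebra_simps)
  qed
  then have "(\<integral>\<^sup>+x. \<integral>\<^sup>+y. centered 1 x * centered 1 y * (\<integral>\<^sup>+x'. \<integral>\<^sup>+y'. centered 1 x' * centered 1 y' * ennreal \<bar>x * y' - x' * y\<bar> \<partial>lborel \<partial>lborel) \<partial>lborel \<partial>lborel)
    = (\<integral>\<^sup>+x. \<integral>\<^sup>+y. centered 1 x * centered 1 y * ennreal (sqrt (x\<^sup>2 + y\<^sup>2)) \<partial>lborel \<partial>lborel) * ennreal (sqrt (2 / pi))"
    by (simp add: nn_integral_multc mult.assoc[symmetric])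
  also have "\<dots> = ennreal (sqrt (pi / 2) * sqrt (2 / pi))"
    unfolding nn_integral_rayleigh by (simp add: ennreal_mult')
  also have "sqrt (pi / 2) * sqrt (2 / pi) = 1"
    by (simp add: real_sqrt_mult[symmetric])
  finally show ?thesis by simp
qed

text \<open>The wedge of two independent copies of the pair of functionals equals \<open>p
  r\<close> times the wedge of two standard normal pairs, and \<open>(p r)\<^sup>2\<close> is the
  Gram determinant of the covariance form.\<close>
lemma expected_wedge:
  assumes f: "gaussian_law f C"
  shows "(\<integral>\<^sup>+v. f v * (\<integral>\<^sup>+w. f w * ennreal \<bar>(a \<bullet> v) * (b \<bullet> w) - (a \<bullet> w) * (b \<bullet> v)\<bar> \<partial>lborel) \<partial>lborel)
     = ennreal (sqrt (C a a * C b b - (C a b)\<^sup>2))"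
proof -
  obtain p q r where 1: "p\<^sup>2 = C a a" "p * q = C a b" "q\<^sup>2 + r\<^sup>2 = C b b"
    and h: "\<And>h. case_prod h \<in> borel_measurable (borel \<Otimes>\<^sub>M borel) \<Longrightarrow> (\<integral>\<^sup>+v. f v * h (a \<bullet> v) (b \<bullet> v) \<partial>lborel)
          = (\<integral>\<^sup>+x. \<integral>\<^sup>+y. centered 1 x * centered 1 y * h (p * x) (q * x + r * y) \<partial>lborel \<partial>lborel)"
    using f unfolding gaussian_law_def by meson
  let ?n = "centered 1"
  have "(\<integral>\<^sup>+v. f v * (\<integral>\<^sup>+w. f w * ennreal \<bar>(a \<bullet> v) * (b \<bullet> w) - (a \<bullet> w) * (b \<bullet> v)\<bar> \<partial>lborel) \<partial>lborel)
    = (\<integral>\<^sup>+v. f v * (\<integral>\<^sup>+x'. \<integral>\<^sup>+y'. ?n x' * ?n y' * ennreal \<bar>(a \<bullet> v) * (q * x' + r * y') - (p * x') * (b \<bullet> v)\<bar> \<partial>lborel \<partial>lborel) \<partial>lborel)"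
    by (intro nn_integral_cong arg_cong2[where f="(*)"] refl h[of "\<lambda>s t. ennreal \<bar>(a \<bullet> _) * t - s * (b \<bullet> _)\<bar>"]) measurable
  also have "\<dots> = (\<integral>\<^sup>+x. \<integral>\<^sup>+y. ?n x * ?n y * (\<integral>\<^sup>+x'. \<integral>\<^sup>+y'. ?n x' * ?n y' * ennreal \<bar>(p * x) * (q * x' + r * y') - (p * x') * (q * x + r * y)\<bar> \<partial>lborel \<partial>lborel) \<partial>lborel \<partial>lborel)"
    by (rule h[of "\<lambda>s t. \<integral>\<^sup>+x'. \<integral>\<^sup>+y'. ?n x' * ?n y' * ennreal \<bar>s * (q * x' + r * y') - (p * x') * t\<bar> \<partial>lborel \<partial>lborel"]) measurable
  also have "\<dots> = (\<integral>\<^sup>+x. \<integral>\<^sup>+y. ?n x * ?n y * (\<integral>\<^sup>+x'. \<integral>\<^sup>+y'. ?n x' * ?n y' * (ennreal \<bar>x * y' - x' * y\<bar> * ennreal \<bar>p * r\<bar>) \<partial>lborel \<partial>lborel) \<partial>lborel \<partial>lborel)"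
  proof -
    have "(p * x) * (q * x' + r * y') - (p * x') * (q * x + r * y) = (x * y' - x' * y) * (p * r)" for x y x' y'
      by (simp add: algebra_simps)
    then show ?thesis by (simp only: abs_mult[of "_ - _"]) (simp only: ennreal_mult' abs_ge_zero)
  qed
  also have "\<dots> = 1 * ennreal \<bar>p * r\<bar>"
    unfolding std_normal_wedge[symmetric] by (simp add: nn_integral_multc mult.assoc[symmetric])
  also have "\<bar>p * r\<bar> = sqrt (p\<^sup>2 * (q\<^sup>2 + r\<^sup>2) - (p * q)\<^sup>2)"
    by (simp add: algebra_simps power_mult_distrib flip: real_sqrt_abs)
  finally show ?thesis by (simp add: 1)
qed

text \<open>A symmetric \<open>4 \<times> 4\<close> matrix in \<open>2 \<times> 2\<close> blocks
  \<open>((A, B), (B\<^sup>T, C))\<close>. The first component lists the upper triangle of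
  \<open>A\<close>, the second lists \<open>B\<close> row by row and then the upper triangle of
  \<open>C\<close>.\<close>
type_synonym sym4 = "(real \<times> real \<times> real) \<times> (real \<times> real \<times> real \<times> real \<times> real \<times> real \<times> real)"

abbreviation off :: real where "off \<equiv> sqrt (1 / 2)"

definition density_A :: "real \<times> real \<times> real \<Rightarrow> ennreal" where
  "density_A = product_density (centered 1) (product_density (centered off) (centered 1))"

definition density_W :: "real \<times> real \<times> real \<times> real \<times> real \<times> real \<times> real \<Rightarrow> ennreal" where
  "density_W = product_density (centered off) (product_density (centered off) (product_density (centered off) (product_density (centered off) (product_density (centered 1) (product_density (centered off) (centered 1))))))"

definition goe_density :: "sym4 \<Rightarrow> ennreal" where
  "goe_density = product_density density_A density_W"

lemma g_measurable [measurable]: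
  "density_A \<in> borel_measurable borel" "density_W \<in> borel_measurable borel" "goe_density \<in> borel_measurable borel"
  unfolding goe_density_def density_A_def density_W_def by measurable

fun goe_cov :: "sym4 \<Rightarrow> sym4 \<Rightarrow> real" where
  "goe_cov ((a11, a12, a22), (b11, b12, b21, b22, c11, c12, c22)) ((a11', a12', a22'), (b11', b12', b21', b22', c11', c12', c22'))
   = a11 * a11' + a12 * a12' / 2 + a22 * a22' + (b11 * b11' + b12 * b12' + b21 * b21' + b22 * b22') / 2
     + c11 * c11' + c12 * c12' / 2 + c22 * c22'"

lemma gaussian_law_goe_density: "gaussian_law goe_density goe_cov"
proof -
  note d = gaussian_law_centered[of 1, OF zero_less_one] and o = gaussian_law_centered[of off]
  have o: "gaussian_law (centered off) (\<lambda>a b. off\<^sup>2 * a * b)" by (rule gaussian_law_centered) simp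
  have eq: "goe_cov a b = 1\<^sup>2 * fst (fst a) * fst (fst b) + (off\<^sup>2 * fst (snd (fst a)) * fst (snd (fst b)) + 1\<^sup>2 * snd (snd (fst a)) * snd (snd (fst b)))
    + (off\<^sup>2 * fst (snd a) * fst (snd b) + (off\<^sup>2 * fst (snd (snd a)) * fst (snd (snd b))
    + (off\<^sup>2 * fst (snd (snd (snd a))) * fst (snd (snd (snd b))) + (off\<^sup>2 * fst (snd (snd (snd (snd a)))) * fst (snd (snd (snd (snd b))))
    + (1\<^sup>2 * fst (snd (snd (snd (snd (snd a))))) * fst (snd (snd (snd (snd (snd b)))))
    + (off\<^sup>2 * fst (snd (snd (snd (snd (snd (snd a)))))) * fst (snd (snd (snd (snd (snd (snd b))))))
    + 1\<^sup>2 * snd (snd (snd (snd (snd (snd (snd a)))))) * snd (snd (snd (snd (snd (snd (snd b))))))))))))" for a b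
    by (cases "(a, b)" rule: goe_cov.cases) simp
  show ?thesis
    unfolding goe_density_def density_A_def density_W_def
    using gaussian_law_product_density[OF gaussian_law_product_density[OF d gaussian_law_product_density[OF o d]]
      gaussian_law_product_density[OF o gaussian_law_product_density[OF o gaussian_law_product_density[OF o gaussian_law_product_density[OF o gaussian_law_product_density[OF d gaussian_law_product_density[OF o d]]]]]]]
    by (simp only: eq[abs_def])
qed

text \<open>The determinant of three symmetric \<open>2 \<times> 2\<close> matrices, each regarded
  as a vector of its three entries.\<close>
fun det3 :: "real \<times> real \<times> real \<Rightarrow> real \<times> real \<times> real \<Rightarrow> real \<times> real \<times> real \<Rightarrow> real" where
  "det3 (m1, m2, m3) (x1, x2, x3) (z1, z2, z3)
   = m1 * (x2 * z3 - x3 * z2) - m2 * (x1 * z3 - x3 * z1) + m3 * (x1 * z2 - x2 * z1)"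

text \<open>The \<open>2 \<times> 2\<close> matrix \<open>(I, - Y) V (I, - Y)\<^sup>T\<close> for
  \<open>Y = ((y11, y12), (y21, y22))\<close>: the restriction of the quadratic form of
  \<open>V\<close> to the plane spanned by the rows of \<open>(I, - Y)\<close>.\<close>
fun compress :: "real \<times> real \<times> real \<times> real \<Rightarrow> sym4 \<Rightarrow> real \<times> real \<times> real" where
  "compress (y11, y12, y21, y22) ((a11, a12, a22), (b11, b12, b21, b22, c11, c12, c22)) =
    (a11 - 2 * (y11 * b11 + y12 * b12) + (y11\<^sup>2 * c11 + 2 * y11 * y12 * c12 + y12\<^sup>2 * c22),
     a12 - (y21 * b11 + y22 * b12) - (y11 * b21 + y12 * b22) + (y11 * y21 * c11 + (y11 * y22 + y12 * y21) * c12 + y12 * y22 * c22),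
     a22 - 2 * (y21 * b21 + y22 * b22) + (y21\<^sup>2 * c11 + 2 * y21 * y22 * c12 + y22\<^sup>2 * c22))"

text \<open>The Gram matrix \<open>I + Y Y\<^sup>T\<close> of the rows of \<open>(I, - Y)\<close>,
  which is also the compression of the identity.\<close>
fun gram :: "real \<times> real \<times> real \<times> real \<Rightarrow> real \<times> real \<times> real" where
  "gram (y11, y12, y21, y22) = (1 + y11\<^sup>2 + y12\<^sup>2, y11 * y21 + y12 * y22, 1 + y21\<^sup>2 + y22\<^sup>2)"

fun gram_det :: "real \<times> real \<times> real \<times> real \<Rightarrow> real" where
  "gram_det (y11, y12, y21, y22) = (1 + y11\<^sup>2 + y12\<^sup>2) * (1 + y21\<^sup>2 + y22\<^sup>2) - (y11 * y21 + y12 * y22)\<^sup>2"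

lemma goe_cov_diff:
  "goe_cov (s *\<^sub>R u - t *\<^sub>R v) (s' *\<^sub>R u' - t' *\<^sub>R v') = s * s' * goe_cov u u' - s * t' * goe_cov u v' - t * s' * goe_cov v u' + t * t' * goe_cov v v'"
  by (cases "(u, v)" rule: goe_cov.cases; cases "(u', v')" rule: goe_cov.cases) (simp add: field_simps)

lemma goe_cov_commute: "goe_cov u v = goe_cov v u"
  by (cases "(u, v)" rule: goe_cov.cases) (simp add: mult.commute)

text \<open>Expanding along the Gram matrix turns the \<open>3 \<times> 3\<close> determinant into
  a wedge of two linear functionals of the Gaussian matrix. Intrinsically, the compressions are
  \<open>2 \<times> 2\<close> GOE matrices transported by a square root of the Gram matrix
  \<open>G\<close>. The transport acts on symmetric matrices with determinant \<open>(det
  G)\<^bsup>3/2\<^esup>\<close>, and the remaining constant is \<open>1\<close>.\<close>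
lemma expected_det3:
  "(\<integral>\<^sup>+v. goe_density v * (\<integral>\<^sup>+w. goe_density w * ennreal \<bar>det3 (gram y) (compress y v) (compress y w)\<bar> \<partial>lborel) \<partial>lborel)
     = ennreal (gram_det y * sqrt (gram_det y))"
proof -
  obtain y11 y12 y21 y22 where y: "y = (y11, y12, y21, y22)" by (cases y)
  define m1 m2 m3 where m: "m1 = 1 + y11\<^sup>2 + y12\<^sup>2" "m2 = y11 * y21 + y12 * y22" "m3 = 1 + y21\<^sup>2 + y22\<^sup>2"
  define \<delta> where "\<delta> = m1 * m3 - m2\<^sup>2"
  have m1: "m1 > 0" by (simp add: m add_pos_nonneg)
  have "\<delta> = 1 + y11\<^sup>2 + y12\<^sup>2 + y21\<^sup>2 + y22\<^sup>2 + (y11 * y22 - y12 * y21)\<^sup>2"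
    by (simp add: \<delta>_def m power2_eq_square algebra_simps)
  then have \<delta>: "\<delta> > 0" by (simp add: add_pos_nonneg)
  \<comment> \<open>the coefficient vectors of the three entries of the compression\<close>
  define x1 x2 x3 :: sym4 where x:
    "x1 = ((1, 0, 0), (- 2 * y11, - 2 * y12, 0, 0, y11\<^sup>2, 2 * y11 * y12, y12\<^sup>2))"
    "x2 = ((0, 1, 0), (- y21, - y22, - y11, - y12, y11 * y21, y11 * y22 + y12 * y21, y12 * y22))"
    "x3 = ((0, 0, 1), (0, 0, - 2 * y21, - 2 * y22, y21\<^sup>2, 2 * y21 * y22, y22\<^sup>2))"
  have comp: "compress y v = (x1 \<bullet> v, x2 \<bullet> v, x3 \<bullet> v)" for v
    unfolding y x by (cases "((y11, y12, y21, y22), v)" rule: compress.cases) (simp add: algebra_simps power2_eq_square)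
  have c: "goe_cov x1 x1 = m1\<^sup>2" "goe_cov x1 x2 = m1 * m2" "goe_cov x1 x3 = m2\<^sup>2" "goe_cov x2 x2 = (m1 * m3 + m2\<^sup>2) / 2"
    "goe_cov x2 x3 = m2 * m3" "goe_cov x3 x3 = m3\<^sup>2"
    by (simp_all add: x m power2_eq_square field_simps)
  let ?a = "m1 *\<^sub>R x2 - m2 *\<^sub>R x1" and ?b = "m1 *\<^sub>R x3 - m3 *\<^sub>R x1"
  note c' = goe_cov_commute[of x2 x1] goe_cov_commute[of x3 x1] goe_cov_commute[of x3 x2]
  have aa: "goe_cov ?a ?a = m1\<^sup>2 * \<delta> / 2"
    by (simp add: goe_cov_diff c c' \<delta>_def power2_eq_square field_simps)
  have bb: "goe_cov ?b ?b = 2 * m1 * m3 * \<delta>"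
    by (simp add: goe_cov_diff c c' \<delta>_def power2_eq_square field_simps)
  have ab: "goe_cov ?a ?b = m1 * m2 * \<delta>"
    by (simp add: goe_cov_diff c c' \<delta>_def power2_eq_square field_simps)
  have "goe_cov ?a ?a * goe_cov ?b ?b - (goe_cov ?a ?b)\<^sup>2 = (m1 * \<delta>)\<^sup>2 * \<delta>"
    unfolding aa bb ab by (simp add: \<delta>_def power2_eq_square field_simps)
  then have sq: "sqrt (goe_cov ?a ?a * goe_cov ?b ?b - (goe_cov ?a ?b)\<^sup>2) = m1 * (\<delta> * sqrt \<delta>)"
    using m1 \<delta> by (simp add: real_sqrt_mult)
  have det: "ennreal m1 * ennreal \<bar>det3 (gram y) (compress y v) (compress y w)\<bar> = ennreal \<bar>(?a \<bullet> v) * (?b \<bullet> w) - (?a \<bullet> w) * (?b \<bullet> v)\<bar>" for v w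
  proof -
    have "(?a \<bullet> v) * (?b \<bullet> w) - (?a \<bullet> w) * (?b \<bullet> v) = m1 * det3 (m1, m2, m3) (x1 \<bullet> v, x2 \<bullet> v, x3 \<bullet> v) (x1 \<bullet> w, x2 \<bullet> w, x3 \<bullet> w)"
      by (simp add: inner_diff_left algebra_simps)
    then show ?thesis using m1 by (simp add: comp[unfolded y] y m[symmetric] abs_mult ennreal_mult')
  qed
  have [measurable]: "(\<lambda>(v, w). det3 (gram y) (compress y v) (compress y w)) \<in> borel_measurable (borel \<Otimes>\<^sub>M borel)"
    unfolding comp by (cases "gram y") (simp, measurable)
  have "ennreal m1 * (\<integral>\<^sup>+v. goe_density v * (\<integral>\<^sup>+w. goe_density w * ennreal \<bar>det3 (gram y) (compress y v) (compress y w)\<bar> \<partial>lborel) \<partial>lborel)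
     = (\<integral>\<^sup>+v. ennreal m1 * (goe_density v * (\<integral>\<^sup>+w. goe_density w * ennreal \<bar>det3 (gram y) (compress y v) (compress y w)\<bar> \<partial>lborel)) \<partial>lborel)"
    by (rule nn_integral_cmult[symmetric]) measurable
  also have "\<dots> = (\<integral>\<^sup>+v. goe_density v * (\<integral>\<^sup>+w. goe_density w * (ennreal m1 * ennreal \<bar>det3 (gram y) (compress y v) (compress y w)\<bar>) \<partial>lborel) \<partial>lborel)"
    by (simp add: nn_integral_cmult[symmetric] mult_ac)
  also have "\<dots> = ennreal (m1 * (\<delta> * sqrt \<delta>))"
    unfolding det by (subst expected_wedge[OF gaussian_law_goe_density]) (simp only: sq)
  also have "\<dots> = ennreal m1 * ennreal (\<delta> * sqrt \<delta>)"
    using m1 by (simp add: ennreal_mult')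
  finally have "(\<integral>\<^sup>+v. goe_density v * (\<integral>\<^sup>+w. goe_density w * ennreal \<bar>det3 (gram y) (compress y v) (compress y w)\<bar> \<partial>lborel) \<partial>lborel) = ennreal (\<delta> * sqrt \<delta>)"
    using m1 by (simp add: ennreal_mult_cancel_left)
  then show ?thesis by (simp add: y \<delta>_def m)
qed

section \<open>Completing squares in the Gaussian densities\<close>

text \<open>The trace of the square, so that the density of the GOE is a multiple of \<open>exp (-
  trace_square v / 2)\<close>.\<close>
fun trace_square :: "sym4 \<Rightarrow> real" where
  "trace_square ((a11, a12, a22), (b11, b12, b21, b22, c11, c12, c22)) =
     a11\<^sup>2 + 2 * a12\<^sup>2 + a22\<^sup>2 + 2 * (b11\<^sup>2 + b12\<^sup>2 + b21\<^sup>2 + b22\<^sup>2) + c11\<^sup>2 + 2 * c12\<^sup>2 + c22\<^sup>2"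

lemma goe_density_exp: "goe_density v = ennreal (exp (- trace_square v / 2) / (4 * pi ^ 5))"
proof -
  obtain a11 a12 a22 b11 b12 b21 b22 c11 c12 c22 where v: "v = ((a11, a12, a22), (b11, b12, b21, b22, c11, c12, c22))"
    by (cases v rule: trace_square.cases)
  have o: "centered off x = ennreal (exp (- x\<^sup>2) / sqrt pi)" for x
    by (simp add: centered_def normal_density_def)
  have d: "centered 1 x = ennreal (exp (- x\<^sup>2 / 2) / (sqrt 2 * sqrt pi))" for x
    by (simp add: centered_1 real_sqrt_mult)
  have e: "exp (- trace_square v / 2) = exp (- a11\<^sup>2 / 2) * exp (- a12\<^sup>2) * exp (- a22\<^sup>2 / 2) * exp (- b11\<^sup>2) * exp (- b12\<^sup>2) *
      exp (- b21\<^sup>2) * exp (- b22\<^sup>2) * exp (- c11\<^sup>2 / 2) * exp (- c12\<^sup>2) * exp (- c22\<^sup>2 / 2)"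
    by (simp add: v exp_add[symmetric] add_divide_distrib field_simps)
  have "4 * pi ^ 5 = (sqrt 2 * sqrt 2) * (sqrt 2 * sqrt 2) * (sqrt pi * sqrt pi) * (sqrt pi * sqrt pi) * (sqrt pi * sqrt pi) * (sqrt pi * sqrt pi) * (sqrt pi * sqrt pi)"
    by (simp only: real_sqrt_mult_self) (simp add: numeral_eq_Suc)
  then have c: "4 * pi ^ 5 = (sqrt 2 * sqrt pi) * sqrt pi * (sqrt 2 * sqrt pi) * sqrt pi * sqrt pi * sqrt pi * sqrt pi * (sqrt 2 * sqrt pi) * sqrt pi * (sqrt 2 * sqrt pi)"
    by (simp only: mult_ac)
  show ?thesis
    unfolding e c
    by (simp add: v goe_density_def density_A_def density_W_def product_density_def o d ennreal_mult'[symmetric] del: real_sqrt_mult_self real_sqrt_mult)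
qed

text \<open>The trace of the product of two symmetric matrices.\<close>
fun trace_form :: "sym4 \<Rightarrow> sym4 \<Rightarrow> real" where
  "trace_form ((a11, a12, a22), (b11, b12, b21, b22, c11, c12, c22)) ((a11', a12', a22'), (b11', b12', b21', b22', c11', c12', c22'))
   = a11 * a11' + 2 * a12 * a12' + a22 * a22' + 2 * (b11 * b11' + b12 * b12' + b21 * b21' + b22 * b22')
     + c11 * c11' + 2 * c12 * c12' + c22 * c22'"

lemma trace_square_lincomb: "trace_square (s *\<^sub>R u + t *\<^sub>R v) = s\<^sup>2 * trace_square u + 2 * s * t * trace_form u v + t\<^sup>2 * trace_square v"
  by (cases "(u, v)" rule: trace_form.cases) (simp add: power2_eq_square algebra_simps)

lemma nn_integral_lborel_affine:
  fixes f :: "'a::euclidean_space \<Rightarrow> ennreal"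
  assumes [measurable]: "f \<in> borel_measurable borel" and c: "c \<noteq> 0"
  shows "(\<integral>\<^sup>+x. f x \<partial>lborel) = ennreal (\<bar>c\<bar> ^ DIM('a)) * (\<integral>\<^sup>+x. f (t + c *\<^sub>R x) \<partial>lborel)"
  by (subst lborel_affine[OF c, of t])
    (simp add: nn_integral_density nn_integral_distr nn_integral_cmult ennreal_power)

text \<open>Completing the square in a product of two Gaussian densities: the convolution variable
  is recentred at a multiple of \<open>u\<close> and rescaled by \<open>\<mu>\<close>. The
  exponent \<open>10\<close> is the dimension of the space of symmetric \<open>4 \<times>
  4\<close> matrices.\<close>
lemma gauss_shift:
  assumes \<mu>: "\<mu> > 0" "\<mu>\<^sup>2 * (1 + s\<^sup>2) = 1" and h [measurable]: "h \<in> borel_measurable borel"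
  shows "(\<integral>\<^sup>+v. goe_density v * (goe_density (u - s *\<^sub>R v) * h v) \<partial>lborel)
     = ennreal (\<mu> ^ 10) * (goe_density (\<mu> *\<^sub>R u) * (\<integral>\<^sup>+g. goe_density g * h ((s * \<mu>\<^sup>2) *\<^sub>R u + \<mu> *\<^sub>R g) \<partial>lborel))"
proof -
  let ?v = "\<lambda>g. (s * \<mu>\<^sup>2) *\<^sub>R u + \<mu> *\<^sub>R g"
  have key: "goe_density (?v g) * goe_density (u - s *\<^sub>R ?v g) = goe_density (\<mu> *\<^sub>R u) * goe_density g" for g
  proof -
    have s2: "1 - s * (s * \<mu>\<^sup>2) = \<mu>\<^sup>2" using \<mu>(2) by (simp add: power2_eq_square algebra_simps)
    have "u - s *\<^sub>R ?v g = (1 - s * (s * \<mu>\<^sup>2)) *\<^sub>R u + (- s * \<mu>) *\<^sub>R g"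
      by (simp add: algebra_simps)
    then have u: "u - s *\<^sub>R ?v g = \<mu>\<^sup>2 *\<^sub>R u + (- s * \<mu>) *\<^sub>R g" by (simp only: s2)
    have "trace_square (?v g) + trace_square (u - s *\<^sub>R ?v g) = (\<mu>\<^sup>2 * (1 + s\<^sup>2)) * (\<mu>\<^sup>2 * trace_square u + trace_square g)"
      unfolding u trace_square_lincomb by (simp add: power2_eq_square algebra_simps)
    also have "\<dots> = \<mu>\<^sup>2 * trace_square u + trace_square g" using \<mu>(2) by simp
    also have "\<mu>\<^sup>2 * trace_square u = trace_square (\<mu> *\<^sub>R u)" using trace_square_lincomb[of \<mu> u 0 u] by simp
    finally have "exp (- trace_square (?v g) / 2) * exp (- trace_square (u - s *\<^sub>R ?v g) / 2) = exp (- trace_square (\<mu> *\<^sub>R u) / 2) * exp (- trace_square g / 2)"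
      by (simp add: exp_add[symmetric] add_divide_distrib[symmetric] del: exp_add)
    then show ?thesis
      by (simp only: goe_density_exp) (simp add: ennreal_mult'[symmetric])
  qed
  have "(\<integral>\<^sup>+v. goe_density v * (goe_density (u - s *\<^sub>R v) * h v) \<partial>lborel)
     = ennreal (\<bar>\<mu>\<bar> ^ DIM(sym4)) * (\<integral>\<^sup>+g. goe_density (?v g) * (goe_density (u - s *\<^sub>R ?v g) * h (?v g)) \<partial>lborel)"
    using \<mu>(1) by (intro nn_integral_lborel_affine) auto
  also have "\<dots> = ennreal (\<mu> ^ 10) * (\<integral>\<^sup>+g. goe_density (?v g) * (goe_density (u - s *\<^sub>R ?v g) * h (?v g)) \<partial>lborel)"
  proof -
    have "DIM(sym4) = 10" by simp
    then show ?thesis using \<mu>(1) by (simp only: abs_of_pos)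
  qed
  also have "\<dots> = (\<integral>\<^sup>+g. ennreal (\<mu> ^ 10) * (goe_density (?v g) * (goe_density (u - s *\<^sub>R ?v g) * h (?v g))) \<partial>lborel)"
    by (rule nn_integral_cmult[symmetric]) measurable
  also have "\<dots> = (\<integral>\<^sup>+g. ennreal (\<mu> ^ 10) * (goe_density (\<mu> *\<^sub>R u) * (goe_density g * h (?v g))) \<partial>lborel)"
    by (simp only: mult.assoc[symmetric, of "goe_density (?v _)"] key mult.assoc)
  also have "\<dots> = ennreal (\<mu> ^ 10) * (goe_density (\<mu> *\<^sub>R u) * (\<integral>\<^sup>+g. goe_density g * h (?v g) \<partial>lborel))"
    by (subst nn_integral_cmult, measurable, subst nn_integral_cmult, measurable)
  finally show ?thesis .
qed

lemma compress_lincomb: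
  "compress y (s *\<^sub>R u + t *\<^sub>R v) = s *\<^sub>R compress y u + t *\<^sub>R compress y v"
  by (cases "(y, u)" rule: compress.cases; cases "(y, v)" rule: compress.cases) (simp add: algebra_simps)

lemma compress_add: "compress y (u + v) = compress y u + compress y v"
  using compress_lincomb[of y 1 u 1 v] by simp

lemma compress_scaleR: "compress y (s *\<^sub>R u) = s *\<^sub>R compress y u"
  using compress_lincomb[of y s u 0 u] by simp

lemma compress_measurable: "compress y \<in> borel_measurable borel"
proof -
  have "linear (compress y)"
  proof (rule linearI)
    show "compress y (u + v) = compress y u + compress y v" for u v using compress_lincomb[of y 1 u 1 v] by simp
    show "compress y (c *\<^sub>R u) = c *\<^sub>R compress y u" for c u using compress_lincomb[of y c u 0 u] by simp
  qed
  then show ?thesis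
    by (intro borel_measurable_continuous_onI linear_continuous_on) (simp add: linear_conv_bounded_linear)
qed

lemma measurable_det3:
  "(\<lambda>(x, z). det3 m x z) \<in> borel_measurable (borel \<Otimes>\<^sub>M borel)"
proof -
  have eq: "(\<lambda>(x, z). det3 m x z) = (\<lambda>p. fst m * (fst (snd (fst p)) * snd (snd (snd p)) - snd (snd (fst p)) * fst (snd (snd p)))
     - fst (snd m) * (fst (fst p) * snd (snd (snd p)) - snd (snd (fst p)) * fst (snd p))
     + snd (snd m) * (fst (fst p) * fst (snd (snd p)) - fst (snd (fst p)) * fst (snd p)))"
    by (cases m) (auto simp: fun_eq_iff)
  show ?thesis unfolding eq borel_prod
    by (intro borel_measurable_continuous_onI continuous_intros)
qed

text \<open>This integrates out the second and the third matrix of the pencil. Two applications of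
  the shift recentre \<open>v\<close> and \<open>v'\<close> along \<open>r\<close>; since the
  compression of \<open>r\<close> is a multiple of the Gram matrix, the alternating determinant
  does not see these translations. Each of the two rescalings contributes a tenth power from the
  volume, and together they give one more factor from the bilinear determinant, hence
  \<open>\<rho>\<^bsup>- 11\<^esup>\<close>.\<close>
lemma gauss_double_shift:
  fixes s t :: real
  assumes r: "compress y r = l *\<^sub>R gram y"
  defines "\<rho> \<equiv> sqrt (1 + s\<^sup>2 + t\<^sup>2)"
  shows "(\<integral>\<^sup>+v'. goe_density v' * (\<integral>\<^sup>+v. goe_density v * (goe_density (r - t *\<^sub>R v' - s *\<^sub>R v) * ennreal \<bar>det3 (gram y) (compress y v) (compress y v')\<bar>) \<partial>lborel) \<partial>lborel)
     = ennreal (1 / \<rho> ^ 11) * (goe_density ((1 / \<rho>) *\<^sub>R r) * ennreal (gram_det y * sqrt (gram_det y)))"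
proof -
  note [measurable] = compress_measurable measurable_det3
  define \<mu> where "\<mu> = 1 / sqrt (1 + s\<^sup>2)"
  have S: "1 + s\<^sup>2 > 0" by (simp add: add_pos_nonneg)
  then have R: "1 + s\<^sup>2 + t\<^sup>2 > 0" by (rule add_pos_nonneg) simp
  have \<mu>: "\<mu> > 0" "\<mu>\<^sup>2 * (1 + s\<^sup>2) = 1" using S by (auto simp: \<mu>_def power_divide)
  define s' where "s' = \<mu> * t"
  define \<nu> where "\<nu> = 1 / sqrt (1 + s'\<^sup>2)"
  have S': "1 + s'\<^sup>2 > 0" by (auto intro: add_pos_nonneg)
  have \<nu>: "\<nu> > 0" "\<nu>\<^sup>2 * (1 + s'\<^sup>2) = 1" using S' by (auto simp: \<nu>_def power_divide)
  have "(\<mu> * \<nu>)\<^sup>2 = (1 / \<rho>)\<^sup>2"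
  proof -
    have "1 + s'\<^sup>2 = \<mu>\<^sup>2 * (1 + s\<^sup>2 + t\<^sup>2)" using \<mu>(2) by (simp add: s'_def power_mult_distrib algebra_simps)
    then have "\<nu>\<^sup>2 * (\<mu>\<^sup>2 * (1 + s\<^sup>2 + t\<^sup>2)) = 1" using \<nu>(2) by simp
    then show ?thesis using R by (simp add: \<rho>_def power_mult_distrib power_divide field_simps)
  qed
  moreover have "\<rho> > 0" using R by (simp add: \<rho>_def)
  ultimately have \<mu>\<nu>: "\<mu> * \<nu> = 1 / \<rho>" using \<mu>(1) \<nu>(1) by (simp add: power2_eq_iff_nonneg)
  let ?H = "\<lambda>v v'. ennreal \<bar>det3 (gram y) (compress y v) (compress y v')\<bar>"
  let ?w = "\<lambda>g'. (s' * \<nu>\<^sup>2) *\<^sub>R (\<mu> *\<^sub>R r) + \<nu> *\<^sub>R g'"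
  let ?v = "\<lambda>v' g. (s * \<mu>\<^sup>2) *\<^sub>R (r - t *\<^sub>R v') + \<mu> *\<^sub>R g"
  have H: "?H (?v (?w g') g) (?w g') = ennreal (1 / \<rho>) * ?H g g'" for g g'
  proof -
    have w: "compress y (?w g') = (s' * \<nu>\<^sup>2 * \<mu> * l) *\<^sub>R gram y + \<nu> *\<^sub>R compress y g'"
      by (simp only: compress_add compress_scaleR r scaleR_scaleR mult.assoc)
    have v: "compress y (?v w' g) = (s * \<mu>\<^sup>2 * l) *\<^sub>R gram y + (- (s * \<mu>\<^sup>2 * t)) *\<^sub>R compress y w' + \<mu> *\<^sub>R compress y g" for w'
    proof -
      have "?v w' g = (s * \<mu>\<^sup>2) *\<^sub>R r + (- (s * \<mu>\<^sup>2 * t)) *\<^sub>R w' + \<mu> *\<^sub>R g"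
        by (simp add: algebra_simps)
      then show ?thesis
        by (simp only: compress_add compress_scaleR r scaleR_scaleR mult.assoc)
    qed
    have "det3 (gram y) (compress y (?v (?w g') g)) (compress y (?w g')) = \<mu> * \<nu> * det3 (gram y) (compress y g) (compress y g')"
      unfolding v w by (cases "gram y"; cases "compress y g"; cases "compress y g'") (simp add: algebra_simps)
    then show ?thesis using \<mu>\<nu> \<open>\<rho> > 0\<close> by (simp add: abs_mult ennreal_mult' mult.assoc divide_inverse)
  qed
  have "(\<integral>\<^sup>+v'. goe_density v' * (\<integral>\<^sup>+v. goe_density v * (goe_density (r - t *\<^sub>R v' - s *\<^sub>R v) * ?H v v') \<partial>lborel) \<partial>lborel)
     = (\<integral>\<^sup>+v'. goe_density v' * (ennreal (\<mu> ^ 10) * (goe_density (\<mu> *\<^sub>R (r - t *\<^sub>R v')) * (\<integral>\<^sup>+g. goe_density g * ?H (?v v' g) v' \<partial>lborel))) \<partial>lborel)"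
    by (intro nn_integral_cong arg_cong2[where f="(*)"] refl gauss_shift[OF \<mu>]) measurable
  also have "\<dots> = (\<integral>\<^sup>+v'. ennreal (\<mu> ^ 10) * (goe_density v' * (goe_density (\<mu> *\<^sub>R r - s' *\<^sub>R v') * (\<integral>\<^sup>+g. goe_density g * ?H (?v v' g) v' \<partial>lborel))) \<partial>lborel)"
    by (simp add: s'_def scaleR_diff_right mult_ac)
  also have "\<dots> = ennreal (\<mu> ^ 10) * (\<integral>\<^sup>+v'. goe_density v' * (goe_density (\<mu> *\<^sub>R r - s' *\<^sub>R v') * (\<integral>\<^sup>+g. goe_density g * ?H (?v v' g) v' \<partial>lborel)) \<partial>lborel)"
    by (rule nn_integral_cmult) measurable
  also have "\<dots> = ennreal (\<mu> ^ 10) * (ennreal (\<nu> ^ 10) * (goe_density (\<nu> *\<^sub>R (\<mu> *\<^sub>R r)) * (\<integral>\<^sup>+g'. goe_density g' * (\<integral>\<^sup>+g. goe_density g * ?H (?v (?w g') g) (?w g') \<partial>lborel) \<partial>lborel)))"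
    by (intro arg_cong2[where f="(*)"] refl gauss_shift[OF \<nu>]) measurable
  also have "(\<integral>\<^sup>+g'. goe_density g' * (\<integral>\<^sup>+g. goe_density g * ?H (?v (?w g') g) (?w g') \<partial>lborel) \<partial>lborel)
     = (\<integral>\<^sup>+g'. ennreal (1 / \<rho>) * (goe_density g' * (\<integral>\<^sup>+g. goe_density g * ?H g g' \<partial>lborel)) \<partial>lborel)"
  proof -
    have "(\<integral>\<^sup>+g. goe_density g * (ennreal (1 / \<rho>) * ?H g g') \<partial>lborel) = ennreal (1 / \<rho>) * (\<integral>\<^sup>+g. goe_density g * ?H g g' \<partial>lborel)" for g'
      by (subst nn_integral_cmult[symmetric], measurable) (simp only: mult.left_commute)
    then show ?thesis unfolding H by (simp only: mult.left_commute)
  qed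
  also have "\<dots> = ennreal (1 / \<rho>) * (\<integral>\<^sup>+g'. goe_density g' * (\<integral>\<^sup>+g. goe_density g * ?H g g' \<partial>lborel) \<partial>lborel)"
    by (rule nn_integral_cmult) measurable
  also have "(\<integral>\<^sup>+g'. goe_density g' * (\<integral>\<^sup>+g. goe_density g * ?H g g' \<partial>lborel) \<partial>lborel) = ennreal (gram_det y * sqrt (gram_det y))"
  proof -
    have "\<bar>det3 m x z\<bar> = \<bar>det3 m z x\<bar>" for m x z
      by (cases "(m, x, z)" rule: det3.cases) (simp add: abs_if algebra_simps)
    then show ?thesis using expected_det3[of y] by simp
  qed
  also have "\<nu> *\<^sub>R (\<mu> *\<^sub>R r) = (1 / \<rho>) *\<^sub>R r" using \<mu>\<nu> by (simp add: mult.commute)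
  finally have "(\<integral>\<^sup>+v'. goe_density v' * (\<integral>\<^sup>+v. goe_density v * (goe_density (r - t *\<^sub>R v' - s *\<^sub>R v) * ?H v v') \<partial>lborel) \<partial>lborel)
    = (ennreal (\<mu> ^ 10) * ennreal (\<nu> ^ 10) * ennreal (1 / \<rho>)) * (goe_density ((1 / \<rho>) *\<^sub>R r) * ennreal (gram_det y * sqrt (gram_det y)))"
    by (simp only: mult_ac)
  also have "ennreal (\<mu> ^ 10) * ennreal (\<nu> ^ 10) * ennreal (1 / \<rho>) = ennreal (1 / \<rho> ^ 11)"
  proof -
    have "\<mu> ^ 10 * \<nu> ^ 10 * (1 / \<rho>) = (1 / \<rho>) ^ 10 * (1 / \<rho>)" by (simp only: power_mult_distrib[symmetric] \<mu>\<nu>)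
    also have "\<dots> = 1 / \<rho> ^ 11" by (simp add: power_one_over numeral_eq_Suc)
    finally show ?thesis using \<mu>(1) \<nu>(1) by (simp add: ennreal_mult'[symmetric])
  qed
  finally show ?thesis .
qed

section \<open>The chart of matrices of corank two\<close>

lemma borel_measurable_fst_comp [measurable (raw)]:
  fixes f :: "'c \<Rightarrow> 'a::euclidean_space \<times> 'b::euclidean_space"
  shows "f \<in> borel_measurable M \<Longrightarrow> (\<lambda>x. fst (f x)) \<in> borel_measurable M"
  by (rule borel_measurable_continuous_on[of fst]) (auto intro: continuous_intros)

lemma borel_measurable_snd_comp [measurable (raw)]:
  fixes f :: "'c \<Rightarrow> 'a::euclidean_space \<times> 'b::euclidean_space"
  shows "f \<in> borel_measurable M \<Longrightarrow> (\<lambda>x. snd (f x)) \<in> borel_measurable M"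
  by (rule borel_measurable_continuous_on[of snd]) (auto intro: continuous_intros)

text \<open>The entries of \<open>B\<close> and \<open>C\<close> in the block form \<open>((A, B),
  (B\<^sup>T, C))\<close>.\<close>
type_synonym block7 = "real \<times> real \<times> real \<times> real \<times> real \<times> real \<times> real"

definition corner_det :: "real \<Rightarrow> block7 \<Rightarrow> real" where
  "corner_det l = (\<lambda>(b11, b12, b21, b22, c11, c12, c22). (c11 - l) * (c22 - l) - c12\<^sup>2)"

text \<open>The matrix \<open>Y = B (C - l)\<^sup>-\<^sup>1\<close>, by Cramer's rule. The rows of
  \<open>(I, - Y)\<close> annihilate the last two columns of the matrix minus
  \<open>l\<close>.\<close>
definition kernel_coef :: "real \<Rightarrow> block7 \<Rightarrow> real \<times> real \<times> real \<times> real" where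
  "kernel_coef l = (\<lambda>(b11, b12, b21, b22, c11, c12, c22).
     ((b11 * (c22 - l) - b12 * c12) / ((c11 - l) * (c22 - l) - c12\<^sup>2), (b12 * (c11 - l) - b11 * c12) / ((c11 - l) * (c22 - l) - c12\<^sup>2),
      (b21 * (c22 - l) - b22 * c12) / ((c11 - l) * (c22 - l) - c12\<^sup>2), (b22 * (c11 - l) - b21 * c12) / ((c11 - l) * (c22 - l) - c12\<^sup>2)))"

text \<open>The block \<open>A = l + B (C - l)\<^sup>-\<^sup>1 B\<^sup>T\<close>, the unique one
  for which the Schur complement of \<open>C - l\<close> vanishes, i.e. for which \<open>l\<close>
  is a double eigenvalue.\<close>
definition corank2_block :: "real \<Rightarrow> block7 \<Rightarrow> real \<times> real \<times> real" where
  "corank2_block l w = (case w of (b11, b12, b21, b22, c11, c12, c22) \<Rightarrow> case kernel_coef l w of (y11, y12, y21, y22) \<Rightarrow>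
     (l + (y11 * b11 + y12 * b12), y21 * b11 + y22 * b12, l + (y21 * b21 + y22 * b22)))"

lemma chart_measurable [measurable (raw)]:
  assumes [measurable]: "f \<in> borel_measurable M" "g \<in> borel_measurable M"
  shows "(\<lambda>x. corner_det (f x) (g x)) \<in> borel_measurable M"
    "(\<lambda>x. kernel_coef (f x) (g x)) \<in> borel_measurable M"
    "(\<lambda>x. corank2_block (f x) (g x)) \<in> borel_measurable M"
  unfolding corank2_block_def corner_det_def kernel_coef_def case_prod_beta by measurable

lemma gram_det_alt: "gram_det y = (1 + (fst y)\<^sup>2 + (fst (snd y))\<^sup>2) * (1 + (fst (snd (snd y)))\<^sup>2 + (snd (snd (snd y)))\<^sup>2)
    - (fst y * fst (snd (snd y)) + fst (snd y) * snd (snd (snd y)))\<^sup>2"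
  by (cases y) simp

lemma gram_det_measurable [measurable (raw)]:
  "f \<in> borel_measurable M \<Longrightarrow> (\<lambda>x. gram_det (f x)) \<in> borel_measurable M"
  by (rule borel_measurable_continuous_on[of gram_det]) (auto simp: gram_det_alt[abs_def] intro!: continuous_intros)

lemma gram_det_pos: "gram_det y > 0"
proof -
  obtain y11 y12 y21 y22 where y: "y = (y11, y12, y21, y22)" by (cases y)
  have "gram_det y = 1 + (y11\<^sup>2 + y12\<^sup>2 + y21\<^sup>2 + y22\<^sup>2 + (y11 * y22 - y12 * y21)\<^sup>2)"
    by (simp add: y power2_eq_square algebra_simps)
  then show ?thesis by (simp add: add_pos_nonneg)
qed

text \<open>Reparametrisation of the chart by \<open>E = C - l\<close> and \<open>Y\<close>, with
  \<open>B = Y E\<close>. All rational expressions become polynomials.\<close>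
lemma chart_coords:
  fixes l y11 y12 y21 y22 :: real
  assumes \<delta>: "e11 * e22 - e12\<^sup>2 \<noteq> (0::real)"
  defines "w \<equiv> (y11 * e11 + y12 * e12, y11 * e12 + y12 * e22, y21 * e11 + y22 * e12, y21 * e12 + y22 * e22, l + e11, e12, l + e22)"
  shows "corner_det l w = e11 * e22 - e12\<^sup>2" "kernel_coef l w = (y11, y12, y21, y22)"
    "corank2_block l w = (l + (y11\<^sup>2 * e11 + 2 * y11 * y12 * e12 + y12\<^sup>2 * e22),
       y11 * y21 * e11 + (y11 * y22 + y12 * y21) * e12 + y12 * y22 * e22,
       l + (y21\<^sup>2 * e11 + 2 * y21 * y22 * e12 + y22\<^sup>2 * e22))"
proof -
  show "corner_det l w = e11 * e22 - e12\<^sup>2" by (simp add: corner_det_def w_def)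
  have 1: "(y * e11 + z * e12) * e22 - (y * e12 + z * e22) * e12 = y * (e11 * e22 - e12\<^sup>2)"
    and 2: "(y * e12 + z * e22) * e11 - (y * e11 + z * e12) * e12 = z * (e11 * e22 - e12\<^sup>2)" for y z
    by (simp_all add: power2_eq_square algebra_simps)
  show y: "kernel_coef l w = (y11, y12, y21, y22)"
    using \<delta> by (simp add: kernel_coef_def w_def 1 2)
  have "corank2_block l w = (l + (y11 * (y11 * e11 + y12 * e12) + y12 * (y11 * e12 + y12 * e22)),
      y21 * (y11 * e11 + y12 * e12) + y22 * (y11 * e12 + y12 * e22),
      l + (y21 * (y21 * e11 + y22 * e12) + y22 * (y21 * e12 + y22 * e22)))"
    unfolding corank2_block_def y by (simp add: w_def)
  then show "corank2_block l w = (l + (y11\<^sup>2 * e11 + 2 * y11 * y12 * e12 + y12\<^sup>2 * e22),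
       y11 * y21 * e11 + (y11 * y22 + y12 * y21) * e12 + y12 * y22 * e22,
       l + (y21\<^sup>2 * e11 + 2 * y21 * y22 * e12 + y22\<^sup>2 * e22))"
    by (simp add: power2_eq_square algebra_simps)
qed

lemma chart_coords_surj:
  assumes "corner_det l w \<noteq> 0"
  obtains e11 e12 e22 y11 y12 y21 y22 where "e11 * e22 - e12\<^sup>2 \<noteq> 0"
    "w = (y11 * e11 + y12 * e12, y11 * e12 + y12 * e22, y21 * e11 + y22 * e12, y21 * e12 + y22 * e22, l + e11, e12, l + e22)"
proof -
  obtain b11 b12 b21 b22 c11 c12 c22 where w: "w = (b11, b12, b21, b22, c11, c12, c22)" by (cases w)
  let ?d = "(c11 - l) * (c22 - l) - c12\<^sup>2"
  have d: "?d \<noteq> 0" using assms by (simp add: w corner_det_def)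
  have 1: "(b * (c22 - l) - b' * c12) / ?d * (c11 - l) + (b' * (c11 - l) - b * c12) / ?d * c12 = b"
    and 2: "(b * (c22 - l) - b' * c12) / ?d * c12 + (b' * (c11 - l) - b * c12) / ?d * (c22 - l) = b'" for b b'
  proof -
    have "(b * (c22 - l) - b' * c12) * (c11 - l) + (b' * (c11 - l) - b * c12) * c12 = b * ?d"
      "(b * (c22 - l) - b' * c12) * c12 + (b' * (c11 - l) - b * c12) * (c22 - l) = b' * ?d"
      by (simp_all add: power2_eq_square algebra_simps)
    then show "(b * (c22 - l) - b' * c12) / ?d * (c11 - l) + (b' * (c11 - l) - b * c12) / ?d * c12 = b"
      "(b * (c22 - l) - b' * c12) / ?d * c12 + (b' * (c11 - l) - b * c12) / ?d * (c22 - l) = b'"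
      using d by (simp_all only: times_divide_eq_left add_divide_distrib[symmetric]) simp_all
  qed
  show ?thesis
    using that[of "c11 - l" "c22 - l" c12 "(b11 * (c22 - l) - b12 * c12) / ?d" "(b12 * (c11 - l) - b11 * c12) / ?d"
      "(b21 * (c22 - l) - b22 * c12) / ?d" "(b22 * (c11 - l) - b21 * c12) / ?d"] d
    unfolding w 1 2 by simp
qed

text \<open>The rows of \<open>(I, - Y)\<close> span the eigenspace of \<open>l\<close>, on which
  the matrix acts as the scalar \<open>l\<close>.\<close>
lemma compress_chart:
  assumes "corner_det l w \<noteq> 0"
  shows "compress (kernel_coef l w) (corank2_block l w, w) = l *\<^sub>R gram (kernel_coef l w)"
proof -
  obtain e11 e12 e22 y11 y12 y21 y22 where e: "e11 * e22 - e12\<^sup>2 \<noteq> 0"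
    and w: "w = (y11 * e11 + y12 * e12, y11 * e12 + y12 * e22, y21 * e11 + y22 * e12, y21 * e12 + y22 * e22, l + e11, e12, l + e22)"
    using chart_coords_surj[OF assms] .
  show ?thesis
    unfolding w chart_coords[OF e] by (simp add: power2_eq_square algebra_simps)
qed

text \<open>The nonzero part of the matrix minus \<open>l\<close> has trace \<open>T = tr (E (I +
  Y\<^sup>T Y))\<close> and second elementary symmetric function \<open>det E \<cdot> det (I +
  Y\<^sup>T Y)\<close>; the formula is \<open>\<Sum>\<lambda>\<^sup>2\<close> in these
  terms.\<close>
lemma trace_square_chart:
  fixes e11 e12 e22 l y11 y12 y21 y22 :: real
  defines "T \<equiv> e11 * (1 + y11\<^sup>2 + y21\<^sup>2) + 2 * e12 * (y11 * y12 + y21 * y22) + e22 * (1 + y12\<^sup>2 + y22\<^sup>2)"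
  shows "trace_square ((l + (y11\<^sup>2 * e11 + 2 * y11 * y12 * e12 + y12\<^sup>2 * e22),
       y11 * y21 * e11 + (y11 * y22 + y12 * y21) * e12 + y12 * y22 * e22,
       l + (y21\<^sup>2 * e11 + 2 * y21 * y22 * e12 + y22\<^sup>2 * e22)),
     (y11 * e11 + y12 * e12, y11 * e12 + y12 * e22, y21 * e11 + y22 * e12, y21 * e12 + y22 * e22, l + e11, e12, l + e22))
   = 4 * l\<^sup>2 + 2 * l * T + (T\<^sup>2 - 2 * gram_det (y11, y12, y21, y22) * (e11 * e22 - e12\<^sup>2))"
  by (simp add: T_def power2_eq_square algebra_simps)

lemma nn_integral_pair:
  fixes f :: "'a::euclidean_space \<times> 'b::euclidean_space \<Rightarrow> ennreal"
  assumes f [measurable]: "f \<in> borel_measurable borel"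
  shows "(\<integral>\<^sup>+p. f p \<partial>lborel) = (\<integral>\<^sup>+x. \<integral>\<^sup>+y. f (x, y) \<partial>lborel \<partial>lborel)"
  unfolding lborel_prod[symmetric] by (rule lborel.nn_integral_fst[symmetric]) (simp add: lborel_prod)

lemma nn_integral_pair_swap:
  fixes f :: "'a::euclidean_space \<times> 'b::euclidean_space \<Rightarrow> ennreal"
  assumes f [measurable]: "f \<in> borel_measurable borel"
  shows "(\<integral>\<^sup>+p. f p \<partial>lborel) = (\<integral>\<^sup>+y. \<integral>\<^sup>+x. f (x, y) \<partial>lborel \<partial>lborel)"
  unfolding nn_integral_pair[OF f] by (rule lborel_pair.Fubini'[symmetric]) measurable

lemma nn_integral_quadruple:
  fixes f :: "real \<times> real \<times> real \<times> real \<Rightarrow> ennreal"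
  assumes f [measurable]: "f \<in> borel_measurable borel"
  shows "(\<integral>\<^sup>+b. f b \<partial>lborel) = (\<integral>\<^sup>+b11. \<integral>\<^sup>+b12. \<integral>\<^sup>+b21. \<integral>\<^sup>+b22. f (b11, b12, b21, b22) \<partial>lborel \<partial>lborel \<partial>lborel \<partial>lborel)"
  by (subst nn_integral_pair, measurable, rule nn_integral_cong, subst nn_integral_pair, measurable, rule nn_integral_cong,
      subst nn_integral_pair, measurable)

lemma nn_integral_triple_swap:
  fixes f :: "real \<times> real \<times> real \<Rightarrow> ennreal"
  assumes f [measurable]: "f \<in> borel_measurable borel"
  shows "(\<integral>\<^sup>+c. f c \<partial>lborel) = (\<integral>\<^sup>+c22. \<integral>\<^sup>+c12. \<integral>\<^sup>+c11. f (c11, c12, c22) \<partial>lborel \<partial>lborel \<partial>lborel)"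
  by (subst nn_integral_pair_swap, measurable, subst nn_integral_pair_swap, measurable)

lemma nn_integral_block7:
  fixes f :: "block7 \<Rightarrow> ennreal"
  assumes f [measurable]: "f \<in> borel_measurable borel"
  shows "(\<integral>\<^sup>+w. f w \<partial>lborel) =
    (\<integral>\<^sup>+c22. \<integral>\<^sup>+c12. \<integral>\<^sup>+c11. \<integral>\<^sup>+b11. \<integral>\<^sup>+b12. \<integral>\<^sup>+b21. \<integral>\<^sup>+b22. f (b11, b12, b21, b22, c11, c12, c22)
      \<partial>lborel \<partial>lborel \<partial>lborel \<partial>lborel \<partial>lborel \<partial>lborel \<partial>lborel)"
proof -
  let ?g = "\<lambda>b c. f (fst b, fst (snd b), fst (snd (snd b)), snd (snd (snd b)), c)"
  have "(\<integral>\<^sup>+w. f w \<partial>lborel) = (\<integral>\<^sup>+b11. \<integral>\<^sup>+b12. \<integral>\<^sup>+b21. \<integral>\<^sup>+b22. \<integral>\<^sup>+c. f (b11, b12, b21, b22, c) \<partial>lborel \<partial>lborel \<partial>lborel \<partial>lborel \<partial>lborel)"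
    by (subst nn_integral_pair, measurable, rule nn_integral_cong, subst nn_integral_pair, measurable, rule nn_integral_cong,
        subst nn_integral_pair, measurable, rule nn_integral_cong, subst nn_integral_pair, measurable)
  also have "\<dots> = (\<integral>\<^sup>+b. \<integral>\<^sup>+c. ?g b c \<partial>lborel \<partial>lborel)"
    using nn_integral_quadruple[of "\<lambda>b. \<integral>\<^sup>+c. ?g b c \<partial>lborel"] by simp
  also have "\<dots> = (\<integral>\<^sup>+c. \<integral>\<^sup>+b. ?g b c \<partial>lborel \<partial>lborel)"
    by (rule lborel_pair.Fubini') measurable
  also have "\<dots> = (\<integral>\<^sup>+c. \<integral>\<^sup>+b11. \<integral>\<^sup>+b12. \<integral>\<^sup>+b21. \<integral>\<^sup>+b22. f (b11, b12, b21, b22, c) \<partial>lborel \<partial>lborel \<partial>lborel \<partial>lborel \<partial>lborel)"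
  proof (rule nn_integral_cong)
    fix c :: "real \<times> real \<times> real"
    have "(\<lambda>b. ?g b c) \<in> borel_measurable borel"
      by (rule measurable_compose[OF _ f]) (intro borel_measurable_continuous_onI continuous_intros)
    then show "(\<integral>\<^sup>+b. ?g b c \<partial>lborel) = (\<integral>\<^sup>+b11. \<integral>\<^sup>+b12. \<integral>\<^sup>+b21. \<integral>\<^sup>+b22. f (b11, b12, b21, b22, c) \<partial>lborel \<partial>lborel \<partial>lborel \<partial>lborel)"
      by (subst nn_integral_quadruple) simp_all
  qed
  also have "\<dots> = (\<integral>\<^sup>+c22. \<integral>\<^sup>+c12. \<integral>\<^sup>+c11. \<integral>\<^sup>+b11. \<integral>\<^sup>+b12. \<integral>\<^sup>+b21. \<integral>\<^sup>+b22. f (b11, b12, b21, b22, c11, c12, c22)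
      \<partial>lborel \<partial>lborel \<partial>lborel \<partial>lborel \<partial>lborel \<partial>lborel \<partial>lborel)"
    by (rule nn_integral_triple_swap) measurable
  finally show ?thesis .
qed

text \<open>The congruence \<open>E \<mapsto> L E L\<^sup>T\<close> with a triangular \<open>2
  \<times> 2\<close> matrix \<open>L\<close> acts on symmetric matrices with Jacobian \<open>(det
  L)\<^sup>3\<close>.\<close>
lemma nn_integral_triangular:
  fixes G :: "real \<times> real \<times> real \<Rightarrow> ennreal"
  assumes G [measurable]: "G \<in> borel_measurable borel"
    and p: "p > 0" and r: "r > 0"
  shows "(\<integral>\<^sup>+c. \<integral>\<^sup>+b. \<integral>\<^sup>+a. G (a, b, c) \<partial>lborel \<partial>lborel \<partial>lborel) =
    ennreal ((p * r) ^ 3) * (\<integral>\<^sup>+c. \<integral>\<^sup>+b. \<integral>\<^sup>+a. G (p\<^sup>2 * a + 2 * p * q * b + q\<^sup>2 * c, r * (p * b + q * c), r\<^sup>2 * c) \<partial>lborel \<partial>lborel \<partial>lborel)"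
proof -
  let ?H = "\<lambda>a b c. G (a, b, c)"
  have "(\<integral>\<^sup>+c. \<integral>\<^sup>+b. \<integral>\<^sup>+a. ?H a b c \<partial>lborel \<partial>lborel \<partial>lborel)
    = ennreal \<bar>r\<^sup>2\<bar> * (\<integral>\<^sup>+c. \<integral>\<^sup>+b. \<integral>\<^sup>+a. ?H a b (0 + r\<^sup>2 * c) \<partial>lborel \<partial>lborel \<partial>lborel)"
    using r by (intro nn_integral_real_affine) auto
  also have "\<dots> = ennreal \<bar>r\<^sup>2\<bar> * (\<integral>\<^sup>+c. ennreal \<bar>r * p\<bar> * (\<integral>\<^sup>+b. \<integral>\<^sup>+a. ?H a (r * q * c + r * p * b) (0 + r\<^sup>2 * c) \<partial>lborel \<partial>lborel) \<partial>lborel)"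
    using p r by (intro arg_cong2[where f="(*)"] refl nn_integral_cong nn_integral_real_affine) auto
  also have "\<dots> = ennreal \<bar>r\<^sup>2\<bar> * (\<integral>\<^sup>+c. ennreal \<bar>r * p\<bar> * (\<integral>\<^sup>+b. ennreal \<bar>p\<^sup>2\<bar> * (\<integral>\<^sup>+a. ?H ((2 * p * q * b + q\<^sup>2 * c) + p\<^sup>2 * a) (r * q * c + r * p * b) (0 + r\<^sup>2 * c) \<partial>lborel) \<partial>lborel) \<partial>lborel)"
    using p by (intro arg_cong2[where f="(*)"] refl nn_integral_cong nn_integral_real_affine) auto
  also have "\<dots> = ennreal \<bar>r\<^sup>2\<bar> * (ennreal \<bar>r * p\<bar> * (ennreal \<bar>p\<^sup>2\<bar> * (\<integral>\<^sup>+c. \<integral>\<^sup>+b. \<integral>\<^sup>+a. ?H ((2 * p * q * b + q\<^sup>2 * c) + p\<^sup>2 * a) (r * q * c + r * p * b) (0 + r\<^sup>2 * c) \<partial>lborel \<partial>lborel \<partial>lborel)))"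
    by (simp add: nn_integral_cmult)
  also have "\<dots> = ennreal ((p * r) ^ 3) * (\<integral>\<^sup>+c. \<integral>\<^sup>+b. \<integral>\<^sup>+a. ?H ((2 * p * q * b + q\<^sup>2 * c) + p\<^sup>2 * a) (r * q * c + r * p * b) (0 + r\<^sup>2 * c) \<partial>lborel \<partial>lborel \<partial>lborel)"
  proof -
    have "\<bar>r\<^sup>2\<bar> * (\<bar>r * p\<bar> * \<bar>p\<^sup>2\<bar>) = (p * r) ^ 3"
      using p r by (simp add: power2_eq_square power3_eq_cube)
    then show ?thesis by (simp only: mult.assoc[symmetric] ennreal_mult'[symmetric] abs_ge_zero)
  qed
  also have "(\<integral>\<^sup>+c. \<integral>\<^sup>+b. \<integral>\<^sup>+a. ?H ((2 * p * q * b + q\<^sup>2 * c) + p\<^sup>2 * a) (r * q * c + r * p * b) (0 + r\<^sup>2 * c) \<partial>lborel \<partial>lborel \<partial>lborel)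
    = (\<integral>\<^sup>+c. \<integral>\<^sup>+b. \<integral>\<^sup>+a. ?H (p\<^sup>2 * a + 2 * p * q * b + q\<^sup>2 * c) (r * (p * b + q * c)) (r\<^sup>2 * c) \<partial>lborel \<partial>lborel \<partial>lborel)"
    by (simp add: algebra_simps)
  finally show ?thesis .
qed

text \<open>Up to normalisation this is the volume of the Grassmannian of planes in
  \<open>\<real>\<^sup>4\<close> in the affine chart \<open>Y\<close>. For a fixed first row, a
  linear substitution in the second row makes the integrand radial.\<close>
lemma grassmannian_integral:
  "(\<integral>\<^sup>+a. \<integral>\<^sup>+b. \<integral>\<^sup>+c. \<integral>\<^sup>+d. ennreal (1 / (gram_det (a, b, c, d))\<^sup>2) \<partial>lborel \<partial>lborel \<partial>lborel \<partial>lborel) = ennreal (2 * pi\<^sup>2)"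
proof -
  have inner: "(\<integral>\<^sup>+c. \<integral>\<^sup>+d. ennreal (1 / (gram_det (a, b, c, d))\<^sup>2) \<partial>lborel \<partial>lborel) = ennreal pi * ennreal ((1 + a\<^sup>2 + b\<^sup>2) powr - (3 / 2))" for a b :: real
  proof -
    define m where "m = 1 + a\<^sup>2 + b\<^sup>2"
    define B where "B = 1 + b\<^sup>2"
    have m: "m > 0" and B: "B > 0" by (auto simp: m_def B_def add_pos_nonneg)
    \<comment> \<open>this substitution turns the quadratic form in the second row into \<open>m (u\<^sup>2 + v\<^sup>2)\<close>\<close>
    let ?p = "sqrt (m / B)" and ?q = "a * b / sqrt B" and ?r = "sqrt B"
    have gd: "gram_det (a, b, ?p * u + ?q * v, 0 * u + ?r * v) = m * (1 + u\<^sup>2 + v\<^sup>2)" for u v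
    proof -
      define c d where cd: "c = ?p * u + ?q * v" "d = ?r * v"
      have "B * (c - a * b * d / B)\<^sup>2 = m * u\<^sup>2"
      proof -
        have "a * b * d / B = ?q * v"
          using B by (simp add: cd(2) real_div_sqrt field_simps)
        then have "c - a * b * d / B = ?p * u" by (simp add: cd(1))
        then show ?thesis using m B by (simp add: power_mult_distrib)
      qed
      moreover have "d\<^sup>2 * m = B * (m * v\<^sup>2)" using B by (simp add: cd(2) power_mult_distrib)
      moreover have "B * gram_det (a, b, c, d) = B * m + B * (B * (c - a * b * d / B)\<^sup>2) + d\<^sup>2 * m"
        using B by (simp add: power2_eq_square field_simps) (simp add: m_def B_def power2_eq_square algebra_simps)
      ultimately have "B * gram_det (a, b, c, d) = B * (m * (1 + u\<^sup>2 + v\<^sup>2))" by (simp add: algebra_simps)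
      then show ?thesis using B unfolding cd by simp
    qed
    have [measurable]: "(\<lambda>(c, d). ennreal (1 / (gram_det (a, b, c, d))\<^sup>2)) \<in> borel_measurable (borel \<Otimes>\<^sub>M borel)"
      unfolding gram_det.simps by measurable
    have det: "?p * ?r - ?q * 0 = sqrt m" using B m by (simp add: real_sqrt_divide)
    have "(\<integral>\<^sup>+c. \<integral>\<^sup>+d. ennreal (1 / (gram_det (a, b, c, d))\<^sup>2) \<partial>lborel \<partial>lborel)
      = ennreal \<bar>?p * ?r - ?q * 0\<bar> * (\<integral>\<^sup>+u. \<integral>\<^sup>+v. ennreal (1 / (gram_det (a, b, ?p * u + ?q * v, 0 * u + ?r * v))\<^sup>2) \<partial>lborel \<partial>lborel)"
      using m by (intro nn_integral_linear_2d) (measurable, simp only: det, simp)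
    also have "\<dots> = ennreal (sqrt m) * (\<integral>\<^sup>+u. \<integral>\<^sup>+v. ennreal (1 / m\<^sup>2) * ennreal ((1 + u\<^sup>2 + v\<^sup>2) powr - 2) \<partial>lborel \<partial>lborel)"
    proof -
      have "1 / (m * (1 + u\<^sup>2 + v\<^sup>2))\<^sup>2 = 1 / m\<^sup>2 * (1 + u\<^sup>2 + v\<^sup>2) powr - 2" for u v :: real
      proof -
        have "0 < 1 + u\<^sup>2 + v\<^sup>2" by (simp add: add_pos_nonneg)
        then show ?thesis by (simp add: powr_minus power_mult_distrib divide_inverse)
      qed
      then show ?thesis using m unfolding gd det by (simp add: ennreal_mult'[symmetric])
    qed
    also have "\<dots> = ennreal (sqrt m) * (ennreal (1 / m\<^sup>2) * ennreal pi)"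
      using nn_integral_polar_powr[of 2] by (simp add: nn_integral_cmult)
    also have "\<dots> = ennreal pi * ennreal (m powr - (3 / 2))"
    proof -
      have "sqrt m * (1 / m\<^sup>2) = m powr - (3 / 2)"
        using m by (simp add: powr_half_sqrt[symmetric] powr_numeral[symmetric] powr_diff[symmetric] del: powr_numeral)
      from this[symmetric] show ?thesis using m by (simp only:) (simp add: ennreal_mult'[symmetric] mult_ac)
    qed
    finally show ?thesis by (simp add: m_def)
  qed
  have "(\<integral>\<^sup>+a. \<integral>\<^sup>+b. \<integral>\<^sup>+c. \<integral>\<^sup>+d. ennreal (1 / (gram_det (a, b, c, d))\<^sup>2) \<partial>lborel \<partial>lborel \<partial>lborel \<partial>lborel)
     = ennreal pi * (\<integral>\<^sup>+a. \<integral>\<^sup>+b. ennreal ((1 + a\<^sup>2 + b\<^sup>2) powr - (3 / 2)) \<partial>lborel \<partial>lborel)"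
    unfolding inner by (simp add: nn_integral_cmult)
  also have "\<dots> = ennreal (2 * pi\<^sup>2)"
    by (subst nn_integral_polar_powr) (simp_all add: ennreal_mult'[symmetric] power2_eq_square)
  finally show ?thesis .
qed

section \<open>Integration over the chart\<close>

lemma nn_integral_move_inside:
  fixes f :: "real \<Rightarrow> real \<Rightarrow> real \<Rightarrow> real \<Rightarrow> real \<Rightarrow> ennreal"
  assumes [measurable]: "(\<lambda>(x, a, b, c, d). f x a b c d) \<in> borel_measurable (borel \<Otimes>\<^sub>M borel \<Otimes>\<^sub>M borel \<Otimes>\<^sub>M borel \<Otimes>\<^sub>M borel)"
  shows "(\<integral>\<^sup>+x. \<integral>\<^sup>+a. \<integral>\<^sup>+b. \<integral>\<^sup>+c. \<integral>\<^sup>+d. f x a b c d \<partial>lborel \<partial>lborel \<partial>lborel \<partial>lborel \<partial>lborel)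
       = (\<integral>\<^sup>+a. \<integral>\<^sup>+b. \<integral>\<^sup>+c. \<integral>\<^sup>+d. \<integral>\<^sup>+x. f x a b c d \<partial>lborel \<partial>lborel \<partial>lborel \<partial>lborel \<partial>lborel)"
proof -
  define F where "F = (\<lambda>(x, a, b, c, d). f x a b c d)"
  have [measurable]: "F \<in> borel_measurable borel"
    using assms by (simp add: F_def borel_prod)
  have F: "f x a b c d = F (x, a, b, c, d)" for x a b c d by (simp add: F_def)
  have "(\<integral>\<^sup>+x. \<integral>\<^sup>+a. \<integral>\<^sup>+b. \<integral>\<^sup>+c. \<integral>\<^sup>+d. F (x, a, b, c, d) \<partial>lborel \<partial>lborel \<partial>lborel \<partial>lborel \<partial>lborel)
     = (\<integral>\<^sup>+a. \<integral>\<^sup>+x. \<integral>\<^sup>+b. \<integral>\<^sup>+c. \<integral>\<^sup>+d. F (x, a, b, c, d) \<partial>lborel \<partial>lborel \<partial>lborel \<partial>lborel \<partial>lborel)"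
    by (rule lborel_pair.Fubini') measurable
  also have "\<dots> = (\<integral>\<^sup>+a. \<integral>\<^sup>+b. \<integral>\<^sup>+x. \<integral>\<^sup>+c. \<integral>\<^sup>+d. F (x, a, b, c, d) \<partial>lborel \<partial>lborel \<partial>lborel \<partial>lborel \<partial>lborel)"
    by (rule nn_integral_cong, rule lborel_pair.Fubini') measurable
  also have "\<dots> = (\<integral>\<^sup>+a. \<integral>\<^sup>+b. \<integral>\<^sup>+c. \<integral>\<^sup>+x. \<integral>\<^sup>+d. F (x, a, b, c, d) \<partial>lborel \<partial>lborel \<partial>lborel \<partial>lborel \<partial>lborel)"
    by (rule nn_integral_cong, rule nn_integral_cong, rule lborel_pair.Fubini') measurable
  also have "\<dots> = (\<integral>\<^sup>+a. \<integral>\<^sup>+b. \<integral>\<^sup>+c. \<integral>\<^sup>+d. \<integral>\<^sup>+x. F (x, a, b, c, d) \<partial>lborel \<partial>lborel \<partial>lborel \<partial>lborel \<partial>lborel)"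
    by (rule nn_integral_cong, rule nn_integral_cong, rule nn_integral_cong, rule lborel_pair.Fubini') measurable
  finally show ?thesis by (simp only: F)
qed

text \<open>Density of matrices of corank two after the second and third matrix have been
  integrated out, at a pencil parameter where the first matrix carries the full weight.\<close>
definition sector_integrand :: "real set \<Rightarrow> real \<Rightarrow> block7 \<Rightarrow> ennreal" where
  "sector_integrand D l w = ennreal (indicator D (corner_det l w) * (gram_det (kernel_coef l w) * sqrt (gram_det (kernel_coef l w)))) * goe_density (corank2_block l w, w)"

lemma sector_integrand_measurable [measurable (raw)]:
  assumes [measurable]: "D \<in> sets borel" "f \<in> borel_measurable M" "g \<in> borel_measurable M"
  shows "(\<lambda>x. sector_integrand D (f x) (g x)) \<in> borel_measurable M"
  unfolding sector_integrand_def by measurable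

text \<open>The previous integrand in the coordinates \<open>E, Y\<close>, including the Jacobian
  \<open>(det E)\<^sup>2\<close> of \<open>B = Y E\<close>.\<close>
definition chart_integrand :: "real set \<Rightarrow> real \<Rightarrow> real \<Rightarrow> real \<Rightarrow> real \<Rightarrow> real \<Rightarrow> real \<Rightarrow> real \<Rightarrow> real \<Rightarrow> ennreal" where
  "chart_integrand D l e11 e12 e22 y11 y12 y21 y22 =
    (let \<delta> = e11 * e22 - e12\<^sup>2; g = gram_det (y11, y12, y21, y22);
       T = e11 * (1 + y11\<^sup>2 + y21\<^sup>2) + 2 * e12 * (y11 * y12 + y21 * y22) + e22 * (1 + y12\<^sup>2 + y22\<^sup>2)
     in ennreal (indicator D \<delta> * \<delta>\<^sup>2 * (g * sqrt g) * (exp (- (4 * l\<^sup>2 + 2 * l * T + (T\<^sup>2 - 2 * g * \<delta>)) / 2) / (4 * pi ^ 5))))"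

lemma chart_integrand_measurable [measurable (raw)]:
  assumes [measurable]: "D \<in> sets borel" "f1 \<in> borel_measurable M" "f2 \<in> borel_measurable M" "f3 \<in> borel_measurable M" "f4 \<in> borel_measurable M"
    "g1 \<in> borel_measurable M" "g2 \<in> borel_measurable M" "g3 \<in> borel_measurable M" "g4 \<in> borel_measurable M"
  shows "(\<lambda>x. chart_integrand D (f1 x) (f2 x) (f3 x) (f4 x) (g1 x) (g2 x) (g3 x) (g4 x)) \<in> borel_measurable M"
  unfolding chart_integrand_def Let_def by measurable

lemma sector_integrand_chart:
  assumes \<delta>: "e11 * e22 - e12\<^sup>2 \<noteq> 0"
  shows "ennreal ((e11 * e22 - e12\<^sup>2)\<^sup>2) * sector_integrand D l (y11 * e11 + y12 * e12, y11 * e12 + y12 * e22, y21 * e11 + y22 * e12, y21 * e12 + y22 * e22, l + e11, e12, l + e22)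
     = chart_integrand D l e11 e12 e22 y11 y12 y21 y22"
proof -
  have g: "gram_det (y11, y12, y21, y22) \<ge> 0" using gram_det_pos less_imp_le by blast
  show ?thesis
    unfolding sector_integrand_def chart_coords[OF \<delta>] goe_density_exp trace_square_chart chart_integrand_def Let_def
    using g by (simp only: ennreal_mult'[symmetric] zero_le_power2 mult_nonneg_nonneg indicator_pos_le real_sqrt_ge_zero) (simp only: mult_ac)
qed

text \<open>Each row of \<open>B = Y E\<close> is a linear image of the corresponding row of
  \<open>Y\<close>; each of the two contributes the Jacobian \<open>\<bar>det E\<bar>\<close>. For
  singular \<open>E\<close> both sides vanish because \<open>0 \<notin> D\<close>.\<close>
lemma sector_integrand_substitution:
  assumes D [measurable]: "D \<in> sets borel" "0 \<notin> D"
  shows "(\<integral>\<^sup>+b11. \<integral>\<^sup>+b12. \<integral>\<^sup>+b21. \<integral>\<^sup>+b22. sector_integrand D l (b11, b12, b21, b22, l + e11, e12, l + e22) \<partial>lborel \<partial>lborel \<partial>lborel \<partial>lborel)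
     = (\<integral>\<^sup>+y11. \<integral>\<^sup>+y12. \<integral>\<^sup>+y21. \<integral>\<^sup>+y22. chart_integrand D l e11 e12 e22 y11 y12 y21 y22 \<partial>lborel \<partial>lborel \<partial>lborel \<partial>lborel)"
proof (cases "e11 * e22 - e12\<^sup>2 = 0")
  case True
  have "sector_integrand D l (b11, b12, b21, b22, l + e11, e12, l + e22) = 0" for b11 b12 b21 b22
    using True D(2) by (simp add: sector_integrand_def corner_det_def)
  moreover have "chart_integrand D l e11 e12 e22 y11 y12 y21 y22 = 0" for y11 y12 y21 y22
    using True D(2) by (simp add: chart_integrand_def)
  ultimately show ?thesis by simp
next
  case False
  let ?d = "e11 * e22 - e12 * e12"
  have d: "?d \<noteq> 0" "?d = e11 * e22 - e12\<^sup>2" using False by (simp_all add: power2_eq_square)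
  let ?K = "\<lambda>b11 b12 b21 b22. sector_integrand D l (b11, b12, b21, b22, l + e11, e12, l + e22)"
  have "(\<integral>\<^sup>+b11. \<integral>\<^sup>+b12. \<integral>\<^sup>+b21. \<integral>\<^sup>+b22. ?K b11 b12 b21 b22 \<partial>lborel \<partial>lborel \<partial>lborel \<partial>lborel)
    = ennreal \<bar>?d\<bar> * (\<integral>\<^sup>+y11. \<integral>\<^sup>+y12. \<integral>\<^sup>+b21. \<integral>\<^sup>+b22. ?K (e11 * y11 + e12 * y12) (e12 * y11 + e22 * y12) b21 b22 \<partial>lborel \<partial>lborel \<partial>lborel \<partial>lborel)"
    by (rule nn_integral_linear_2d[OF _ d(1)]) measurable
  also have "\<dots> = ennreal \<bar>?d\<bar> * (\<integral>\<^sup>+y11. \<integral>\<^sup>+y12. ennreal \<bar>?d\<bar> * (\<integral>\<^sup>+y21. \<integral>\<^sup>+y22. ?K (e11 * y11 + e12 * y12) (e12 * y11 + e22 * y12) (e11 * y21 + e12 * y22) (e12 * y21 + e22 * y22) \<partial>lborel \<partial>lborel) \<partial>lborel \<partial>lborel)"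
    by (intro arg_cong2[where f="(*)"] refl nn_integral_cong nn_integral_linear_2d[OF _ d(1)]) measurable
  also have "\<dots> = (\<integral>\<^sup>+y11. \<integral>\<^sup>+y12. \<integral>\<^sup>+y21. \<integral>\<^sup>+y22. ennreal \<bar>?d\<bar> * (ennreal \<bar>?d\<bar> * ?K (e11 * y11 + e12 * y12) (e12 * y11 + e22 * y12) (e11 * y21 + e12 * y22) (e12 * y21 + e22 * y22)) \<partial>lborel \<partial>lborel \<partial>lborel \<partial>lborel)"
    by (simp add: nn_integral_cmult)
  also have "\<dots> = (\<integral>\<^sup>+y11. \<integral>\<^sup>+y12. \<integral>\<^sup>+y21. \<integral>\<^sup>+y22. chart_integrand D l e11 e12 e22 y11 y12 y21 y22 \<partial>lborel \<partial>lborel \<partial>lborel \<partial>lborel)"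
  proof (intro nn_integral_cong)
    fix y11 y12 y21 y22
    have "ennreal \<bar>?d\<bar> * (ennreal \<bar>?d\<bar> * k) = ennreal ((e11 * e22 - e12\<^sup>2)\<^sup>2) * k" for k
      by (simp add: mult.assoc[symmetric] ennreal_mult'[symmetric] d(2) power2_eq_square[of "_ - _"])
    show "ennreal \<bar>?d\<bar> * (ennreal \<bar>?d\<bar> * ?K (e11 * y11 + e12 * y12) (e12 * y11 + e22 * y12) (e11 * y21 + e12 * y22) (e12 * y21 + e22 * y22))
        = chart_integrand D l e11 e12 e22 y11 y12 y21 y22"
    proof -
      have 1: "e11 * y + e12 * z = y * e11 + z * e12" and 2: "e12 * y + e22 * z = y * e12 + z * e22" for y z
        by simp_all
      show ?thesis
        unfolding 1 2 using sector_integrand_chart[OF False, of D l y11 y12 y21 y22]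
          \<open>\<And>k. ennreal \<bar>?d\<bar> * (ennreal \<bar>?d\<bar> * k) = ennreal ((e11 * e22 - e12\<^sup>2)\<^sup>2) * k\<close> by (simp only:)
    qed
  qed
  finally show ?thesis .
qed

lemma nn_integral_translate:
  fixes f :: "real \<Rightarrow> ennreal"
  assumes [measurable]: "f \<in> borel_measurable borel"
  shows "(\<integral>\<^sup>+x. f x \<partial>lborel) = (\<integral>\<^sup>+x. f (l + x) \<partial>lborel)"
  using nn_integral_real_affine[of f 1 l] by simp

text \<open>The congruence of \<open>E\<close> with a Cholesky factor of \<open>I + Y\<^sup>T
  Y\<close> makes the exponent independent of \<open>Y\<close>. It preserves the sign of the
  determinant, so the sector \<open>D\<close> is unaffected, and the collected powers of the Gram
  determinant are \<open>3/2 - 3/2 - 2\<close>.\<close>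
lemma chart_integrand_integral:
  assumes D [measurable]: "D \<in> sets borel" and cone: "\<And>g x. g > 0 \<Longrightarrow> g * x \<in> D \<longleftrightarrow> x \<in> D"
  shows "(\<integral>\<^sup>+e22. \<integral>\<^sup>+e12. \<integral>\<^sup>+e11. chart_integrand D l e11 e12 e22 y11 y12 y21 y22 \<partial>lborel \<partial>lborel \<partial>lborel)
     = ennreal (1 / (4 * pi ^ 5)) * (ennreal (1 / (gram_det (y11, y12, y21, y22))\<^sup>2) *
      (\<integral>\<^sup>+c. \<integral>\<^sup>+b. \<integral>\<^sup>+a. ennreal (indicator D (a * c - b\<^sup>2) * (a * c - b\<^sup>2)\<^sup>2 *
        exp (- (4 * l\<^sup>2 + 2 * l * (a + c) + (a\<^sup>2 + 2 * b\<^sup>2 + c\<^sup>2)) / 2)) \<partial>lborel \<partial>lborel \<partial>lborel))"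
proof -
  define g where "g = gram_det (y11, y12, y21, y22)"
  have g: "g > 0" unfolding g_def by (rule gram_det_pos)
  define h11 h12 h22 where h: "h11 = 1 + y11\<^sup>2 + y21\<^sup>2" "h12 = y11 * y12 + y21 * y22" "h22 = 1 + y12\<^sup>2 + y22\<^sup>2"
  have h11: "h11 > 0" by (simp add: h add_pos_nonneg)
  have gh: "g = h11 * h22 - h12\<^sup>2" by (simp add: g_def h power2_eq_square algebra_simps)
  \<comment> \<open>\<open>(p, q; 0, r)\<close> is a Cholesky factor of \<open>I + Y\<^sup>T Y\<close>\<close>
  define p q r where pqr: "p = sqrt h11" "q = h12 / sqrt h11" "r = sqrt (g / h11)"
  have p: "p > 0" and r: "r > 0" using h11 g by (simp_all add: pqr)
  have p2: "p\<^sup>2 = h11" and pq: "p * q = h12" and q2: "q\<^sup>2 = h12\<^sup>2 / h11" and r2: "r\<^sup>2 = g / h11"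
    using h11 g by (simp_all add: pqr power_divide)
  have qr: "q\<^sup>2 + r\<^sup>2 = h22" using h11 by (simp add: q2 r2 gh field_simps)
  have pr2: "(p * r)\<^sup>2 = g" using h11 by (simp add: power_mult_distrib p2 r2)
  then have pr: "p * r = sqrt g" using p r by (simp add: real_sqrt_unique)
  have pr3: "(p * r) ^ 3 = g * sqrt g" using g by (simp add: pr power3_eq_cube)
  let ?G = "\<lambda>(a, b, c). ennreal (indicator D (a * c - b\<^sup>2) * (a * c - b\<^sup>2)\<^sup>2 *
        exp (- (4 * l\<^sup>2 + 2 * l * (a + c) + (a\<^sup>2 + 2 * b\<^sup>2 + c\<^sup>2)) / 2))"
  have G [measurable]: "?G \<in> borel_measurable borel"
    unfolding borel_prod[symmetric] by measurable
  have eq: "chart_integrand D l e11 e12 e22 y11 y12 y21 y22 = ennreal (1 / (4 * pi ^ 5)) * (ennreal (1 / g\<^sup>2) * (ennreal ((p * r) ^ 3) *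
      ?G (p\<^sup>2 * e11 + 2 * p * q * e12 + q\<^sup>2 * e22, r * (p * e12 + q * e22), r\<^sup>2 * e22)))" for e11 e12 e22
  proof -
    define a b c where abc: "a = p\<^sup>2 * e11 + 2 * p * q * e12 + q\<^sup>2 * e22" "b = r * (p * e12 + q * e22)" "c = r\<^sup>2 * e22"
    define \<delta> T where dT: "\<delta> = e11 * e22 - e12\<^sup>2" "T = e11 * h11 + 2 * e12 * h12 + e22 * h22"
    have "a * c - b\<^sup>2 = (p * r)\<^sup>2 * \<delta>"
      unfolding abc dT by (simp add: power2_eq_square algebra_simps)
    then have det: "a * c - b\<^sup>2 = g * \<delta>" by (simp only: pr2)
    have "a + c = p\<^sup>2 * e11 + 2 * (p * q) * e12 + (q\<^sup>2 + r\<^sup>2) * e22"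
      unfolding abc by (simp add: algebra_simps)
    then have tr: "a + c = T" by (simp only: p2 pq qr dT) (simp add: algebra_simps)
    have "a\<^sup>2 + 2 * b\<^sup>2 + c\<^sup>2 = (a + c)\<^sup>2 - 2 * (a * c - b\<^sup>2)" by (simp add: power2_eq_square algebra_simps)
    then have sq: "a\<^sup>2 + 2 * b\<^sup>2 + c\<^sup>2 = T\<^sup>2 - 2 * g * \<delta>" by (simp add: tr det)
    have ind: "indicator D (g * \<delta>) = (indicator D \<delta> :: real)" using cone[OF g] by (simp add: indicator_def)
    have "indicator D \<delta> * \<delta>\<^sup>2 * (g * sqrt g) * (E / (4 * pi ^ 5)) = 1 / (4 * pi ^ 5) * (1 / g\<^sup>2 * (g * sqrt g * (indicator D \<delta> * (g * \<delta>)\<^sup>2 * E)))" for E :: real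
      using g by (simp add: power_mult_distrib)
    note this [of "exp (- (4 * l\<^sup>2 + 2 * l * T + (T\<^sup>2 - 2 * g * \<delta>)) / 2)"]
    then have "chart_integrand D l e11 e12 e22 y11 y12 y21 y22 = ennreal (1 / (4 * pi ^ 5) * (1 / g\<^sup>2 * ((p * r) ^ 3 * (indicator D (a * c - b\<^sup>2) * (a * c - b\<^sup>2)\<^sup>2 *
        exp (- (4 * l\<^sup>2 + 2 * l * (a + c) + (a\<^sup>2 + 2 * b\<^sup>2 + c\<^sup>2)) / 2)))))"
      unfolding chart_integrand_def Let_def h[symmetric] g_def[symmetric] dT[symmetric] det tr sq ind pr3 by (rule arg_cong)
    also have "\<dots> = ennreal (1 / (4 * pi ^ 5)) * (ennreal (1 / g\<^sup>2) * (ennreal ((p * r) ^ 3) * ?G (a, b, c)))"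
      using p r by (simp only: prod.case ennreal_mult' zero_le_divide_1_iff zero_le_power2 zero_le_power mult_nonneg_nonneg less_imp_le pi_ge_zero zero_le_numeral)
    finally show ?thesis unfolding abc .
  qed
  have "(\<integral>\<^sup>+e22. \<integral>\<^sup>+e12. \<integral>\<^sup>+e11. chart_integrand D l e11 e12 e22 y11 y12 y21 y22 \<partial>lborel \<partial>lborel \<partial>lborel)
    = ennreal (1 / (4 * pi ^ 5)) * (ennreal (1 / g\<^sup>2) * (ennreal ((p * r) ^ 3) *
       (\<integral>\<^sup>+c. \<integral>\<^sup>+b. \<integral>\<^sup>+a. ?G (p\<^sup>2 * a + 2 * p * q * b + q\<^sup>2 * c, r * (p * b + q * c), r\<^sup>2 * c) \<partial>lborel \<partial>lborel \<partial>lborel)))"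
    unfolding eq by (simp add: nn_integral_cmult)
  also have "\<dots> = ennreal (1 / (4 * pi ^ 5)) * (ennreal (1 / g\<^sup>2) * (\<integral>\<^sup>+c. \<integral>\<^sup>+b. \<integral>\<^sup>+a. ?G (a, b, c) \<partial>lborel \<partial>lborel \<partial>lborel))"
    by (subst nn_integral_triangular[OF G p r, of q]) (rule refl)
  finally show ?thesis by (simp add: g_def)
qed

lemma cone_D: "D = - {0} \<or> D = {0<..} \<Longrightarrow> g > 0 \<Longrightarrow> g * x \<in> D \<longleftrightarrow> x \<in> (D :: real set)"
  by (auto simp: zero_less_mult_iff)

text \<open>The integral factors into the Grassmannian volume \<open>2 \<pi>\<^sup>2\<close>, the
  radial integral and the Gaussian normalisation \<open>1 / (4 \<pi>\<^sup>5)\<close>.\<close>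
lemma sector_integral:
  assumes D: "D = - {0} \<or> D = {0<..}"
  shows "(\<integral>\<^sup>+l. \<integral>\<^sup>+w. sector_integrand D l w \<partial>lborel \<partial>lborel) = ennreal (sector_constant D / pi)"
proof -
  have Db [measurable]: "D \<in> sets borel" and D0: "0 \<notin> D" using D by auto
  let ?core = "\<integral>\<^sup>+l. \<integral>\<^sup>+c. \<integral>\<^sup>+b. \<integral>\<^sup>+a. ennreal (indicator D (a * c - b\<^sup>2) * (a * c - b\<^sup>2)\<^sup>2 *
        exp (- (4 * l\<^sup>2 + 2 * l * (a + c) + (a\<^sup>2 + 2 * b\<^sup>2 + c\<^sup>2)) / 2)) \<partial>lborel \<partial>lborel \<partial>lborel \<partial>lborel"
  have "(\<integral>\<^sup>+l. \<integral>\<^sup>+w. sector_integrand D l w \<partial>lborel \<partial>lborel) = (\<integral>\<^sup>+l. \<integral>\<^sup>+c22. \<integral>\<^sup>+c12. \<integral>\<^sup>+c11. \<integral>\<^sup>+b11. \<integral>\<^sup>+b12. \<integral>\<^sup>+b21. \<integral>\<^sup>+b22. sector_integrand D l (b11, b12, b21, b22, c11, c12, c22)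
      \<partial>lborel \<partial>lborel \<partial>lborel \<partial>lborel \<partial>lborel \<partial>lborel \<partial>lborel \<partial>lborel)"
    by (intro nn_integral_cong nn_integral_block7) measurable
  also have "\<dots> = (\<integral>\<^sup>+l. \<integral>\<^sup>+e22. \<integral>\<^sup>+c12. \<integral>\<^sup>+c11. \<integral>\<^sup>+b11. \<integral>\<^sup>+b12. \<integral>\<^sup>+b21. \<integral>\<^sup>+b22. sector_integrand D l (b11, b12, b21, b22, c11, c12, l + e22)
      \<partial>lborel \<partial>lborel \<partial>lborel \<partial>lborel \<partial>lborel \<partial>lborel \<partial>lborel \<partial>lborel)"
    by (rule nn_integral_cong, rule nn_integral_translate) measurable
  also have "\<dots> = (\<integral>\<^sup>+l. \<integral>\<^sup>+e22. \<integral>\<^sup>+c12. \<integral>\<^sup>+e11. \<integral>\<^sup>+b11. \<integral>\<^sup>+b12. \<integral>\<^sup>+b21. \<integral>\<^sup>+b22. sector_integrand D l (b11, b12, b21, b22, l + e11, c12, l + e22)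
      \<partial>lborel \<partial>lborel \<partial>lborel \<partial>lborel \<partial>lborel \<partial>lborel \<partial>lborel \<partial>lborel)"
    by (rule nn_integral_cong, rule nn_integral_cong, rule nn_integral_cong, rule nn_integral_translate) measurable
  also have "\<dots> = (\<integral>\<^sup>+l. \<integral>\<^sup>+e22. \<integral>\<^sup>+e12. \<integral>\<^sup>+e11. \<integral>\<^sup>+y11. \<integral>\<^sup>+y12. \<integral>\<^sup>+y21. \<integral>\<^sup>+y22. chart_integrand D l e11 e12 e22 y11 y12 y21 y22
      \<partial>lborel \<partial>lborel \<partial>lborel \<partial>lborel \<partial>lborel \<partial>lborel \<partial>lborel \<partial>lborel)"
    by (simp only: sector_integrand_substitution[OF Db D0])
  also have "\<dots> = (\<integral>\<^sup>+l. \<integral>\<^sup>+e22. \<integral>\<^sup>+e12. \<integral>\<^sup>+y11. \<integral>\<^sup>+y12. \<integral>\<^sup>+y21. \<integral>\<^sup>+y22. \<integral>\<^sup>+e11. chart_integrand D l e11 e12 e22 y11 y12 y21 y22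
      \<partial>lborel \<partial>lborel \<partial>lborel \<partial>lborel \<partial>lborel \<partial>lborel \<partial>lborel \<partial>lborel)"
    by (rule nn_integral_cong, rule nn_integral_cong, rule nn_integral_cong, rule nn_integral_move_inside) measurable
  also have "\<dots> = (\<integral>\<^sup>+l. \<integral>\<^sup>+e22. \<integral>\<^sup>+y11. \<integral>\<^sup>+y12. \<integral>\<^sup>+y21. \<integral>\<^sup>+y22. \<integral>\<^sup>+e12. \<integral>\<^sup>+e11. chart_integrand D l e11 e12 e22 y11 y12 y21 y22
      \<partial>lborel \<partial>lborel \<partial>lborel \<partial>lborel \<partial>lborel \<partial>lborel \<partial>lborel \<partial>lborel)"
    by (rule nn_integral_cong, rule nn_integral_cong, rule nn_integral_move_inside) measurable
  also have "\<dots> = (\<integral>\<^sup>+l. \<integral>\<^sup>+y11. \<integral>\<^sup>+y12. \<integral>\<^sup>+y21. \<integral>\<^sup>+y22. \<integral>\<^sup>+e22. \<integral>\<^sup>+e12. \<integral>\<^sup>+e11. chart_integrand D l e11 e12 e22 y11 y12 y21 y22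
      \<partial>lborel \<partial>lborel \<partial>lborel \<partial>lborel \<partial>lborel \<partial>lborel \<partial>lborel \<partial>lborel)"
    by (rule nn_integral_cong, rule nn_integral_move_inside) measurable
  also have "\<dots> = (\<integral>\<^sup>+y11. \<integral>\<^sup>+y12. \<integral>\<^sup>+y21. \<integral>\<^sup>+y22. \<integral>\<^sup>+l. \<integral>\<^sup>+e22. \<integral>\<^sup>+e12. \<integral>\<^sup>+e11. chart_integrand D l e11 e12 e22 y11 y12 y21 y22
      \<partial>lborel \<partial>lborel \<partial>lborel \<partial>lborel \<partial>lborel \<partial>lborel \<partial>lborel \<partial>lborel)"
    by (rule nn_integral_move_inside) measurable
  also have "\<dots> = (\<integral>\<^sup>+y11. \<integral>\<^sup>+y12. \<integral>\<^sup>+y21. \<integral>\<^sup>+y22. ennreal (1 / (4 * pi ^ 5)) * (ennreal (1 / (gram_det (y11, y12, y21, y22))\<^sup>2) * ?core) \<partial>lborel \<partial>lborel \<partial>lborel \<partial>lborel)"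
  proof -
    have eq: "(\<integral>\<^sup>+e22. \<integral>\<^sup>+e12. \<integral>\<^sup>+e11. chart_integrand D l e11 e12 e22 y11 y12 y21 y22 \<partial>lborel \<partial>lborel \<partial>lborel)
     = ennreal (1 / (4 * pi ^ 5)) * (ennreal (1 / (gram_det (y11, y12, y21, y22))\<^sup>2) *
      (\<integral>\<^sup>+c. \<integral>\<^sup>+b. \<integral>\<^sup>+a. ennreal (indicator D (a * c - b\<^sup>2) * (a * c - b\<^sup>2)\<^sup>2 *
        exp (- (4 * l\<^sup>2 + 2 * l * (a + c) + (a\<^sup>2 + 2 * b\<^sup>2 + c\<^sup>2)) / 2)) \<partial>lborel \<partial>lborel \<partial>lborel))" for l y11 y12 y21 y22
      by (rule chart_integrand_integral[OF Db]) (rule cone_D[OF D])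
    show ?thesis
      unfolding eq by (intro nn_integral_cong, subst nn_integral_cmult, measurable, subst nn_integral_cmult, measurable)
  qed
  also have "\<dots> = ennreal (1 / (4 * pi ^ 5)) * ((\<integral>\<^sup>+y11. \<integral>\<^sup>+y12. \<integral>\<^sup>+y21. \<integral>\<^sup>+y22. ennreal (1 / (gram_det (y11, y12, y21, y22))\<^sup>2) \<partial>lborel \<partial>lborel \<partial>lborel \<partial>lborel) * ?core)"
    by (simp add: nn_integral_cmult nn_integral_multc)
  also have "\<dots> = ennreal (1 / (4 * pi ^ 5)) * (ennreal (2 * pi\<^sup>2) * ennreal (2 * pi\<^sup>2 * sector_constant D))"
    unfolding core_integral_value[OF D] grassmannian_integral ..
  also have "\<dots> = ennreal (sector_constant D / pi)"
  proof -
    have "1 / (4 * pi ^ 5) * (2 * pi\<^sup>2 * (2 * pi\<^sup>2 * sector_constant D)) = sector_constant D / pi"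
      by (simp add: numeral_eq_Suc)
    then show ?thesis by (simp only: ennreal_mult'[symmetric] zero_le_power2 mult_nonneg_nonneg zero_le_numeral zero_le_divide_1_iff zero_le_power pi_ge_zero)
  qed
  finally show ?thesis .
qed

section \<open>The full integral\<close>

text \<open>All three chart functions are homogeneous, because scaling a matrix scales its
  eigenvalues and keeps its eigenspaces.\<close>
lemma chart_scale:
  assumes \<rho>: "\<rho> > 0"
  shows "corner_det (\<rho> * l) (\<rho> *\<^sub>R w) = \<rho>\<^sup>2 * corner_det l w" "kernel_coef (\<rho> * l) (\<rho> *\<^sub>R w) = kernel_coef l w" "corank2_block (\<rho> * l) (\<rho> *\<^sub>R w) = \<rho> *\<^sub>R corank2_block l w"
proof -
  obtain b11 b12 b21 b22 c11 c12 c22 where w: "w = (b11, b12, b21, b22, c11, c12, c22)" by (cases w)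
  have d: "(\<rho> * c11 - \<rho> * l) * (\<rho> * c22 - \<rho> * l) - (\<rho> * c12)\<^sup>2 = \<rho>\<^sup>2 * ((c11 - l) * (c22 - l) - c12\<^sup>2)"
    by (simp add: power2_eq_square algebra_simps)
  have n: "(\<rho> * b) * (\<rho> * c - \<rho> * l) - (\<rho> * b') * (\<rho> * c') = \<rho>\<^sup>2 * (b * (c - l) - b' * c')" for b c b' c'
    by (simp add: power2_eq_square algebra_simps)
  show "corner_det (\<rho> * l) (\<rho> *\<^sub>R w) = \<rho>\<^sup>2 * corner_det l w" by (simp add: corner_det_def w d)
  show y: "kernel_coef (\<rho> * l) (\<rho> *\<^sub>R w) = kernel_coef l w"
    using \<rho> by (simp add: kernel_coef_def w d n)
  obtain y11 y12 y21 y22 where y': "kernel_coef l w = (y11, y12, y21, y22)" by (cases "kernel_coef l w")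
  show "corank2_block (\<rho> * l) (\<rho> *\<^sub>R w) = \<rho> *\<^sub>R corank2_block l w"
    unfolding corank2_block_def y y' by (simp add: w algebra_simps)
qed

text \<open>Scaling \<open>l\<close> and the seven coordinates of \<open>w\<close> together
  produces the eighth power of \<open>\<rho>\<close>; the other factors of the integrand are
  invariant.\<close>
lemma scaled_sector_integral:
  assumes D: "D = - {0} \<or> D = {0<..}" and \<rho>: "\<rho> > 0"
  shows "(\<integral>\<^sup>+l. \<integral>\<^sup>+w. ennreal (indicator D (corner_det l w) * (gram_det (kernel_coef l w) * sqrt (gram_det (kernel_coef l w)))) * goe_density ((1 / \<rho>) *\<^sub>R (corank2_block l w, w)) \<partial>lborel \<partial>lborel)
     = ennreal (\<rho> ^ 8 * (sector_constant D / pi))" (is "(\<integral>\<^sup>+l. \<integral>\<^sup>+w. ?f l w \<partial>lborel \<partial>lborel) = _")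
proof -
  have [measurable]: "D \<in> sets borel" using D by auto
  have pt: "?f (0 + \<rho> * l) (0 + \<rho> *\<^sub>R w) = sector_integrand D l w" for l w
  proof -
    have "indicator D (\<rho>\<^sup>2 * corner_det l w) = (indicator D (corner_det l w) :: real)"
      using cone_D[OF D, of "\<rho>\<^sup>2" "corner_det l w"] \<rho> by (simp add: indicator_def)
    moreover have "(1 / \<rho>) *\<^sub>R (\<rho> *\<^sub>R corank2_block l w, \<rho> *\<^sub>R w) = (corank2_block l w, w)" using \<rho> by simp
    ultimately show ?thesis by (simp only: add_0_left chart_scale[OF \<rho>] sector_integrand_def)
  qed
  have "(\<integral>\<^sup>+l. \<integral>\<^sup>+w. ?f l w \<partial>lborel \<partial>lborel) = ennreal \<bar>\<rho>\<bar> * (\<integral>\<^sup>+l. \<integral>\<^sup>+w. ?f (0 + \<rho> * l) w \<partial>lborel \<partial>lborel)"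
    using \<rho> by (intro nn_integral_real_affine) auto
  also have "\<dots> = ennreal \<bar>\<rho>\<bar> * (\<integral>\<^sup>+l. ennreal (\<bar>\<rho>\<bar> ^ DIM(block7)) * (\<integral>\<^sup>+w. ?f (0 + \<rho> * l) (0 + \<rho> *\<^sub>R w) \<partial>lborel) \<partial>lborel)"
    using \<rho> by (intro arg_cong2[where f="(*)"] refl nn_integral_cong nn_integral_lborel_affine) auto
  also have "\<dots> = ennreal \<bar>\<rho>\<bar> * (ennreal (\<bar>\<rho>\<bar> ^ DIM(block7)) * (\<integral>\<^sup>+l. \<integral>\<^sup>+w. sector_integrand D l w \<partial>lborel \<partial>lborel))"
    unfolding pt by (subst nn_integral_cmult) simp_all
  also have "\<dots> = ennreal \<rho> * (ennreal (\<rho> ^ 7) * ennreal (sector_constant D / pi))"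
  proof -
    have "DIM(block7) = 7" by simp
    then show ?thesis using \<rho> by (simp only: sector_integral[OF D] abs_of_pos)
  qed
  also have "\<dots> = ennreal (\<rho> * (\<rho> ^ 7 * (sector_constant D / pi)))"
    using \<rho> by (simp only: ennreal_mult'[symmetric] less_imp_le zero_le_power)
  also have "\<rho> * (\<rho> ^ 7 * (sector_constant D / pi)) = \<rho> ^ 8 * (sector_constant D / pi)"
    by (simp add: numeral_eq_Suc)
  finally show ?thesis .
qed

text \<open>For pencil parameters \<open>(s, t)\<close> the inner integral is
  \<open>\<rho>\<^bsup>- 11\<^esup> \<rho>\<^sup>8 = (1 + s\<^sup>2 + t\<^sup>2)\<^bsup>-
  3/2\<^esup>\<close> times a constant. This is the density of the uniform measure on the
  projective plane in the affine chart, as rotation invariance of the pencil demands, and its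
  total mass is \<open>2 \<pi>\<close>.\<close>
lemma total_integral:
  assumes D: "D = - {0} \<or> D = {0<..}"
  shows "(\<integral>\<^sup>+s. \<integral>\<^sup>+t. \<integral>\<^sup>+l. \<integral>\<^sup>+w. indicator D (corner_det l w) *
      (\<integral>\<^sup>+v'. goe_density v' * (\<integral>\<^sup>+v. goe_density v * (goe_density ((corank2_block l w, w) - t *\<^sub>R v' - s *\<^sub>R v) *
         ennreal \<bar>det3 (gram (kernel_coef l w)) (compress (kernel_coef l w) v) (compress (kernel_coef l w) v')\<bar>) \<partial>lborel) \<partial>lborel) \<partial>lborel \<partial>lborel \<partial>lborel \<partial>lborel)
    = ennreal (2 * sector_constant D)"
proof -
  have Db [measurable]: "D \<in> sets borel" and D0: "0 \<notin> D" using D by auto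
  let ?f = "\<lambda>\<rho> l w. ennreal (indicator D (corner_det l w) * (gram_det (kernel_coef l w) * sqrt (gram_det (kernel_coef l w)))) * goe_density ((1 / \<rho>) *\<^sub>R (corank2_block l w, w))"
  have k0: "sector_constant D \<ge> 0"
  proof -
    have "2 / sqrt 3 \<le> 3" by (simp add: divide_le_eq) (rule order_trans[of _ "3 * 1"], simp_all)
    then show ?thesis by (simp add: sector_constant_def)
  qed
  have inner: "(\<integral>\<^sup>+l. \<integral>\<^sup>+w. indicator D (corner_det l w) *
      (\<integral>\<^sup>+v'. goe_density v' * (\<integral>\<^sup>+v. goe_density v * (goe_density ((corank2_block l w, w) - t *\<^sub>R v' - s *\<^sub>R v) *
         ennreal \<bar>det3 (gram (kernel_coef l w)) (compress (kernel_coef l w) v) (compress (kernel_coef l w) v')\<bar>) \<partial>lborel) \<partial>lborel) \<partial>lborel \<partial>lborel)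
     = ennreal ((1 + s\<^sup>2 + t\<^sup>2) powr - (3 / 2)) * ennreal (sector_constant D / pi)" for s t
  proof -
    define \<rho> where "\<rho> = sqrt (1 + s\<^sup>2 + t\<^sup>2)"
    have R: "1 + s\<^sup>2 + t\<^sup>2 > 0" by (simp add: add_pos_nonneg)
    then have \<rho>: "\<rho> > 0" by (simp add: \<rho>_def)
    have "indicator D (corner_det l w) *
      (\<integral>\<^sup>+v'. goe_density v' * (\<integral>\<^sup>+v. goe_density v * (goe_density ((corank2_block l w, w) - t *\<^sub>R v' - s *\<^sub>R v) *
         ennreal \<bar>det3 (gram (kernel_coef l w)) (compress (kernel_coef l w) v) (compress (kernel_coef l w) v')\<bar>) \<partial>lborel) \<partial>lborel)
      = ennreal (1 / \<rho> ^ 11) * ?f \<rho> l w" for l w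
    proof (cases "corner_det l w \<in> D")
      case True
      then have "corner_det l w \<noteq> 0" using D0 by auto
      from gauss_double_shift[OF compress_chart[OF this], of t s] True show ?thesis
        by (simp add: \<rho>_def mult_ac)
    qed simp
    then have "(\<integral>\<^sup>+l. \<integral>\<^sup>+w. indicator D (corner_det l w) *
      (\<integral>\<^sup>+v'. goe_density v' * (\<integral>\<^sup>+v. goe_density v * (goe_density ((corank2_block l w, w) - t *\<^sub>R v' - s *\<^sub>R v) *
         ennreal \<bar>det3 (gram (kernel_coef l w)) (compress (kernel_coef l w) v) (compress (kernel_coef l w) v')\<bar>) \<partial>lborel) \<partial>lborel) \<partial>lborel \<partial>lborel)
      = (\<integral>\<^sup>+l. \<integral>\<^sup>+w. ennreal (1 / \<rho> ^ 11) * ?f \<rho> l w \<partial>lborel \<partial>lborel)"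
      by (simp only:)
    also have "\<dots> = ennreal (1 / \<rho> ^ 11) * (\<integral>\<^sup>+l. \<integral>\<^sup>+w. ?f \<rho> l w \<partial>lborel \<partial>lborel)"
      by (subst nn_integral_cmult, measurable, subst nn_integral_cmult, measurable)
    also have "\<dots> = ennreal (1 / \<rho> ^ 11 * \<rho> ^ 8) * ennreal (sector_constant D / pi)"
      unfolding scaled_sector_integral[OF D \<rho>] using \<rho> k0 by (simp add: ennreal_mult'[symmetric] ennreal_mult[symmetric])
    also have "1 / \<rho> ^ 11 * \<rho> ^ 8 = (1 + s\<^sup>2 + t\<^sup>2) powr - (3 / 2)"
    proof -
      have "1 / \<rho> ^ 11 * \<rho> ^ 8 = 1 / \<rho> ^ 3" using \<rho> by (simp add: numeral_eq_Suc)
      also have "\<rho> ^ 3 = \<rho> powr 3" using \<rho> by (simp add: powr_numeral)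
      also have "\<dots> = (1 + s\<^sup>2 + t\<^sup>2) powr (3 / 2)" using R by (simp add: \<rho>_def powr_half_sqrt[symmetric] powr_powr)
      finally show ?thesis by (simp only: powr_minus_divide)
    qed
    finally show ?thesis .
  qed
  have "(\<integral>\<^sup>+s. \<integral>\<^sup>+t. ennreal ((1 + s\<^sup>2 + t\<^sup>2) powr - (3 / 2)) * ennreal (sector_constant D / pi) \<partial>lborel \<partial>lborel)
     = (\<integral>\<^sup>+s. \<integral>\<^sup>+t. ennreal ((1 + s\<^sup>2 + t\<^sup>2) powr - (3 / 2)) \<partial>lborel \<partial>lborel) * ennreal (sector_constant D / pi)"
    by (subst nn_integral_multc[symmetric], measurable, rule nn_integral_cong, subst nn_integral_multc[symmetric], measurable)
  also have "\<dots> = ennreal (2 * sector_constant D)"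
    using k0 by (subst nn_integral_polar_powr) (simp_all add: ennreal_mult[symmetric])
  finally show ?thesis unfolding inner .
qed

section \<open>Area formula with multiplicities\<close>

text \<open>The change of variables theorem for absolutely integrable functions, freed of its
  finiteness condition: the two sides are infinite simultaneously.\<close>
lemma differentiable_inj_image_emeasure:
  fixes f :: "real ^ 'n::{finite,wellorder} \<Rightarrow> real ^ 'n::{finite,wellorder}"
  assumes T: "T \<in> sets lebesgue"
    and der: "\<And>x. x \<in> T \<Longrightarrow> (f has_derivative (\<lambda>h. J x *v h)) (at x within T)"
    and inj: "inj_on f T"
    and J: "(\<lambda>x. indicator T x * \<bar>det (J x)\<bar>) \<in> borel_measurable lebesgue"
  shows "f ` T \<in> sets lebesgue"
    and "emeasure lebesgue (f ` T) = (\<integral>\<^sup>+x. ennreal (indicator T x * \<bar>det (J x)\<bar>) \<partial>lebesgue)"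
proof -
  show sets: "f ` T \<in> sets lebesgue"
  proof (rule differentiable_image_in_sets_lebesgue[OF T])
    show "f differentiable_on T"
      using der by (auto simp: differentiable_on_def differentiable_def)
  qed simp
  note key = has_measure_differentiable_image[OF T der inj]
  have integral: "((\<lambda>x. \<bar>det (matrix (\<lambda>h. J x *v h))\<bar>) has_integral m) T
      \<longleftrightarrow> (\<integral>\<^sup>+x. ennreal (indicator T x * \<bar>det (J x)\<bar>) \<partial>lebesgue) = ennreal m" if "0 \<le> m" for m
  proof -
    have "((\<lambda>x. \<bar>det (matrix (\<lambda>h. J x *v h))\<bar>) has_integral m) T
      \<longleftrightarrow> ((\<lambda>x. indicator T x * \<bar>det (J x)\<bar>) has_integral m) UNIV"
    proof -
      have "(\<lambda>x. if x \<in> T then \<bar>det (J x)\<bar> else 0) = (\<lambda>x. indicator T x * \<bar>det (J x)\<bar>)"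
        by (auto simp: fun_eq_iff)
      then show ?thesis using has_integral_restrict_UNIV[of T "\<lambda>x. \<bar>det (J x)\<bar>" m] by simp
    qed
    also have "\<dots> \<longleftrightarrow> (\<integral>\<^sup>+x. ennreal (indicator T x * \<bar>det (J x)\<bar>) \<partial>lebesgue) = ennreal m"
      using that J by (subst has_integral_iff_nn_integral_lebesgue) auto
    finally show ?thesis .
  qed
  show "emeasure lebesgue (f ` T) = (\<integral>\<^sup>+x. ennreal (indicator T x * \<bar>det (J x)\<bar>) \<partial>lebesgue)"
  proof (cases "emeasure lebesgue (f ` T) = \<infinity>")
    case False
    then have fm: "f ` T \<in> lmeasurable" using sets by (auto simp: fmeasurable_def top.not_eq_extremum)
    then have "((\<lambda>x. \<bar>det (matrix (\<lambda>h. J x *v h))\<bar>) has_integral measure lebesgue (f ` T)) T"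
      using key by blast
    then show ?thesis
      using fm integral[of "measure lebesgue (f ` T)"] by (simp add: emeasure_eq_measure2 fmeasurableD2)
  next
    case True
    show ?thesis
    proof (cases "(\<integral>\<^sup>+x. ennreal (indicator T x * \<bar>det (J x)\<bar>) \<partial>lebesgue)")
      case (real m)
      then have "f ` T \<in> lmeasurable" using key[of m] integral[of m] by auto
      then show ?thesis using True by (auto simp: fmeasurable_def)
    qed (use True in simp)
  qed
qed

text \<open>Both sides are integrals of \<open>g\<close> against measures on the target that agree
  on every Borel set by the previous lemma.\<close>
lemma change_of_variables_inj:
  fixes f :: "real ^ 'n::{finite,wellorder} \<Rightarrow> real ^ 'n::{finite,wellorder}"
  assumes P: "P \<in> sets borel"
    and der: "\<And>x. x \<in> P \<Longrightarrow> (f has_derivative (\<lambda>h. J x *v h)) (at x)"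
    and contJ: "continuous_on P J"
    and inj: "inj_on f P"
    and g [measurable]: "g \<in> borel_measurable borel"
  shows "f ` P \<in> sets lebesgue"
    and "(\<integral>\<^sup>+y. g y * indicator (f ` P) y \<partial>lebesgue) = (\<integral>\<^sup>+x\<in>P. ennreal \<bar>det (J x)\<bar> * g (f x) \<partial>lborel)"
proof -
  note [measurable] = P
  have "continuous_on P f"
    using der by (meson has_derivative_at_withinI has_derivative_continuous_on)
  then have f': "(\<lambda>x. if x \<in> P then f x else 0) \<in> borel_measurable borel" (is "?f \<in> _")
    using P by (intro borel_measurable_continuous_on_if) auto
  note [measurable] = f'
  have "continuous_on P (\<lambda>x. \<bar>det (J x)\<bar>)"
    unfolding det_def using contJ by (intro continuous_intros)
  then have d': "(\<lambda>x. indicator P x * \<bar>det (J x)\<bar>) \<in> borel_measurable borel" (is "?d \<in> _")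
    using borel_measurable_continuous_on_indicator[OF P, of "\<lambda>x. \<bar>det (J x)\<bar>"] by simp
  note [measurable] = d'
  have img: "f ` T \<in> sets lebesgue \<and> emeasure lebesgue (f ` T) = (\<integral>\<^sup>+x. ennreal (indicator T x * ?d x) \<partial>lebesgue)"
    if [measurable]: "T \<in> sets borel" and sub: "T \<subseteq> P" for T
  proof -
    have eq: "(\<lambda>x. indicator T x * \<bar>det (J x)\<bar>) = (\<lambda>x. indicator T x * ?d x)"
      using sub by (auto simp: fun_eq_iff split: split_indicator)
    have m: "(\<lambda>x. indicator T x * \<bar>det (J x)\<bar>) \<in> borel_measurable lebesgue"
      unfolding eq by (rule measurable_completion) measurable
    have T: "T \<in> sets lebesgue" using that by simp
    have derT: "(f has_derivative (\<lambda>h. J x *v h)) (at x within T)" if "x \<in> T" for x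
      using der sub that by (blast intro: has_derivative_at_withinI)
    have "indicator T x * \<bar>det (J x)\<bar> = indicator T x * ?d x" for x
      using fun_cong[OF eq] .
    moreover have "f ` T \<in> sets lebesgue"
      "emeasure lebesgue (f ` T) = (\<integral>\<^sup>+x. ennreal (indicator T x * \<bar>det (J x)\<bar>) \<partial>lebesgue)"
      by (rule differentiable_inj_image_emeasure[OF T derT inj_on_subset[OF inj sub] m], assumption)+
    ultimately show ?thesis by (simp only:)
  qed
  then show fP: "f ` P \<in> sets lebesgue" using P by blast
  let ?mu = "distr (density lebesgue (indicator (f ` P))) borel (\<lambda>x. x)"
  let ?nu = "distr (density lborel (\<lambda>x. ennreal (?d x))) borel ?f"
  have "?mu = ?nu"
  proof (rule measure_eqI)
    fix A assume "A \<in> sets ?mu"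
    then have A [measurable]: "A \<in> sets borel" by simp
    have id: "(\<lambda>x. x) \<in> density lebesgue (indicator (f ` P)) \<rightarrow>\<^sub>M borel"
      by (simp add: measurable_completion)
    have Al: "A \<in> sets lebesgue" by simp
    let ?T = "?f -` A \<inter> P"
    have T: "?T \<in> sets borel" "?T \<subseteq> P"
      using measurable_sets[OF f' A] P by auto
    have "emeasure ?mu A = emeasure (density lebesgue (indicator (f ` P))) A"
      using emeasure_distr[OF id A] by simp
    also have "\<dots> = (\<integral>\<^sup>+y. indicator (f ` P) y * indicator A y \<partial>lebesgue)"
      using fP Al by (intro emeasure_density) auto
    also have "\<dots> = emeasure lebesgue (f ` P \<inter> A)"
      by (simp only: indicator_inter_arith[symmetric] nn_integral_indicator[OF sets.Int[OF fP Al]])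
    also have "f ` P \<inter> A = f ` ?T" by auto
    also have "emeasure lebesgue \<dots> = (\<integral>\<^sup>+x. ennreal (indicator ?T x * ?d x) \<partial>lborel)"
      using img[OF T] by (simp add: nn_integral_completion)
    also have "\<dots> = (\<integral>\<^sup>+x. ennreal (?d x) * indicator (?f -` A) x \<partial>lborel)"
      by (intro nn_integral_cong) (auto simp: indicator_def)
    also have "\<dots> = emeasure (density lborel (\<lambda>x. ennreal (?d x))) (?f -` A)"
      using measurable_sets[OF f' A] by (subst emeasure_density) auto
    also have "\<dots> = emeasure ?nu A"
      by (subst emeasure_distr) auto
    finally show "emeasure ?mu A = emeasure ?nu A" .
  qed simp
  then have "(\<integral>\<^sup>+y. g y \<partial>?mu) = (\<integral>\<^sup>+y. g y \<partial>?nu)" by simp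
  moreover have "(\<integral>\<^sup>+y. g y \<partial>?mu) = (\<integral>\<^sup>+y. g y * indicator (f ` P) y \<partial>lebesgue)"
  proof -
    have "(\<lambda>x. x) \<in> density lebesgue (indicator (f ` P)) \<rightarrow>\<^sub>M borel"
      by (simp add: measurable_completion)
    then have "(\<integral>\<^sup>+y. g y \<partial>?mu) = (\<integral>\<^sup>+y. g y \<partial>density lebesgue (indicator (f ` P)))"
      by (rule nn_integral_distr) simp
    also have "\<dots> = (\<integral>\<^sup>+y. indicator (f ` P) y * g y \<partial>lebesgue)"
      using fP by (intro nn_integral_density) (auto intro!: measurable_completion)
    finally show ?thesis by (simp only: mult.commute)
  qed
  moreover have "(\<integral>\<^sup>+y. g y \<partial>?nu) = (\<integral>\<^sup>+x\<in>P. ennreal \<bar>det (J x)\<bar> * g (f x) \<partial>lborel)"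
    by (subst nn_integral_distr, simp, simp, subst nn_integral_density)
      (auto intro!: nn_integral_cong split: split_indicator)
  ultimately show "(\<integral>\<^sup>+y. g y * indicator (f ` P) y \<partial>lebesgue) = (\<integral>\<^sup>+x\<in>P. ennreal \<bar>det (J x)\<bar> * g (f x) \<partial>lborel)"
    by simp
qed

text \<open>The inverse function theorem gives injectivity near every point, and Lindeloef's
  theorem reduces the cover to countably many balls.\<close>
lemma locally_injective_countable_cover:
  fixes f :: "real ^ 'n::{finite,wellorder} \<Rightarrow> real ^ 'n::{finite,wellorder}"
  assumes U: "open U"
    and der: "\<And>x. x \<in> U \<Longrightarrow> (f has_derivative (\<lambda>h. J x *v h)) (at x)"
    and contJ: "continuous_on U J"
    and det: "\<And>x. x \<in> U \<Longrightarrow> det (J x) \<noteq> 0"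
  shows "\<exists>B :: nat \<Rightarrow> (real ^ 'n::{finite,wellorder}) set. (\<forall>n. open (B n) \<and> inj_on f (B n)) \<and> (\<Union>n. B n) = U"
proof -
  let ?F = "{B. open B \<and> B \<subseteq> U \<and> inj_on f B}"
  have "\<exists>B. x \<in> B \<and> B \<in> ?F" if x: "x \<in> U" for x
  proof -
    obtain K where K: "K ** J x = mat 1"
      using det[OF x] by (metis invertible_det_nz invertible_left_inverse)
    have ons: "\<exists>d>0. \<forall>z. dist x z < d \<longrightarrow> onorm (\<lambda>v. J z *v v - J x *v v) < e" if e: "e > 0" for e
    proof -
      define c where "c = real CARD('n) * real CARD('n)"
      have c: "c > 0" by (simp add: c_def)
      have "isCont J x" using contJ U x by (simp add: continuous_on_eq_continuous_at)
      then obtain d where d: "d > 0" "\<And>z. dist z x < d \<Longrightarrow> dist (J z) (J x) < e / (2 * c)"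
        using continuous_at_eps_delta[THEN iffD1, rule_format, of x J "e / (2 * c)"] e c by auto
      have "onorm (\<lambda>v. J z *v v - J x *v v) < e" if z: "dist x z < d" for z
      proof -
        have "\<bar>(J z - J x) $ i $ j\<bar> \<le> e / (2 * c)" for i j
        proof -
          have "\<bar>(J z - J x) $ i $ j\<bar> \<le> norm ((J z - J x) $ i)" by (rule component_le_norm_cart)
          also have "\<dots> \<le> norm (J z - J x)" by (rule Finite_Cartesian_Product.norm_nth_le)
          also have "\<dots> \<le> e / (2 * c)" using d(2)[of z] z by (simp add: dist_norm norm_minus_commute)
          finally show ?thesis .
        qed
        then have "onorm ((*v) (J z - J x)) \<le> c * (e / (2 * c))"
          unfolding c_def by (rule onorm_le_matrix_component)
        also have "\<dots> < e" using c e by simp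
        finally have "onorm ((*v) (J z - J x)) < e" .
        moreover have "(*v) (J z - J x) = (\<lambda>v. J z *v v - J x *v v)"
          by (simp add: fun_eq_iff matrix_vector_mult_diff_rdistrib)
        ultimately show ?thesis by simp
      qed
      then show ?thesis using d(1) by blast
    qed
    have inv: "(*v) K \<circ> (\<lambda>h. J x *v h) = id"
      using K by (auto simp: fun_eq_iff matrix_vector_mul_assoc)
    obtain r where "r > 0" "ball x r \<subseteq> U" "inj_on f (ball x r)"
      using has_derivative_locally_injective[of x U "(*v) K" "\<lambda>x h. J x *v h" f, OF x U _ inv der ons]
      by blast
    then show ?thesis by (intro exI[of _ "ball x r"]) auto
  qed
  then have UF: "\<Union>?F = U" by blast
  obtain F' where F': "F' \<subseteq> ?F" "countable F'" "\<Union>F' = \<Union>?F"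
    using Lindelof[of ?F] by blast
  have ne: "insert {} F' \<noteq> {}" and cnt: "countable (insert {} F')" using F' by auto
  have mem: "from_nat_into (insert {} F') n \<in> ?F" for n
    using from_nat_into[OF ne, of n] F'(1) by auto
  have un: "(\<Union>n. from_nat_into (insert {} F') n) = U"
    using range_from_nat_into[OF ne cnt] F'(3) UF by simp
  show ?thesis
    by (rule exI[of _ "from_nat_into (insert {} F')"]) (use mem un in auto)
qed

text \<open>The regular points split into countably many disjoint pieces on which \<open>f\<close>
  is injective, and the number of preimages is the sum of the indicators of the images. Critical
  points contribute nothing on the right because the Jacobian vanishes there, and nothing on the
  left by Sard's theorem.\<close>
lemma area_formula:
  fixes f :: "real ^ 'n::{finite,wellorder} \<Rightarrow> real ^ 'n::{finite,wellorder}"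
  assumes U: "open U"
    and der: "\<And>x. x \<in> U \<Longrightarrow> (f has_derivative (\<lambda>h. J x *v h)) (at x)"
    and contJ: "continuous_on U J"
    and S [measurable]: "S \<in> sets borel" and SU: "S \<subseteq> U"
    and g [measurable]: "g \<in> borel_measurable borel"
  shows "(\<integral>\<^sup>+y. g y * emeasure (count_space UNIV) {x \<in> S. f x = y} \<partial>lborel)
       = (\<integral>\<^sup>+x\<in>S. ennreal \<bar>det (J x)\<bar> * g (f x) \<partial>lborel)"
proof -
  have contdet: "continuous_on U (\<lambda>x. det (J x))"
    unfolding det_def using contJ by (intro continuous_intros)
  let ?R = "{x \<in> U. det (J x) \<noteq> 0}"
  have openR: "open ?R"
  proof -
    have "?R = (\<lambda>x. det (J x)) -` (- {0}) \<inter> U" by auto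
    then show ?thesis using contdet U by (simp add: continuous_on_open_vimage open_Compl)
  qed
  have contR: "continuous_on ?R J" using contJ by (rule continuous_on_subset) auto
  have derR: "(f has_derivative (\<lambda>h. J x *v h)) (at x)" if "x \<in> ?R" for x
    using der that by blast
  have detR: "det (J x) \<noteq> 0" if "x \<in> ?R" for x using that by simp
  have "\<exists>B :: nat \<Rightarrow> (real ^ 'n::{finite,wellorder}) set. (\<forall>n. open (B n) \<and> inj_on f (B n)) \<and> (\<Union>n. B n) = ?R"
    by (rule locally_injective_countable_cover[OF openR derR contR detR])
  then obtain B :: "nat \<Rightarrow> (real ^ 'n::{finite,wellorder}) set"
    where "(\<forall>n. open (B n) \<and> inj_on f (B n)) \<and> (\<Union>n. B n) = ?R" ..
  then have B: "\<And>n. open (B n)" "\<And>n. inj_on f (B n)" "(\<Union>n. B n) = ?R"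
    by simp_all
  \<comment> \<open>disjoint pieces on which \<open>f\<close> is injective\<close>
  define P where "P n = disjointed B n \<inter> S" for n
  have PB: "P n \<subseteq> B n" for n using disjointed_subset[of B n] by (auto simp: P_def)
  have PU: "P n \<subseteq> U" for n using PB B(3) by blast
  have P [measurable]: "P n \<in> sets borel" for n
    unfolding P_def using B(1) by (intro sets.Int S sets.range_disjointed_sets[THEN subsetD, OF _ rangeI]) auto
  have UnP: "(\<Union>n. P n) = S \<inter> ?R"
    unfolding P_def using B(3) UN_disjointed_eq[of B] by auto
  have disj: "disjoint_family P"
    using disjoint_family_disjointed[of B] by (auto simp: P_def disjoint_family_on_def)
  have injP: "inj_on f (P n)" for n using B(2) PB by (meson inj_on_subset)
  have cov: "f ` P n \<in> sets lebesgue"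
    "(\<integral>\<^sup>+y. g y * indicator (f ` P n) y \<partial>lebesgue) = (\<integral>\<^sup>+x\<in>P n. ennreal \<bar>det (J x)\<bar> * g (f x) \<partial>lborel)" for n
    using change_of_variables_inj[of "P n" f J g] P der PU injP contJ g continuous_on_subset by blast+
  let ?C = "{x \<in> U. det (J x) = 0}"
  have negl: "negligible (f ` ?C)"
  proof (rule baby_Sard)
    show "(f has_derivative (\<lambda>h. J x *v h)) (at x within ?C)" if "x \<in> ?C" for x
      using der that by (auto intro: has_derivative_at_withinI)
    show "rank (matrix (\<lambda>h. J x *v h)) < CARD('n)" if "x \<in> ?C" for x
      using that by (simp add: det_eq_0_rank[symmetric])
  qed simp
  have count: "emeasure (count_space UNIV) {x \<in> S. f x = y} = (\<Sum>n. indicator (f ` P n) y)" if "y \<notin> f ` ?C" for y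
  proof -
    have "{x \<in> S. f x = y} = (\<Union>n. {x \<in> P n. f x = y})"
    proof -
      have "{x \<in> S. f x = y} = {x \<in> \<Union>n. P n. f x = y}"
        unfolding UnP using that SU by auto
      then show ?thesis by auto
    qed
    then have split: "emeasure (count_space UNIV) {x \<in> S. f x = y} = (\<Sum>n. emeasure (count_space UNIV) {x \<in> P n. f x = y})"
      using disj by (subst suminf_emeasure) (auto simp: disjoint_family_on_def)
    have piece: "emeasure (count_space UNIV) {x \<in> P n. f x = y} = indicator (f ` P n) y" for n
    proof (cases "y \<in> f ` P n")
      case True
      then obtain x where "x \<in> P n" "y = f x" by blast
      then have "{x \<in> P n. f x = y} = {x}" using injP[of n] by (auto dest: inj_onD)
      then show ?thesis using True by simp
    next
      case False
      then have empty: "{x \<in> P n. f x = y} = {}" by auto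
      show ?thesis unfolding empty using False by simp
    qed
    show ?thesis unfolding split by (simp only: piece)
  qed
  have "(\<integral>\<^sup>+y. g y * emeasure (count_space UNIV) {x \<in> S. f x = y} \<partial>lborel)
     = (\<integral>\<^sup>+y. g y * emeasure (count_space UNIV) {x \<in> S. f x = y} \<partial>lebesgue)"
    by (simp add: nn_integral_completion)
  also have "\<dots> = (\<integral>\<^sup>+y. (\<Sum>n. g y * indicator (f ` P n) y) \<partial>lebesgue)"
  proof (rule nn_integral_cong_AE)
    have "AE y in lebesgue. y \<notin> f ` ?C"
      using negl by (intro AE_not_in) (simp add: negligible_iff_null_sets)
    then show "AE y in lebesgue. g y * emeasure (count_space UNIV) {x \<in> S. f x = y} = (\<Sum>n. g y * indicator (f ` P n) y)"
      by eventually_elim (simp add: count ennreal_suminf_cmult)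
  qed
  also have "\<dots> = (\<Sum>n. \<integral>\<^sup>+y. g y * indicator (f ` P n) y \<partial>lebesgue)"
    using cov(1) by (intro nn_integral_suminf borel_measurable_times_ennreal borel_measurable_indicator measurable_completion) auto
  also have "\<dots> = (\<Sum>n. \<integral>\<^sup>+x\<in>P n. ennreal \<bar>det (J x)\<bar> * g (f x) \<partial>lborel)"
    by (simp only: cov(2))
  also have "\<dots> = (\<Sum>n. \<integral>\<^sup>+x. ennreal (indicator S x * \<bar>det (J x)\<bar>) * g (if x \<in> S then f x else 0) * indicator (P n) x \<partial>lborel)"
    by (intro suminf_cong nn_integral_cong) (auto simp: P_def indicator_def)
  also have "\<dots> = (\<integral>\<^sup>+x. (\<Sum>n. ennreal (indicator S x * \<bar>det (J x)\<bar>) * g (if x \<in> S then f x else 0) * indicator (P n) x) \<partial>lborel)"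
  proof (rule nn_integral_suminf[symmetric])
    have "(f has_derivative (\<lambda>h. J x *v h)) (at x within S)" if "x \<in> S" for x
      using der[of x] SU that by (auto intro: has_derivative_at_withinI)
    then have "continuous_on S f" by (rule has_derivative_continuous_on)
    then have [measurable]: "(\<lambda>x. if x \<in> S then f x else 0) \<in> borel_measurable borel"
      using S by (intro borel_measurable_continuous_on_if) auto
    have "continuous_on S (\<lambda>x. \<bar>det (J x)\<bar>)"
      using contdet SU by (intro continuous_intros) (rule continuous_on_subset)
    then have [measurable]: "(\<lambda>x. indicator S x * \<bar>det (J x)\<bar>) \<in> borel_measurable borel"
      using borel_measurable_continuous_on_indicator[OF S, of "\<lambda>x. \<bar>det (J x)\<bar>"] by simp
    show "(\<lambda>x. ennreal (indicator S x * \<bar>det (J x)\<bar>) * g (if x \<in> S then f x else 0) * indicator (P n) x) \<in> borel_measurable lborel" for n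
      by measurable
  qed
  also have "\<dots> = (\<integral>\<^sup>+x\<in>S. ennreal \<bar>det (J x)\<bar> * g (f x) \<partial>lborel)"
  proof (rule nn_integral_cong)
    fix x
    have "(\<Sum>n. indicator (P n) x) = (indicator (S \<inter> ?R) x :: ennreal)"
      unfolding UnP[symmetric] by (rule suminf_indicator[OF disj])
    then show "(\<Sum>n. ennreal (indicator S x * \<bar>det (J x)\<bar>) * g (if x \<in> S then f x else 0) * indicator (P n) x)
        = ennreal \<bar>det (J x)\<bar> * g (f x) * indicator S x"
      using SU by (subst ennreal_suminf_cmult) (auto simp: indicator_def)
  qed
  finally show ?thesis .
qed

section \<open>Derivative of the corank-two chart\<close>

lemma nn_integral_vec3:
  fixes f :: "real ^ 3 \<Rightarrow> ennreal"
  assumes [measurable]: "f \<in> borel_measurable borel"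
  shows "(\<integral>\<^sup>+x. f x \<partial>lborel) = (\<integral>\<^sup>+p. f (vector [fst p, fst (snd p), snd (snd p)]) \<partial>(lborel :: (real \<times> real \<times> real) measure))"
proof -
  let ?v = "\<lambda>p :: real \<times> real \<times> real. vector [fst p, fst (snd p), snd (snd p)] :: real ^ 3"
  have "continuous_on UNIV ?v"
  proof (subst continuous_on_componentwise, intro ballI)
    fix i :: "real ^ 3" assume "i \<in> Basis"
    then obtain k where "i = axis k 1" by (auto simp: Basis_vec_def)
    then show "continuous_on UNIV (\<lambda>p. ?v p \<bullet> i)"
      using exhaust_3[of k] by (elim disjE) (simp_all add: inner_axis, (intro continuous_intros)+)
  qed
  then have v [measurable]: "?v \<in> borel_measurable borel" by (rule borel_measurable_continuous_onI)
  have "(lborel :: (real ^ 3) measure) = distr lborel borel ?v"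
  proof (rule lborel_eqI)
    fix l u :: "real ^ 3" assume le: "\<And>b. b \<in> Basis \<Longrightarrow> l \<bullet> b \<le> u \<bullet> b"
    have le': "l $ i \<le> u $ i" for i using le[of "axis i 1"] by (simp add: inner_axis)
    let ?l = "(l $ 1, l $ 2, l $ 3)" and ?u = "(u $ 1, u $ 2, u $ 3)"
    have "?v -` box l u = box ?l ?u"
      by (auto simp: box_def Basis_vec_def inner_axis Basis_prod_def forall_3)
    then have "emeasure (distr lborel borel ?v) (box l u) = emeasure lborel (box ?l ?u)"
      by (subst emeasure_distr) auto
    also have "\<dots> = ennreal (\<Prod>b\<in>Basis. (?u - ?l) \<bullet> b)"
      using le' by (intro emeasure_lborel_box) (auto simp: Basis_prod_def)
    also have "(\<Prod>b\<in>Basis. (?u - ?l) \<bullet> b) = (u $ 1 - l $ 1) * ((u $ 2 - l $ 2) * (u $ 3 - l $ 3))"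
      unfolding Basis_prod_def by (subst prod.union_disjoint; auto simp: prod.reindex inj_on_def prod.union_disjoint image_Un)
    also have "\<dots> = (\<Prod>b\<in>Basis. (u - l) \<bullet> b)"
    proof -
      have B: "Basis = {axis 1 1, axis 2 1, axis 3 1 :: real ^ 3}" by (auto simp: Basis_vec_def UNIV_3)
      show ?thesis unfolding B by (simp add: axis_eq_axis inner_axis)
    qed
    finally show "emeasure (distr lborel borel ?v) (box l u) = ennreal (\<Prod>b\<in>Basis. (u - l) \<bullet> b)" .
  qed simp
  then have "(\<integral>\<^sup>+x. f x \<partial>lborel) = (\<integral>\<^sup>+x. f x \<partial>distr lborel borel ?v)" by simp
  also have "\<dots> = (\<integral>\<^sup>+p. f (?v p) \<partial>lborel)" by (rule nn_integral_distr) auto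
  finally show ?thesis .
qed

text \<open>A product with two vanishing factors vanishes to second order; this disposes of the
  quadratic remainder in the expansion below.\<close>
lemma has_derivative_vanishing_product:
  fixes u u' k :: "'a::real_normed_vector \<Rightarrow> real"
  assumes "u differentiable (at x)" "u' differentiable (at x)" "k differentiable (at x)" "u x = 0" "u' x = 0"
  shows "((\<lambda>x. u x * u' x * k x) has_derivative (\<lambda>_. 0)) (at x)"
proof -
  obtain du du' dk where "(u has_derivative du) (at x)" "(u' has_derivative du') (at x)" "(k has_derivative dk) (at x)"
    using assms by (auto simp: differentiable_def)
  then show ?thesis
    by (auto intro!: derivative_eq_intros simp: assms(4,5))
qed

text \<open>Schur complements are critical values: as a function of \<open>Y\<close>, the
  expression \<open>l G - compress Y (0, w)\<close> differs from the corank-two block by a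
  quadratic form in the residual \<open>B - Y (C - l)\<close>, which vanishes to second order at
  the true \<open>Y\<close>.\<close>
lemma corank2_block_expansion:
  fixes l b11 b12 b21 b22 c11 c12 c22 y11 y12 y21 y22 :: real
  assumes d: "(c11 - l) * (c22 - l) - c12\<^sup>2 \<noteq> 0"
  defines "\<delta> \<equiv> (c11 - l) * (c22 - l) - c12\<^sup>2"
  defines "u1 \<equiv> b11 - y11 * (c11 - l) - y12 * c12" and "u2 \<equiv> b12 - y11 * c12 - y12 * (c22 - l)"
  defines "u3 \<equiv> b21 - y21 * (c11 - l) - y22 * c12" and "u4 \<equiv> b22 - y21 * c12 - y22 * (c22 - l)"
  shows "corank2_block l (b11, b12, b21, b22, c11, c12, c22) =
    l *\<^sub>R gram (y11, y12, y21, y22) - compress (y11, y12, y21, y22) ((0, 0, 0), (b11, b12, b21, b22, c11, c12, c22))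
    + (u1 * u1 * ((c22 - l) / \<delta>) + u1 * u2 * (- 2 * c12 / \<delta>) + u2 * u2 * ((c11 - l) / \<delta>),
       u1 * u3 * ((c22 - l) / \<delta>) + u1 * u4 * (- c12 / \<delta>) + u2 * u3 * (- c12 / \<delta>) + u2 * u4 * ((c11 - l) / \<delta>),
       u3 * u3 * ((c22 - l) / \<delta>) + u3 * u4 * (- 2 * c12 / \<delta>) + u4 * u4 * ((c11 - l) / \<delta>))"
proof -
  define e11 e22 where e: "e11 = c11 - l" "e22 = c22 - l"
  have c: "c11 = l + e11" "c22 = l + e22" by (simp_all add: e)
  have \<delta>: "\<delta> \<noteq> 0" "\<delta> = e11 * e22 - c12\<^sup>2" using d by (simp_all add: \<delta>_def e)
  have cancel: "X = Y" if "\<delta> * X = \<delta> * Y" for X Y using that \<delta>(1) by simp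
  have div: "\<delta> * (X / \<delta>) = X" "\<delta> * (X * (Y / \<delta>)) = X * Y" for X Y using \<delta>(1) by simp_all
  show ?thesis
    unfolding corank2_block_def kernel_coef_def u1_def u2_def u3_def u4_def c
    apply (simp add: \<delta>_def[symmetric, unfolded c, simplified])
    apply (intro conjI; rule cancel; simp add: distrib_left right_diff_distrib div mult.assoc \<delta>(2) power2_eq_square; simp add: \<delta>(1) field_simps; simp add: \<delta>(2) power2_eq_square algebra_simps)
    done
qed

definition vec3 :: "real \<times> real \<times> real \<Rightarrow> real ^ 3" where
  "vec3 p = vector [fst p, fst (snd p), snd (snd p)]"

lemma vec3_nth: "vec3 p $ 1 = fst p" "vec3 p $ 2 = fst (snd p)" "vec3 p $ 3 = snd (snd p)"
  by (simp_all add: vec3_def)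

lemma vec3_linear: "vec3 (p + q) = vec3 p + vec3 q" "vec3 (p - q) = vec3 p - vec3 q" "vec3 (c *\<^sub>R p) = c *\<^sub>R vec3 p"
  by (simp_all add: vec_eq_iff forall_3 vec3_nth)

lemma bounded_linear_vec3: "bounded_linear vec3"
  unfolding linear_conv_bounded_linear[symmetric] by (rule linearI) (simp_all add: vec3_linear)

lemma differentiable_nth: "(\<lambda>x :: real ^ 'n. x $ i) differentiable (at x)"
  by (rule bounded_linear_imp_differentiable) (rule bounded_linear_vec_nth)

lemma continuous_compress [continuous_intros]:
  assumes "continuous_on S f" shows "continuous_on S (\<lambda>x. compress (f x) v)"
proof -
  obtain a11 a12 a22 b11 b12 b21 b22 c11 c12 c22 where v: "v = ((a11, a12, a22), (b11, b12, b21, b22, c11, c12, c22))"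
    by (cases v rule: trace_square.cases)
  have "compress y v =
    (a11 - 2 * (fst y * b11 + fst (snd y) * b12) + ((fst y)\<^sup>2 * c11 + 2 * fst y * fst (snd y) * c12 + (fst (snd y))\<^sup>2 * c22),
     a12 - (fst (snd (snd y)) * b11 + snd (snd (snd y)) * b12) - (fst y * b21 + fst (snd y) * b22) + (fst y * fst (snd (snd y)) * c11 + (fst y * snd (snd (snd y)) + fst (snd y) * fst (snd (snd y))) * c12 + fst (snd y) * snd (snd (snd y)) * c22),
     a22 - 2 * (fst (snd (snd y)) * b21 + snd (snd (snd y)) * b22) + ((fst (snd (snd y)))\<^sup>2 * c11 + 2 * fst (snd (snd y)) * snd (snd (snd y)) * c12 + (snd (snd (snd y)))\<^sup>2 * c22))" for y
    by (cases y) (simp add: v)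
  then show ?thesis using assms by (simp only:) (intro continuous_intros)
qed

lemma continuous_gram [continuous_intros]:
  assumes "continuous_on S f" shows "continuous_on S (\<lambda>x. gram (f x))"
proof -
  have "gram y = (1 + (fst y)\<^sup>2 + (fst (snd y))\<^sup>2, fst y * fst (snd (snd y)) + fst (snd y) * snd (snd (snd y)), 1 + (fst (snd (snd y)))\<^sup>2 + (snd (snd (snd y)))\<^sup>2)" for y
    by (cases y) simp
  then show ?thesis using assms by (simp only:) (intro continuous_intros)
qed

lemma det3_alt: "det3 m x z = fst m * (fst (snd x) * snd (snd z) - snd (snd x) * fst (snd z))
     - fst (snd m) * (fst x * snd (snd z) - snd (snd x) * fst z) + snd (snd m) * (fst x * fst (snd z) - fst (snd x) * fst z)"
  by (cases m; cases x; cases z) simp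

lemma compress_split: "compress y (A, w) = A + compress y (0, w)"
proof -
  have "compress y (A, 0) = A" by (cases y; cases A) (simp add: zero_prod_def)
  then show ?thesis using compress_add[of y "(A, 0)" "(0, w)"] by simp
qed

text \<open>By the expansion above, the dependence of \<open>Y\<close> on the parameters may be
  ignored when differentiating. What remains is affine in the parameters: the derivative in
  \<open>l\<close> is the Gram matrix and those in \<open>s\<close> and \<open>t\<close> are the
  compressions of the corresponding matrices.\<close>
lemma chart_has_derivative:
  fixes w1 w2 w3 :: block7 and A2 A3 :: "real \<times> real \<times> real"
  defines "w \<equiv> \<lambda>x :: real ^ 3. w1 + (x $ 1) *\<^sub>R w2 + (x $ 2) *\<^sub>R w3"
  defines "f \<equiv> \<lambda>x :: real ^ 3. vec3 (corank2_block (x $ 3) (w x) - (x $ 1) *\<^sub>R A2 - (x $ 2) *\<^sub>R A3)"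
  defines "y \<equiv> \<lambda>x :: real ^ 3. kernel_coef (x $ 3) (w x)"
  assumes x: "corner_det (x $ 3) (w x) \<noteq> 0" and U: "open {x. corner_det (x $ 3) (w x) \<noteq> 0}"
  shows "(f has_derivative (\<lambda>h. (h $ 3) *\<^sub>R vec3 (gram (y x)) - (h $ 1) *\<^sub>R vec3 (compress (y x) (A2, w2)) - (h $ 2) *\<^sub>R vec3 (compress (y x) (A3, w3)))) (at x)"
proof -
  obtain p1 p2 p3 p4 p5 p6 p7 where w1: "w1 = (p1, p2, p3, p4, p5, p6, p7)" by (cases w1)
  obtain q1 q2 q3 q4 q5 q6 q7 where w2: "w2 = (q1, q2, q3, q4, q5, q6, q7)" by (cases w2)
  obtain r1 r2 r3 r4 r5 r6 r7 where w3: "w3 = (r1, r2, r3, r4, r5, r6, r7)" by (cases w3)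
  obtain e11 e12 e22 y11 y12 y21 y22 where d: "e11 * e22 - e12\<^sup>2 \<noteq> 0"
    and wx: "w x = (y11 * e11 + y12 * e12, y11 * e12 + y12 * e22, y21 * e11 + y22 * e12, y21 * e12 + y22 * e22, x $ 3 + e11, e12, x $ 3 + e22)"
    using chart_coords_surj[OF x] .
  have yx: "y x = (y11, y12, y21, y22)" unfolding y_def wx by (rule chart_coords[OF d])
  let ?lin = "\<lambda>p q r x :: real ^ 3. p + x $ 1 * q + x $ 2 * r :: real"
  have wz: "w z = (?lin p1 q1 r1 z, ?lin p2 q2 r2 z, ?lin p3 q3 r3 z, ?lin p4 q4 r4 z, ?lin p5 q5 r5 z, ?lin p6 q6 r6 z, ?lin p7 q7 r7 z)" for z
    by (simp add: w_def w1 w2 w3)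
  define b11 b12 b21 b22 c11 c12 c22 where b: "b11 = ?lin p1 q1 r1" "b12 = ?lin p2 q2 r2" "b21 = ?lin p3 q3 r3" "b22 = ?lin p4 q4 r4"
    "c11 = ?lin p5 q5 r5" "c12 = ?lin p6 q6 r6" "c22 = ?lin p7 q7 r7"
  have wz': "w z = (b11 z, b12 z, b21 z, b22 z, c11 z, c12 z, c22 z)" for z unfolding wz b ..
  have db: "b11 differentiable (at x)" "b12 differentiable (at x)" "b21 differentiable (at x)" "b22 differentiable (at x)"
    "c11 differentiable (at x)" "c12 differentiable (at x)" "c22 differentiable (at x)"
    unfolding b by (intro differentiable_add differentiable_mult differentiable_const differentiable_nth)+
  define \<delta> where "\<delta> z = (c11 z - z $ 3) * (c22 z - z $ 3) - c12 z * c12 z" for z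
  have cd: "corner_det (z $ 3) (w z) = \<delta> z" for z unfolding wz' corner_det_def \<delta>_def by (simp add: power2_eq_square)
  have \<delta>x: "\<delta> x \<noteq> 0" using x unfolding cd .
  have d\<delta>: "\<delta> differentiable (at x)"
    unfolding \<delta>_def by (intro differentiable_diff differentiable_mult db differentiable_nth)
  define u1 u2 u3 u4 where u: "u1 = (\<lambda>z. b11 z - y11 * (c11 z - z $ 3) - y12 * c12 z)" "u2 = (\<lambda>z. b12 z - y11 * c12 z - y12 * (c22 z - z $ 3))"
    "u3 = (\<lambda>z. b21 z - y21 * (c11 z - z $ 3) - y22 * c12 z)" "u4 = (\<lambda>z. b22 z - y21 * c12 z - y22 * (c22 z - z $ 3))"
  have du: "u1 differentiable (at x)" "u2 differentiable (at x)" "u3 differentiable (at x)" "u4 differentiable (at x)"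
    unfolding u by (intro differentiable_diff differentiable_mult differentiable_const db differentiable_nth)+
  have vals: "b11 x = y11 * e11 + y12 * e12" "b12 x = y11 * e12 + y12 * e22" "b21 x = y21 * e11 + y22 * e12" "b22 x = y21 * e12 + y22 * e22"
    "c11 x = x $ 3 + e11" "c12 x = e12" "c22 x = x $ 3 + e22"
    using wx unfolding wz' by simp_all
  have u0: "u1 x = 0" "u2 x = 0" "u3 x = 0" "u4 x = 0"
    unfolding u vals by simp_all
  have dk: "(\<lambda>z. (c22 z - z $ 3) / \<delta> z) differentiable (at x)" "(\<lambda>z. (c11 z - z $ 3) / \<delta> z) differentiable (at x)"
    "(\<lambda>z. - 2 * c12 z / \<delta> z) differentiable (at x)" "(\<lambda>z. - c12 z / \<delta> z) differentiable (at x)"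
    by (intro differentiable_divide differentiable_diff differentiable_mult differentiable_minus differentiable_const db d\<delta> differentiable_nth \<delta>x)+
  define R where "R z = (u1 z * u1 z * ((c22 z - z $ 3) / \<delta> z) + u1 z * u2 z * (- 2 * c12 z / \<delta> z) + u2 z * u2 z * ((c11 z - z $ 3) / \<delta> z),
       u1 z * u3 z * ((c22 z - z $ 3) / \<delta> z) + u1 z * u4 z * (- c12 z / \<delta> z) + u2 z * u3 z * (- c12 z / \<delta> z) + u2 z * u4 z * ((c11 z - z $ 3) / \<delta> z),
       u3 z * u3 z * ((c22 z - z $ 3) / \<delta> z) + u3 z * u4 z * (- 2 * c12 z / \<delta> z) + u4 z * u4 z * ((c11 z - z $ 3) / \<delta> z))" for z
  have dR: "(R has_derivative (\<lambda>_. (0 + 0 + 0, 0 + 0 + 0 + 0, 0 + 0 + 0))) (at x)"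
    unfolding R_def by (intro has_derivative_Pair has_derivative_add has_derivative_vanishing_product du dk u0)
  let ?g = "\<lambda>z. (z $ 3) *\<^sub>R vec3 (gram (y x)) - vec3 (compress (y x) (0, w1)) - (z $ 1) *\<^sub>R vec3 (compress (y x) (A2, w2))
      - (z $ 2) *\<^sub>R vec3 (compress (y x) (A3, w3)) + vec3 (R z)"
  \<comment> \<open>with \<open>Y\<close> frozen at its value at \<open>x\<close>, the function \<open>f\<close> is affine up to the remainder \<open>R\<close>\<close>
  have fg: "f z = ?g z" if "\<delta> z \<noteq> 0" for z
  proof -
    have d': "(c11 z - z $ 3) * (c22 z - z $ 3) - (c12 z)\<^sup>2 \<noteq> 0" using that by (simp add: \<delta>_def power2_eq_square)
    have "corank2_block (z $ 3) (w z) = (z $ 3) *\<^sub>R gram (y x) - compress (y x) (0, w z) + R z"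
      unfolding yx wz' corank2_block_expansion[OF d', of _ _ _ _ y11 y12 y21 y22] R_def u \<delta>_def power2_eq_square zero_prod_def ..
    moreover have "compress (y x) (0, w z) = compress (y x) (0, w1) + (z $ 1) *\<^sub>R compress (y x) (0, w2) + (z $ 2) *\<^sub>R compress (y x) (0, w3)"
    proof -
      have "((0, w z) :: sym4) = (0, w1) + (z $ 1) *\<^sub>R (0, w2) + (z $ 2) *\<^sub>R (0, w3)" by (simp add: w_def)
      then show ?thesis by (simp only: compress_add compress_scaleR)
    qed
    ultimately have "corank2_block (z $ 3) (w z) - (z $ 1) *\<^sub>R A2 - (z $ 2) *\<^sub>R A3 = (z $ 3) *\<^sub>R gram (y x) - compress (y x) (0, w1)
       - (z $ 1) *\<^sub>R compress (y x) (A2, w2) - (z $ 2) *\<^sub>R compress (y x) (A3, w3) + R z"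
      by (simp add: compress_split[of _ A2] compress_split[of _ A3] algebra_simps)
    then show ?thesis unfolding f_def by (simp only: vec3_linear)
  qed
  have nth: "((\<lambda>z. z $ i) has_derivative (\<lambda>h. h $ i)) (at x)" for i :: 3
    by (rule bounded_linear_imp_has_derivative) (rule bounded_linear_vec_nth)
  have "(?g has_derivative (\<lambda>h. (h $ 3) *\<^sub>R vec3 (gram (y x)) - 0 - (h $ 1) *\<^sub>R vec3 (compress (y x) (A2, w2)) - (h $ 2) *\<^sub>R vec3 (compress (y x) (A3, w3))
      + vec3 (0 + 0 + 0, 0 + 0 + 0 + 0, 0 + 0 + 0))) (at x)"
    by (intro has_derivative_add has_derivative_diff has_derivative_const has_derivative_scaleR_left nth
        bounded_linear.has_derivative[OF bounded_linear_vec3] dR)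
  moreover have "vec3 (0 + 0 + 0, 0 + 0 + 0 + 0, 0 + 0 + 0) = 0" by (simp add: vec_eq_iff forall_3 vec3_nth)
  ultimately have "(?g has_derivative (\<lambda>h. (h $ 3) *\<^sub>R vec3 (gram (y x)) - (h $ 1) *\<^sub>R vec3 (compress (y x) (A2, w2)) - (h $ 2) *\<^sub>R vec3 (compress (y x) (A3, w3)))) (at x)"
    by simp
  then show ?thesis
    by (rule has_derivative_transform_within_open[OF _ U]) (use x fg cd in auto)
qed

section \<open>The adjugate of a symmetric matrix\<close>

lemma det_4:
  "det (A :: real ^ 4 ^ 4) =
     A$1$1 * (A$2$2 * (A$3$3 * A$4$4 - A$3$4 * A$4$3) - A$2$3 * (A$3$2 * A$4$4 - A$3$4 * A$4$2) + A$2$4 * (A$3$2 * A$4$3 - A$3$3 * A$4$2))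
   - A$1$2 * (A$2$1 * (A$3$3 * A$4$4 - A$3$4 * A$4$3) - A$2$3 * (A$3$1 * A$4$4 - A$3$4 * A$4$1) + A$2$4 * (A$3$1 * A$4$3 - A$3$3 * A$4$1))
   + A$1$3 * (A$2$1 * (A$3$2 * A$4$4 - A$3$4 * A$4$2) - A$2$2 * (A$3$1 * A$4$4 - A$3$4 * A$4$1) + A$2$4 * (A$3$1 * A$4$2 - A$3$2 * A$4$1))
   - A$1$4 * (A$2$1 * (A$3$2 * A$4$3 - A$3$3 * A$4$2) - A$2$2 * (A$3$1 * A$4$3 - A$3$3 * A$4$1) + A$2$3 * (A$3$1 * A$4$2 - A$3$2 * A$4$1))"
proof -
  have f1234: "finite {2 :: 4, 3, 4}" "1 \<notin> {2 :: 4, 3, 4}" by auto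
  have f234: "finite {3 :: 4, 4}" "2 \<notin> {3 :: 4, 4}" by auto
  have f34: "finite {4 :: 4}" "3 \<notin> {4 :: 4}" by auto
  show ?thesis
    unfolding det_def UNIV_4
    unfolding sum_over_permutations_insert[OF f1234]
    unfolding sum_over_permutations_insert[OF f234]
    unfolding sum_over_permutations_insert[OF f34]
    unfolding permutes_sing
    by (simp add: sign_swap_id permutation_swap_id permutation_compose sign_compose sign_id swap_id_eq) (simp add: algebra_simps)
qed

text \<open>The adjugate matrix. It vanishes precisely when the corank is at least two.\<close>
fun adj :: "sym4 \<Rightarrow> sym4" where
  "adj ((a, b, e), (c, d, f, g, h, i, j)) =
    ((e * (h * j - i * i) - f * (f * j - g * i) + g * (f * i - g * h),
      - (b * (h * j - i * i) - f * (c * j - d * i) + g * (c * i - d * h)),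
      a * (h * j - i * i) - c * (c * j - d * i) + d * (c * i - d * h)),
     (b * (f * j - g * i) - e * (c * j - d * i) + g * (c * g - d * f),
      - (b * (f * i - g * h) - e * (c * i - d * h) + f * (c * g - d * f)),
      - (a * (f * j - g * i) - b * (c * j - d * i) + d * (c * g - d * f)),
      a * (f * i - g * h) - b * (c * i - d * h) + c * (c * g - d * f),
      a * (e * j - g * g) - b * (b * j - d * g) + d * (b * g - d * e),
      - (a * (e * i - f * g) - b * (b * i - f * d) + c * (b * g - e * d)),
      a * (e * h - f * f) - b * (b * h - c * f) + c * (b * f - c * e)))"

fun sdet :: "sym4 \<Rightarrow> real" where
  "sdet ((a, b, e), (c, d, f, g, h, i, j)) =
     a * (e * (h * j - i * i) - f * (f * j - g * i) + g * (f * i - g * h))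
   - b * (b * (h * j - i * i) - f * (c * j - d * i) + g * (c * i - d * h))
   + c * (b * (f * j - g * i) - e * (c * j - d * i) + g * (c * g - d * f))
   - d * (b * (f * i - g * h) - e * (c * i - d * h) + f * (c * g - d * f))"

text \<open>The identity matrix.\<close>
definition sym_id :: sym4 where "sym_id = ((1, 0, 1), (0, 0, 0, 0, 1, 0, 1))"

definition entries :: "real ^ 4 ^ 4 \<Rightarrow> sym4" where
  "entries A = ((A $ 0 $ 0, A $ 0 $ 1, A $ 1 $ 1), (A $ 0 $ 2, A $ 0 $ 3, A $ 1 $ 2, A $ 1 $ 3, A $ 2 $ 2, A $ 2 $ 3, A $ 3 $ 3))"

lemma four_eq_zero: "(4 :: 4) = 0" by simp

lemma det_sym:
  assumes "transpose A = A"
  shows "det (A :: real ^ 4 ^ 4) = sdet (entries A)"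
proof -
  have s: "A $ i $ j = A $ j $ i" for i j
    using arg_cong[OF assms, of "\<lambda>B. B $ j $ i"] by (simp add: transpose_def)
  show ?thesis
    unfolding det_4 entries_def four_eq_zero
    by (simp add: s[of 1 0] s[of 2 0] s[of 3 0] s[of 2 1] s[of 3 1] s[of 3 2] algebra_simps)
qed

lemma adj_sdet: "trace_form (adj v) v = 4 * sdet v"
  by (cases v rule: adj.cases) (simp add: algebra_simps)

text \<open>The adjugate of a singular matrix has rank at most one, so its \<open>2 \<times>
  2\<close> minors vanish; being symmetric, it is then a multiple of \<open>v v\<^sup>T\<close>
  and its trace vanishes only if it does. Hence a point of a determinantal hypersurface whose
  pencil contains the identity is singular only if the corank is at least two.\<close>
lemma adj_trace_zero:
  assumes det: "sdet v = 0" and tr: "trace_form (adj v) sym_id = 0"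
  shows "adj v = 0"
proof -
  obtain a b e c d f g h i j where v: "v = ((a, b, e), (c, d, f, g, h, i, j))" by (cases v rule: adj.cases)
  obtain C11 C12 C22 C13 C14 C23 C24 C33 C34 C44 where C: "adj v = ((C11, C12, C22), (C13, C14, C23, C24, C33, C34, C44))"
    by (cases "adj v" rule: adj.cases)
  have Ceq: "C11 = e * (h * j - i * i) - f * (f * j - g * i) + g * (f * i - g * h)"
      "C12 = - (b * (h * j - i * i) - f * (c * j - d * i) + g * (c * i - d * h))"
      "C22 = a * (h * j - i * i) - c * (c * j - d * i) + d * (c * i - d * h)"
     "C13 = b * (f * j - g * i) - e * (c * j - d * i) + g * (c * g - d * f)"
      "C14 = - (b * (f * i - g * h) - e * (c * i - d * h) + f * (c * g - d * f))"
      "C23 = - (a * (f * j - g * i) - b * (c * j - d * i) + d * (c * g - d * f))"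
      "C24 = a * (f * i - g * h) - b * (c * i - d * h) + c * (c * g - d * f)"
      "C33 = a * (e * j - g * g) - b * (b * j - d * g) + d * (b * g - d * e)"
      "C34 = - (a * (e * i - f * g) - b * (b * i - f * d) + c * (b * g - e * d))"
      "C44 = a * (e * h - f * f) - b * (b * h - c * f) + c * (b * f - c * e)"
    using C unfolding v by simp_all
  \<comment> \<open>Jacobi's identity for \<open>2 \<times> 2\<close> minors of the adjugate\<close>
  have J: "C11 * C22 - C12 * C12 = sdet v * (h * j - i * i)" "C11 * C33 - C13 * C13 = sdet v * (e * j - g * g)"
    "C11 * C44 - C14 * C14 = sdet v * (e * h - f * f)" "C22 * C33 - C23 * C23 = sdet v * (a * j - d * d)"
    "C22 * C44 - C24 * C24 = sdet v * (a * h - c * c)" "C33 * C44 - C34 * C34 = sdet v * (a * e - b * b)"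
    unfolding v sdet.simps Ceq by algebra+
  have P: "C11 * C22 = C12 * C12" "C11 * C33 = C13 * C13" "C11 * C44 = C14 * C14" "C22 * C33 = C23 * C23"
    "C22 * C44 = C24 * C24" "C33 * C44 = C34 * C34"
    using J det by simp_all
  have S: "C11 + C22 + C33 + C44 = 0" using tr by (simp add: C sym_id_def)
  have "C11 * (C11 + C22 + C33 + C44) = C11 * C11 + C12 * C12 + C13 * C13 + C14 * C14"
    "C22 * (C11 + C22 + C33 + C44) = C22 * C22 + C12 * C12 + C23 * C23 + C24 * C24"
    "C33 * (C11 + C22 + C33 + C44) = C33 * C33 + C13 * C13 + C23 * C23 + C34 * C34"
    "C44 * (C11 + C22 + C33 + C44) = C44 * C44 + C14 * C14 + C24 * C24 + C34 * C34"
    by (simp_all only: P[symmetric]) (simp_all add: algebra_simps)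
  then have "C11 * C11 + C12 * C12 + C13 * C13 + C14 * C14 = 0"
    "C22 * C22 + C12 * C12 + C23 * C23 + C24 * C24 = 0"
    "C33 * C33 + C13 * C13 + C23 * C23 + C34 * C34 = 0" "C44 * C44 + C14 * C14 + C24 * C24 + C34 * C34 = 0"
    unfolding S by simp_all
  moreover have "C11 * C11 \<ge> 0" "C12 * C12 \<ge> 0" "C13 * C13 \<ge> 0" "C14 * C14 \<ge> 0" "C22 * C22 \<ge> 0" "C23 * C23 \<ge> 0"
    "C24 * C24 \<ge> 0" "C33 * C33 \<ge> 0" "C34 * C34 \<ge> 0" "C44 * C44 \<ge> 0" by simp_all
  ultimately have "C11 * C11 = 0" "C12 * C12 = 0" "C13 * C13 = 0" "C14 * C14 = 0" "C22 * C22 = 0" "C23 * C23 = 0"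
    "C24 * C24 = 0" "C33 * C33 = 0" "C34 * C34 = 0" "C44 * C44 = 0" by linarith+
  then show ?thesis unfolding C by (simp add: zero_prod_def)
qed

text \<open>Jacobi's formula.\<close>
lemma sdet_has_derivative: "(sdet has_derivative trace_form (adj v)) (at v)"
proof -
  have eq: "sdet = (\<lambda>x. let a = fst (fst x); b = fst (snd (fst x)); e = snd (snd (fst x)); c = fst (snd x); d = fst (snd (snd x));
     f = fst (snd (snd (snd x))); g = fst (snd (snd (snd (snd x)))); h = fst (snd (snd (snd (snd (snd x)))));
     i = fst (snd (snd (snd (snd (snd (snd x)))))); j = snd (snd (snd (snd (snd (snd (snd x))))))
    in a * (e * (h * j - i * i) - f * (f * j - g * i) + g * (f * i - g * h))
   - b * (b * (h * j - i * i) - f * (c * j - d * i) + g * (c * i - d * h))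
   + c * (b * (f * j - g * i) - e * (c * j - d * i) + g * (c * g - d * f))
   - d * (b * (f * i - g * h) - e * (c * i - d * h) + f * (c * g - d * f)))"
    by (rule ext, rename_tac x, case_tac x rule: adj.cases) (simp add: Let_def)
  obtain a b e c d f g h i j where v: "v = ((a, b, e), (c, d, f, g, h, i, j))" by (cases v rule: adj.cases)
  show ?thesis
    unfolding eq Let_def
    by (rule has_derivative_eq_rhs, (rule derivative_eq_intros refl)+)
      (rule ext, rename_tac x, case_tac x rule: adj.cases, simp add: v, simp add: algebra_simps)
qed

lemma adj_scaleR: "adj (k *\<^sub>R v) = k ^ 3 *\<^sub>R adj v"
  by (cases v rule: adj.cases) (simp add: power3_eq_cube algebra_simps)

lemma adj_sym_id: "adj (k *\<^sub>R sym_id) = 0 \<longleftrightarrow> k = 0"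
  by (simp add: sym_id_def zero_prod_def)

text \<open>Since \<open>C - l\<close> is invertible, the corank equals that of the Schur
  complement \<open>A - l - B (C - l)\<^sup>-\<^sup>1 B\<^sup>T\<close>, a \<open>2 \<times>
  2\<close> matrix that must therefore vanish.\<close>
lemma adj_chart:
  assumes c: "corner_det l w \<noteq> 0"
  shows "adj ((A, w) - l *\<^sub>R sym_id) = 0 \<longleftrightarrow> A = corank2_block l w"
proof -
  obtain e11 e12 e22 y11 y12 y21 y22 where d: "e11 * e22 - e12\<^sup>2 \<noteq> 0"
    and w: "w = (y11 * e11 + y12 * e12, y11 * e12 + y12 * e22, y21 * e11 + y22 * e12, y21 * e12 + y22 * e22, l + e11, e12, l + e22)"
    using chart_coords_surj[OF c] .
  obtain a b e where A: "A = (a, b, e)" by (cases A)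
  have d': "e11 * e22 - e12 * e12 \<noteq> 0" using d by (simp add: power2_eq_square)
  let ?a = "y11\<^sup>2 * e11 + 2 * y11 * y12 * e12 + y12\<^sup>2 * e22"
  let ?b = "y11 * y21 * e11 + (y11 * y22 + y12 * y21) * e12 + y12 * y22 * e22"
  let ?e = "y21\<^sup>2 * e11 + 2 * y21 * y22 * e12 + y22\<^sup>2 * e22"
  let ?w = "(y11 * e11 + y12 * e12, y11 * e12 + y12 * e22, y21 * e11 + y22 * e12, y21 * e12 + y22 * e22, e11, e12, e22)"
  have N: "(A, w) - l *\<^sub>R sym_id = ((a - l, b, e - l), ?w)" by (simp add: A w sym_id_def)
  have B: "corank2_block l w = (l + ?a, ?b, l + ?e)" unfolding w by (rule chart_coords[OF d])
  have 1: "fst (fst (adj ((a', b', e'), ?w))) = (e' - ?e) * (e11 * e22 - e12 * e12)"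
    "fst (snd (fst (adj ((a', b', e'), ?w)))) = - (b' - ?b) * (e11 * e22 - e12 * e12)"
    "snd (snd (fst (adj ((a', b', e'), ?w)))) = (a' - ?a) * (e11 * e22 - e12 * e12)" for a' b' e'
    by (simp_all add: power2_eq_square algebra_simps)
  have 2: "adj ((?a, ?b, ?e), ?w) = 0"
    by (simp add: zero_prod_def power2_eq_square algebra_simps)
  show ?thesis
  proof
    assume z: "adj ((A, w) - l *\<^sub>R sym_id) = 0"
    have z': "adj ((a - l, b, e - l), ?w) = 0" using z unfolding N .
    have "(e - l - ?e) * (e11 * e22 - e12 * e12) = 0" "- (b - ?b) * (e11 * e22 - e12 * e12) = 0" "(a - l - ?a) * (e11 * e22 - e12 * e12) = 0"
      using 1[of "a - l" b "e - l"] unfolding z' by (simp_all only: fst_zero snd_zero)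
    then have "e - l - ?e = 0" "b - ?b = 0" "a - l - ?a = 0"
      using d' by (simp_all only: mult_eq_0_iff neg_equal_0_iff_equal) blast+
    then show "A = corank2_block l w" unfolding A B by simp
  next
    assume "A = corank2_block l w"
    then have "a - l = ?a" "b = ?b" "e - l = ?e" unfolding A B by simp_all
    then show "adj ((A, w) - l *\<^sub>R sym_id) = 0" unfolding N using 2 by simp
  qed
qed

text \<open>The quadratic form of a symmetric matrix; the index \<open>0\<close> denotes the first
  row.\<close>
fun qform :: "sym4 \<Rightarrow> real ^ 4 \<Rightarrow> real" where
  "qform ((a, b, e), (c, d, f, g, h, i, j)) v =
     a * (v $ 0 * v $ 0) + e * (v $ 1 * v $ 1) + h * (v $ 2 * v $ 2) + j * (v $ 3 * v $ 3)
   + 2 * (b * (v $ 0 * v $ 1) + c * (v $ 0 * v $ 2) + d * (v $ 0 * v $ 3) + f * (v $ 1 * v $ 2) + g * (v $ 1 * v $ 3) + i * (v $ 2 * v $ 3))"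

lemma qform_sym:
  assumes "transpose A = A"
  shows "v \<bullet> (A *v v) = qform (entries A) v"
proof -
  have s: "A $ i $ j = A $ j $ i" for i j
    using arg_cong[OF assms, of "\<lambda>B. B $ j $ i"] by (simp add: transpose_def)
  show ?thesis
    by (simp add: entries_def inner_vec_def matrix_vector_mult_def sum_4 four_eq_zero s[of 1 0] s[of 2 0] s[of 3 0] s[of 2 1] s[of 3 1] s[of 3 2] algebra_simps)
qed

text \<open>The quadratic form of a matrix in the chart is that of \<open>E = C - l\<close> in two
  linear forms of the vector, so it is semidefinite exactly if \<open>det E > 0\<close>, and then
  the sign is that of the upper left entry \<open>c11 - l\<close> of \<open>E\<close>.\<close>
lemma chart_definite:
  assumes c: "corner_det l w \<noteq> 0" and \<kappa>: "\<kappa> \<noteq> 0"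
  shows "(\<forall>v. 0 \<le> qform (\<kappa> *\<^sub>R ((corank2_block l w, w) - l *\<^sub>R sym_id)) v)
    \<longleftrightarrow> corner_det l w > 0 \<and> \<kappa> * (fst (snd (snd (snd (snd w)))) - l) > 0"
proof -
  obtain e11 e12 e22 y11 y12 y21 y22 where d: "e11 * e22 - e12\<^sup>2 \<noteq> 0"
    and w: "w = (y11 * e11 + y12 * e12, y11 * e12 + y12 * e22, y21 * e11 + y22 * e12, y21 * e12 + y22 * e22, l + e11, e12, l + e22)"
    using chart_coords_surj[OF c] .
  have cd: "corner_det l w = e11 * e22 - e12\<^sup>2" unfolding w by (rule chart_coords[OF d])
  have h: "fst (snd (snd (snd (snd w)))) - l = e11" by (simp add: w)
  have q: "qform (\<kappa> *\<^sub>R ((corank2_block l w, w) - l *\<^sub>R sym_id)) v =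
    \<kappa> * (e11 * (y11 * v $ 0 + y21 * v $ 1 + v $ 2)\<^sup>2 + 2 * e12 * (y11 * v $ 0 + y21 * v $ 1 + v $ 2) * (y12 * v $ 0 + y22 * v $ 1 + v $ 3)
      + e22 * (y12 * v $ 0 + y22 * v $ 1 + v $ 3)\<^sup>2)" for v
    unfolding w chart_coords[OF d] by (simp add: sym_id_def power2_eq_square algebra_simps)
  have two: "\<kappa> * e11 * (\<kappa> * (e11 * x\<^sup>2 + 2 * e12 * x * z + e22 * z\<^sup>2)) = \<kappa>\<^sup>2 * ((e11 * x + e12 * z)\<^sup>2 + (e11 * e22 - e12\<^sup>2) * z\<^sup>2)" for x z
    by (simp add: power2_eq_square algebra_simps)
  show ?thesis
  proof
    assume "\<forall>v. 0 \<le> qform (\<kappa> *\<^sub>R ((corank2_block l w, w) - l *\<^sub>R sym_id)) v"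
    then have nn: "0 \<le> \<kappa> * (e11 * x\<^sup>2 + 2 * e12 * x * z + e22 * z\<^sup>2)" for x z
    proof -
      define v :: "real ^ 4" where "v = (\<chi> i. if i = 2 then x else if i = 3 then z else 0)"
      have "v $ 0 = 0" "v $ 1 = 0" "v $ 2 = x" "v $ 3 = z" by (simp_all add: v_def)
      then show ?thesis using q[of v] \<open>\<forall>v. _ v\<close> by (simp add: mult.assoc) metis
    qed
    have e11: "0 \<le> \<kappa> * e11" using nn[of 1 0] by simp
    have "e11 \<noteq> 0"
    proof
      assume z: "e11 = 0"
      then have "e12 \<noteq> 0" using d by auto
      have "0 \<le> \<kappa> * (2 * e12 * (- (e22 + \<kappa>) / (2 * e12)) + e22)" using nn[of "- (e22 + \<kappa>) / (2 * e12)" 1] z by simp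
      also have "\<kappa> * (2 * e12 * (- (e22 + \<kappa>) / (2 * e12)) + e22) = - (\<kappa> * \<kappa>)" using \<open>e12 \<noteq> 0\<close> by (simp add: field_simps)
      finally show False using \<kappa> by (simp add: mult_le_0_iff) linarith
    qed
    then have pos: "0 < \<kappa> * e11" using e11 \<kappa> by (simp add: less_le)
    have "0 \<le> \<kappa> * e11 * (\<kappa> * (e11 * (- e12)\<^sup>2 + 2 * e12 * (- e12) * e11 + e22 * e11\<^sup>2))"
      by (rule mult_nonneg_nonneg[OF less_imp_le[OF pos] nn])
    also have "\<dots> = \<kappa>\<^sup>2 * ((e11 * e22 - e12\<^sup>2) * e11\<^sup>2)" unfolding two by (simp add: algebra_simps)
    finally have "0 \<le> (e11 * e22 - e12\<^sup>2) * (\<kappa>\<^sup>2 * e11\<^sup>2)" by (simp add: mult_ac)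
    moreover have "0 < \<kappa>\<^sup>2 * e11\<^sup>2" using \<kappa> \<open>e11 \<noteq> 0\<close> by simp
    ultimately have "0 \<le> e11 * e22 - e12\<^sup>2" by (simp add: zero_le_mult_iff)
    then show "corner_det l w > 0 \<and> \<kappa> * (fst (snd (snd (snd (snd w)))) - l) > 0" using d pos unfolding cd h by simp
  next
    assume "corner_det l w > 0 \<and> \<kappa> * (fst (snd (snd (snd (snd w)))) - l) > 0"
    then have pos: "e11 * e22 - e12\<^sup>2 > 0" "\<kappa> * e11 > 0" unfolding cd h by auto
    have "0 \<le> \<kappa> * (e11 * x\<^sup>2 + 2 * e12 * x * z + e22 * z\<^sup>2)" for x z
    proof -
      have "0 \<le> \<kappa>\<^sup>2 * ((e11 * x + e12 * z)\<^sup>2 + (e11 * e22 - e12\<^sup>2) * z\<^sup>2)" using pos by simp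
      then have "0 \<le> \<kappa> * e11 * (\<kappa> * (e11 * x\<^sup>2 + 2 * e12 * x * z + e22 * z\<^sup>2))" unfolding two .
      then show ?thesis using pos(2) by (simp add: zero_le_mult_iff)
    qed
    then show "\<forall>v. 0 \<le> qform (\<kappa> *\<^sub>R ((corank2_block l w, w) - l *\<^sub>R sym_id)) v" unfolding q by blast
  qed
qed

lemma continuous_adj [continuous_intros]:
  assumes "continuous_on S f" shows "continuous_on S (\<lambda>x. adj (f x))"
proof -
  have eq: "adj x = (let a = fst (fst x); b = fst (snd (fst x)); e = snd (snd (fst x)); c = fst (snd x); d = fst (snd (snd x));
     f = fst (snd (snd (snd x))); g = fst (snd (snd (snd (snd x)))); h = fst (snd (snd (snd (snd (snd x)))));
     i = fst (snd (snd (snd (snd (snd (snd x)))))); j = snd (snd (snd (snd (snd (snd (snd x))))))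
    in ((e * (h * j - i * i) - f * (f * j - g * i) + g * (f * i - g * h),
      - (b * (h * j - i * i) - f * (c * j - d * i) + g * (c * i - d * h)),
      a * (h * j - i * i) - c * (c * j - d * i) + d * (c * i - d * h)),
     (b * (f * j - g * i) - e * (c * j - d * i) + g * (c * g - d * f),
      - (b * (f * i - g * h) - e * (c * i - d * h) + f * (c * g - d * f)),
      - (a * (f * j - g * i) - b * (c * j - d * i) + d * (c * g - d * f)),
      a * (f * i - g * h) - b * (c * i - d * h) + c * (c * g - d * f),
      a * (e * j - g * g) - b * (b * j - d * g) + d * (b * g - d * e),
      - (a * (e * i - f * g) - b * (b * i - f * d) + c * (b * g - e * d)),
      a * (e * h - f * f) - b * (b * h - c * f) + c * (b * f - c * e))))" for x
    by (cases x rule: adj.cases) (simp add: Let_def)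
  have "continuous_on UNIV adj" unfolding eq[abs_def] Let_def by (intro continuous_intros)
  then show ?thesis using assms by (rule continuous_on_compose2) simp
qed

section \<open>Dimension counts for exceptional pencils\<close>

type_synonym dom9 = "real \<times> real \<times> real \<times> real \<times> real \<times> real \<times> real \<times> real \<times> real"

text \<open>A smooth image of \<open>\<real>\<^sup>9\<close> is null in the ten-dimensional space
  of symmetric matrices. All exceptional sets below are covered by such images.\<close>
lemma negligible_range9:
  fixes g :: "dom9 \<Rightarrow> sym4"
  assumes "\<And>x. g differentiable (at x)"
  shows "negligible (range g)"
proof (rule negligible_differentiable_image_lowdim)
  show "g differentiable_on UNIV"
    using assms by (simp add: differentiable_on_def differentiable_at_withinI)
qed simp

lemma differentiable_fst_comp: "f differentiable F \<Longrightarrow> (\<lambda>x. fst (f x)) differentiable F"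
  unfolding differentiable_def using has_derivative_fst by blast

lemma differentiable_snd_comp: "f differentiable F \<Longrightarrow> (\<lambda>x. snd (f x)) differentiable F"
  unfolding differentiable_def using has_derivative_snd by blast

lemmas poly_differentiable = differentiable_Pair differentiable_add differentiable_diff differentiable_mult
  differentiable_const differentiable_fst_comp differentiable_snd_comp differentiable_ident differentiable_scaleR

text \<open>The matrices \<open>\<epsilon> n n\<^sup>T + \<epsilon>' w w\<^sup>T\<close> with
  \<open>w\<close> supported on the first two coordinates.\<close>
fun signed_squares :: "real \<Rightarrow> real \<Rightarrow> real \<times> real \<times> real \<times> real \<times> real \<times> real \<Rightarrow> sym4" where
  "signed_squares \<epsilon> \<epsilon>' (n1, n2, n3, n4, w1, w2) =
    ((\<epsilon> * (n1 * n1) + \<epsilon>' * (w1 * w1), \<epsilon> * (n1 * n2) + \<epsilon>' * (w1 * w2), \<epsilon> * (n2 * n2) + \<epsilon>' * (w2 * w2)),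
     (\<epsilon> * (n1 * n3), \<epsilon> * (n1 * n4), \<epsilon> * (n2 * n3), \<epsilon> * (n2 * n4), \<epsilon> * (n3 * n3), \<epsilon> * (n3 * n4), \<epsilon> * (n4 * n4)))"

text \<open>Matrices with \<open>C = 0\<close> and a block \<open>B\<close> of rank at most one.
  The parametrisation by a column and a factor misses the case of a vanishing first column, which
  the second family covers.\<close>
fun isotropic_block :: "real \<times> real \<times> real \<times> real \<times> real \<times> real \<Rightarrow> sym4" where
  "isotropic_block (a, b, e, c, f, k) = ((a, b, e), (c, k * c, f, k * f, 0, 0, 0))"

fun isotropic_block' :: "real \<times> real \<times> real \<times> real \<times> real \<times> real \<Rightarrow> sym4" where
  "isotropic_block' (a, b, e, d, g, k) = ((a, b, e), (0, d, 0, g, 0, 0, 0))"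

text \<open>The chart at \<open>l = 0\<close> in its polynomial coordinates \<open>Y,
  E\<close>.\<close>
fun block_param :: "real \<times> real \<times> real \<times> real \<times> real \<times> real \<times> real \<Rightarrow> sym4" where
  "block_param (y11, y12, y21, y22, e11, e12, e22) =
    ((y11 * y11 * e11 + 2 * y11 * y12 * e12 + y12 * y12 * e22, y11 * y21 * e11 + (y11 * y22 + y12 * y21) * e12 + y12 * y22 * e22,
      y21 * y21 * e11 + 2 * y21 * y22 * e12 + y22 * y22 * e22),
     (y11 * e11 + y12 * e12, y11 * e12 + y12 * e22, y21 * e11 + y22 * e12, y21 * e12 + y22 * e22, e11, e12, e22))"

text \<open>A singular symmetric \<open>2 \<times> 2\<close> matrix is plus or minus a
  square.\<close>
lemma rank_one_param:
  assumes "x * z = y * (y :: real)"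
  shows "\<exists>\<epsilon>\<in>{1, - 1}. \<exists>w1 w2. x = \<epsilon> * (w1 * w1) \<and> y = \<epsilon> * (w1 * w2) \<and> z = \<epsilon> * (w2 * w2)"
proof (cases "x = 0")
  case True
  then have y: "y = 0" using assms by simp
  show ?thesis
  proof (cases "z \<ge> 0")
    case True then show ?thesis using \<open>x = 0\<close> y by (intro bexI[of _ 1] exI[of _ 0] exI[of _ "sqrt z"]) simp_all
  next
    case False then show ?thesis using \<open>x = 0\<close> y by (intro bexI[of _ "- 1"] exI[of _ 0] exI[of _ "sqrt (- z)"]) simp_all
  qed
next
  case False
  have z: "z = y * y / x" using assms False by (simp add: field_simps)
  show ?thesis
  proof (cases "x > 0")
    case True
    have "y / sqrt x * (y / sqrt x) = y * y / x" "sqrt x * (y / sqrt x) = y" using True by simp_all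
    then show ?thesis using True z by (intro bexI[of _ 1] exI[of _ "sqrt x"] exI[of _ "y / sqrt x"]) simp_all
  next
    case False
    then have x: "- x > 0" using \<open>x \<noteq> 0\<close> by simp
    have "- y / sqrt (- x) * (- y / sqrt (- x)) = y * y / (- x)" "sqrt (- x) * (- y / sqrt (- x)) = - y" "sqrt (- x) * sqrt (- x) = - x"
      using x by simp_all
    then show ?thesis using z by (intro bexI[of _ "- 1"] exI[of _ "sqrt (- x)"] exI[of _ "- y / sqrt (- x)"]) simp_all
  qed
qed

lemma signed_sqrt:
  assumes "x \<noteq> (0 :: real)"
  obtains \<epsilon> s where "\<epsilon> \<in> {1, - 1}" "s \<noteq> 0" "x = \<epsilon> * (s * s)" "\<epsilon> * \<epsilon> = 1"
proof (cases "x > 0")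
  case True then show ?thesis using that[of 1 "sqrt x"] by simp
next
  case False then show ?thesis using that[of "- 1" "sqrt (- x)"] assms by simp
qed

text \<open>A matrix of rank at most two whose corner \<open>C\<close> is singular: if \<open>C
  \<noteq> 0\<close>, then \<open>C = \<epsilon> n n\<^sup>T\<close>, and splitting off this
  square leaves a matrix of rank at most one supported on the first block. If \<open>C =
  0\<close>, the block \<open>B\<close> must have rank at most one. Both families have dimension
  at most six, one less than the family of all matrices of rank two.\<close>
lemma degenerate_corank2:
  assumes adj: "adj N = 0" and deg: "corner_det 0 (snd N) = 0"
  shows "(\<exists>\<epsilon>\<in>{1, - 1}. \<exists>\<epsilon>'\<in>{1, - 1}. N \<in> range (signed_squares \<epsilon> \<epsilon>')) \<or> N \<in> range isotropic_block \<or> N \<in> range isotropic_block'"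
proof -
  obtain a b e c d f g h i j where N: "N = ((a, b, e), (c, d, f, g, h, i, j))" by (cases N rule: adj.cases)
  have hj: "h * j = i * i" using deg by (simp add: N corner_det_def power2_eq_square)
  have C11: "e * (h * j - i * i) - f * (f * j - g * i) + g * (f * i - g * h) = 0"
    and C22: "a * (h * j - i * i) - c * (c * j - d * i) + d * (c * i - d * h) = 0"
    and C13: "b * (f * j - g * i) - e * (c * j - d * i) + g * (c * g - d * f) = 0"
    and C14: "- (b * (f * i - g * h) - e * (c * i - d * h) + f * (c * g - d * f)) = 0"
    and C23: "- (a * (f * j - g * i) - b * (c * j - d * i) + d * (c * g - d * f)) = 0"
    and C24: "a * (f * i - g * h) - b * (c * i - d * h) + c * (c * g - d * f) = 0"
    and C33: "a * (e * j - g * g) - b * (b * j - d * g) + d * (b * g - d * e) = 0"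
    and C44: "a * (e * h - f * f) - b * (b * h - c * f) + c * (b * f - c * e) = 0"
    using adj unfolding N by (simp_all add: zero_prod_def)
  show ?thesis
  \<comment> \<open>the diagonal entries of \<open>C\<close> decide whether it vanishes, because \<open>h j = i\<^sup>2\<close>\<close>
  proof (cases "j = 0")
    case False
    have "(f * j - g * i) * (f * j - g * i) = 0"
    proof -
      have "(f * j - g * i) * (f * j - g * i) = (e * j - g * g) * (h * j - i * i) - j * (e * (h * j - i * i) - f * (f * j - g * i) + g * (f * i - g * h))"
        by algebra
      then show ?thesis using C11 hj by simp
    qed
    then have f: "f * j = g * i" by simp
    have "(c * j - d * i) * (c * j - d * i) = 0"
    proof -
      have "(c * j - d * i) * (c * j - d * i) = (a * j - d * d) * (h * j - i * i) - j * (a * (h * j - i * i) - c * (c * j - d * i) + d * (c * i - d * h))"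
        by algebra
      then show ?thesis using C22 hj by simp
    qed
    then have c: "c * j = d * i" by simp
    have "(a - d * d / j) * (e - g * g / j) = (b - d * g / j) * (b - d * g / j)"
    proof -
      have "j * ((a * j - d * d) * (e * j - g * g) - (b * j - d * g) * (b * j - d * g)) = j * j * (a * (e * j - g * g) - b * (b * j - d * g) + d * (b * g - d * e))"
        by algebra
      then have "(a * j - d * d) * (e * j - g * g) = (b * j - d * g) * (b * j - d * g)" using C33 False by simp
      moreover have "x - y / j = (x * j - y) / j" for x y using False by (simp add: field_simps)
      ultimately show ?thesis by simp
    qed
    then obtain \<epsilon>' w1 w2 where w: "\<epsilon>' \<in> {1, - 1}" "a - d * d / j = \<epsilon>' * (w1 * w1)" "b - d * g / j = \<epsilon>' * (w1 * w2)" "e - g * g / j = \<epsilon>' * (w2 * w2)"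
      using rank_one_param by blast
    obtain \<epsilon> s where s: "\<epsilon> \<in> {1, - 1}" "s \<noteq> 0" "j = \<epsilon> * (s * s)" "\<epsilon> * \<epsilon> = 1" using signed_sqrt[OF False] .
    have \<epsilon>: "\<epsilon> \<noteq> 0" using s(1) by auto
    have div: "\<epsilon> * (\<epsilon> * x / s * (\<epsilon> * y / s)) = x * y / j" "\<epsilon> * (\<epsilon> * x / s * s) = x" for x y
    proof -
      have "\<epsilon> * (\<epsilon> * x / s * s) = \<epsilon> * \<epsilon> * x" using s(2) by simp
      then show "\<epsilon> * (\<epsilon> * x / s * s) = x" using s(4) by simp
      have "\<epsilon> * (\<epsilon> * x / s * (\<epsilon> * y / s)) * j = (\<epsilon> * \<epsilon>) * (\<epsilon> * \<epsilon>) * (x * y)" unfolding s(3) using s(2) by simp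
      then show "\<epsilon> * (\<epsilon> * x / s * (\<epsilon> * y / s)) = x * y / j" using s(4) False by (simp add: eq_divide_eq)
    qed
    have "N = signed_squares \<epsilon> \<epsilon>' (\<epsilon> * d / s, \<epsilon> * g / s, \<epsilon> * i / s, s, w1, w2)"
      unfolding N signed_squares.simps div w(2,3,4)[symmetric] s(3)[symmetric] using f c hj False by (simp add: eq_divide_eq)
    then show ?thesis using s(1) w(1) by blast
  next
    case j: True
    then have i: "i = 0" using hj by simp
    show ?thesis
    proof (cases "h = 0")
      case False
      have g: "g = 0" using C11 False by (simp add: i j)
      have d: "d = 0" using C22 False by (simp add: i j)
      have "(a - c * c / h) * (e - f * f / h) = (b - c * f / h) * (b - c * f / h)"
      proof -
        have "h * ((a * h - c * c) * (e * h - f * f) - (b * h - c * f) * (b * h - c * f)) = h * h * (a * (e * h - f * f) - b * (b * h - c * f) + c * (b * f - c * e))"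
          by algebra
        then have "(a * h - c * c) * (e * h - f * f) = (b * h - c * f) * (b * h - c * f)" using C44 False by simp
        moreover have "x - y / h = (x * h - y) / h" for x y using False by (simp add: field_simps)
        ultimately show ?thesis by simp
      qed
      then obtain \<epsilon>' w1 w2 where w: "\<epsilon>' \<in> {1, - 1}" "a - c * c / h = \<epsilon>' * (w1 * w1)" "b - c * f / h = \<epsilon>' * (w1 * w2)" "e - f * f / h = \<epsilon>' * (w2 * w2)"
        using rank_one_param by blast
      obtain \<epsilon> s where s: "\<epsilon> \<in> {1, - 1}" "s \<noteq> 0" "h = \<epsilon> * (s * s)" "\<epsilon> * \<epsilon> = 1" using signed_sqrt[OF False] .
      have div: "\<epsilon> * (\<epsilon> * x / s * (\<epsilon> * y / s)) = x * y / h" "\<epsilon> * (\<epsilon> * x / s * s) = x" for x y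
      proof -
        have "\<epsilon> * (\<epsilon> * x / s * s) = \<epsilon> * \<epsilon> * x" using s(2) by simp
        then show "\<epsilon> * (\<epsilon> * x / s * s) = x" using s(4) by simp
        have "\<epsilon> * (\<epsilon> * x / s * (\<epsilon> * y / s)) * h = (\<epsilon> * \<epsilon>) * (\<epsilon> * \<epsilon>) * (x * y)" unfolding s(3) using s(2) by simp
        then show "\<epsilon> * (\<epsilon> * x / s * (\<epsilon> * y / s)) = x * y / h" using s(4) False by (simp add: eq_divide_eq)
      qed
      have "N = signed_squares \<epsilon> \<epsilon>' (\<epsilon> * c / s, \<epsilon> * f / s, s, 0, w1, w2)"
        unfolding N signed_squares.simps div w(2,3,4)[symmetric] s(3)[symmetric] by (simp add: g d i j)
      then show ?thesis using s(1) w(1) by blast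
    next
      case h: True
      have det: "c * g = d * f"
      proof (rule ccontr)
        assume n: "c * g \<noteq> d * f"
        then have "g = 0" "f = 0" using C13 C14 by (simp_all add: h i j)
        then show False using n by simp
      qed
      show ?thesis
      proof (cases "c = 0 \<and> f = 0")
        case True
        then have "N = isotropic_block' (a, b, e, d, g, 0)" by (simp add: N h i j)
        then show ?thesis by blast
      next
        case False
        define k where "k = (if c = 0 then g / f else d / c)"
        have "d = k * c" "g = k * f" using False det by (auto simp: k_def field_simps)
        then have "N = isotropic_block (a, b, e, c, f, k)" by (simp add: N h i j)
        then show ?thesis by blast
      qed
    qed
  qed
qed

text \<open>Matrices of corank two with invertible corner form a family of dimension seven.\<close>
lemma nondegenerate_corank2:
  assumes adj: "adj N = 0" and nondeg: "corner_det 0 (snd N) \<noteq> 0"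
  shows "N \<in> range block_param"
proof -
  obtain e11 e12 e22 y11 y12 y21 y22 where d: "e11 * e22 - e12\<^sup>2 \<noteq> 0"
    and w: "snd N = (y11 * e11 + y12 * e12, y11 * e12 + y12 * e22, y21 * e11 + y22 * e12, y21 * e12 + y22 * e22, 0 + e11, e12, 0 + e22)"
    using chart_coords_surj[OF nondeg] .
  have "fst N = corank2_block 0 (snd N)"
    using adj_chart[OF nondeg, of "fst N"] adj by simp
  then have "N = block_param (y11, y12, y21, y22, e11, e12, e22)"
    unfolding w chart_coords[OF d] by (simp add: prod_eq_iff w power2_eq_square)
  then show ?thesis by blast
qed

lemma isolate_first:
  fixes x :: "'a :: real_vector"
  shows "x + a + b - c = p \<Longrightarrow> x = p - a - b + c" "x + b - c = p \<Longrightarrow> x = p - b + c"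
  by (auto simp: algebra_simps)

lemma corner_det_shift: "corner_det l (snd v) = corner_det 0 (snd (v - l *\<^sub>R sym_id))"
  by (cases v rule: adj.cases) (simp add: corner_det_def sym_id_def)

text \<open>Six parameters for the degenerate matrix and three for \<open>s, t, l\<close> make
  nine.\<close>
lemma negligible_degenerate:
  "negligible {v1. \<exists>s t l. adj (v1 + s *\<^sub>R v2 + t *\<^sub>R v3 - l *\<^sub>R sym_id) = 0 \<and> corner_det l (snd (v1 + s *\<^sub>R v2 + t *\<^sub>R v3)) = 0}" (is "negligible ?B")
proof -
  let ?T = "\<lambda>P :: real \<times> real \<times> real \<times> real \<times> real \<times> real \<Rightarrow> sym4. \<lambda>p :: dom9. P (snd (snd (snd p))) - fst p *\<^sub>R v2 - fst (snd p) *\<^sub>R v3 + fst (snd (snd p)) *\<^sub>R sym_id"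
  have eqs: "signed_squares \<epsilon> \<epsilon>' q = ((\<epsilon> * (fst q * fst q) + \<epsilon>' * (fst (snd (snd (snd (snd q)))) * fst (snd (snd (snd (snd q))))),
      \<epsilon> * (fst q * fst (snd q)) + \<epsilon>' * (fst (snd (snd (snd (snd q)))) * snd (snd (snd (snd (snd q))))),
      \<epsilon> * (fst (snd q) * fst (snd q)) + \<epsilon>' * (snd (snd (snd (snd (snd q)))) * snd (snd (snd (snd (snd q)))))),
     (\<epsilon> * (fst q * fst (snd (snd q))), \<epsilon> * (fst q * fst (snd (snd (snd q)))), \<epsilon> * (fst (snd q) * fst (snd (snd q))), \<epsilon> * (fst (snd q) * fst (snd (snd (snd q)))),
      \<epsilon> * (fst (snd (snd q)) * fst (snd (snd q))), \<epsilon> * (fst (snd (snd q)) * fst (snd (snd (snd q)))), \<epsilon> * (fst (snd (snd (snd q))) * fst (snd (snd (snd q))))))"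
    "isotropic_block q = ((fst q, fst (snd q), fst (snd (snd q))), (fst (snd (snd (snd q))), snd (snd (snd (snd (snd q)))) * fst (snd (snd (snd q))),
       fst (snd (snd (snd (snd q)))), snd (snd (snd (snd (snd q)))) * fst (snd (snd (snd (snd q)))), 0, 0, 0))"
    "isotropic_block' q = ((fst q, fst (snd q), fst (snd (snd q))), (0, fst (snd (snd (snd q))), 0, fst (snd (snd (snd (snd q)))), 0, 0, 0))" for \<epsilon> \<epsilon>' q
    by (cases q; simp)+
  have n: "negligible (range (?T (signed_squares \<epsilon> \<epsilon>')))" "negligible (range (?T isotropic_block))" "negligible (range (?T isotropic_block'))" for \<epsilon> \<epsilon>'
    unfolding eqs by (rule negligible_range9, (rule poly_differentiable)+)+
  have "?B \<subseteq> (\<Union>\<epsilon>\<in>{1, - 1}. \<Union>\<epsilon>'\<in>{1, - 1}. range (?T (signed_squares \<epsilon> \<epsilon>'))) \<union> range (?T isotropic_block) \<union> range (?T isotropic_block')"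
  proof
    fix v1 assume "v1 \<in> ?B"
    then obtain s t l where z: "adj (v1 + s *\<^sub>R v2 + t *\<^sub>R v3 - l *\<^sub>R sym_id) = 0" "corner_det l (snd (v1 + s *\<^sub>R v2 + t *\<^sub>R v3)) = 0" by blast
    have in_range: "v1 \<in> range (?T P)" if "v1 + s *\<^sub>R v2 + t *\<^sub>R v3 - l *\<^sub>R sym_id \<in> range P" for P
    proof -
      from that obtain q where "v1 + s *\<^sub>R v2 + t *\<^sub>R v3 - l *\<^sub>R sym_id = P q" by blast
      then have "v1 = P q - s *\<^sub>R v2 - t *\<^sub>R v3 + l *\<^sub>R sym_id" by (rule isolate_first)
      then have "v1 = ?T P (s, t, l, q)" by (simp only: fst_conv snd_conv)
      then show ?thesis by blast
    qed
    show "v1 \<in> (\<Union>\<epsilon>\<in>{1, - 1}. \<Union>\<epsilon>'\<in>{1, - 1}. range (?T (signed_squares \<epsilon> \<epsilon>'))) \<union> range (?T isotropic_block) \<union> range (?T isotropic_block')"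
      using degenerate_corank2[OF z(1) z(2)[unfolded corner_det_shift[of l]]]
    proof (elim disjE bexE)
      fix \<epsilon> \<epsilon>' assume *: "\<epsilon> \<in> {1, - 1}" "\<epsilon>' \<in> {1, - 1}" "v1 + s *\<^sub>R v2 + t *\<^sub>R v3 - l *\<^sub>R sym_id \<in> range (signed_squares \<epsilon> \<epsilon>')"
      show ?thesis by (rule UnI1, rule UnI1, rule UN_I[OF *(1)], rule UN_I[OF *(2)], rule in_range[OF *(3)])
    next
      assume *: "v1 + s *\<^sub>R v2 + t *\<^sub>R v3 - l *\<^sub>R sym_id \<in> range isotropic_block"
      show ?thesis by (rule UnI1, rule UnI2, rule in_range[OF *])
    next
      assume *: "v1 + s *\<^sub>R v2 + t *\<^sub>R v3 - l *\<^sub>R sym_id \<in> range isotropic_block'"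
      show ?thesis by (rule UnI2, rule in_range[OF *])
    qed
  qed
  moreover have "negligible ((\<Union>\<epsilon>\<in>{1, - 1}. \<Union>\<epsilon>'\<in>{1, - 1}. range (?T (signed_squares \<epsilon> \<epsilon>'))) \<union> range (?T isotropic_block) \<union> range (?T isotropic_block'))"
    using n by (intro negligible_Un negligible_Union) (auto intro!: negligible_Un)
  ultimately show ?thesis by (rule negligible_subset[rotated])
qed

text \<open>Seven parameters for a matrix with invertible corner and two for \<open>t, l\<close>
  make nine. The matrices with singular corner are already negligible by the previous
  lemma.\<close>
lemma negligible_line:
  "negligible {v2. \<exists>t l. adj (v2 + t *\<^sub>R v3 - l *\<^sub>R sym_id) = 0}" (is "negligible ?B")
proof -
  let ?T = "\<lambda>p :: dom9. block_param (snd (snd p)) - fst p *\<^sub>R v3 + fst (snd p) *\<^sub>R sym_id"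
  have eq: "block_param q = ((fst q * fst q * fst (snd (snd (snd (snd q)))) + 2 * fst q * fst (snd q) * fst (snd (snd (snd (snd (snd q))))) + fst (snd q) * fst (snd q) * snd (snd (snd (snd (snd (snd q))))),
      fst q * fst (snd (snd q)) * fst (snd (snd (snd (snd q)))) + (fst q * fst (snd (snd (snd q))) + fst (snd q) * fst (snd (snd q))) * fst (snd (snd (snd (snd (snd q))))) + fst (snd q) * fst (snd (snd (snd q))) * snd (snd (snd (snd (snd (snd q))))),
      fst (snd (snd q)) * fst (snd (snd q)) * fst (snd (snd (snd (snd q)))) + 2 * fst (snd (snd q)) * fst (snd (snd (snd q))) * fst (snd (snd (snd (snd (snd q))))) + fst (snd (snd (snd q))) * fst (snd (snd (snd q))) * snd (snd (snd (snd (snd (snd q)))))),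
     (fst q * fst (snd (snd (snd (snd q)))) + fst (snd q) * fst (snd (snd (snd (snd (snd q))))), fst q * fst (snd (snd (snd (snd (snd q))))) + fst (snd q) * snd (snd (snd (snd (snd (snd q))))),
      fst (snd (snd q)) * fst (snd (snd (snd (snd q)))) + fst (snd (snd (snd q))) * fst (snd (snd (snd (snd (snd q))))), fst (snd (snd q)) * fst (snd (snd (snd (snd (snd q))))) + fst (snd (snd (snd q))) * snd (snd (snd (snd (snd (snd q))))),
      fst (snd (snd (snd (snd q)))), fst (snd (snd (snd (snd (snd q))))), snd (snd (snd (snd (snd (snd q)))))))" for q
    by (cases q; simp)
  have n: "negligible (range ?T)"
    unfolding eq by (rule negligible_range9, (rule poly_differentiable)+)
  have "?B \<subseteq> range ?T \<union> {v1. \<exists>s t l. adj (v1 + s *\<^sub>R 0 + t *\<^sub>R v3 - l *\<^sub>R sym_id) = 0 \<and> corner_det l (snd (v1 + s *\<^sub>R 0 + t *\<^sub>R v3)) = 0}"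
  proof
    fix v2 assume "v2 \<in> ?B"
    then obtain t l where z: "adj (v2 + t *\<^sub>R v3 - l *\<^sub>R sym_id) = 0" by blast
    show "v2 \<in> range ?T \<union> {v1. \<exists>s t l. adj (v1 + s *\<^sub>R 0 + t *\<^sub>R v3 - l *\<^sub>R sym_id) = 0 \<and> corner_det l (snd (v1 + s *\<^sub>R 0 + t *\<^sub>R v3)) = 0}"
    proof (cases "corner_det l (snd (v2 + t *\<^sub>R v3)) = 0")
      case True
      then show ?thesis using z by auto
    next
      case False
      obtain q where "v2 + t *\<^sub>R v3 - l *\<^sub>R sym_id = block_param q"
        using nondegenerate_corank2[OF z] False unfolding corner_det_shift[of l] by blast
      then have "v2 = block_param q - t *\<^sub>R v3 + l *\<^sub>R sym_id" by (rule isolate_first)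
      then have "v2 = ?T (t, l, q)" by (simp only: fst_conv snd_conv)
      then show ?thesis by blast
    qed
  qed
  then show ?thesis using n negligible_degenerate[of 0 v3] by (meson negligible_Un negligible_subset)
qed

lemma negligible_point: "negligible {v3. \<exists>l. adj (v3 - l *\<^sub>R sym_id) = 0}"
  by (rule negligible_subset[OF negligible_line[of 0]]) auto

section \<open>Measurability of solution counts\<close>

text \<open>Projections along Euclidean factors preserve \<open>F\<^sub>\<sigma>\<close> sets
  because projections along compact factors preserve closedness. This avoids analytic
  sets.\<close>
lemma projection_borel:
  fixes E :: "('a::euclidean_space \<times> 'b::euclidean_space) set"
  assumes E: "fsigma E" and B: "open B"
  shows "{y. \<exists>x\<in>B. (x, y) \<in> E} \<in> sets borel"
proof -
  obtain K where K: "\<And>n :: nat. closed (K n)" "E = (\<Union>n. K n)"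
    using E by (auto elim!: fsigma.cases)
  obtain C where C: "\<And>n :: nat. compact (C n)" "(\<Union>n. C n) = B"
    using open_Union_compact_subsets[OF B] by metis
  have "{y. \<exists>x\<in>B. (x, y) \<in> E} = (\<Union>m. \<Union>n. {y. \<exists>x. x \<in> C m \<and> (x, y) \<in> K n})"
    using C(2) K(2) by blast
  moreover have "closed {y. \<exists>x. x \<in> C m \<and> (x, y) \<in> K n}" for m n
    by (rule closed_compact_projection[OF C(1) K(1)])
  ultimately show ?thesis by auto
qed

lemma fsigma_closed: "closed S \<Longrightarrow> fsigma S"
  using fsigma.intros[of "\<lambda>_. S"] by simp

lemma fsigma_closed_Int_open:
  fixes S :: "'a::euclidean_space set"
  assumes "closed S" "open U"
  shows "fsigma (S \<inter> U)"
proof -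
  obtain C where C: "\<And>n :: nat. compact (C n)" "(\<Union>n. C n) = U"
    using open_Union_compact_subsets[OF assms(2)] by metis
  have "fsigma (\<Union>n. S \<inter> C n)"
    by (rule fsigma.intros) (rule closed_Int[OF assms(1) compact_imp_closed[OF C(1)]])
  then show ?thesis using C(2) by (simp add: Int_UN_distrib)
qed

text \<open>Counts take values in the natural numbers and \<open>\<infinity>\<close>, so
  superlevel sets at integers determine all others.\<close>
lemma ennreal_count_ge:
  "y \<le> emeasure (count_space UNIV) A \<longleftrightarrow> (\<forall>m :: nat. of_nat m < y \<longrightarrow> of_nat (Suc m) \<le> emeasure (count_space UNIV) A)"
proof (cases "finite A")
  case True
  then have e: "emeasure (count_space UNIV) A = of_nat (card A)" by (simp add: emeasure_count_space)
  show ?thesis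
  proof
    assume "y \<le> emeasure (count_space UNIV) A"
    then show "\<forall>m :: nat. of_nat m < y \<longrightarrow> of_nat (Suc m) \<le> emeasure (count_space UNIV) A"
      unfolding e by (metis Suc_leI of_nat_le_iff of_nat_less_iff order_less_le_trans)
  next
    assume *: "\<forall>m :: nat. of_nat m < y \<longrightarrow> of_nat (Suc m) \<le> emeasure (count_space UNIV) A"
    show "y \<le> emeasure (count_space UNIV) A"
    proof (rule ccontr)
      assume "\<not> y \<le> emeasure (count_space UNIV) A"
      then have "of_nat (Suc (card A)) \<le> (of_nat (card A) :: ennreal)" using * unfolding e by (simp add: not_le)
      then show False by (simp only: of_nat_le_iff)
    qed
  qed
qed (simp add: emeasure_count_space)

lemma separated_basis:
  fixes T :: "'a::euclidean_space set"
  assumes \<B>: "topological_basis \<B>" and T: "finite T"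
  shows "\<exists>b. (\<forall>x\<in>T. x \<in> b x \<and> b x \<in> \<B>) \<and> (\<forall>x\<in>T. \<forall>y\<in>T. x \<noteq> y \<longrightarrow> b x \<inter> b y = {})"
proof -
  let ?P = "insert 1 ((\<lambda>(x, y). dist x y) ` {(x, y) \<in> T \<times> T. x \<noteq> y})"
  have fin: "finite ?P"
  proof -
    have "finite {(x, y) \<in> T \<times> T. x \<noteq> y}" by (rule finite_subset[OF _ finite_cartesian_product[OF T T]]) auto
    then show ?thesis by (intro finite.insertI finite_imageI)
  qed
  define \<delta> where "\<delta> = Min ?P"
  have \<delta>: "\<delta> > 0" unfolding \<delta>_def using fin by (subst Min_gr_iff) auto
  have sep: "\<delta> \<le> dist x y" if "x \<in> T" "y \<in> T" "x \<noteq> y" for x y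
    unfolding \<delta>_def using fin that by (intro Min_le) auto
  have "\<exists>B. x \<in> B \<and> B \<in> \<B> \<and> B \<subseteq> ball x (\<delta> / 2)" for x
    using topological_basisE[OF \<B>, of "ball x (\<delta> / 2)" x] \<delta> by (metis centre_in_ball half_gt_zero open_ball)
  then obtain b where b: "\<And>x. x \<in> b x" "\<And>x. b x \<in> \<B>" "\<And>x. b x \<subseteq> ball x (\<delta> / 2)" by metis
  have "b x \<inter> b y = {}" if xy: "x \<in> T" "y \<in> T" "x \<noteq> y" for x y
  proof (rule ccontr)
    assume "b x \<inter> b y \<noteq> {}"
    then obtain z where "z \<in> b x" "z \<in> b y" by blast
    then have "dist x z < \<delta> / 2" "dist y z < \<delta> / 2" using b(3) by (auto simp: subset_iff)
    then have "dist x y < \<delta>" using dist_triangle_half_l[of x z \<delta> y] by (simp add: dist_commute)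
    then show False using sep[OF xy] by simp
  qed
  then show ?thesis using b by blast
qed

text \<open>There are at least \<open>n\<close> solutions if and only if solutions occur in each
  of \<open>n\<close> pairwise disjoint members of a countable basis. This is a countable union of
  Borel conditions on the parameter.\<close>
lemma count_solutions_measurable:
  fixes E :: "('a::euclidean_space \<times> 'b::euclidean_space) set"
  assumes E: "fsigma E"
  shows "(\<lambda>y. emeasure (count_space UNIV) {x. (x, y) \<in> E}) \<in> borel_measurable borel"
proof -
  obtain \<B> :: "'a set set" where \<B>: "countable \<B>" "topological_basis \<B>"
    using ex_countable_basis by blast
  define P where "P B = {y. \<exists>x\<in>B. (x, y) \<in> E}" for B
  have P: "P B \<in> sets borel" if "B \<in> \<B>" for B
    unfolding P_def using projection_borel[OF E] topological_basis_open[OF \<B>(2) that] .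
  let ?c = "\<lambda>y. emeasure (count_space UNIV) {x. (x, y) \<in> E}"
  let ?F = "\<lambda>n :: nat. {F. F \<subseteq> \<B> \<and> finite F \<and> card F = n \<and> pairwise disjnt F}"
  have set: "{y. of_nat n \<le> ?c y} = (\<Union>F\<in>?F n. {y. \<forall>B\<in>F. y \<in> P B})" for n
  proof (intro equalityI subsetI)
    fix y assume "y \<in> {y. of_nat n \<le> ?c y}"
    then have "of_nat n \<le> ?c y" by simp
    then have "\<exists>T. finite T \<and> card T = n \<and> T \<subseteq> {x. (x, y) \<in> E}"
    proof (cases "finite {x. (x, y) \<in> E}")
      case True
      then have "n \<le> card {x. (x, y) \<in> E}" using \<open>of_nat n \<le> ?c y\<close> by (simp add: emeasure_count_space)
      then show ?thesis using obtain_subset_with_card_n True by (metis finite_subset)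
    next
      case False
      then show ?thesis using infinite_arbitrarily_large by blast
    qed
    then obtain T where T: "finite T" "card T = n" "T \<subseteq> {x. (x, y) \<in> E}" by blast
    obtain b where b: "\<And>x. x \<in> T \<Longrightarrow> x \<in> b x \<and> b x \<in> \<B>" "\<And>x z. x \<in> T \<Longrightarrow> z \<in> T \<Longrightarrow> x \<noteq> z \<Longrightarrow> b x \<inter> b z = {}"
      using separated_basis[OF \<B>(2) T(1)] by blast
    have "inj_on b T"
    proof (rule inj_onI)
      fix x z assume *: "x \<in> T" "z \<in> T" "b x = b z"
      show "x = z"
      proof (rule ccontr)
        assume "x \<noteq> z"
        from b(2)[OF *(1,2) this] b(1)[OF *(1)] show False using *(3) by auto
      qed
    qed
    then have "b ` T \<in> ?F n" using b T by (auto simp: card_image pairwise_def disjnt_def)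
    moreover have "\<forall>B\<in>b ` T. y \<in> P B" using b(1) T(3) by (auto simp: P_def)
    ultimately show "y \<in> (\<Union>F\<in>?F n. {y. \<forall>B\<in>F. y \<in> P B})" by blast
  next
    fix y assume "y \<in> (\<Union>F\<in>?F n. {y. \<forall>B\<in>F. y \<in> P B})"
    then obtain F where F: "finite F" "card F = n" "pairwise disjnt F" "\<And>B. B \<in> F \<Longrightarrow> \<exists>x\<in>B. (x, y) \<in> E"
      by (auto simp: P_def)
    then obtain p where p: "\<And>B. B \<in> F \<Longrightarrow> p B \<in> B \<and> (p B, y) \<in> E" by metis
    have "inj_on p F"
    proof (rule inj_onI)
      fix B B' assume "B \<in> F" "B' \<in> F" "p B = p B'"
      then show "B = B'" using p[of B] p[of B'] F(3) by (auto simp: pairwise_def disjnt_def)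
    qed
    then have "card (p ` F) = n" using F by (simp add: card_image)
    then have "of_nat n = emeasure (count_space UNIV) (p ` F)" using F(1) by (simp add: emeasure_count_space)
    also have "\<dots> \<le> ?c y" using p by (intro emeasure_mono) auto
    finally show "y \<in> {y. of_nat n \<le> ?c y}" by simp
  qed
  have "countable (?F n)" for n
    using countable_Collect_finite_subset[OF \<B>(1)] by (rule countable_subset[rotated]) auto
  moreover have "{y. \<forall>B\<in>F. y \<in> P B} \<in> sets borel" if "F \<in> ?F n" for F n
  proof -
    have "{y \<in> space borel. \<forall>B\<in>F. y \<in> P B} \<in> sets borel"
    proof (rule sets.sets_Collect_finite_All)
      fix B assume "B \<in> F"
      then have "P B \<in> sets borel" using that by (intro P) blast
      then show "{y \<in> space borel. y \<in> P B} \<in> sets borel" by simp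
    qed (use that in blast)
    then show ?thesis by simp
  qed
  ultimately have ge: "{y. of_nat n \<le> ?c y} \<in> sets borel" for n
    unfolding set by (intro sets.countable_UN') auto
  show ?thesis
  proof (rule borel_measurableI_ge)
    fix u :: ennreal
    have "{y \<in> space borel. u \<le> ?c y} = {y \<in> space borel. \<forall>m :: nat. of_nat m < u \<longrightarrow> of_nat (Suc m) \<le> ?c y}"
      using ennreal_count_ge by auto
    also have "\<dots> \<in> sets borel"
    proof (rule sets.sets_Collect_countable_All)
      fix m :: nat
      show "{y \<in> space borel. of_nat m < u \<longrightarrow> of_nat (Suc m) \<le> ?c y} \<in> sets borel"
        using ge[of "Suc m"] by (cases "of_nat m < u") simp_all
    qed
    finally show "{y \<in> space borel. u \<le> ?c y} \<in> sets borel" .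
  qed
qed

text \<open>Fubini's theorem, applied to the projection of \<open>E\<close>, whose measurability
  comes from the closedness of \<open>E\<close>.\<close>
lemma AE_lborel_projection:
  fixes E :: "('x::euclidean_space \<times> ('a::euclidean_space \<times> 'b::euclidean_space)) set"
  assumes E: "closed E" and negl: "\<And>u. negligible {v. \<exists>x. (x, (v, u)) \<in> E}"
  shows "AE p in lborel. \<nexists>x. (x, p) \<in> E"
proof -
  let ?B = "{p. \<exists>x\<in>UNIV. (x, p) \<in> E}"
  have B: "?B \<in> sets borel"
    by (rule projection_borel) (simp_all add: fsigma_closed E)
  have "emeasure lborel ?B = (\<integral>\<^sup>+p. indicator ?B p \<partial>(lborel \<Otimes>\<^sub>M lborel))"
    using B by (simp add: lborel_prod)
  also have "\<dots> = (\<integral>\<^sup>+u. \<integral>\<^sup>+v. indicator ?B (v, u) \<partial>lborel \<partial>lborel)"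
    using B by (intro lborel_pair.nn_integral_snd[symmetric]) (simp add: lborel_prod)
  also have "\<dots> = (\<integral>\<^sup>+u. 0 \<partial>(lborel :: 'b measure))"
  proof (rule nn_integral_cong)
    fix u
    have m: "{v. (v, u) \<in> ?B} \<in> sets borel"
      using measurable_sets[of "\<lambda>v. (v, u)" borel borel ?B] B by (simp add: vimage_def)
    have "negligible {v. (v, u) \<in> ?B}" using negl[of u] by simp
    then have z: "emeasure lborel {v. (v, u) \<in> ?B} = 0"
      using m by (simp add: negligible_iff_null_sets null_sets_def emeasure_completion)
    have "(\<integral>\<^sup>+v. indicator ?B (v, u) \<partial>lborel) = (\<integral>\<^sup>+v. indicator {v. (v, u) \<in> ?B} v \<partial>lborel)"
      by (intro nn_integral_cong) (simp add: indicator_def)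
    also have "\<dots> = 0" using z m by simp
    finally show "(\<integral>\<^sup>+v. indicator ?B (v, u) \<partial>lborel) = 0" .
  qed
  finally have "?B \<in> null_sets lborel" using B by auto
  then have "AE p in lborel. p \<notin> ?B" by (rule AE_not_in)
  then show ?thesis by simp
qed

section \<open>Expected number of corank-two points in the chart\<close>

lemma compress_measurable2 [measurable (raw)]:
  assumes [measurable]: "f \<in> borel_measurable M" "g \<in> borel_measurable M"
  shows "(\<lambda>x. compress (f x) (g x)) \<in> borel_measurable M"
proof -
  have eq: "compress y v = (let y11 = fst y; y12 = fst (snd y); y21 = fst (snd (snd y)); y22 = snd (snd (snd y));
      a11 = fst (fst v); a12 = fst (snd (fst v)); a22 = snd (snd (fst v)); b11 = fst (snd v); b12 = fst (snd (snd v));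
      b21 = fst (snd (snd (snd v))); b22 = fst (snd (snd (snd (snd v)))); c11 = fst (snd (snd (snd (snd (snd v)))));
      c12 = fst (snd (snd (snd (snd (snd (snd v)))))); c22 = snd (snd (snd (snd (snd (snd (snd v))))))
    in (a11 - 2 * (y11 * b11 + y12 * b12) + (y11\<^sup>2 * c11 + 2 * y11 * y12 * c12 + y12\<^sup>2 * c22),
     a12 - (y21 * b11 + y22 * b12) - (y11 * b21 + y12 * b22) + (y11 * y21 * c11 + (y11 * y22 + y12 * y21) * c12 + y12 * y22 * c22),
     a22 - 2 * (y21 * b21 + y22 * b22) + (y21\<^sup>2 * c11 + 2 * y21 * y22 * c12 + y22\<^sup>2 * c22)))" for y v
    by (cases "(y, v)" rule: compress.cases) (simp add: Let_def)
  have "continuous_on UNIV (\<lambda>p. compress (fst p) (snd p))"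
    unfolding eq Let_def by (intro continuous_intros)
  then have "(\<lambda>x. (\<lambda>p. compress (fst p) (snd p)) (f x, g x)) \<in> borel_measurable M"
    by (rule borel_measurable_continuous_on) measurable
  then show ?thesis by simp
qed

lemma gram_measurable [measurable (raw)]:
  "f \<in> borel_measurable M \<Longrightarrow> (\<lambda>x. gram (f x)) \<in> borel_measurable M"
  by (rule borel_measurable_continuous_on[of gram]) (rule continuous_gram[OF continuous_on_id])

lemma det3_measurable2 [measurable (raw)]:
  assumes [measurable]: "f \<in> borel_measurable M" "g \<in> borel_measurable M" "h \<in> borel_measurable M"
  shows "(\<lambda>x. det3 (f x) (g x) (h x)) \<in> borel_measurable M"
proof -
  have "continuous_on UNIV (\<lambda>p. det3 (fst p) (fst (snd p)) (snd (snd p)))"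
    unfolding det3_alt by (intro continuous_intros)
  then have "(\<lambda>x. (\<lambda>p. det3 (fst p) (fst (snd p)) (snd (snd p))) (f x, g x, h x)) \<in> borel_measurable M"
    by (rule borel_measurable_continuous_on) measurable
  then show ?thesis by simp
qed

lemma count_inj_image:
  assumes "inj_on f A"
  shows "emeasure (count_space UNIV) (f ` A) = emeasure (count_space UNIV) A"
  using assms by (simp add: emeasure_count_space finite_image_iff card_image)

lemma continuous_corner_det [continuous_intros]:
  assumes "continuous_on S f" "continuous_on S g" shows "continuous_on S (\<lambda>x. corner_det (f x) (g x))"
  unfolding corner_det_def case_prod_beta using assms by (intro continuous_intros)

lemma continuous_kernel_coef:
  assumes "continuous_on S f" "continuous_on S g" "\<And>x. x \<in> S \<Longrightarrow> corner_det (f x) (g x) \<noteq> 0"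
  shows "continuous_on S (\<lambda>x. kernel_coef (f x) (g x))"
  unfolding kernel_coef_def case_prod_beta using assms by (intro continuous_intros) (auto simp: corner_det_def case_prod_beta)

text \<open>For fixed \<open>B, C\<close> blocks of the first matrix and fixed second and third
  matrices, a triple \<open>(s, t, l)\<close> solves the system exactly if its image under the
  chart map is the block \<open>A\<close> of the first matrix. Averaging over the Gaussian block
  \<open>A\<close> is then an instance of the area formula in
  \<open>\<real>\<^sup>3\<close>.\<close>
lemma chart_area:
  fixes w1 w2 w3 :: block7 and A2 A3 :: "real \<times> real \<times> real"
  defines "w \<equiv> \<lambda>s t. w1 + s *\<^sub>R w2 + t *\<^sub>R w3"
  defines "sol \<equiv> \<lambda>D a. {(s, t, l). corner_det l (w s t) \<in> D \<and> corank2_block l (w s t) - s *\<^sub>R A2 - t *\<^sub>R A3 = a}"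
  assumes D [measurable]: "D \<in> sets borel" and D0: "0 \<notin> D"
    and meas [measurable]: "(\<lambda>a. emeasure (count_space UNIV) (sol D a)) \<in> borel_measurable borel"
  shows "(\<integral>\<^sup>+a. density_A a * emeasure (count_space UNIV) (sol D a) \<partial>lborel) =
    (\<integral>\<^sup>+s. \<integral>\<^sup>+t. \<integral>\<^sup>+l. indicator D (corner_det l (w s t)) * (density_A (corank2_block l (w s t) - s *\<^sub>R A2 - t *\<^sub>R A3) *
      ennreal \<bar>det3 (gram (kernel_coef l (w s t))) (compress (kernel_coef l (w s t)) (A2, w2)) (compress (kernel_coef l (w s t)) (A3, w3))\<bar>) \<partial>lborel \<partial>lborel \<partial>lborel)"
proof -
  define W where "W = (\<lambda>x :: real ^ 3. w1 + (x $ 1) *\<^sub>R w2 + (x $ 2) *\<^sub>R w3)"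
  define f where "f = (\<lambda>x :: real ^ 3. vec3 (corank2_block (x $ 3) (W x) - (x $ 1) *\<^sub>R A2 - (x $ 2) *\<^sub>R A3))"
  define y where "y = (\<lambda>x :: real ^ 3. kernel_coef (x $ 3) (W x))"
  define U where "U = {x :: real ^ 3. corner_det (x $ 3) (W x) \<noteq> 0}"
  define S where "S = {x :: real ^ 3. corner_det (x $ 3) (W x) \<in> D}"
  define J :: "real ^ 3 \<Rightarrow> real ^ 3 ^ 3" where "J x = (\<chi> i j. if j = 1 then - vec3 (compress (y x) (A2, w2)) $ i else if j = 2 then - vec3 (compress (y x) (A3, w3)) $ i else vec3 (gram (y x)) $ i)" for x
  define uv where "uv = (\<lambda>a :: real ^ 3. (a $ 1, a $ 2, a $ 3))"
  have tvuv: "vec3 (uv a) = a" for a by (simp add: vec_eq_iff forall_3 vec3_nth uv_def)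
  have uvtv: "uv (vec3 p) = p" for p by (simp add: uv_def vec3_nth)
  have contW: "continuous_on T W" for T unfolding W_def by (intro continuous_intros)
  have contc: "continuous_on UNIV (\<lambda>x :: real ^ 3. corner_det (x $ 3) (W x))" by (intro continuous_intros contW)
  have U: "open U" unfolding U_def using contc by (intro open_Collect_neq) auto
  have SU: "S \<subseteq> U" using D0 by (auto simp: S_def U_def)
  have [measurable]: "W \<in> borel_measurable borel" using contW by (rule borel_measurable_continuous_onI)
  have [measurable]: "(\<lambda>x :: real ^ 3. x $ i) \<in> borel_measurable borel" for i
    by (intro borel_measurable_continuous_onI continuous_intros)
  have S: "S \<in> sets borel"
  proof -
    have "(\<lambda>x :: real ^ 3. corner_det (x $ 3) (W x)) \<in> borel_measurable borel" using contc by (rule borel_measurable_continuous_onI)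
    from measurable_sets[OF this D] show ?thesis by (simp add: S_def vimage_def)
  qed
  note [measurable] = S
  have der: "(f has_derivative (\<lambda>h. J x *v h)) (at x)" if x: "x \<in> U" for x
  proof -
    have "(f has_derivative (\<lambda>h. (h $ 3) *\<^sub>R vec3 (gram (y x)) - (h $ 1) *\<^sub>R vec3 (compress (y x) (A2, w2)) - (h $ 2) *\<^sub>R vec3 (compress (y x) (A3, w3)))) (at x)"
      unfolding f_def y_def W_def using x U unfolding U_def W_def by (intro chart_has_derivative) auto
    moreover have "J x *v h = (h $ 3) *\<^sub>R vec3 (gram (y x)) - (h $ 1) *\<^sub>R vec3 (compress (y x) (A2, w2)) - (h $ 2) *\<^sub>R vec3 (compress (y x) (A3, w3))" for h
      by (simp add: vec_eq_iff matrix_vector_mult_def sum_3 J_def mult.commute)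
    ultimately show ?thesis by (simp only:)
  qed
  have conty: "continuous_on U y"
    unfolding y_def by (rule continuous_kernel_coef) (auto simp: U_def intro!: continuous_intros contW)
  have contJ: "continuous_on U J"
    unfolding J_def
  proof (intro continuous_on_vec_lambda)
    fix i j :: 3
    have tvc: "continuous_on U (\<lambda>x. vec3 (q x) $ i)" if "continuous_on U q" for q
      using bounded_linear.continuous_on[OF bounded_linear_vec3 that] by (intro continuous_intros)
    show "continuous_on U (\<lambda>x. if j = 1 then - vec3 (compress (y x) (A2, w2)) $ i else if j = 2 then - vec3 (compress (y x) (A3, w3)) $ i else vec3 (gram (y x)) $ i)"
      using conty by (cases "j = 1"; cases "j = 2"; simp) (intro continuous_on_minus tvc continuous_intros; assumption)+
  qed
  have detJ: "\<bar>det (J x)\<bar> = \<bar>det3 (gram (y x)) (compress (y x) (A2, w2)) (compress (y x) (A3, w3))\<bar>" for x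
  proof -
    have "det (J x) = det3 (gram (y x)) (compress (y x) (A2, w2)) (compress (y x) (A3, w3))"
      unfolding det_3 det3_alt J_def by (simp add: vec3_nth algebra_simps)
    then show ?thesis by simp
  qed
  have [measurable]: "uv \<in> borel_measurable borel"
    unfolding uv_def by (intro borel_measurable_continuous_onI continuous_intros)
  have g: "(\<lambda>a. density_A (uv a)) \<in> borel_measurable borel" by measurable
  have count: "emeasure (count_space UNIV) {x \<in> S. f x = a} = emeasure (count_space UNIV) (sol D (uv a))" for a
  proof -
    have "{x \<in> S. f x = a} = vec3 ` sol D (uv a)"
    proof (intro equalityI subsetI)
      fix x assume x: "x \<in> {x \<in> S. f x = a}"
      have "uv x \<in> sol D (uv a)"
        using x by (auto simp: S_def f_def W_def sol_def w_def uvtv) (auto simp: uv_def uvtv simp flip: uvtv)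
      then show "x \<in> vec3 ` sol D (uv a)" by (metis tvuv imageI)
    next
      fix x assume "x \<in> vec3 ` sol D (uv a)"
      then obtain s t l where p: "(s, t, l) \<in> sol D (uv a)" and x: "x = vec3 (s, t, l)" by auto
      have "x $ 1 = s" "x $ 2 = t" "x $ 3 = l" by (simp_all add: x vec3_nth)
      then show "x \<in> {x \<in> S. f x = a}" using p by (simp add: S_def f_def W_def sol_def w_def tvuv)
    qed
    moreover have "inj_on vec3 (sol D (uv a))" by (rule inj_on_inverseI[of _ uv]) (rule uvtv)
    ultimately show ?thesis by (simp add: count_inj_image)
  qed
  have "(\<integral>\<^sup>+a. density_A a * emeasure (count_space UNIV) (sol D a) \<partial>lborel)
     = (\<integral>\<^sup>+a. density_A (uv a) * emeasure (count_space UNIV) (sol D (uv a)) \<partial>lborel)"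
    by (subst nn_integral_vec3) (simp_all add: vec3_def[symmetric] uvtv)
  also have "\<dots> = (\<integral>\<^sup>+a. density_A (uv a) * emeasure (count_space UNIV) {x \<in> S. f x = a} \<partial>lborel)"
    by (simp only: count)
  also have "\<dots> = (\<integral>\<^sup>+x\<in>S. ennreal \<bar>det (J x)\<bar> * density_A (uv (f x)) \<partial>lborel)"
    by (rule area_formula[OF U der contJ S SU g])
  also have "\<dots> = (\<integral>\<^sup>+x. indicator D (corner_det (x $ 3) (W x)) * (density_A (corank2_block (x $ 3) (W x) - (x $ 1) *\<^sub>R A2 - (x $ 2) *\<^sub>R A3) *
      ennreal \<bar>det3 (gram (kernel_coef (x $ 3) (W x))) (compress (kernel_coef (x $ 3) (W x)) (A2, w2)) (compress (kernel_coef (x $ 3) (W x)) (A3, w3))\<bar>) \<partial>lborel)"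
    by (intro nn_integral_cong) (simp add: detJ f_def uvtv y_def S_def indicator_def mult_ac)
  also have "\<dots> = (\<integral>\<^sup>+p. indicator D (corner_det (snd (snd p)) (w (fst p) (fst (snd p)))) * (density_A (corank2_block (snd (snd p)) (w (fst p) (fst (snd p))) - fst p *\<^sub>R A2 - fst (snd p) *\<^sub>R A3) *
      ennreal \<bar>det3 (gram (kernel_coef (snd (snd p)) (w (fst p) (fst (snd p))))) (compress (kernel_coef (snd (snd p)) (w (fst p) (fst (snd p)))) (A2, w2)) (compress (kernel_coef (snd (snd p)) (w (fst p) (fst (snd p)))) (A3, w3))\<bar>) \<partial>lborel)"
    by (subst nn_integral_vec3, measurable) (simp add: W_def w_def)
  also have "\<dots> = (\<integral>\<^sup>+s. \<integral>\<^sup>+t. \<integral>\<^sup>+l. indicator D (corner_det l (w s t)) * (density_A (corank2_block l (w s t) - s *\<^sub>R A2 - t *\<^sub>R A3) *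
      ennreal \<bar>det3 (gram (kernel_coef l (w s t))) (compress (kernel_coef l (w s t)) (A2, w2)) (compress (kernel_coef l (w s t)) (A3, w3))\<bar>) \<partial>lborel \<partial>lborel \<partial>lborel)"
  proof -
    define H where "H = (\<lambda>p. indicator D (corner_det (snd (snd p)) (w (fst p) (fst (snd p)))) * (density_A (corank2_block (snd (snd p)) (w (fst p) (fst (snd p))) - fst p *\<^sub>R A2 - fst (snd p) *\<^sub>R A3) *
      ennreal \<bar>det3 (gram (kernel_coef (snd (snd p)) (w (fst p) (fst (snd p))))) (compress (kernel_coef (snd (snd p)) (w (fst p) (fst (snd p)))) (A2, w2)) (compress (kernel_coef (snd (snd p)) (w (fst p) (fst (snd p)))) (A3, w3))\<bar>))"
    have "(\<lambda>p :: real \<times> real \<times> real. w (fst p) (fst (snd p))) \<in> borel_measurable borel"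
      unfolding w_def by (intro borel_measurable_continuous_onI continuous_intros)
    moreover have "(\<lambda>p :: real \<times> real \<times> real. fst p) \<in> borel_measurable borel" "(\<lambda>p :: real \<times> real \<times> real. fst (snd p)) \<in> borel_measurable borel"
      "(\<lambda>p :: real \<times> real \<times> real. snd (snd p)) \<in> borel_measurable borel"
      by (intro borel_measurable_continuous_onI continuous_intros)+
    ultimately have [measurable]: "H \<in> borel_measurable borel"
      unfolding H_def by (intro borel_measurable_times_ennreal measurable_compose[OF _ measurable_ennreal] borel_measurable_abs det3_measurable2 gram_measurable
          compress_measurable2 chart_measurable measurable_const measurable_compose[OF _ g_measurable(1)] borel_measurable_diff borel_measurable_scaleR
          measurable_compose[OF _ borel_measurable_indicator[OF D]]) simp_all
    have "(\<integral>\<^sup>+p. H p \<partial>lborel) = (\<integral>\<^sup>+s. \<integral>\<^sup>+q. H (s, q) \<partial>lborel \<partial>lborel)" by (rule nn_integral_pair) measurable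
    also have "\<dots> = (\<integral>\<^sup>+s. \<integral>\<^sup>+t. \<integral>\<^sup>+l. H (s, t, l) \<partial>lborel \<partial>lborel \<partial>lborel)"
      by (rule nn_integral_cong, rule nn_integral_pair) measurable
    finally show ?thesis by (simp add: H_def)
  qed
  finally show ?thesis .
qed

text \<open>The number of \<open>(s, t, l)\<close> for which \<open>v\<^sub>1 + s v\<^sub>2 + t
  v\<^sub>3 - l I\<close> has corank at least two and lies in the sector \<open>D\<close>.\<close>
definition ncount :: "real set \<Rightarrow> sym4 \<times> sym4 \<times> sym4 \<Rightarrow> ennreal" where
  "ncount D v = emeasure (count_space UNIV) {(s, t, l). corner_det l (snd (fst v + s *\<^sub>R fst (snd v) + t *\<^sub>R snd (snd v))) \<in> D \<and>
      adj (fst v + s *\<^sub>R fst (snd v) + t *\<^sub>R snd (snd v) - l *\<^sub>R sym_id) = 0}"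

lemma ncount_measurable:
  assumes D: "open D"
  shows "ncount D \<in> borel_measurable borel"
proof -
  let ?u = "\<lambda>q :: (real \<times> real \<times> real) \<times> (sym4 \<times> sym4 \<times> sym4). fst (snd q) + fst (fst q) *\<^sub>R fst (snd (snd q)) + fst (snd (fst q)) *\<^sub>R snd (snd (snd q))"
  have "closed {q. adj (?u q - snd (snd (fst q)) *\<^sub>R sym_id) = 0}"
    by (intro closed_Collect_eq continuous_intros)
  moreover have "open {q. corner_det (snd (snd (fst q))) (snd (?u q)) \<in> D}"
    using open_vimage[OF D, of "\<lambda>q. corner_det (snd (snd (fst q))) (snd (?u q))"] by (simp add: vimage_def continuous_intros)
  ultimately have "fsigma ({q. adj (?u q - snd (snd (fst q)) *\<^sub>R sym_id) = 0} \<inter> {q. corner_det (snd (snd (fst q))) (snd (?u q)) \<in> D})"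
    by (rule fsigma_closed_Int_open)
  from count_solutions_measurable[OF this] show ?thesis
    by (rule measurable_cong[THEN iffD1, rotated]) (auto simp: ncount_def intro!: arg_cong[where f="emeasure (count_space UNIV)"])
qed

lemma nn_integral_triple:
  fixes f :: "real \<times> real \<times> real \<Rightarrow> ennreal"
  assumes f [measurable]: "f \<in> borel_measurable borel"
  shows "(\<integral>\<^sup>+x. f x \<partial>lborel) = (\<integral>\<^sup>+s. \<integral>\<^sup>+t. \<integral>\<^sup>+l. f (s, t, l) \<partial>lborel \<partial>lborel \<partial>lborel)"
  by (subst nn_integral_pair, measurable, rule nn_integral_cong, subst nn_integral_pair, measurable)

lemma nn_integral_shift:
  fixes f :: "'a::euclidean_space \<Rightarrow> ennreal"
  assumes "f \<in> borel_measurable borel"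
  shows "(\<integral>\<^sup>+x. f x \<partial>lborel) = (\<integral>\<^sup>+x. f (x - c) \<partial>lborel)"
  using nn_integral_lborel_affine[OF assms, of 1 "- c"] by simp

text \<open>Fubini together with a translation of the last variable by an amount that depends on
  the others.\<close>
lemma nn_integral_exchange_shift:
  fixes K :: "(real \<times> real \<times> real) \<times> ('a::euclidean_space \<times> 'b::euclidean_space) \<times> 'c::euclidean_space \<Rightarrow> ennreal"
  assumes K [measurable]: "K \<in> borel_measurable borel"
    and shifted [measurable]: "(\<lambda>p. K (fst p, fst (snd p), snd (snd p) - \<tau> (fst p) (fst (snd p)))) \<in> borel_measurable borel"
  shows "(\<integral>\<^sup>+u. \<integral>\<^sup>+w. \<integral>\<^sup>+s. \<integral>\<^sup>+t. \<integral>\<^sup>+l. K ((s, t, l), u, w) \<partial>lborel \<partial>lborel \<partial>lborel \<partial>lborel \<partial>lborel)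
    = (\<integral>\<^sup>+s. \<integral>\<^sup>+t. \<integral>\<^sup>+l. \<integral>\<^sup>+w. \<integral>\<^sup>+v'. \<integral>\<^sup>+v. K ((s, t, l), (v, v'), w - \<tau> (s, t, l) (v, v')) \<partial>lborel \<partial>lborel \<partial>lborel \<partial>lborel \<partial>lborel \<partial>lborel)"
proof -
  define L where "L = (\<lambda>p. K (fst p, fst (snd p), snd (snd p) - \<tau> (fst p) (fst (snd p))))"
  have Lm [measurable]: "L \<in> borel_measurable borel" using shifted by (simp add: L_def)
  have L: "K (x, u, w - \<tau> x u) = L (x, u, w)" for x u w by (simp add: L_def)
  have Km: "(\<lambda>w. K (x, u, w)) \<in> borel_measurable borel" for x u by measurable
  have "(\<integral>\<^sup>+u. \<integral>\<^sup>+w. \<integral>\<^sup>+s. \<integral>\<^sup>+t. \<integral>\<^sup>+l. K ((s, t, l), u, w) \<partial>lborel \<partial>lborel \<partial>lborel \<partial>lborel \<partial>lborel)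
    = (\<integral>\<^sup>+u. \<integral>\<^sup>+w. \<integral>\<^sup>+x. K (x, u, w) \<partial>lborel \<partial>lborel \<partial>lborel)"
    by (intro nn_integral_cong nn_integral_triple[symmetric]) measurable
  also have "\<dots> = (\<integral>\<^sup>+q. \<integral>\<^sup>+x. K (x, q) \<partial>lborel \<partial>lborel)"
  proof -
    have "(\<lambda>q. \<integral>\<^sup>+x. K (x, q) \<partial>lborel) \<in> borel_measurable borel"
      using lborel.borel_measurable_nn_integral[of "\<lambda>q x. K (x, q)" borel] by simp
    then show ?thesis by (rule nn_integral_pair[symmetric])
  qed
  also have "\<dots> = (\<integral>\<^sup>+\<theta>. K \<theta> \<partial>lborel)" by (rule nn_integral_pair_swap[OF K, symmetric])
  also have "\<dots> = (\<integral>\<^sup>+x. \<integral>\<^sup>+q. K (x, q) \<partial>lborel \<partial>lborel)" by (rule nn_integral_pair[OF K])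
  also have "\<dots> = (\<integral>\<^sup>+x. \<integral>\<^sup>+u. \<integral>\<^sup>+w. L (x, u, w) \<partial>lborel \<partial>lborel \<partial>lborel)"
  proof (rule nn_integral_cong)
    fix x
    have "(\<integral>\<^sup>+q. K (x, q) \<partial>lborel) = (\<integral>\<^sup>+u. \<integral>\<^sup>+w. K (x, u, w) \<partial>lborel \<partial>lborel)"
      by (rule nn_integral_pair) measurable
    also have "\<dots> = (\<integral>\<^sup>+u. \<integral>\<^sup>+w. K (x, u, w - \<tau> x u) \<partial>lborel \<partial>lborel)"
      by (rule nn_integral_cong) (rule nn_integral_shift[OF Km])
    finally show "(\<integral>\<^sup>+q. K (x, q) \<partial>lborel) = (\<integral>\<^sup>+u. \<integral>\<^sup>+w. L (x, u, w) \<partial>lborel \<partial>lborel)" unfolding L .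
  qed
  also have "\<dots> = (\<integral>\<^sup>+x. \<integral>\<^sup>+w. \<integral>\<^sup>+v'. \<integral>\<^sup>+v. L (x, (v, v'), w) \<partial>lborel \<partial>lborel \<partial>lborel \<partial>lborel)"
  proof (rule nn_integral_cong)
    fix x
    have m: "(\<lambda>q. L (x, q)) \<in> borel_measurable borel" by measurable
    have "(\<integral>\<^sup>+u. \<integral>\<^sup>+w. L (x, u, w) \<partial>lborel \<partial>lborel) = (\<integral>\<^sup>+w. \<integral>\<^sup>+u. L (x, u, w) \<partial>lborel \<partial>lborel)"
      using nn_integral_pair[OF m] nn_integral_pair_swap[OF m] by simp
    also have "\<dots> = (\<integral>\<^sup>+w. \<integral>\<^sup>+v'. \<integral>\<^sup>+v. L (x, (v, v'), w) \<partial>lborel \<partial>lborel \<partial>lborel)"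
      by (rule nn_integral_cong, rule nn_integral_pair_swap) measurable
    finally show "(\<integral>\<^sup>+u. \<integral>\<^sup>+w. L (x, u, w) \<partial>lborel \<partial>lborel) = (\<integral>\<^sup>+w. \<integral>\<^sup>+v'. \<integral>\<^sup>+v. L (x, (v, v'), w) \<partial>lborel \<partial>lborel \<partial>lborel)" .
  qed
  also have "\<dots> = (\<integral>\<^sup>+s. \<integral>\<^sup>+t. \<integral>\<^sup>+l. \<integral>\<^sup>+w. \<integral>\<^sup>+v'. \<integral>\<^sup>+v. L ((s, t, l), (v, v'), w) \<partial>lborel \<partial>lborel \<partial>lborel \<partial>lborel \<partial>lborel \<partial>lborel)"
  proof (rule nn_integral_triple)
    have L4: "(\<lambda>p. L (fst (fst (fst p)), (snd p, snd (fst p)), snd (fst (fst p)))) \<in> borel_measurable borel"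
      by (rule measurable_compose[OF _ Lm], intro borel_measurable_continuous_onI continuous_intros)
    have "(\<lambda>p. \<integral>\<^sup>+v. L (fst (fst p), (v, snd p), snd (fst p)) \<partial>lborel) \<in> borel_measurable borel"
      using lborel.borel_measurable_nn_integral[of "\<lambda>p v. L (fst (fst p), (v, snd p), snd (fst p))" borel] L4
      by (simp add: case_prod_beta' borel_prod)
    then have "(\<lambda>p. \<integral>\<^sup>+v'. \<integral>\<^sup>+v. L (fst p, (v, v'), snd p) \<partial>lborel \<partial>lborel) \<in> borel_measurable borel"
      using lborel.borel_measurable_nn_integral[of "\<lambda>p v'. \<integral>\<^sup>+v. L (fst p, (v, v'), snd p) \<partial>lborel" borel]
      by (simp add: case_prod_beta' borel_prod)
    then show "(\<lambda>x. \<integral>\<^sup>+w. \<integral>\<^sup>+v'. \<integral>\<^sup>+v. L (x, (v, v'), w) \<partial>lborel \<partial>lborel \<partial>lborel) \<in> borel_measurable borel"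
      using lborel.borel_measurable_nn_integral[of "\<lambda>x w. \<integral>\<^sup>+v'. \<integral>\<^sup>+v. L (x, (v, v'), w) \<partial>lborel \<partial>lborel" borel]
      by (simp add: case_prod_beta' borel_prod)
  qed
  finally show ?thesis unfolding L .
qed

text \<open>The area formula expresses the expectation as an integral over \<open>(s, t,
  l)\<close> and the remaining entries. Replacing the blocks of the first matrix by those of
  \<open>v\<^sub>1 + s v\<^sub>2 + t v\<^sub>3\<close> turns the integrand into the one evaluated
  before.\<close>
lemma expected_count:
  assumes D: "D = - {0} \<or> D = {0<..}"
  shows "(\<integral>\<^sup>+v. goe_density (fst v) * (goe_density (fst (snd v)) * goe_density (snd (snd v))) * ncount D v \<partial>lborel) = ennreal (2 * sector_constant D)"
proof -
  have Do: "open D" and D0: "0 \<notin> D" using D by auto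
  have Db [measurable]: "D \<in> sets borel" using Do by simp
  note nm [measurable] = ncount_measurable[OF Do]
  define K :: "(real \<times> real \<times> real) \<times> (sym4 \<times> sym4) \<times> block7 \<times> block7 \<Rightarrow> ennreal" where
    "K = (\<lambda>p. density_W (snd (snd (snd p))) * (goe_density (fst (fst (snd p))) * goe_density (snd (fst (snd p)))) * (indicator D (corner_det (snd (snd (fst p))) (fst (snd (snd p)))) *
      (density_A (corank2_block (snd (snd (fst p))) (fst (snd (snd p))) - fst (fst p) *\<^sub>R fst (fst (fst (snd p))) - fst (snd (fst p)) *\<^sub>R fst (snd (fst (snd p)))) *
      ennreal \<bar>det3 (gram (kernel_coef (snd (snd (fst p))) (fst (snd (snd p))))) (compress (kernel_coef (snd (snd (fst p))) (fst (snd (snd p)))) (fst (fst (snd p))))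
        (compress (kernel_coef (snd (snd (fst p))) (fst (snd (snd p)))) (snd (fst (snd p))))\<bar>)))"
  have Km: "K \<in> borel_measurable borel"
  proof -
    show ?thesis
      unfolding K_def by (intro borel_measurable_times_ennreal measurable_compose[OF _ measurable_ennreal] borel_measurable_abs det3_measurable2 gram_measurable
          compress_measurable2 chart_measurable measurable_compose[OF _ g_measurable(1)] measurable_compose[OF _ g_measurable(2)] measurable_compose[OF _ g_measurable(3)] borel_measurable_diff borel_measurable_scaleR
          measurable_compose[OF _ borel_measurable_indicator[OF Db]] borel_measurable_fst_comp borel_measurable_snd_comp) simp_all
  qed
  have slice: "(\<integral>\<^sup>+a. density_A a * ncount D ((a, w1), v2, v3) \<partial>lborel) =
    (\<integral>\<^sup>+s. \<integral>\<^sup>+t. \<integral>\<^sup>+l. indicator D (corner_det l (w1 + s *\<^sub>R snd v2 + t *\<^sub>R snd v3)) * (density_A (corank2_block l (w1 + s *\<^sub>R snd v2 + t *\<^sub>R snd v3) - s *\<^sub>R fst v2 - t *\<^sub>R fst v3) *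
      ennreal \<bar>det3 (gram (kernel_coef l (w1 + s *\<^sub>R snd v2 + t *\<^sub>R snd v3))) (compress (kernel_coef l (w1 + s *\<^sub>R snd v2 + t *\<^sub>R snd v3)) v2) (compress (kernel_coef l (w1 + s *\<^sub>R snd v2 + t *\<^sub>R snd v3)) v3)\<bar>) \<partial>lborel \<partial>lborel \<partial>lborel)" for w1 v2 v3
  proof -
    have eq: "ncount D ((a, w1), v2, v3) = emeasure (count_space UNIV) {(s, t, l). corner_det l (w1 + s *\<^sub>R snd v2 + t *\<^sub>R snd v3) \<in> D \<and>
        corank2_block l (w1 + s *\<^sub>R snd v2 + t *\<^sub>R snd v3) - s *\<^sub>R fst v2 - t *\<^sub>R fst v3 = a}" for a
    proof -
      have "adj ((a, w1) + s *\<^sub>R v2 + t *\<^sub>R v3 - l *\<^sub>R sym_id) = 0 \<longleftrightarrow> corank2_block l (w1 + s *\<^sub>R snd v2 + t *\<^sub>R snd v3) - s *\<^sub>R fst v2 - t *\<^sub>R fst v3 = a"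
        if "corner_det l (w1 + s *\<^sub>R snd v2 + t *\<^sub>R snd v3) \<in> D" for s t l
      proof -
        have c: "corner_det l (w1 + s *\<^sub>R snd v2 + t *\<^sub>R snd v3) \<noteq> 0" using that D0 by auto
        have "(a, w1) + s *\<^sub>R v2 + t *\<^sub>R v3 = (a + s *\<^sub>R fst v2 + t *\<^sub>R fst v3, w1 + s *\<^sub>R snd v2 + t *\<^sub>R snd v3)"
          by (simp add: prod_eq_iff)
        then show ?thesis by (simp only: adj_chart[OF c]) (auto simp: algebra_simps)
      qed
      then show ?thesis unfolding ncount_def by (intro arg_cong[where f="emeasure (count_space UNIV)"]) auto
    qed
    have "(\<lambda>a. ncount D ((a, w1), v2, v3)) \<in> borel_measurable borel" by measurable
    then show ?thesis
      unfolding eq using chart_area[OF Db D0, of w1 "snd v2" "snd v3" "fst v2" "fst v3"] by simp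
  qed
  have "(\<integral>\<^sup>+v. goe_density (fst v) * (goe_density (fst (snd v)) * goe_density (snd (snd v))) * ncount D v \<partial>lborel)
    = (\<integral>\<^sup>+u. \<integral>\<^sup>+v1. goe_density v1 * (goe_density (fst u) * goe_density (snd u)) * ncount D (v1, u) \<partial>lborel \<partial>lborel)"
  proof -
    have m: "(\<lambda>v. goe_density (fst v) * (goe_density (fst (snd v)) * goe_density (snd (snd v))) * ncount D v) \<in> borel_measurable borel"
      by (intro borel_measurable_times_ennreal nm measurable_compose[OF _ g_measurable(3)] borel_measurable_continuous_onI continuous_intros)
    show ?thesis by (subst nn_integral_pair_swap[OF m]) simp
  qed
  also have "\<dots> = (\<integral>\<^sup>+u. \<integral>\<^sup>+w1. \<integral>\<^sup>+a. density_W w1 * (goe_density (fst u) * goe_density (snd u)) * (density_A a * ncount D ((a, w1), u)) \<partial>lborel \<partial>lborel \<partial>lborel)"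
  proof (rule nn_integral_cong)
    fix u :: "sym4 \<times> sym4"
    have "(\<integral>\<^sup>+v1. goe_density v1 * (goe_density (fst u) * goe_density (snd u)) * ncount D (v1, u) \<partial>lborel) = (\<integral>\<^sup>+w1. \<integral>\<^sup>+a. goe_density (a, w1) * (goe_density (fst u) * goe_density (snd u)) * ncount D ((a, w1), u) \<partial>lborel \<partial>lborel)"
      by (rule nn_integral_pair_swap) measurable
    then show "(\<integral>\<^sup>+v1. goe_density v1 * (goe_density (fst u) * goe_density (snd u)) * ncount D (v1, u) \<partial>lborel) = (\<integral>\<^sup>+w1. \<integral>\<^sup>+a. density_W w1 * (goe_density (fst u) * goe_density (snd u)) * (density_A a * ncount D ((a, w1), u)) \<partial>lborel \<partial>lborel)"
      by (simp add: goe_density_def product_density_def mult_ac)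
  qed
  also have "\<dots> = (\<integral>\<^sup>+u. \<integral>\<^sup>+w1. density_W w1 * (goe_density (fst u) * goe_density (snd u)) * (\<integral>\<^sup>+a. density_A a * ncount D ((a, w1), fst u, snd u) \<partial>lborel) \<partial>lborel \<partial>lborel)"
    by (intro nn_integral_cong) (simp add: nn_integral_cmult)
  also have "\<dots> = (\<integral>\<^sup>+u. \<integral>\<^sup>+w1. \<integral>\<^sup>+s. \<integral>\<^sup>+t. \<integral>\<^sup>+l. density_W w1 * (goe_density (fst u) * goe_density (snd u)) * (indicator D (corner_det l (w1 + s *\<^sub>R snd (fst u) + t *\<^sub>R snd (snd u))) * (density_A (corank2_block l (w1 + s *\<^sub>R snd (fst u) + t *\<^sub>R snd (snd u)) - s *\<^sub>R fst (fst u) - t *\<^sub>R fst (snd u)) *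
      ennreal \<bar>det3 (gram (kernel_coef l (w1 + s *\<^sub>R snd (fst u) + t *\<^sub>R snd (snd u)))) (compress (kernel_coef l (w1 + s *\<^sub>R snd (fst u) + t *\<^sub>R snd (snd u))) (fst u)) (compress (kernel_coef l (w1 + s *\<^sub>R snd (fst u) + t *\<^sub>R snd (snd u))) (snd u))\<bar>)) \<partial>lborel \<partial>lborel \<partial>lborel \<partial>lborel \<partial>lborel)"
    unfolding slice by (intro nn_integral_cong) (simp add: nn_integral_cmult)
  also have "\<dots> = (\<integral>\<^sup>+u. \<integral>\<^sup>+w1. \<integral>\<^sup>+s. \<integral>\<^sup>+t. \<integral>\<^sup>+l. K ((s, t, l), u, w1 + s *\<^sub>R snd (fst u) + t *\<^sub>R snd (snd u), w1) \<partial>lborel \<partial>lborel \<partial>lborel \<partial>lborel \<partial>lborel)"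
    by (simp add: K_def)
  also have "\<dots> = (\<integral>\<^sup>+s. \<integral>\<^sup>+t. \<integral>\<^sup>+l. \<integral>\<^sup>+w. \<integral>\<^sup>+v'. \<integral>\<^sup>+v. K ((s, t, l), (v, v'), w, w - (s *\<^sub>R snd v + t *\<^sub>R snd v')) \<partial>lborel \<partial>lborel \<partial>lborel \<partial>lborel \<partial>lborel \<partial>lborel)"
  proof -
    let ?\<tau> = "\<lambda>x u. fst x *\<^sub>R snd (fst u) + fst (snd x) *\<^sub>R snd (snd u)"
    let ?K = "\<lambda>p. K (fst p, fst (snd p), snd (snd p) + ?\<tau> (fst p) (fst (snd p)), snd (snd p))"
    have "?K \<in> borel_measurable borel"
      by (rule measurable_compose[OF _ Km]) (intro borel_measurable_continuous_onI continuous_intros)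
    moreover have "(\<lambda>p. ?K (fst p, fst (snd p), snd (snd p) - ?\<tau> (fst p) (fst (snd p)))) \<in> borel_measurable borel"
      by (rule measurable_compose[OF _ Km]) (intro borel_measurable_continuous_onI continuous_intros)
    ultimately show ?thesis using nn_integral_exchange_shift[of ?K ?\<tau>] by (simp add: add.assoc)
  qed
  also have "\<dots> = (\<integral>\<^sup>+s. \<integral>\<^sup>+t. \<integral>\<^sup>+l. \<integral>\<^sup>+w. indicator D (corner_det l w) *
      (\<integral>\<^sup>+v'. goe_density v' * (\<integral>\<^sup>+v. goe_density v * (goe_density ((corank2_block l w, w) - t *\<^sub>R v' - s *\<^sub>R v) *
         ennreal \<bar>det3 (gram (kernel_coef l w)) (compress (kernel_coef l w) v) (compress (kernel_coef l w) v')\<bar>) \<partial>lborel) \<partial>lborel) \<partial>lborel \<partial>lborel \<partial>lborel \<partial>lborel)"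
  proof (intro nn_integral_cong)
    fix s t l :: real and w :: block7
    show "(\<integral>\<^sup>+v'. \<integral>\<^sup>+v. K ((s, t, l), (v, v'), w, w - (s *\<^sub>R snd v + t *\<^sub>R snd v')) \<partial>lborel \<partial>lborel) = indicator D (corner_det l w) *
      (\<integral>\<^sup>+v'. goe_density v' * (\<integral>\<^sup>+v. goe_density v * (goe_density ((corank2_block l w, w) - t *\<^sub>R v' - s *\<^sub>R v) *
         ennreal \<bar>det3 (gram (kernel_coef l w)) (compress (kernel_coef l w) v) (compress (kernel_coef l w) v')\<bar>) \<partial>lborel) \<partial>lborel)"
    proof (cases "corner_det l w \<in> D")
      case True
      have "goe_density ((corank2_block l w, w) - t *\<^sub>R v' - s *\<^sub>R v) = density_A (corank2_block l w - s *\<^sub>R fst v - t *\<^sub>R fst v') * density_W (w - (s *\<^sub>R snd v + t *\<^sub>R snd v'))" for v v'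
      proof -
        have "(corank2_block l w, w) - t *\<^sub>R v' - s *\<^sub>R v = (corank2_block l w - s *\<^sub>R fst v - t *\<^sub>R fst v', w - (s *\<^sub>R snd v + t *\<^sub>R snd v'))"
          by (rule prod_eqI) simp_all
        then show ?thesis by (simp only: goe_density_def product_density_def split)
      qed
      then have "K ((s, t, l), (v, v'), w, w - (s *\<^sub>R snd v + t *\<^sub>R snd v')) = goe_density v' * (goe_density v * (goe_density ((corank2_block l w, w) - t *\<^sub>R v' - s *\<^sub>R v) *
         ennreal \<bar>det3 (gram (kernel_coef l w)) (compress (kernel_coef l w) v) (compress (kernel_coef l w) v')\<bar>))" for v v'
        using True by (simp add: K_def mult_ac)
      moreover have "(\<lambda>v. goe_density v * (goe_density ((corank2_block l w, w) - t *\<^sub>R v' - s *\<^sub>R v) *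
         ennreal \<bar>det3 (gram (kernel_coef l w)) (compress (kernel_coef l w) v) (compress (kernel_coef l w) v')\<bar>)) \<in> borel_measurable borel" for v'
        by (intro borel_measurable_times_ennreal g_measurable(3) measurable_compose[OF _ measurable_ennreal] borel_measurable_abs det3_measurable2
          compress_measurable2 measurable_compose[OF _ g_measurable(3)]) simp_all
      ultimately show ?thesis using True by (simp add: nn_integral_cmult)
    qed (simp add: K_def)
  qed
  also have "\<dots> = ennreal (2 * sector_constant D)" by (rule total_integral[OF D])
  finally show ?thesis .
qed

section \<open>Singular points on the sphere\<close>

text \<open>The pencil in terms of the upper triangular entries.\<close>
definition sym_pencil :: "sym4 \<times> sym4 \<times> sym4 \<Rightarrow> real ^ 4 \<Rightarrow> sym4" where
  "sym_pencil v x = (x $ 0) *\<^sub>R sym_id + (1 / sqrt 24) *\<^sub>R ((x $ 1) *\<^sub>R fst v + (x $ 2) *\<^sub>R fst (snd v) + (x $ 3) *\<^sub>R snd (snd v))"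

lemma entries_pencil: "entries (pencil Q1 Q2 Q3 x) = sym_pencil (entries Q1, entries Q2, entries Q3) x"
  by (simp add: entries_def pencil_def sym_pencil_def sym_id_def mat_def)

lemma transpose_pencil:
  assumes "transpose Q1 = Q1" "transpose Q2 = Q2" "transpose Q3 = Q3"
  shows "transpose (pencil Q1 Q2 Q3 x) = pencil Q1 Q2 Q3 x"
proof -
  have s: "A $ i $ j = A $ j $ i" if t: "transpose A = A" for A :: "real ^ 4 ^ 4" and i j
  proof -
    have "transpose A $ j $ i = A $ i $ j" by (simp add: transpose_def)
    then show ?thesis unfolding t by simp
  qed
  have "pencil Q1 Q2 Q3 x $ i $ j = pencil Q1 Q2 Q3 x $ j $ i" for i j
    unfolding pencil_def by (simp add: s[OF assms(1), of i j] s[OF assms(2), of i j] s[OF assms(3), of i j] mat_def)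
  then show ?thesis by (simp add: vec_eq_iff transpose_def)
qed

lemma sym_pencil_has_derivative: "(sym_pencil v has_derivative sym_pencil v) (at x)"
proof (rule bounded_linear_imp_has_derivative)
  have "linear (sym_pencil v)"
  proof (rule linearI)
    show "sym_pencil v (x + y) = sym_pencil v x + sym_pencil v y" for x y
      by (rule prod_eqI) (simp_all add: sym_pencil_def scaleR_add_left scaleR_add_right)
    show "sym_pencil v (c *\<^sub>R x) = c *\<^sub>R sym_pencil v x" for c x
      by (rule prod_eqI) (simp_all add: sym_pencil_def scaleR_add_left scaleR_add_right mult_ac)
  qed
  then show "bounded_linear (sym_pencil v)" by (simp add: linear_conv_bounded_linear)
qed

lemma trace_form_zero_left: "trace_form 0 u = 0"
  by (cases u rule: adj.cases) (simp add: zero_prod_def)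

lemma gderiv_zero_iff:
  assumes "(f has_derivative f') (at x)"
  shows "GDERIV f x :> 0 \<longleftrightarrow> (\<forall>h. f' h = 0)"
proof
  assume "GDERIV f x :> 0"
  then have "f' = (\<lambda>h. h \<bullet> 0)" unfolding gderiv_def by (rule has_derivative_unique[OF assms])
  then show "\<forall>h. f' h = 0" by simp
next
  assume "\<forall>h. f' h = 0"
  then have "f' = (\<lambda>h. h \<bullet> 0)" by auto
  then show "GDERIV f x :> 0" using assms unfolding gderiv_def by simp
qed

text \<open>Differentiating in the direction of the identity shows that the trace of the adjugate
  vanishes at a singular point. With the vanishing determinant this forces corank two. Conversely,
  all derivatives of the determinant factor through the adjugate.\<close>
lemma sing_symmetroid_iff_adj:
  assumes sym: "transpose Q1 = Q1" "transpose Q2 = Q2" "transpose Q3 = Q3"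
  shows "sing_symmetroid Q1 Q2 Q3 = {x. norm x = 1 \<and> adj (sym_pencil (entries Q1, entries Q2, entries Q3) x) = 0}"
proof -
  define L where "L = sym_pencil (entries Q1, entries Q2, entries Q3)"
  have f: "det (pencil Q1 Q2 Q3 y) = sdet (L y)" for y
    unfolding L_def entries_pencil[symmetric] by (rule det_sym[OF transpose_pencil[OF sym]])
  have der: "((\<lambda>y. sdet (L y)) has_derivative (\<lambda>h. trace_form (adj (L x)) (L h))) (at x)" for x
    unfolding L_def by (rule has_derivative_compose[OF sym_pencil_has_derivative sdet_has_derivative])
  have e0: "L (axis 0 1) = sym_id" by (rule prod_eqI) (simp_all add: L_def sym_pencil_def axis_def)
  have "sdet (L x) = 0 \<and> (\<forall>h. trace_form (adj (L x)) (L h) = 0) \<longleftrightarrow> adj (L x) = 0" for x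
  proof
    assume *: "sdet (L x) = 0 \<and> (\<forall>h. trace_form (adj (L x)) (L h) = 0)"
    then have "trace_form (adj (L x)) sym_id = 0" using e0 by metis
    then show "adj (L x) = 0" using adj_trace_zero * by blast
  next
    assume z: "adj (L x) = 0"
    have "4 * sdet (L x) = 0" using adj_sdet[of "L x"] unfolding z by (simp add: trace_form_zero_left)
    then show "sdet (L x) = 0 \<and> (\<forall>h. trace_form (adj (L x)) (L h) = 0)" unfolding z by (simp add: trace_form_zero_left)
  qed
  then show ?thesis
    unfolding sing_symmetroid_def symmetroid_def f gderiv_zero_iff[OF der] L_def[symmetric] by auto
qed

lemma sing_spectrahedron_iff_adj:
  assumes sym: "transpose Q1 = Q1" "transpose Q2 = Q2" "transpose Q3 = Q3"
  shows "sing_spectrahedron Q1 Q2 Q3 = {x. norm x = 1 \<and> adj (sym_pencil (entries Q1, entries Q2, entries Q3) x) = 0 \<and>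
    (\<forall>u. 0 \<le> qform (sym_pencil (entries Q1, entries Q2, entries Q3) x) u)}"
  unfolding sing_spectrahedron_def sing_symmetroid_iff_adj[OF sym] spectrahedron_def psd_def
    qform_sym[OF transpose_pencil[OF sym]] entries_pencil by (auto simp: transpose_pencil[OF sym])

text \<open>The point with \<open>x\<^sub>1 = 1\<close> on the line through the origin that
  belongs to the solution \<open>(s, t, l)\<close>. The factor \<open>\<surd>24\<close> undoes the
  scaling of the \<open>Q\<^sub>k\<close> relative to the identity.\<close>
definition chart_point :: "real \<times> real \<times> real \<Rightarrow> real ^ 4" where
  "chart_point p = (\<chi> i. if i = 0 then - snd (snd p) / sqrt 24 else if i = 1 then 1 else if i = 2 then fst p else fst (snd p))"

definition sphere_chart :: "real ^ 4 \<Rightarrow> real \<times> real \<times> real" where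
  "sphere_chart x = (x $ 2 / x $ 1, x $ 3 / x $ 1, - sqrt 24 * x $ 0 / x $ 1)"

lemma chart_point_nth: "chart_point p $ 0 = - snd (snd p) / sqrt 24" "chart_point p $ 1 = 1" "chart_point p $ 2 = fst p" "chart_point p $ 3 = fst (snd p)"
  by (simp_all add: chart_point_def)

lemma norm_chart_point: "norm (chart_point p) > 0"
proof -
  have "chart_point p \<noteq> 0" using chart_point_nth(2)[of p] by (metis zero_index zero_neq_one)
  then show ?thesis by simp
qed

lemma sphere_chart_point: "c \<noteq> 0 \<Longrightarrow> sphere_chart (c *\<^sub>R chart_point p) = p"
  by (cases p) (simp add: sphere_chart_def chart_point_nth)

lemma sym_pencil_chart_point:
  "sym_pencil v (c *\<^sub>R chart_point (s, t, l)) = (c / sqrt 24) *\<^sub>R (fst v + s *\<^sub>R fst (snd v) + t *\<^sub>R snd (snd v) - l *\<^sub>R sym_id)"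
proof -
  have "sym_pencil v (c *\<^sub>R chart_point (s, t, l)) = - (c * (l / sqrt 24)) *\<^sub>R sym_id + (1 / sqrt 24) *\<^sub>R (c *\<^sub>R fst v + (c * s) *\<^sub>R fst (snd v) + (c * t) *\<^sub>R snd (snd v))"
    by (simp add: sym_pencil_def chart_point_nth)
  also have "\<dots> = (c / sqrt 24) *\<^sub>R (fst v + s *\<^sub>R fst (snd v) + t *\<^sub>R snd (snd v) - l *\<^sub>R sym_id)"
    by (simp add: scaleR_add_right scaleR_diff_right)
  finally show ?thesis .
qed

text \<open>The three clauses exclude, in turn, solutions outside the corank-two chart, singular
  points with \<open>x\<^sub>1 = 0 \<noteq> x\<^sub>2\<close> and singular points with
  \<open>x\<^sub>1 = x\<^sub>2 = 0\<close>. For the last, the identity itself is never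
  singular.\<close>
definition generic :: "sym4 \<times> sym4 \<times> sym4 \<Rightarrow> bool" where
  "generic v \<longleftrightarrow> (\<forall>s t l. adj (fst v + s *\<^sub>R fst (snd v) + t *\<^sub>R snd (snd v) - l *\<^sub>R sym_id) = 0 \<longrightarrow> corner_det l (snd (fst v + s *\<^sub>R fst (snd v) + t *\<^sub>R snd (snd v))) \<noteq> 0)
    \<and> (\<forall>t l. adj (fst (snd v) + t *\<^sub>R snd (snd v) - l *\<^sub>R sym_id) \<noteq> 0) \<and> (\<forall>l. adj (snd (snd v) - l *\<^sub>R sym_id) \<noteq> 0)"

lemma vec4_eq_iff: "x = y \<longleftrightarrow> x $ 0 = y $ 0 \<and> x $ 1 = y $ 1 \<and> x $ 2 = y $ 2 \<and> x $ 3 = (y :: real ^ 4) $ 3"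
  unfolding vec_eq_iff forall_4 four_eq_zero by auto

lemma generic_first_coordinate:
  assumes g: "generic v" and x: "norm x = 1" "adj (sym_pencil v x) = 0"
  shows "x $ 1 \<noteq> 0"
proof
  assume x1: "x $ 1 = 0"
  obtain v1 v2 v3 where v: "v = (v1, v2, v3)" by (cases v)
  show False
  proof (cases "x $ 2 = 0")
    case False
    have "sym_pencil v x = (x $ 2 / sqrt 24) *\<^sub>R (v2 + (x $ 3 / x $ 2) *\<^sub>R v3 - (- sqrt 24 * x $ 0 / x $ 2) *\<^sub>R sym_id)"
      using False by (simp add: sym_pencil_def v x1 scaleR_add_right)
    then have "adj (v2 + (x $ 3 / x $ 2) *\<^sub>R v3 - (- sqrt 24 * x $ 0 / x $ 2) *\<^sub>R sym_id) = 0"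
      using x(2) False by (simp only: adj_scaleR) simp
    then show False using g by (simp only: generic_def v fst_conv snd_conv)
  next
    case x2: True
    show False
    proof (cases "x $ 3 = 0")
      case False
      have "sym_pencil v x = (x $ 3 / sqrt 24) *\<^sub>R (v3 - (- sqrt 24 * x $ 0 / x $ 3) *\<^sub>R sym_id)"
        using False by (simp add: sym_pencil_def v x1 x2 scaleR_add_right)
      then have "adj (v3 - (- sqrt 24 * x $ 0 / x $ 3) *\<^sub>R sym_id) = 0"
        using x(2) False by (simp only: adj_scaleR) simp
      then show False using g by (simp only: generic_def v fst_conv snd_conv)
    next
      case True
      have "sym_pencil v x = (x $ 0) *\<^sub>R sym_id" by (simp add: sym_pencil_def v x1 x2 True)
      then have "x $ 0 = 0" using x(2) by (simp only: adj_sym_id)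
      then have "x = 0" using x1 x2 True by (simp add: vec4_eq_iff)
      then show False using x(1) by simp
    qed
  qed
qed

definition chart_solutions :: "sym4 \<times> sym4 \<times> sym4 \<Rightarrow> (real \<times> real \<times> real) set" where
  "chart_solutions v = {(s, t, l). adj (fst v + s *\<^sub>R fst (snd v) + t *\<^sub>R snd (snd v) - l *\<^sub>R sym_id) = 0}"

lemma singular_points_chart:
  assumes g: "generic v"
  shows "norm x = 1 \<and> adj (sym_pencil v x) = 0 \<longleftrightarrow>
    (\<exists>p\<in>chart_solutions v. \<exists>\<epsilon>\<in>{1, - 1}. x = (\<epsilon> / norm (chart_point p)) *\<^sub>R chart_point p)"
proof
  assume x: "norm x = 1 \<and> adj (sym_pencil v x) = 0"
  then have x1: "x $ 1 \<noteq> 0" using generic_first_coordinate[OF g] by blast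
  obtain s t l where p: "sphere_chart x = (s, t, l)" by (metis prod_cases3)
  have xp: "x = (x $ 1) *\<^sub>R chart_point (s, t, l)"
    unfolding p[symmetric] using x1 by (simp add: vec4_eq_iff chart_point_nth sphere_chart_def)
  have "\<bar>x $ 1\<bar> * norm (chart_point (s, t, l)) = 1" using x by (subst (asm) xp) simp
  then have "x $ 1 = 1 / norm (chart_point (s, t, l)) \<or> x $ 1 = - 1 / norm (chart_point (s, t, l))"
    using norm_chart_point[of "(s, t, l)"] by (auto simp: abs_if field_simps split: if_splits)
  moreover have "adj (fst v + s *\<^sub>R fst (snd v) + t *\<^sub>R snd (snd v) - l *\<^sub>R sym_id) = 0"
  proof -
    have "adj (sym_pencil v ((x $ 1) *\<^sub>R chart_point (s, t, l))) = 0" using x xp by metis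
    then show ?thesis unfolding sym_pencil_chart_point adj_scaleR using x1 by simp
  qed
  then have "(s, t, l) \<in> chart_solutions v" by (simp add: chart_solutions_def)
  ultimately show "\<exists>p\<in>chart_solutions v. \<exists>\<epsilon>\<in>{1, - 1}. x = (\<epsilon> / norm (chart_point p)) *\<^sub>R chart_point p"
    using xp by (metis insertI1 insertI2)
next
  assume "\<exists>p\<in>chart_solutions v. \<exists>\<epsilon>\<in>{1, - 1}. x = (\<epsilon> / norm (chart_point p)) *\<^sub>R chart_point p"
  then obtain q \<epsilon> where q: "q \<in> chart_solutions v" and e: "\<epsilon> \<in> {1, - 1}" and xq: "x = (\<epsilon> / norm (chart_point q)) *\<^sub>R chart_point q"
    by blast
  obtain s t l where stl: "q = (s, t, l)" by (cases q)
  note p = q[unfolded stl] and x = xq[unfolded stl]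
  have "\<bar>\<epsilon>\<bar> = 1" using e by auto
  then have "norm x = 1" unfolding x using norm_chart_point[of "(s, t, l)"] by simp
  moreover have "adj (sym_pencil v x) = 0"
    unfolding x sym_pencil_chart_point adj_scaleR using p by (simp add: chart_solutions_def)
  ultimately show "norm x = 1 \<and> adj (sym_pencil v x) = 0" ..
qed

lemma inj_on_chart_lift:
  assumes "\<And>p. p \<in> A \<Longrightarrow> c p \<noteq> 0"
  shows "inj_on (\<lambda>p. c p *\<^sub>R chart_point p) A"
  by (rule inj_on_inverseI[of _ sphere_chart]) (simp add: sphere_chart_point assms)

text \<open>Each affine solution lies on a line through the origin that meets the sphere in two
  antipodal points.\<close>
lemma count_singular_points:
  assumes g: "generic v"
  shows "emeasure (count_space UNIV) {x. norm x = 1 \<and> adj (sym_pencil v x) = 0} = 2 * emeasure (count_space UNIV) (chart_solutions v)"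
proof -
  define U where "U \<epsilon> p = (\<epsilon> / norm (chart_point p)) *\<^sub>R chart_point p" for \<epsilon> p
  have set: "{x. norm x = 1 \<and> adj (sym_pencil v x) = 0} = U 1 ` chart_solutions v \<union> U (- 1) ` chart_solutions v"
    unfolding singular_points_chart[OF g] U_def by auto
  have pos: "U 1 p $ 1 > 0" "U (- 1) p $ 1 < 0" for p
    using norm_chart_point[of p] by (simp_all add: U_def chart_point_nth(2))
  have disj: "U 1 ` chart_solutions v \<inter> U (- 1) ` chart_solutions v = {}"
  proof (rule ccontr)
    assume "U 1 ` chart_solutions v \<inter> U (- 1) ` chart_solutions v \<noteq> {}"
    then obtain p q where "U 1 p = U (- 1) q" by blast
    then show False using pos(1)[of p] pos(2)[of q] by simp
  qed
  have inj: "inj_on (U \<epsilon>) A" if "\<epsilon> \<noteq> 0" for \<epsilon> A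
    unfolding U_def using that norm_chart_point by (intro inj_on_chart_lift) (metis divide_eq_0_iff less_irrefl)
  have im: "emeasure (count_space UNIV) (U \<epsilon> ` A) = emeasure (count_space UNIV) A" if "\<epsilon> \<noteq> 0" for \<epsilon> A
    using inj[OF that, of A] by (simp add: emeasure_count_space finite_image_iff card_image)
  have "emeasure (count_space UNIV) {x. norm x = 1 \<and> adj (sym_pencil v x) = 0}
     = emeasure (count_space UNIV) (U 1 ` chart_solutions v) + emeasure (count_space UNIV) (U (- 1) ` chart_solutions v)"
    unfolding set using disj by (intro plus_emeasure[symmetric]) simp_all
  then show ?thesis by (simp add: im mult_2)
qed

text \<open>At two antipodal points the matrices are negatives of each other, both of rank two. If
  the two nonzero eigenvalues have equal signs, exactly one of the points is positive
  semidefinite; otherwise neither is.\<close>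
lemma count_psd_singular_points:
  assumes g: "generic v"
  shows "emeasure (count_space UNIV) {x. norm x = 1 \<and> adj (sym_pencil v x) = 0 \<and> (\<forall>u. 0 \<le> qform (sym_pencil v x) u)}
    = emeasure (count_space UNIV) {(s, t, l). (s, t, l) \<in> chart_solutions v \<and> corner_det l (snd (fst v + s *\<^sub>R fst (snd v) + t *\<^sub>R snd (snd v))) > 0}"
    (is "_ = emeasure _ ?N")
proof -
  define w where "w p = snd (fst v + fst p *\<^sub>R fst (snd v) + fst (snd p) *\<^sub>R snd (snd v))" for p :: "real \<times> real \<times> real"
  define \<delta> where "\<delta> p = fst (snd (snd (snd (snd (w p))))) - snd (snd p)" for p
  have definite: "(\<forall>u. 0 \<le> qform (sym_pencil v ((\<epsilon> / norm (chart_point p)) *\<^sub>R chart_point p)) u) \<longleftrightarrow> p \<in> ?N \<and> \<epsilon> * \<delta> p > 0"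
    if p: "p \<in> chart_solutions v" and e: "\<epsilon> \<in> {1, - 1}" for p \<epsilon>
  proof -
    obtain s t l where stl: "p = (s, t, l)" by (cases p)
    define N where "N = fst v + s *\<^sub>R fst (snd v) + t *\<^sub>R snd (snd v)"
    have z: "adj (N - l *\<^sub>R sym_id) = 0" using p by (simp add: stl chart_solutions_def N_def)
    have c: "corner_det l (snd N) \<noteq> 0" using g z by (simp add: generic_def N_def)
    have "adj ((fst N, snd N) - l *\<^sub>R sym_id) = 0" using z by simp
    then have N: "N = (corank2_block l (snd N), snd N)" using adj_chart[OF c] by (metis prod.collapse)
    define \<kappa> where "\<kappa> = \<epsilon> / norm (chart_point p) / sqrt 24"
    have k: "\<kappa> \<noteq> 0" using e norm_chart_point[of p] by (auto simp: \<kappa>_def)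
    have "sym_pencil v ((\<epsilon> / norm (chart_point p)) *\<^sub>R chart_point p) = \<kappa> *\<^sub>R (N - l *\<^sub>R sym_id)"
      unfolding stl sym_pencil_chart_point \<kappa>_def N_def ..
    also have "\<dots> = \<kappa> *\<^sub>R ((corank2_block l (snd N), snd N) - l *\<^sub>R sym_id)"
      by (rule arg_cong[OF N])
    finally have eq: "sym_pencil v ((\<epsilon> / norm (chart_point p)) *\<^sub>R chart_point p) = \<kappa> *\<^sub>R ((corank2_block l (snd N), snd N) - l *\<^sub>R sym_id)" .
    have "(\<forall>u. 0 \<le> qform (sym_pencil v ((\<epsilon> / norm (chart_point p)) *\<^sub>R chart_point p)) u) \<longleftrightarrow> corner_det l (snd N) > 0 \<and> \<kappa> * \<delta> p > 0"
      unfolding eq chart_definite[OF c k] by (simp add: \<delta>_def w_def stl N_def)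
    also have "\<kappa> * \<delta> p > 0 \<longleftrightarrow> \<epsilon> * \<delta> p > 0"
    proof -
      have c: "norm (chart_point p) * sqrt 24 > 0" by (rule mult_pos_pos[OF norm_chart_point]) simp
      have "\<kappa> * \<delta> p = \<epsilon> * \<delta> p / (norm (chart_point p) * sqrt 24)" by (simp add: \<kappa>_def)
      then show ?thesis using pos_less_divide_eq[OF c, of 0 "\<epsilon> * \<delta> p"] by simp
    qed
    also have "corner_det l (snd N) > 0 \<longleftrightarrow> p \<in> ?N" using p by (simp add: stl N_def)
    finally show ?thesis .
  qed
  have nz: "\<delta> p \<noteq> 0" if "p \<in> ?N" for p
  proof
    assume z: "\<delta> p = 0"
    obtain s t l where stl: "p = (s, t, l)" by (cases p)
    have "corner_det l (w p) > 0" using that by (simp add: stl w_def)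
    then show False using z by (simp add: stl corner_det_def \<delta>_def case_prod_beta)
  qed
  \<comment> \<open>the sign of \<open>\<delta> p\<close> selects the positive semidefinite one of the two antipodal points\<close>
  have set: "{x. norm x = 1 \<and> adj (sym_pencil v x) = 0 \<and> (\<forall>u. 0 \<le> qform (sym_pencil v x) u)} = (\<lambda>p. (sgn (\<delta> p) / norm (chart_point p)) *\<^sub>R chart_point p) ` ?N"
  proof (intro equalityI subsetI)
    fix x assume x: "x \<in> {x. norm x = 1 \<and> adj (sym_pencil v x) = 0 \<and> (\<forall>u. 0 \<le> qform (sym_pencil v x) u)}"
    then obtain p \<epsilon> where p: "p \<in> chart_solutions v" "\<epsilon> \<in> {1, - 1}" "x = (\<epsilon> / norm (chart_point p)) *\<^sub>R chart_point p"
      using singular_points_chart[OF g, of x] by blast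
    then have N: "p \<in> ?N" "\<epsilon> * \<delta> p > 0" using x definite[OF p(1,2)] by blast+
    then have "\<epsilon> = sgn (\<delta> p)" using p(2) by (auto simp: zero_less_mult_iff)
    then show "x \<in> (\<lambda>p. (sgn (\<delta> p) / norm (chart_point p)) *\<^sub>R chart_point p) ` ?N" using p(3) N(1) by blast
  next
    fix x assume "x \<in> (\<lambda>p. (sgn (\<delta> p) / norm (chart_point p)) *\<^sub>R chart_point p) ` ?N"
    then obtain p where p: "p \<in> ?N" and x: "x = (sgn (\<delta> p) / norm (chart_point p)) *\<^sub>R chart_point p" by blast
    have s: "sgn (\<delta> p) \<in> {1, - 1}" "sgn (\<delta> p) * \<delta> p > 0" using nz[OF p] by (auto simp: sgn_if)
    have pc: "p \<in> chart_solutions v" using p by blast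
    have "norm x = 1 \<and> adj (sym_pencil v x) = 0" using singular_points_chart[OF g, of x] pc s(1) x by blast
    moreover have "\<forall>u. 0 \<le> qform (sym_pencil v x) u" using definite[OF pc s(1)] p s(2) unfolding x by blast
    ultimately show "x \<in> {x. norm x = 1 \<and> adj (sym_pencil v x) = 0 \<and> (\<forall>u. 0 \<le> qform (sym_pencil v x) u)}" by blast
  qed
  have "inj_on (\<lambda>p. (sgn (\<delta> p) / norm (chart_point p)) *\<^sub>R chart_point p) ?N"
  proof (rule inj_on_chart_lift)
    fix p assume "p \<in> ?N"
    then show "sgn (\<delta> p) / norm (chart_point p) \<noteq> 0" using nz norm_chart_point[of p] by (simp add: sgn_zero_iff)
  qed
  then show ?thesis unfolding set by (simp add: emeasure_count_space finite_image_iff card_image)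
qed

section \<open>Exceptional pencils have probability zero\<close>

lemma det_has_derivative:
  fixes A :: "'a::real_normed_vector \<Rightarrow> real ^ 'n ^ 'n"
  assumes "(A has_derivative A') (at x)"
  shows "((\<lambda>x. det (A x)) has_derivative (\<lambda>h. \<Sum>p | p permutes UNIV. of_int (sign p) *
    (\<Sum>i\<in>UNIV. A' h $ i $ p i * (\<Prod>j\<in>UNIV - {i}. A x $ j $ p j)))) (at x)"
proof -
  have nth: "((\<lambda>x. A x $ i $ j) has_derivative (\<lambda>h. A' h $ i $ j)) (at x)" for i j
    by (intro bounded_linear.has_derivative[OF bounded_linear_vec_nth] assms)
  show ?thesis
    unfolding det_def
    by (intro has_derivative_sum bounded_linear.has_derivative[OF bounded_linear_mult_right] has_derivative_prod nth)
qed

text \<open>The derivative of the determinant at \<open>A\<close> in the direction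
  \<open>H\<close>, for arbitrary matrices. Symmetry holds only almost surely, so measurability of
  the counts has to be established without it.\<close>
definition det_gradient :: "real ^ 4 ^ 4 \<Rightarrow> real ^ 4 ^ 4 \<Rightarrow> real" where
  "det_gradient A H = (\<Sum>p | p permutes UNIV. of_int (sign p) * (\<Sum>i\<in>UNIV. H $ i $ p i * (\<Prod>j\<in>UNIV - {i}. A $ j $ p j)))"

lemma pencil_has_derivative: "(pencil Q1 Q2 Q3 has_derivative pencil Q1 Q2 Q3) (at x)"
proof (rule bounded_linear_imp_has_derivative)
  have "linear (pencil Q1 Q2 Q3)"
    by (rule linearI) (simp_all add: pencil_def vec_eq_iff algebra_simps)
  then show "bounded_linear (pencil Q1 Q2 Q3)" by (simp add: linear_conv_bounded_linear)
qed

lemma continuous_pencil: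
  assumes "continuous_on S f" "continuous_on S g" "continuous_on S h" "continuous_on S x"
  shows "continuous_on S (\<lambda>q. pencil (f q) (g q) (h q) (x q))"
  unfolding pencil_def using assms by (intro continuous_intros)

text \<open>Written with the explicit derivative, being a singular point is a closed polynomial
  condition on the point and the three matrices jointly.\<close>
lemma closed_sing_symmetroid:
  "closed {q. fst q \<in> sing_symmetroid (fst (snd q)) (fst (snd (snd q))) (snd (snd (snd q)))}" (is "closed ?E")
proof -
  let ?P = "\<lambda>q x. pencil (fst (snd q)) (fst (snd (snd q))) (snd (snd (snd q))) x"
  have "x \<in> sing_symmetroid Q1 Q2 Q3 \<longleftrightarrow> norm x = 1 \<and> det (pencil Q1 Q2 Q3 x) = 0 \<and> (\<forall>h. det_gradient (pencil Q1 Q2 Q3 x) (pencil Q1 Q2 Q3 h) = 0)" for x Q1 Q2 Q3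
    unfolding sing_symmetroid_def symmetroid_def det_gradient_def
    using gderiv_zero_iff[OF det_has_derivative[OF pencil_has_derivative[of Q1 Q2 Q3 x]]] by auto
  then have "?E = {q. norm (fst q) = 1 \<and> det (?P q (fst q)) = 0 \<and> (\<forall>h. det_gradient (?P q (fst q)) (?P q h) = 0)}"
    by auto
  also have "closed \<dots>"
    unfolding det_gradient_def det_def
    by (intro closed_Collect_conj closed_Collect_all closed_Collect_eq continuous_on_sum continuous_on_mult continuous_on_prod
        continuous_on_norm continuous_on_fst continuous_on_snd continuous_on_id continuous_on_const continuous_pencil continuous_on_component)
  finally show ?thesis .
qed

lemma closed_sing_spectrahedron:
  "closed {q. fst q \<in> sing_spectrahedron (fst (snd q)) (fst (snd (snd q))) (snd (snd (snd q)))}" (is "closed ?E")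
proof -
  let ?P = "\<lambda>q x. pencil (fst (snd q)) (fst (snd (snd q))) (snd (snd (snd q))) x"
  have "?E = {q. fst q \<in> sing_symmetroid (fst (snd q)) (fst (snd (snd q))) (snd (snd (snd q))) \<and>
      (\<forall>i j. ?P q (fst q) $ j $ i = ?P q (fst q) $ i $ j) \<and> (\<forall>v. 0 \<le> (\<Sum>i\<in>UNIV. v $ i * (\<Sum>j\<in>UNIV. ?P q (fst q) $ i $ j * v $ j)))}"
    by (auto simp: sing_spectrahedron_def spectrahedron_def sing_symmetroid_def symmetroid_def psd_def transpose_def vec_eq_iff
        inner_vec_def matrix_vector_mult_def)
  also have "closed \<dots>"
    by (intro closed_Collect_conj closed_sing_symmetroid closed_Collect_all closed_Collect_eq closed_Collect_le continuous_on_sum continuous_on_mult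
        continuous_on_fst continuous_on_snd continuous_on_id continuous_on_const continuous_pencil continuous_on_component)
  finally show ?thesis .
qed

lemma count_sing_measurable:
  assumes [measurable]: "Q1 \<in> borel_measurable M" "Q2 \<in> borel_measurable M" "Q3 \<in> borel_measurable M"
  shows "(\<lambda>\<omega>. emeasure (count_space UNIV) (sing_symmetroid (Q1 \<omega>) (Q2 \<omega>) (Q3 \<omega>))) \<in> borel_measurable M"
    "(\<lambda>\<omega>. emeasure (count_space UNIV) (sing_spectrahedron (Q1 \<omega>) (Q2 \<omega>) (Q3 \<omega>))) \<in> borel_measurable M"
proof -
  have t: "(\<lambda>\<omega>. (Q1 \<omega>, Q2 \<omega>, Q3 \<omega>)) \<in> borel_measurable M" by measurable
  show "(\<lambda>\<omega>. emeasure (count_space UNIV) (sing_symmetroid (Q1 \<omega>) (Q2 \<omega>) (Q3 \<omega>))) \<in> borel_measurable M"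
    using measurable_compose[OF t count_solutions_measurable[OF fsigma_closed[OF closed_sing_symmetroid]]] by simp
  show "(\<lambda>\<omega>. emeasure (count_space UNIV) (sing_spectrahedron (Q1 \<omega>) (Q2 \<omega>) (Q3 \<omega>))) \<in> borel_measurable M"
    using measurable_compose[OF t count_solutions_measurable[OF fsigma_closed[OF closed_sing_spectrahedron]]] by simp
qed

lemma AE_lborel_snd:
  fixes P :: "'b::euclidean_space \<Rightarrow> bool"
  assumes "AE p in lborel. P p"
  shows "AE q :: 'a::euclidean_space \<times> 'b in lborel. P (snd q)"
proof -
  obtain N where N: "{p \<in> space lborel. \<not> P p} \<subseteq> N" "emeasure lborel N = 0" "N \<in> sets lborel"
    using AE_E[OF assms] by blast
  have "emeasure (lborel \<Otimes>\<^sub>M lborel) ((UNIV :: 'a set) \<times> N) = 0"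
    using N by (subst lborel.emeasure_pair_measure_Times) simp_all
  moreover have "(UNIV :: 'a set) \<times> N \<in> sets (lborel \<Otimes>\<^sub>M lborel)" using N(3) by (intro pair_measureI) simp_all
  ultimately have "(UNIV :: 'a set) \<times> N \<in> null_sets lborel" unfolding lborel_prod by (rule null_setsI)
  then show ?thesis using N(1) by (intro AE_I') auto
qed

lemma AE_negligible:
  fixes N :: "'a::euclidean_space set"
  assumes "negligible N"
  shows "AE p in lborel. p \<notin> N"
proof -
  have "N \<in> null_sets lebesgue" using assms by (simp add: negligible_iff_null_sets)
  then obtain N' where "N' \<in> null_sets lborel" "N \<subseteq> N'" unfolding null_sets_completion_iff2 by blast
  then show ?thesis by (intro AE_I') auto
qed

text \<open>Each clause is the complement of the projection of a closed set, or of a negligible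
  set outright, in one of the matrices for fixed values of the others.\<close>
lemma AE_generic: "AE v in lborel. generic v"
proof -
  let ?N = "\<lambda>q :: (real \<times> real \<times> real) \<times> (sym4 \<times> sym4 \<times> sym4). fst (snd q) + fst (fst q) *\<^sub>R fst (snd (snd q)) + fst (snd (fst q)) *\<^sub>R snd (snd (snd q))"
  have "AE v in lborel. \<nexists>x. (x, v) \<in> {q. adj (?N q - snd (snd (fst q)) *\<^sub>R sym_id) = 0 \<and> corner_det (snd (snd (fst q))) (snd (?N q)) = 0}"
  proof (rule AE_lborel_projection)
    show "closed {q. adj (?N q - snd (snd (fst q)) *\<^sub>R sym_id) = 0 \<and> corner_det (snd (snd (fst q))) (snd (?N q)) = 0}"
      by (intro closed_Collect_conj closed_Collect_eq continuous_adj continuous_corner_det continuous_intros)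
    show "negligible {v. \<exists>x. (x, v, u) \<in> {q. adj (?N q - snd (snd (fst q)) *\<^sub>R sym_id) = 0 \<and> corner_det (snd (snd (fst q))) (snd (?N q)) = 0}}" for u
      using negligible_degenerate[of "fst u" "snd u"] by simp
  qed
  moreover
  let ?L = "\<lambda>q :: (real \<times> real) \<times> (sym4 \<times> sym4). fst (snd q) + fst (fst q) *\<^sub>R snd (snd q) - snd (fst q) *\<^sub>R sym_id"
  have "AE v :: sym4 \<times> (sym4 \<times> sym4) in lborel. \<nexists>x. (x, snd v) \<in> {q. adj (?L q) = 0}"
  proof (rule AE_lborel_snd, rule AE_lborel_projection)
    show "closed {q. adj (?L q) = 0}"
      by (intro closed_Collect_eq continuous_adj continuous_intros)
    show "negligible {v. \<exists>x. (x, v, u) \<in> {q. adj (?L q) = 0}}" for u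
      using negligible_line[of u] by simp
  qed
  moreover have "AE v :: sym4 \<times> (sym4 \<times> sym4) in lborel. snd (snd v) \<notin> {v3. \<exists>l. adj (v3 - l *\<^sub>R sym_id) = 0}"
    by (intro AE_lborel_snd AE_negligible negligible_point)
  ultimately show ?thesis
  proof eventually_elim
    case (elim v)
    show ?case unfolding generic_def
    proof (intro conjI allI impI notI)
      fix s t l assume "adj (fst v + s *\<^sub>R fst (snd v) + t *\<^sub>R snd (snd v) - l *\<^sub>R sym_id) = 0" "corner_det l (snd (fst v + s *\<^sub>R fst (snd v) + t *\<^sub>R snd (snd v))) = 0"
      then have "((s, t, l), v) \<in> {q. adj (?N q - snd (snd (fst q)) *\<^sub>R sym_id) = 0 \<and> corner_det (snd (snd (fst q))) (snd (?N q)) = 0}" by simp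
      then show False using elim(1) by blast
    next
      fix t l assume "adj (fst (snd v) + t *\<^sub>R snd (snd v) - l *\<^sub>R sym_id) = 0"
      then have "((t, l), snd v) \<in> {q. adj (?L q) = 0}" by simp
      then show False using elim(2) by blast
    next
      fix l assume "adj (snd (snd v) - l *\<^sub>R sym_id) = 0"
      then show False using elim(3) by blast
    qed
  qed
qed

section \<open>The law of three independent GOE matrices\<close>

context prob_space begin

text \<open>The vector \<open>Z\<close> has density \<open>g\<close> and is a function of the
  variables \<open>X i\<close> with \<open>i \<in> J\<close>. Keeping track of \<open>J\<close>
  makes it possible to join independent blocks of different types one after another.\<close>
definition block_law :: "'i set \<Rightarrow> ('i \<Rightarrow> 'a \<Rightarrow> 'x::topological_space) \<Rightarrow> 'i set \<Rightarrow> ('a \<Rightarrow> 'z::euclidean_space) \<Rightarrow> ('z \<Rightarrow> ennreal) \<Rightarrow> bool" where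
  "block_law I X J Z g \<longleftrightarrow> J \<subseteq> I \<and> g \<in> borel_measurable borel \<and> distributed M lborel Z g \<and>
     (\<exists>F \<in> borel_measurable (Pi\<^sub>M J (\<lambda>_. borel)). Z = (\<lambda>\<omega>. F (\<lambda>i\<in>J. X i \<omega>)))"

lemma block_law_single:
  assumes "k \<in> I" "f \<in> borel_measurable borel" "g \<in> borel_measurable borel" "distributed M lborel (\<lambda>\<omega>. f (X k \<omega>)) g"
  shows "block_law I X {k} (\<lambda>\<omega>. f (X k \<omega>)) g"
  unfolding block_law_def
proof (intro conjI bexI[of _ "\<lambda>p. f (p k)"])
  show "(\<lambda>p. f (p k)) \<in> borel_measurable (Pi\<^sub>M {k} (\<lambda>_. borel))"
    using measurable_compose[OF measurable_component_singleton[of k "{k}" "\<lambda>_. borel"] assms(2)] by simp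
qed (use assms in auto)

text \<open>Independence of the restricted families, both functions on index sets with the same
  range, is pushed forward along \<open>F\<close> and \<open>G\<close>, which may have different
  target types.\<close>
lemma block_law_pair:
  fixes X :: "'i \<Rightarrow> 'a \<Rightarrow> 'x::topological_space" and Z :: "'a \<Rightarrow> 'z::euclidean_space" and Y :: "'a \<Rightarrow> 'y::euclidean_space"
  assumes indep: "indep_vars (\<lambda>_. borel) X I"
    and Z: "block_law I X J Z g" and Y: "block_law I X K Y h" and disj: "J \<inter> K = {}"
  shows "block_law I X (J \<union> K) (\<lambda>\<omega>. (Z \<omega>, Y \<omega>)) (product_density g h)"
proof -
  obtain F where F: "F \<in> borel_measurable (Pi\<^sub>M J (\<lambda>_. borel))" "Z = (\<lambda>\<omega>. F (\<lambda>i\<in>J. X i \<omega>))" using Z unfolding block_law_def by blast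
  obtain G where G: "G \<in> borel_measurable (Pi\<^sub>M K (\<lambda>_. borel))" "Y = (\<lambda>\<omega>. G (\<lambda>i\<in>K. X i \<omega>))" using Y unfolding block_law_def by blast
  have JK: "J \<subseteq> I" "K \<subseteq> I" using Z Y by (simp_all add: block_law_def)
  define PJ where "PJ = Pi\<^sub>M J (\<lambda>_. borel :: 'x measure)"
  define PK where "PK = Pi\<^sub>M K (\<lambda>_. borel :: 'x measure)"
  define RJ where "RJ = (\<lambda>\<omega>. \<lambda>i\<in>J. X i \<omega>)"
  define RK where "RK = (\<lambda>\<omega>. \<lambda>i\<in>K. X i \<omega>)"
  have "indep_var PJ RJ PK RK"
    unfolding PJ_def PK_def RJ_def RK_def by (rule indep_var_restrict[OF indep disj JK])
  then have RJ: "RJ \<in> measurable M PJ" and RK: "RK \<in> measurable M PK"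
    and eq: "distr M PJ RJ \<Otimes>\<^sub>M distr M PK RK = distr M (PJ \<Otimes>\<^sub>M PK) (\<lambda>\<omega>. (RJ \<omega>, RK \<omega>))"
    unfolding indep_var_distribution_eq by blast+
  have F': "F \<in> measurable PJ lborel" and G': "G \<in> measurable PK lborel"
    using F(1) G(1) by (simp_all add: PJ_def PK_def)
  have ZF: "Z = F \<circ> RJ" and YG: "Y = G \<circ> RK" by (simp_all add: F(2) G(2) RJ_def RK_def comp_def)
  have dZ: "distr (distr M PJ RJ) lborel F = density lborel g" and gm: "g \<in> borel_measurable lborel"
    using Z unfolding distr_distr[OF F' RJ] ZF[symmetric] block_law_def distributed_def by blast+
  have dY: "distr (distr M PK RK) lborel G = density lborel h" and hm: "h \<in> borel_measurable lborel" and Ym: "Y \<in> measurable M lborel"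
    using Y unfolding distr_distr[OF G' RK] YG[symmetric] block_law_def distributed_def by blast+
  have sf: "sigma_finite_measure (density lborel h)"
  proof -
    have "prob_space (distr M lborel Y)" by (rule prob_space_distr[OF Ym])
    moreover have "distr M lborel Y = density lborel h" unfolding dY[symmetric] distr_distr[OF G' RK] YG[symmetric] ..
    ultimately show ?thesis using prob_space_imp_sigma_finite by metis
  qed
  have FG: "(\<lambda>(x, y). (F x, G y)) \<in> measurable (PJ \<Otimes>\<^sub>M PK) (lborel \<Otimes>\<^sub>M lborel)"
    using F' G' by measurable
  have RR: "(\<lambda>\<omega>. (RJ \<omega>, RK \<omega>)) \<in> measurable M (PJ \<Otimes>\<^sub>M PK)"
    using RJ RK by measurable
  have "distr M (lborel \<Otimes>\<^sub>M lborel) (\<lambda>\<omega>. (Z \<omega>, Y \<omega>)) = distr (distr M (PJ \<Otimes>\<^sub>M PK) (\<lambda>\<omega>. (RJ \<omega>, RK \<omega>))) (lborel \<Otimes>\<^sub>M lborel) (\<lambda>(x, y). (F x, G y))"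
    unfolding distr_distr[OF FG RR] by (simp add: ZF YG comp_def)
  also have "\<dots> = distr (distr M PJ RJ) lborel F \<Otimes>\<^sub>M distr (distr M PK RK) lborel G"
    unfolding eq[symmetric] using F' G' sf by (intro pair_measure_distr[symmetric]) (simp_all add: dY)
  also have "\<dots> = density (lborel \<Otimes>\<^sub>M lborel) (\<lambda>(x, y). g x * h y)"
    unfolding dZ dY by (rule pair_measure_density[OF gm hm lborel.sigma_finite_measure_axioms sf])
  finally have "distr M lborel (\<lambda>\<omega>. (Z \<omega>, Y \<omega>)) = density lborel (product_density g h)"
    by (simp add: lborel_prod product_density_def)
  moreover have "(\<lambda>\<omega>. (Z \<omega>, Y \<omega>)) \<in> measurable M lborel"
    using measurable_comp[OF RR FG] by (simp add: ZF YG comp_def lborel_prod)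
  moreover have pgm: "product_density g h \<in> borel_measurable borel" using gm hm by (intro product_density_measurable) simp_all
  ultimately have d: "distributed M lborel (\<lambda>\<omega>. (Z \<omega>, Y \<omega>)) (product_density g h)" by (simp add: distributed_def)
  have "(\<lambda>p. (F (restrict p J), G (restrict p K))) \<in> borel_measurable (Pi\<^sub>M (J \<union> K) (\<lambda>_. borel))"
    by (intro borel_measurable_Pair measurable_compose[OF measurable_restrict_subset F(1)] measurable_compose[OF measurable_restrict_subset G(1)]) auto
  moreover have "(\<lambda>\<omega>. (Z \<omega>, Y \<omega>)) = (\<lambda>\<omega>. (\<lambda>p. (F (restrict p J), G (restrict p K))) (\<lambda>i\<in>J \<union> K. X i \<omega>))"
    unfolding F(2) G(2) by (simp add: Int_absorb1 restrict_restrict Int_Un_distrib2 Un_Int_eq)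
  ultimately show ?thesis
    using d JK Z Y unfolding block_law_def by (intro conjI bexI) (auto intro: product_density_measurable)
qed

lemma GOE_entries_law:
  assumes "GOE M Q"
  shows "distributed M lborel (\<lambda>\<omega>. entries (Q \<omega>)) goe_density"
proof -
  let ?I = "{(i, j). i \<le> (j :: 4)}" and ?X = "\<lambda>p \<omega>. Q \<omega> $ fst p $ snd p"
  have indep: "indep_vars (\<lambda>_. borel) ?X ?I"
    using assms unfolding GOE_def by (simp add: case_prod_beta')
  have diag: "block_law ?I ?X {(i, i)} (\<lambda>\<omega>. Q \<omega> $ i $ i) (centered 1)" for i
  proof -
    have "distributed M lborel (\<lambda>\<omega>. Q \<omega> $ i $ i) (centered 1)"
      using assms unfolding GOE_def centered_def[abs_def] by simp
    then show ?thesis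
      using block_law_single[where I = ?I and X = ?X and k = "(i, i)" and f = "\<lambda>x. x" and g = "centered 1"] by simp
  qed
  have offd: "block_law ?I ?X {(i, j)} (\<lambda>\<omega>. Q \<omega> $ i $ j) (centered off)" if "i < j" for i j
  proof -
    have "distributed M lborel (\<lambda>\<omega>. Q \<omega> $ i $ j) (centered off)"
      using assms that unfolding GOE_def centered_def[abs_def] by simp
    then show ?thesis
      using block_law_single[where I = ?I and X = ?X and k = "(i, j)" and f = "\<lambda>x. x" and g = "centered off"] that by simp
  qed
  have lt: "(0 :: 4) < 1" "(0 :: 4) < 2" "(0 :: 4) < 3" "(1 :: 4) < 2" "(1 :: 4) < 3" "(2 :: 4) < 3"
    by (simp_all add: less_bit0_def bit0.Rep_0 bit0.Rep_1 bit0.Rep_numeral)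
  note pair = block_law_pair[OF indep]
  have A: "block_law ?I ?X ({(0, 0)} \<union> ({(0, 1)} \<union> {(1, 1)})) (\<lambda>\<omega>. (Q \<omega> $ 0 $ 0, Q \<omega> $ 0 $ 1, Q \<omega> $ 1 $ 1)) density_A"
    unfolding density_A_def by (intro pair diag offd lt) simp_all
  have W: "block_law ?I ?X ({(0, 2)} \<union> ({(0, 3)} \<union> ({(1, 2)} \<union> ({(1, 3)} \<union> ({(2, 2)} \<union> ({(2, 3)} \<union> {(3, 3)}))))))
     (\<lambda>\<omega>. (Q \<omega> $ 0 $ 2, Q \<omega> $ 0 $ 3, Q \<omega> $ 1 $ 2, Q \<omega> $ 1 $ 3, Q \<omega> $ 2 $ 2, Q \<omega> $ 2 $ 3, Q \<omega> $ 3 $ 3)) density_W"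
    unfolding density_W_def by (intro pair diag offd lt) simp_all
  have "block_law ?I ?X (({(0, 0)} \<union> ({(0, 1)} \<union> {(1, 1)})) \<union> ({(0, 2)} \<union> ({(0, 3)} \<union> ({(1, 2)} \<union> ({(1, 3)} \<union> ({(2, 2)} \<union> ({(2, 3)} \<union> {(3, 3)}))))))) (\<lambda>\<omega>. entries (Q \<omega>)) goe_density"
    unfolding goe_density_def entries_def by (rule pair[OF A W]) simp
  then show ?thesis unfolding block_law_def by blast
qed

lemma GOE_triple_law:
  assumes goe: "\<And>k. k \<in> {1, 2, 3} \<Longrightarrow> GOE M (Q k)" and indep: "indep_vars (\<lambda>_. borel) Q {1, 2, 3 :: nat}"
  shows "distributed M lborel (\<lambda>\<omega>. (entries (Q 1 \<omega>), entries (Q 2 \<omega>), entries (Q 3 \<omega>))) (product_density goe_density (product_density goe_density goe_density))"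
proof -
  have entries: "entries \<in> borel_measurable borel"
    unfolding entries_def[abs_def] by (intro borel_measurable_continuous_onI continuous_intros)
  have s: "block_law {1, 2, 3} Q {k} (\<lambda>\<omega>. entries (Q k \<omega>)) goe_density" if "k \<in> {1, 2, 3}" for k
    using block_law_single[where X = Q and k = k and f = entries and g = goe_density, OF that entries g_measurable(3) GOE_entries_law[OF goe[OF that]]] .
  have "block_law {1, 2, 3} Q ({1} \<union> ({2} \<union> {3})) (\<lambda>\<omega>. (entries (Q 1 \<omega>), entries (Q 2 \<omega>), entries (Q 3 \<omega>))) (product_density goe_density (product_density goe_density goe_density))"
    by (intro block_law_pair[OF indep] s) simp_all
  then show ?thesis unfolding block_law_def by blast
qed

text \<open>A law with a density is absolutely continuous.\<close>
lemma distributed_transfer_AE: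
  assumes X: "distributed M lborel X f" and P: "AE v in lborel. P v"
  shows "AE \<omega> in M. P (X \<omega>)"
proof -
  have f: "f \<in> borel_measurable lborel" "X \<in> measurable M lborel" "distr M lborel X = density lborel f"
    using X unfolding distributed_def by blast+
  have "AE v in density lborel f. P v" unfolding AE_density[OF f(1)] using P by eventually_elim simp
  then show ?thesis unfolding f(3)[symmetric] by (rule AE_distrD[OF f(2)])
qed

text \<open>A finite mean makes the count finite almost surely; where it is infinite, the
  cardinality is \<open>0\<close> by convention, which affects only a null set.\<close>
lemma expected_card:
  assumes m: "(\<lambda>\<omega>. emeasure (count_space UNIV) (S \<omega>)) \<in> borel_measurable M" and r: "r \<ge> 0"
    and i: "(\<integral>\<^sup>+\<omega>. emeasure (count_space UNIV) (S \<omega>) \<partial>M) = ennreal r"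
  shows "AE \<omega> in M. finite (S \<omega>)" "integrable M (\<lambda>\<omega>. real (card (S \<omega>)))" "expectation (\<lambda>\<omega>. real (card (S \<omega>))) = r"
proof -
  have "AE \<omega> in M. emeasure (count_space UNIV) (S \<omega>) \<noteq> \<infinity>"
    by (rule nn_integral_noteq_infinite[OF m]) (simp add: i)
  then show fin: "AE \<omega> in M. finite (S \<omega>)"
    by eventually_elim (auto simp: emeasure_count_space split: if_splits)
  have card: "real (card (S \<omega>)) = enn2real (emeasure (count_space UNIV) (S \<omega>))" for \<omega>
    by (cases "finite (S \<omega>)") (simp_all add: emeasure_count_space ennreal_of_nat_eq_real_of_nat)
  have "has_bochner_integral M (\<lambda>\<omega>. real (card (S \<omega>))) r"
  proof (rule has_bochner_integral_nn_integral)
    show "(\<lambda>\<omega>. real (card (S \<omega>))) \<in> borel_measurable M"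
      unfolding card using m by measurable
    have "(\<integral>\<^sup>+\<omega>. ennreal (real (card (S \<omega>))) \<partial>M) = (\<integral>\<^sup>+\<omega>. emeasure (count_space UNIV) (S \<omega>) \<partial>M)"
    proof (rule nn_integral_cong_AE)
      show "AE \<omega> in M. ennreal (real (card (S \<omega>))) = emeasure (count_space UNIV) (S \<omega>)"
        using fin by eventually_elim (simp add: emeasure_count_space ennreal_of_nat_eq_real_of_nat)
    qed
    then show "(\<integral>\<^sup>+\<omega>. ennreal (real (card (S \<omega>))) \<partial>M) = ennreal r" using i by simp
  qed (use r in auto)
  then show "integrable M (\<lambda>\<omega>. real (card (S \<omega>)))" "expectation (\<lambda>\<omega>. real (card (S \<omega>))) = r"
    by (auto simp: has_bochner_integral_iff)
qed

end

text \<open>For a generic pencil the sector \<open>- {0}\<close> imposes no condition.\<close>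
lemma generic_ncount:
  assumes "generic v"
  shows "ncount (- {0}) v = emeasure (count_space UNIV) (chart_solutions v)"
    "ncount {0<..} v = emeasure (count_space UNIV) {(s, t, l). (s, t, l) \<in> chart_solutions v \<and> corner_det l (snd (fst v + s *\<^sub>R fst (snd v) + t *\<^sub>R snd (snd v))) > 0}"
proof -
  have "{(s, t, l). corner_det l (snd (fst v + s *\<^sub>R fst (snd v) + t *\<^sub>R snd (snd v))) \<in> - {0} \<and>
      adj (fst v + s *\<^sub>R fst (snd v) + t *\<^sub>R snd (snd v) - l *\<^sub>R sym_id) = 0} = chart_solutions v"
    using assms unfolding generic_def chart_solutions_def by auto
  then show "ncount (- {0}) v = emeasure (count_space UNIV) (chart_solutions v)" unfolding ncount_def by (rule arg_cong)
  show "ncount {0<..} v = emeasure (count_space UNIV) {(s, t, l). (s, t, l) \<in> chart_solutions v \<and> corner_det l (snd (fst v + s *\<^sub>R fst (snd v) + t *\<^sub>R snd (snd v))) > 0}"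
    unfolding ncount_def chart_solutions_def by (rule arg_cong[where f = "emeasure (count_space UNIV)"]) auto
qed

theorem proposition1p5:
  fixes M :: "'a measure" and Q :: "nat \<Rightarrow> 'a \<Rightarrow> real ^ 4 ^ 4"
  assumes "prob_space M"
    and "\<And>k. k \<in> {1, 2, 3} \<Longrightarrow> GOE M (Q k)"
    and "prob_space.indep_vars M (\<lambda>_. borel) Q {1, 2, 3}"
  shows "(let S = (\<lambda>\<omega>. sing_spectrahedron (Q 1 \<omega>) (Q 2 \<omega>) (Q 3 \<omega>));
              R = (\<lambda>\<omega>. sing_symmetroid (Q 1 \<omega>) (Q 2 \<omega>) (Q 3 \<omega>));
              \<sigma> = (\<lambda>\<omega>. real (card (S \<omega>)));
              \<rho> = (\<lambda>\<omega>. real (card (R \<omega>)))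
          in (AE \<omega> in M. finite (S \<omega>) \<and> finite (R \<omega>)) \<and>
             integrable M \<sigma> \<and> prob_space.expectation M \<sigma> = 6 - 4 / sqrt 3 \<and>
             integrable M \<rho> \<and> prob_space.expectation M \<rho> = 12)"
proof -
  interpret prob_space M by fact
  let ?S = "\<lambda>\<omega>. sing_spectrahedron (Q 1 \<omega>) (Q 2 \<omega>) (Q 3 \<omega>)" and ?R = "\<lambda>\<omega>. sing_symmetroid (Q 1 \<omega>) (Q 2 \<omega>) (Q 3 \<omega>)"
  let ?X = "\<lambda>\<omega>. (entries (Q 1 \<omega>), entries (Q 2 \<omega>), entries (Q 3 \<omega>))" and ?count = "emeasure (count_space UNIV)"
  have ne: "- {0} \<noteq> {0 :: real<..}"
  proof
    assume "- {0} = {0 :: real<..}"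
    moreover have "(- 1 :: real) \<in> - {0}" by simp
    ultimately have "(- 1 :: real) \<in> {0<..}" by (simp only:)
    then show False by simp
  qed
  have law: "distributed M lborel ?X (product_density goe_density (product_density goe_density goe_density))" by (rule GOE_triple_law[OF assms(2,3)])
  have goe: "Q k \<in> borel_measurable M" "AE \<omega> in M. transpose (Q k \<omega>) = Q k \<omega>" if "k \<in> {1, 2, 3}" for k
    using assms(2)[OF that] unfolding GOE_def by blast+
  have meas: "(\<lambda>\<omega>. ?count (?R \<omega>)) \<in> borel_measurable M" "(\<lambda>\<omega>. ?count (?S \<omega>)) \<in> borel_measurable M"
    by (rule count_sing_measurable; rule goe(1); simp)+
  have E: "(\<integral>\<^sup>+\<omega>. ncount D (?X \<omega>) \<partial>M) = ennreal (2 * sector_constant D)" if D: "D = - {0} \<or> D = {0<..}" for D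
  proof -
    have "open D" using D by auto
    then have "ncount D \<in> borel_measurable lborel" using ncount_measurable by simp
    from distributed_nn_integral[OF law this, symmetric] show ?thesis
      unfolding expected_count[OF D, symmetric] by (simp add: product_density_def case_prod_beta')
  qed
  have sym: "AE \<omega> in M. transpose (Q 1 \<omega>) = Q 1 \<omega> \<and> transpose (Q 2 \<omega>) = Q 2 \<omega> \<and> transpose (Q 3 \<omega>) = Q 3 \<omega>"
    using goe(2)[of 1] goe(2)[of 2] goe(2)[of 3] by simp
  have generic: "AE \<omega> in M. generic (?X \<omega>)" by (rule distributed_transfer_AE[OF law AE_generic])
  have "(\<integral>\<^sup>+\<omega>. ?count (?R \<omega>) \<partial>M) = (\<integral>\<^sup>+\<omega>. 2 * ncount (- {0}) (?X \<omega>) \<partial>M)"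
  proof (rule nn_integral_cong_AE)
    show "AE \<omega> in M. ?count (?R \<omega>) = 2 * ncount (- {0}) (?X \<omega>)"
      using sym generic by eventually_elim (simp add: sing_symmetroid_iff_adj count_singular_points generic_ncount(1))
  qed
  also have "\<dots> = 2 * (\<integral>\<^sup>+\<omega>. ncount (- {0}) (?X \<omega>) \<partial>M)"
  proof (rule nn_integral_cmult)
    have "open (- {0 :: real})" by auto
    from measurable_compose[OF distributed_measurable[OF law], of "ncount (- {0})" borel] ncount_measurable[OF this]
    show "(\<lambda>\<omega>. ncount (- {0}) (?X \<omega>)) \<in> borel_measurable M" by simp
  qed
  also have "\<dots> = ennreal 12" using E[of "- {0}"] ne by (simp add: sector_constant_def ennreal_mult'[symmetric] flip: ennreal_numeral)
  finally have R: "(\<integral>\<^sup>+\<omega>. ?count (?R \<omega>) \<partial>M) = ennreal 12" .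
  have "(\<integral>\<^sup>+\<omega>. ?count (?S \<omega>) \<partial>M) = (\<integral>\<^sup>+\<omega>. ncount {0<..} (?X \<omega>) \<partial>M)"
  proof (rule nn_integral_cong_AE)
    show "AE \<omega> in M. ?count (?S \<omega>) = ncount {0<..} (?X \<omega>)"
      using sym generic by eventually_elim (simp only: sing_spectrahedron_iff_adj count_psd_singular_points generic_ncount(2))
  qed
  also have "\<dots> = ennreal (6 - 4 / sqrt 3)"
    using E[of "{0<..}"] by (simp add: sector_constant_def)
  finally have S: "(\<integral>\<^sup>+\<omega>. ?count (?S \<omega>) \<partial>M) = ennreal (6 - 4 / sqrt 3)" .
  have "4 / sqrt 3 \<le> 4 / (1 :: real)" by (rule divide_left_mono) simp_all
  then have pos: "0 \<le> 6 - 4 / sqrt (3 :: real)" by simp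
  show ?thesis
    unfolding Let_def
    using expected_card[OF meas(1) _ R] expected_card[OF meas(2) pos S] by auto
qed

end
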